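(* Let $\sigma=\{\sigma_i\mid i\in I\}$ be a partition of the set $\mathbb{P}$ of all primes, let $G$ be a finite $\sigma$-full group, let $\mathcal{H}=\{1,H_1,\ldots,H_t\}$ be a complete Hall $\sigma$-set of $G$ (where $H_1,\ldots,H_t$ are the distinct non-identity members of $\mathcal H$), and let $D=G^{\mathfrak{N}_\sigma}$ be the $\sigma$-nilpotent residual of $G$. Then any two of the following conditions are equivalent: (i) For each subgroup $A$ of $G$, $G$ has an $H_\sigma$-permutably embedded subgroup of order $|A|$. (ii) $D$ is cyclic of square-free order, $D$ is complemented in $G$, and $|\sigma_i\cap\pi(G)|=1$ for all $i$ such that $\sigma_i\cap\pi(D)\neq\emptyset$. (iii) For each choice of $A_1,\ldots,A_t$ where $A_i$ is a subgroup of $H_i$ for all $i=1,\ldots,t$, $G$ has an $H_\sigma$-permutably embedded subgroup of order $|A_1|\cdots|A_t|$; and for each choice of $A_1,\ldots,A_t$ where $A_i$ is a normal subgroup of $H_i$ for all $i=1,\ldots,t$, $G$ has an $H_\sigma$-normally embedded subgroup of order $|A_1|\cdots|A_t|$.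
   Context: All groups are finite. $\pi(n)$ is the set of primes dividing $n$, $\pi(G)=\pi(|G|)$. $\sigma=\{\sigma_i\mid i\in I\}$ is a partition of $\mathbb P$; $\sigma(n)=\{\sigma_i\mid \sigma_i\cap\pi(n)\neq\emptyset\}$ and $\sigma(G)=\sigma(|G|)$. A group is $\sigma$-primary if it is a $\sigma_i$-group for some $i$ (all primes dividing its order lie in $\sigma_i$). A set $\mathcal H$ of subgroups of $G$ is a complete Hall $\sigma$-set of $G$ if every member of $\mathcal H\setminus\{1\}$ is a Hall $\sigma_i$-subgroup of $G$ for some $i$ and $\mathcal H$ contains exactly one Hall $\sigma_i$-subgroup of $G$ for every $\sigma_i\in\sigma(G)$. $G$ is $\sigma$-full if it possesses a complete Hall $\sigma$-set. A subgroup $A$ of $G$ is a $\sigma$-Hall subgroup of $G$ if $\sigma(|A|)\cap\sigma(|G:A|)=\emptyset$. A subgroup $A$ of $G$ is $\sigma$-permutable in $G$ if $G$ possesses a complete Hall $\sigma$-set $\mathcal H$ such that $AH^x=H^xA$ for all $H\in\mathcal H$ and all $x\in G$. A subgroup $A$ of $G$ is $H_\sigma$-permutably (respectively $H_\sigma$-normally) embedded in $G$ if $A$ is a $\sigma$-Hall subgroup of some $\sigma$-permutable (respectively normal) subgroup of $G$. A group is $\sigma$-nilpotent if it is a direct product of $\sigma$-primary groups. The $\sigma$-nilpotent residual $G^{\mathfrak N_\sigma}$ is the intersection of all normal subgroups $N$ of $G$ with $G/N$ $\sigma$-nilpotent. A subgroup $D$ is complemented in $G$ if there is a subgroup $M$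 with $G=DM$ and $D\cap M=1$. *)

theory Defs
  imports
    "HOL-Algebra.Product_Groups"
    "HOL-Library.Disjoint_Sets"
    "HOL-Computational_Algebra.Squarefree"
begin

text \<open>
  A partition \<open>\<sigma>\<close> of the primes is represented by the set of its classes, so that
  quantification over the indices \<open>i\<close> becomes quantification over \<open>S \<in> \<sigma>\<close>.  The set of prime
  divisors of a positive number \<open>n\<close> is \<^const>\<open>prime_factors\<close> \<open>n\<close>.  All definitions are intended
  for finite groups only; a subgroup \<open>B\<close> of \<open>G\<close>, regarded as a group, is \<open>G\<lparr>carrier := B\<rparr>\<close>.
\<close>

definition prime_partition :: "nat set set \<Rightarrow> bool" where
  "prime_partition \<sigma> \<longleftrightarrow> partition_on {p. prime p} \<sigma>"

definition group_primes :: "('a, 'b) monoid_scheme \<Rightarrow> nat set" where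
  "group_primes G = prime_factors (order G)"

definition sigma_of :: "nat set set \<Rightarrow> nat \<Rightarrow> nat set set" where
  "sigma_of \<sigma> n = {S \<in> \<sigma>. S \<inter> prime_factors n \<noteq> {}}"

definition sigma_primary :: "nat set set \<Rightarrow> ('a, 'b) monoid_scheme \<Rightarrow> bool" where
  "sigma_primary \<sigma> G \<longleftrightarrow> (\<exists>S\<in>\<sigma>. group_primes G \<subseteq> S)"

definition subgroup_index :: "('a, 'b) monoid_scheme \<Rightarrow> 'a set \<Rightarrow> nat" where
  "subgroup_index G A = card (rcosets\<^bsub>G\<^esub> A)"

definition hall_subgroup :: "nat set \<Rightarrow> 'a set \<Rightarrow> ('a, 'b) monoid_scheme \<Rightarrow> bool" where
  "hall_subgroup S A G \<longleftrightarrow> subgroup A G \<and>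
     prime_factors (card A) \<subseteq> S \<and> prime_factors (subgroup_index G A) \<inter> S = {}"

definition complete_hall_set :: "nat set set \<Rightarrow> ('a, 'b) monoid_scheme \<Rightarrow> 'a set set \<Rightarrow> bool" where
  "complete_hall_set \<sigma> G \<H> \<longleftrightarrow>
     (\<forall>A\<in>\<H>. subgroup A G) \<and>
     (\<forall>A\<in>\<H> - {{\<one>\<^bsub>G\<^esub>}}. \<exists>S\<in>\<sigma>. hall_subgroup S A G) \<and>
     (\<forall>S\<in>sigma_of \<sigma> (order G). \<exists>!A. A \<in> \<H> \<and> hall_subgroup S A G)"

definition sigma_full :: "nat set set \<Rightarrow> ('a, 'b) monoid_scheme \<Rightarrow> bool" where
  "sigma_full \<sigma> G \<longleftrightarrow> (\<exists>\<H>. complete_hall_set \<sigma> G \<H>)"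

definition sigma_hall_subgroup :: "nat set set \<Rightarrow> 'a set \<Rightarrow> ('a, 'b) monoid_scheme \<Rightarrow> bool" where
  "sigma_hall_subgroup \<sigma> A G \<longleftrightarrow> subgroup A G \<and>
     sigma_of \<sigma> (card A) \<inter> sigma_of \<sigma> (subgroup_index G A) = {}"

definition conjugate :: "('a, 'b) monoid_scheme \<Rightarrow> 'a set \<Rightarrow> 'a \<Rightarrow> 'a set" where
  "conjugate G H x = (\<lambda>h. inv\<^bsub>G\<^esub> x \<otimes>\<^bsub>G\<^esub> h \<otimes>\<^bsub>G\<^esub> x) ` H"

definition sigma_permutable :: "nat set set \<Rightarrow> 'a set \<Rightarrow> ('a, 'b) monoid_scheme \<Rightarrow> bool" where
  "sigma_permutable \<sigma> A G \<longleftrightarrow> subgroup A G \<and>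
     (\<exists>\<H>. complete_hall_set \<sigma> G \<H> \<and>
        (\<forall>H\<in>\<H>. \<forall>x\<in>carrier G. A <#>\<^bsub>G\<^esub> conjugate G H x = conjugate G H x <#>\<^bsub>G\<^esub> A))"

definition H_sigma_permutably_embedded ::
  "nat set set \<Rightarrow> 'a set \<Rightarrow> ('a, 'b) monoid_scheme \<Rightarrow> bool" where
  "H_sigma_permutably_embedded \<sigma> A G \<longleftrightarrow>
     (\<exists>B. sigma_permutable \<sigma> B G \<and> sigma_hall_subgroup \<sigma> A (G\<lparr>carrier := B\<rparr>))"

definition H_sigma_normally_embedded ::
  "nat set set \<Rightarrow> 'a set \<Rightarrow> ('a, 'b) monoid_scheme \<Rightarrow> bool" where
  "H_sigma_normally_embedded \<sigma> A G \<longleftrightarrow>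
     (\<exists>B. B \<lhd> G \<and> sigma_hall_subgroup \<sigma> A (G\<lparr>carrier := B\<rparr>))"

text \<open>
  Taking the direct factors among the subgroups of \<open>G\<close> avoids quantifying over types and loses
  nothing, since every factor of a direct product isomorphic to \<open>G\<close> embeds in \<open>G\<close>.
  The empty product (\<open>n = 0\<close>) is the trivial group.
\<close>

definition sigma_nilpotent :: "nat set set \<Rightarrow> ('a, 'b) monoid_scheme \<Rightarrow> bool" where
  "sigma_nilpotent \<sigma> G \<longleftrightarrow>
     (\<exists>(n::nat) K. (\<forall>i<n. subgroup (K i) G \<and> sigma_primary \<sigma> (G\<lparr>carrier := K i\<rparr>)) \<and>
        G \<cong> product_group {..<n} (\<lambda>i. G\<lparr>carrier := K i\<rparr>))"

definition sigma_nilpotent_residual :: "nat set set \<Rightarrow> ('a, 'b) monoid_scheme \<Rightarrow> 'a set" where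
  "sigma_nilpotent_residual \<sigma> G = \<Inter>{N. N \<lhd> G \<and> sigma_nilpotent \<sigma> (G Mod N)}"

definition complemented :: "'a set \<Rightarrow> ('a, 'b) monoid_scheme \<Rightarrow> bool" where
  "complemented D G \<longleftrightarrow> subgroup D G \<and>
     (\<exists>M. subgroup M G \<and> carrier G = D <#>\<^bsub>G\<^esub> M \<and> D \<inter> M = {\<one>\<^bsub>G\<^esub>})"

end

theory Submission
  imports Defs "HOL-Algebra.Sylow" "HOL-Algebra.Multiplicative_Group"
begin

text \<open>
  For a class \<open>S\<close> of \<open>\<sigma>\<close> let \<open>O\<^sub>S\<close> be the smallest normal subgroup of \<open>G\<close> whose index is an
  \<open>S\<close>-number and let \<open>c\<^sub>S\<close> be the \<open>S\<close>-part of its order.  Then \<open>D\<close> is the intersection of all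
  \<open>O\<^sub>S\<close> and its \<open>S\<close>-part is \<open>c\<^sub>S\<close>.  A \<open>\<sigma>\<close>-permutable subgroup whose order has full \<open>T\<close>-part for
  every class \<open>T \<noteq> S\<close> contains \<open>O\<^sub>S\<close>; hence both (i) and the first half of (iii) force \<open>c\<^sub>S\<close> to
  divide every prime in \<open>S\<close> that divides \<open>|G|\<close>.  For (iii) this is immediate.  For (i) one first
  shows that the chief factors of \<open>G\<close> are \<open>\<sigma>\<close>-primary, and then finds subgroups of suitable order
  in a complement of a chief factor below \<open>O\<^sub>S\<close>.

  If every \<open>c\<^sub>S\<close> divides all primes in \<open>S\<close> that divide \<open>|G|\<close>, then \<open>|D|\<close> is square-free.  As \<open>D\<close>
  centralizes the cyclic normal subgroups of \<open>G\<close>, it is cyclic by transfer and induction, and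
  crossed homomorphisms produce complements of its Sylow subgroups.  Conversely, if (ii) holds, then
  every subgroup containing \<open>D\<close> is \<open>\<sigma>\<close>-permutable, and such subgroups of prescribed order are
  intersections of subgroups containing the various \<open>O\<^sub>S\<close>.
\<close>

section \<open>Parts of numbers\<close>

text \<open>Everything is tested by one divisibility for each class \<open>S\<close>:
  \<open>part S (card (res S)) dvd r\<close> for all \<open>r\<close> in \<open>S\<close> dividing
  the order of \<open>G\<close>. Since distinct primes do not divide each other, it says that this
  part is 1 or the only prime of \<open>S\<close> dividing \<open>order G\<close>; square-freeness
  and the condition on the classes in (ii) are both contained in it. The two hypotheses differ in
  how a test subgroup is found. Under (iii) the parts of an order are prescribed independently, so
  full part outside \<open>S\<close> and part \<open>r\<close> at \<open>S\<close> can be demanded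
  at once. Under (i) such an order must first be realised by a subgroup, and no Hall subgroup for
  the primes outside \<open>S\<close> is known to exist. Hence a chief factor is split off: its
  complement, intersected with the image of \<open>res S\<close>, supplies the part outside
  \<open>S\<close>, and a compatible subgroup of order \<open>r\<close> is sought in the complement
  or in the chief factor itself. Splitting uses commutativity of the chief factor, which is why
  chief factors that are not primary must be excluded; transfer at a prime and a count of elements
  do this without solubility theorems.\<close>

definition part :: "nat set \<Rightarrow> nat \<Rightarrow> nat" where
  "part S n = (\<Prod>p\<in>prime_factors n \<inter> S. p ^ multiplicity p n)"

text \<open>At \<open>n = 0\<close> the product is empty and equals 1, so parts are always positive
  and can be cancelled.\<close>

lemma part_pos [simp]: "part S n > 0"
  unfolding part_def by (intro prod_pos) (auto simp: in_prime_factors_iff prime_gt_0_nat)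

lemma part_empty [simp]: "part {} n = 1"
  by (simp add: part_def)

lemma part_neq_0 [simp]: "part S n \<noteq> 0"
  using part_pos[of S n] by linarith

lemma multiplicity_part:
  assumes "prime p"
  shows "multiplicity p (part S n) = (if p \<in> S then multiplicity p n else 0)"
proof (cases "n = 0")
  case True
  then show ?thesis by (simp add: part_def)
next
  case False
  have "multiplicity p (part S n) =
      (if p \<in> prime_factors n \<inter> S then multiplicity p n else 0)"
    unfolding part_def
    by (subst multiplicity_prod_prime_powers) (use assms in \<open>auto simp: in_prime_factors_iff\<close>)
  with False show ?thesis using assms
    by (auto simp: in_prime_factors_iff not_dvd_imp_multiplicity_0)
qed

lemma part_dvd_iff:
  assumes "m > 0"
  shows "part S n dvd m \<longleftrightarrow> (\<forall>p\<in>S. prime p \<longrightarrow> multiplicity p n \<le> multiplicity p m)"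
proof
  assume "part S n dvd m"
  then show "\<forall>p\<in>S. prime p \<longrightarrow> multiplicity p n \<le> multiplicity p m"
    using assms dvd_imp_multiplicity_le[of "part S n" m] by (metis multiplicity_part not_gr0)
next
  assume *: "\<forall>p\<in>S. prime p \<longrightarrow> multiplicity p n \<le> multiplicity p m"
  show "part S n dvd m"
    by (rule multiplicity_le_imp_dvd) (use * assms in \<open>auto simp: multiplicity_part\<close>)
qed

lemma part_dvd: "n > 0 \<Longrightarrow> part S n dvd n"
  by (simp add: part_dvd_iff)

lemma part_dvd_mono: "m dvd n \<Longrightarrow> n > 0 \<Longrightarrow> part S m dvd part S n"
  by (subst part_dvd_iff) (auto simp: multiplicity_part intro: dvd_imp_multiplicity_le)

lemma part_eqI:
  assumes "m > 0" "\<And>p. prime p \<Longrightarrow> multiplicity p m = (if p \<in> S then multiplicity p n else 0)"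
  shows "part S n = m"
  by (rule multiplicity_eq_nat) (use assms in \<open>auto simp: multiplicity_part\<close>)

lemma part_mult: "m > 0 \<Longrightarrow> n > 0 \<Longrightarrow> part S (m * n) = part S m * part S n"
  by (rule part_eqI) (auto simp: multiplicity_part prime_elem_multiplicity_mult_distrib)

lemma part_one [simp]: "part S 1 = 1" "part S (Suc 0) = Suc 0"
  by (simp_all add: part_def)

lemma part_part [simp]: "part S (part T n) = part (S \<inter> T) n"
  by (rule part_eqI) (auto simp: multiplicity_part)

lemma part_mult_compl: "n > 0 \<Longrightarrow> part S n * part (-S) n = n"
  by (rule multiplicity_eq_nat)
    (auto simp: multiplicity_part prime_elem_multiplicity_mult_distrib)

lemma part_eq_1_iff: "n > 0 \<Longrightarrow> part S n = 1 \<longleftrightarrow> prime_factors n \<inter> S = {}"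
proof
  assume n: "n > 0" and *: "part S n = 1"
  show "prime_factors n \<inter> S = {}"
  proof (rule ccontr)
    assume "prime_factors n \<inter> S \<noteq> {}"
    then obtain p where p: "p \<in> prime_factors n" "p \<in> S" by auto
    then have "multiplicity p (part S n) > 0"
      by (auto simp: multiplicity_part in_prime_factors_iff prime_multiplicity_gt_zero_iff)
    with * show False by simp
  qed
qed (simp add: part_def)

lemma part_eq_self_iff: "n > 0 \<Longrightarrow> part S n = n \<longleftrightarrow> prime_factors n \<subseteq> S"
  using part_mult_compl[of n S] part_eq_1_iff[of n "-S"]
  by (smt (verit) disjoint_eq_subset_Compl double_compl mult_eq_self_implies_10 nat_mult_1_right part_neq_0)

lemma part_neq_1_iff:
  assumes "n > 0"
  shows "part S n \<noteq> 1 \<longleftrightarrow> (\<exists>p\<in>S. prime p \<and> p dvd n)"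
  unfolding part_eq_1_iff[OF assms] using assms by (auto simp: in_prime_factors_iff)

lemma part_self_dvd:
  assumes "part S n = n" "m dvd n" "n > 0"
  shows "part S m = m"
proof -
  have m: "m > 0" using assms by (meson dvd_pos_nat)
  have "prime_factors m \<subseteq> prime_factors n" using assms by (simp add: dvd_prime_factors)
  with assms m show ?thesis by (simp add: part_eq_self_iff)
qed

lemma part_coprime:
  assumes "part S m = m" "part S n = 1" "m > 0" "n > 0"
  shows "coprime m n"
proof -
  have "prime_factors m \<inter> prime_factors n = {}"
    using assms part_eq_self_iff[of m S] part_eq_1_iff[of n S] by auto
  then show ?thesis
    using assms by (intro coprimeI) (metis disjoint_iff dvd_trans in_prime_factors_iff
        not_gr0 prime_factor_nat nat_dvd_1_iff_1)
qed

lemma part_prime_power: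
  assumes "prime p"
  shows "part S (p ^ k) = (if p \<in> S then p ^ k else 1)"
  by (rule part_eqI)
    (use assms in \<open>auto simp: prime_gt_0_nat, (metis multiplicity_distinct_prime_power)+\<close>)

lemma part_prime: "prime p \<Longrightarrow> part S p = (if p \<in> S then p else 1)"
  using part_prime_power[of p S 1] by simp

lemma part_singleton: "prime p \<Longrightarrow> part {p} n = p ^ multiplicity p n"
  by (rule part_eqI) (auto simp: prime_gt_0_nat multiplicity_distinct_prime_power)

text \<open>The cofactors of \<open>a\<close> and \<open>b\<close> multiply to 1. An order formula
  whose product is as large as possible thus splits into equalities of the single parts, for
  instance for the image and the kernel of a homomorphism.\<close>

lemma part_mult_dvd_eq:
  assumes "a * b = part S m * part S n" "a dvd part S m" "b dvd part S n"
  shows "a = part S m" "b = part S n"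
proof -
  obtain c d where c: "part S m = a * c" and d: "part S n = b * d" using assms by (auto elim!: dvdE)
  have "a > 0" "b > 0" using c d by (metis mult_is_0 not_gr0 part_neq_0)+
  moreover have "a * b * (c * d) = a * b" using assms(1) c d by (simp add: ac_simps)
  ultimately have "c * d = 1" by simp
  then show "a = part S m" "b = part S n" using c d by auto
qed

lemma prime_power_part_self:
  assumes "part {p} n = n" "prime p"
  shows "n = p ^ multiplicity p n"
  using assms part_singleton by metis

section \<open>Finite groups\<close>

text \<open>One inclusion for arbitrary sets, so that the notion restricts to subsets of
  \<open>L\<close> and passes to intersections directly; equality of conjugates comes from
  finiteness where it matters.\<close>

definition normalizes :: "('a, 'b) monoid_scheme \<Rightarrow> 'a set \<Rightarrow> 'a set \<Rightarrow> bool" where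
  "normalizes G L U \<longleftrightarrow> (\<forall>l\<in>L. \<forall>u\<in>U. l \<otimes>\<^bsub>G\<^esub> u \<otimes>\<^bsub>G\<^esub> inv\<^bsub>G\<^esub> l \<in> U)"

definition centralizer :: "('a, 'b) monoid_scheme \<Rightarrow> 'a set \<Rightarrow> 'a set \<Rightarrow> 'a set" where
  "centralizer G L U = {l \<in> L. \<forall>u\<in>U. l \<otimes>\<^bsub>G\<^esub> u = u \<otimes>\<^bsub>G\<^esub> l}"

definition normalizer_in :: "('a, 'b) monoid_scheme \<Rightarrow> 'a set \<Rightarrow> 'a set \<Rightarrow> 'a set" where
  "normalizer_in G L U = {l \<in> L. \<forall>u\<in>U. l \<otimes>\<^bsub>G\<^esub> u \<otimes>\<^bsub>G\<^esub> inv\<^bsub>G\<^esub> l \<in> U}"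

locale fin_group = group +
  assumes finite_carrier [simp]: "finite (carrier G)"
begin

lemma inv_mult_cancel [simp]:
  assumes "a \<in> carrier G" "b \<in> carrier G"
  shows "inv a \<otimes> (a \<otimes> b) = b" "a \<otimes> (inv a \<otimes> b) = b"
  using assms by (simp_all add: m_assoc[symmetric])

lemma order_pos [simp]: "order G > 0"
  using order_gt_0_iff_finite by simp

lemma finite_subgroup: "subgroup A G \<Longrightarrow> finite A"
  by (meson finite_carrier finite_subset subgroup.subset)

lemma card_subgroup_pos: "subgroup A G \<Longrightarrow> card A > 0"
  using finite_subgroup subgroup.one_closed card_gt_0_iff by blast

lemma fin_group_subgroup: "subgroup A G \<Longrightarrow> fin_group (G\<lparr>carrier := A\<rparr>)"
  by (simp add: fin_group_axioms_def fin_group_def finite_subgroup subgroup_imp_group)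

lemma card_subgroup_dvd_order: "subgroup A G \<Longrightarrow> card A dvd order G"
  by (metis dvd_triv_right lagrange)

lemma card_subgroup_dvd:
  assumes "subgroup A G" "subgroup B G" "A \<subseteq> B"
  shows "card A dvd card B"
proof -
  interpret B: fin_group "G\<lparr>carrier := B\<rparr>" using assms fin_group_subgroup by blast
  have "subgroup A (G\<lparr>carrier := B\<rparr>)" using assms subgroup_incl by blast
  from B.card_subgroup_dvd_order[OF this] show ?thesis by (simp add: order_def)
qed

lemma fibre_card:
  assumes "finite A" "\<And>y. y \<in> f ` A \<Longrightarrow> card {x \<in> A. f x = y} = k"
  shows "card A = card (f ` A) * k"
proof -
  have "card A = (\<Sum>y\<in>f ` A. card {x \<in> A. f x = y})"
    using sum.image_gen[OF assms(1), of "\<lambda>_. 1::nat" f] by simp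
  also have "\<dots> = card (f ` A) * k" using assms(2) by simp
  finally show ?thesis .
qed

lemma set_mult_eq_image: "A <#> B = (\<lambda>(a,b). a \<otimes> b) ` (A \<times> B)"
  unfolding set_mult_def by auto

lemma card_set_mult:
  assumes A: "subgroup A G" and B: "subgroup B G"
  shows "card (A <#> B) * card (A \<inter> B) = card A * card B"
proof -
  note cl = subgroup.mem_carrier[OF A] subgroup.mem_carrier[OF B]
  let ?f = "\<lambda>(a,b). a \<otimes> b"
  have "card {x \<in> A \<times> B. ?f x = y} = card (A \<inter> B)" if y: "y \<in> ?f ` (A \<times> B)" for y
  proof -
    from y obtain a b where ab: "a \<in> A" "b \<in> B" and y: "y = a \<otimes> b" by auto
    \<comment> \<open>The pairs with product \<open>a \<otimes> b\<close> are exactly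
      \<open>(a \<otimes> c, inv c \<otimes> b)\<close> with \<open>c\<close> in
      \<open>A \<inter> B\<close>, so all fibres of multiplication have the same size.\<close>
    have "inj_on (\<lambda>c. (a \<otimes> c, inv c \<otimes> b)) (A \<inter> B)"
      using ab cl by (intro inj_onI) simp
    moreover have "(\<lambda>c. (a \<otimes> c, inv c \<otimes> b)) ` (A \<inter> B) = {x \<in> A \<times> B. ?f x = y}"
    proof (intro equalityI subsetI)
      fix z assume "z \<in> (\<lambda>c. (a \<otimes> c, inv c \<otimes> b)) ` (A \<inter> B)"
      then obtain c where c: "c \<in> A" "c \<in> B" and z: "z = (a \<otimes> c, inv c \<otimes> b)" by auto
      have "c \<otimes> (inv c \<otimes> b) = b" using c ab cl by (simp add: m_assoc[symmetric])
      then have "(a \<otimes> c) \<otimes> (inv c \<otimes> b) = y" using c ab cl y by (simp add: m_assoc)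
      moreover have "a \<otimes> c \<in> A" "inv c \<otimes> b \<in> B"
        using c ab A B by (simp_all add: subgroup.m_closed subgroup.m_inv_closed)
      ultimately show "z \<in> {x \<in> A \<times> B. ?f x = y}" using z by simp
    next
      fix z assume "z \<in> {x \<in> A \<times> B. ?f x = y}"
      then obtain u v where uv: "u \<in> A" "v \<in> B" "u \<otimes> v = a \<otimes> b" and z: "z = (u,v)" using y by auto
      let ?c = "inv a \<otimes> u"
      have "a \<in> carrier G" "b \<in> carrier G" "u \<in> carrier G" "v \<in> carrier G" using uv ab cl by auto
      note this[simp]
      have "u = a \<otimes> b \<otimes> inv v" using uv(3) by (simp add: inv_solve_right)
      then have c2: "?c = b \<otimes> inv v" by (simp add: m_assoc)
      have "?c \<in> A" using uv ab A by (simp add: subgroup.m_closed subgroup.m_inv_closed)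
      moreover have "?c \<in> B" unfolding c2 using uv ab B by (simp add: subgroup.m_closed subgroup.m_inv_closed)
      moreover have "a \<otimes> ?c = u" by (simp add: m_assoc[symmetric])
      moreover have "inv ?c \<otimes> b = v" unfolding c2 by (simp add: inv_mult_group m_assoc)
      ultimately have "?c \<in> A \<inter> B" "z = (a \<otimes> ?c, inv ?c \<otimes> b)" using z by simp_all
      then show "z \<in> (\<lambda>c. (a \<otimes> c, inv c \<otimes> b)) ` (A \<inter> B)" by blast
    qed
    ultimately show ?thesis by (metis card_image)
  qed
  from fibre_card[of "A \<times> B" ?f, OF _ this] show ?thesis
    using finite_subgroup[OF A] finite_subgroup[OF B] by (simp add: set_mult_eq_image card_cartesian_product)
qed

lemma normalizesD: "normalizes G L U \<Longrightarrow> l \<in> L \<Longrightarrow> u \<in> U \<Longrightarrow> l \<otimes> u \<otimes> inv l \<in> U"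
  by (auto simp: normalizes_def)

lemma normalizesD':
  assumes "normalizes G L U" "subgroup L G" "l \<in> L" "u \<in> U"
  shows "inv l \<otimes> u \<otimes> l \<in> U"
  using assms normalizesD[of L U "inv l" u] subgroup.m_inv_closed[of L G l]
  by (metis inv_inv subgroup.mem_carrier)

lemma normal_iff_normalizes: "N \<lhd> G \<longleftrightarrow> subgroup N G \<and> normalizes G (carrier G) N"
  by (auto simp: normal_inv_iff normalizes_def)

lemma normalizes_mono: "normalizes G L U \<Longrightarrow> L' \<subseteq> L \<Longrightarrow> normalizes G L' U"
  by (auto simp: normalizes_def)

lemma normal_normalizes: "N \<lhd> G \<Longrightarrow> L \<subseteq> carrier G \<Longrightarrow> normalizes G L N"
  using normal_iff_normalizes normalizes_mono by blast

lemma normalizes_self: "subgroup A G \<Longrightarrow> normalizes G A A"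
  by (simp add: normalizes_def subgroup.m_closed subgroup.m_inv_closed)

lemma normalizes_Int: "normalizes G L U \<Longrightarrow> normalizes G L V \<Longrightarrow> normalizes G L (U \<inter> V)"
  by (auto simp: normalizes_def)

lemma subgroup_set_mult_commute:
  assumes A: "subgroup A G" and B: "subgroup B G" and eq: "A <#> B = B <#> A"
  shows "subgroup (A <#> B) G"
proof -
  note [simp] = subgroup.mem_carrier[OF A] subgroup.mem_carrier[OF B]
  have sub: "A \<subseteq> carrier G" "B \<subseteq> carrier G" using A B by (simp_all add: subgroup.subset)
  show ?thesis
  proof (rule subgroupI)
    show "A <#> B \<subseteq> carrier G" using sub by (rule setmult_subset_G)
    show "A <#> B \<noteq> {}" using A B subgroup.one_closed by (fastforce simp: set_mult_def)
  next
    fix x assume "x \<in> A <#> B"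
    then obtain a b where ab: "a \<in> A" "b \<in> B" "x = a \<otimes> b" by (auto simp: set_mult_def)
    then have "inv x = inv b \<otimes> inv a" by (simp add: inv_mult_group)
    then show "inv x \<in> A <#> B" unfolding eq
      using ab A B subgroup.m_inv_closed by (fastforce simp: set_mult_def)
  next
    fix x y assume "x \<in> A <#> B" "y \<in> A <#> B"
    then have "x \<otimes> y \<in> (A <#> B) <#> (A <#> B)" by (auto simp: set_mult_def)
    also have "(A <#> B) <#> (A <#> B) = (A <#> A) <#> (B <#> B)"
      using sub eq by (metis set_mult_assoc setmult_subset_G)
    also have "\<dots> = A <#> B" using A B by (simp add: subgroup_mult_id)
    finally show "x \<otimes> y \<in> A <#> B" .
  qed
qed

lemma set_mult_subset:
  assumes "subgroup A G" "subgroup B G"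
  shows "A \<subseteq> A <#> B" "B \<subseteq> A <#> B"
proof -
  have "a \<in> A <#> B" if "a \<in> A" for a
    using that assms subgroup.mem_carrier[of A G a] subgroup.one_closed[of B G] r_one[of a]
    unfolding set_mult_def by fastforce
  moreover have "b \<in> A <#> B" if "b \<in> B" for b
    using that assms subgroup.mem_carrier[of B G b] subgroup.one_closed[of A G] l_one[of b]
    unfolding set_mult_def by fastforce
  ultimately show "A \<subseteq> A <#> B" "B \<subseteq> A <#> B" by auto
qed

lemma set_mult_least:
  assumes "subgroup C G" "A \<subseteq> C" "B \<subseteq> C"
  shows "A <#> B \<subseteq> C"
  using assms subgroup.m_closed unfolding set_mult_def by fastforce

lemma set_mult_commute_if_normalizes:
  assumes A: "subgroup A G" and B: "subgroup B G" and n: "normalizes G A B"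
  shows "A <#> B = B <#> A"
proof
  note [simp] = subgroup.mem_carrier[OF A] subgroup.mem_carrier[OF B]
  show "A <#> B \<subseteq> B <#> A"
  proof (clarsimp simp: set_mult_def)
    fix a b assume ab: "a \<in> A" "b \<in> B"
    have "a \<otimes> b = (a \<otimes> b \<otimes> inv a) \<otimes> a" using ab by (simp add: m_assoc)
    then show "\<exists>h\<in>B. \<exists>k\<in>A. a \<otimes> b = h \<otimes> k" using normalizesD[OF n] ab by blast
  qed
  show "B <#> A \<subseteq> A <#> B"
  proof (clarsimp simp: set_mult_def)
    fix b a assume ab: "b \<in> B" "a \<in> A"
    have "b \<otimes> a = a \<otimes> (inv a \<otimes> b \<otimes> a)" using ab by (simp add: m_assoc[symmetric])
    then show "\<exists>h\<in>A. \<exists>k\<in>B. b \<otimes> a = h \<otimes> k" using normalizesD'[OF n A] ab by blast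
  qed
qed

lemma subgroup_set_mult:
  assumes "subgroup A G" "subgroup B G" "normalizes G A B"
  shows "subgroup (A <#> B) G"
  using assms set_mult_commute_if_normalizes subgroup_set_mult_commute by blast

lemma card_Int_coprime:
  assumes "subgroup A G" "subgroup B G" "coprime (card A) (card B)"
  shows "A \<inter> B = {\<one>}"
proof -
  have s: "subgroup (A \<inter> B) G" using assms subgroups_Inter_pair by blast
  have "card (A \<inter> B) = 1"
    using assms card_subgroup_dvd[OF s] by (metis coprime_common_divisor_nat inf_le1 inf_le2)
  then show ?thesis using s subgroup.one_closed by (metis card_1_singletonE singletonD)
qed

text \<open>The index of \<open>N\<close> in \<open>A <#> N\<close> divides both
  \<open>card A\<close> and the index of \<open>N\<close> in \<open>L\<close>, hence is 1.\<close>

lemma coprime_index_subset: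
  assumes A: "subgroup A G" and N: "subgroup N G" and n: "normalizes G A N"
    and L: "subgroup L G" "A \<subseteq> L" "N \<subseteq> L" and c: "coprime (card A) (card L div card N)"
  shows "A \<subseteq> N"
proof -
  have AN: "subgroup (A <#> N) G" using A N n by (rule subgroup_set_mult)
  have "card (A <#> N) dvd card L" "card N dvd card (A <#> N)"
    using AN A N L set_mult_least[of L A N] set_mult_subset[of A N] card_subgroup_dvd by simp_all
  then obtain u v where u: "card (A <#> N) = card N * u" and v: "card L = card (A <#> N) * v"
    unfolding dvd_def by blast
  have pos: "card N > 0" using N card_subgroup_pos by blast
  have "card L div card N = u * v" using u v pos by (simp add: mult.assoc)
  then have "u dvd card L div card N" by simp
  moreover have "u * card (A \<inter> N) = card A"
  proof -
    have "card N * (u * card (A \<inter> N)) = card N * card A"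
      using card_set_mult[OF A N] u by (simp add: mult.assoc mult.commute)
    then show ?thesis using pos by simp
  qed
  ultimately have "u = 1" using c by (metis coprime_common_divisor_nat dvd_triv_left)
  then have "A <#> N = N"
    using u AN N A set_mult_subset(2) finite_subgroup by (metis card_subset_eq nat_mult_1_right)
  then show ?thesis using set_mult_subset(1)[OF A N] by simp
qed

lemma sylow_exists:
  assumes A: "subgroup A G" and p: "prime p" "p ^ k dvd card A"
  obtains R where "subgroup R G" "R \<subseteq> A" "card R = p ^ k"
proof -
  interpret A: fin_group "G\<lparr>carrier := A\<rparr>" using A by (rule fin_group_subgroup)
  obtain m where m: "card A = p ^ k * m" using p(2) unfolding dvd_def by blast
  have "sylow (G\<lparr>carrier := A\<rparr>) p k m"
    using p m finite_subgroup[OF A] A.is_group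
    by (simp add: sylow_def sylow_axioms_def order_def)
  then obtain R where R: "subgroup R (G\<lparr>carrier := A\<rparr>)" "card R = p ^ k"
    using sylow.sylow_thm by blast
  have "R \<subseteq> A" using subgroup.subset[OF R(1)] by simp
  then show thesis using R that incl_subgroup[OF A R(1)] by blast
qed

lemma cauchy_exists:
  assumes "subgroup A G" "prime p" "p dvd card A"
  obtains R where "subgroup R G" "R \<subseteq> A" "card R = p"
  using sylow_exists[OF assms(1,2), of 1] assms(3) by auto

lemma pow_card_eq_one:
  assumes "subgroup A G" "x \<in> A"
  shows "x [^] card A = \<one>"
proof -
  interpret A: fin_group "G\<lparr>carrier := A\<rparr>" using assms fin_group_subgroup by blast
  have "x [^]\<^bsub>G\<lparr>carrier := A\<rparr>\<^esub> order (G\<lparr>carrier := A\<rparr>) = \<one>\<^bsub>G\<lparr>carrier := A\<rparr>\<^esub>"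
    using assms A.pow_order_eq_1 by simp
  then show ?thesis by (simp add: order_def nat_pow_consistent[symmetric])
qed

lemma pow_eq_one_coprime:
  assumes "x \<in> carrier G" "x [^] (m::nat) = \<one>" "x [^] (n::nat) = \<one>" "coprime m n"
  shows "x = \<one>"
  using assms by (metis coprime_common_divisor_nat ord_eq_1 pow_eq_id)

text \<open>Coprimality makes the index of \<open>B\<close> in the group divide the index of
  \<open>A \<inter> B\<close> in \<open>A\<close>; the opposite bound comes from counting the
  product set \<open>A <#> B\<close>, which has at most \<open>order G\<close> elements.\<close>

lemma subgroup_index_mult:
  assumes A: "subgroup A G" and B: "subgroup B G"
    and c: "coprime (order G div card A) (order G div card B)"
  shows "order G div card (A \<inter> B) = (order G div card A) * (order G div card B)"
proof -
  have AB: "subgroup (A \<inter> B) G" using A B subgroups_Inter_pair by blast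
  obtain a where a: "order G = card A * a" using card_subgroup_dvd_order[OF A] by (auto elim: dvdE)
  obtain b where b: "order G = card B * b" using card_subgroup_dvd_order[OF B] by (auto elim: dvdE)
  obtain u where u: "card A = card (A \<inter> B) * u" using card_subgroup_dvd[OF AB A] by (auto elim: dvdE)
  obtain v where v: "card B = card (A \<inter> B) * v" using card_subgroup_dvd[OF AB B] by (auto elim: dvdE)
  have pos: "card A > 0" "card B > 0" "card (A \<inter> B) > 0" using A B AB card_subgroup_pos by auto
  have da: "order G div card A = a" and db: "order G div card B = b" and d: "order G div card (A \<inter> B) = u * a"
    using a b u pos by (simp_all add: mult.assoc)
      (metis a mult.assoc nonzero_mult_div_cancel_left not_gr0)+
  have "u * a = v * b" using a b u v pos by (metis mult.assoc mult_left_cancel not_gr0)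
  then have "b dvd u" using c da db by (metis coprime_commute coprime_dvd_mult_left_iff dvd_triv_right)
  moreover have "u \<le> b"
  proof -
    have "card (A <#> B) \<le> order G"
      using A B subgroup.subset setmult_subset_G by (metis card_mono finite_carrier order_def)
    then have "card A * card B \<le> order G * card (A \<inter> B)"
      by (metis A B card_set_mult mult_le_mono1)
    then have "(card (A \<inter> B) * u) * card B \<le> (card B * b) * card (A \<inter> B)" using u b by simp
    then have "(card (A \<inter> B) * card B) * u \<le> (card (A \<inter> B) * card B) * b" by (simp add: ac_simps)
    then show ?thesis using pos by simp
  qed
  moreover have "u > 0" using u pos by (metis mult_0_right not_gr0)
  ultimately have "u = b" by (meson dvd_imp_le le_antisym)
  then show ?thesis using da db d by simp
qed

end

section \<open>Actions of p-groups\<close>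

context fin_group
begin

lemma orbit_card:
  assumes P: "subgroup P G" and y: "y \<in> X"
    and cl: "\<And>g x. g \<in> P \<Longrightarrow> x \<in> X \<Longrightarrow> f g x \<in> X"
    and one: "\<And>x. x \<in> X \<Longrightarrow> f \<one> x = x"
    and mult: "\<And>g h x. g \<in> P \<Longrightarrow> h \<in> P \<Longrightarrow> x \<in> X \<Longrightarrow> f (g \<otimes> h) x = f g (f h x)"
  shows "card P = card ((\<lambda>g. f g y) ` P) * card {g \<in> P. f g y = y}"
proof (rule fibre_card)
  show "finite P" using P by (rule finite_subgroup)
  fix z assume "z \<in> (\<lambda>g. f g y) ` P"
  then obtain a where a: "a \<in> P" and z: "z = f a y" by auto
  note cP = subgroup.mem_carrier[OF P]
  have inva: "inv a \<in> P" using P a by (rule subgroup.m_inv_closed)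
  have "bij_betw (\<lambda>g. a \<otimes> g) {g \<in> P. f g y = y} {g \<in> P. f g y = z}"
  proof (rule bij_betwI[where g = "\<lambda>g. inv a \<otimes> g"])
    show "(\<lambda>g. a \<otimes> g) \<in> {g \<in> P. f g y = y} \<rightarrow> {g \<in> P. f g y = z}"
      using a P y z by (auto simp: mult subgroup.m_closed)
    have "f (inv a \<otimes> g) y = y" if "g \<in> P" "f g y = z" for g
    proof -
      have "f (inv a \<otimes> g) y = f (inv a) (f a y)" using that inva y z by (simp add: mult)
      also have "\<dots> = f (inv a \<otimes> a) y" using inva a y by (simp add: mult)
      finally show ?thesis using a y by (simp add: one cP)
    qed
    then show "(\<lambda>g. inv a \<otimes> g) \<in> {g \<in> P. f g y = z} \<rightarrow> {g \<in> P. f g y = y}"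
      using inva P by (auto simp: subgroup.m_closed)
  qed (use a in \<open>auto simp: cP m_assoc\<close>)
  then show "card {g \<in> P. f g y = z} = card {g \<in> P. f g y = y}"
    by (rule bij_betw_same_card[symmetric])
qed

text \<open>Orbits are removed one at a time; without fixed points every orbit length is a power of
  \<open>p\<close> other than 1.\<close>

lemma p_dvd_card_no_fixed_points:
  assumes P: "subgroup P G" "card P = p ^ k" "prime p" and fin: "finite X"
    and cl: "\<And>g x. g \<in> P \<Longrightarrow> x \<in> X \<Longrightarrow> f g x \<in> X"
    and one: "\<And>x. x \<in> X \<Longrightarrow> f \<one> x = x"
    and mult: "\<And>g h x. g \<in> P \<Longrightarrow> h \<in> P \<Longrightarrow> x \<in> X \<Longrightarrow> f (g \<otimes> h) x = f g (f h x)"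
    and nofix: "\<And>x. x \<in> X \<Longrightarrow> \<exists>g\<in>P. f g x \<noteq> x"
  shows "p dvd card X"
  using fin cl one mult nofix
proof (induction X rule: finite_psubset_induct)
  case (psubset X)
  show ?case
  proof (cases "X = {}")
    case False
    then obtain y where y: "y \<in> X" by auto
    let ?O = "(\<lambda>g. f g y) ` P"
    have oP: "\<one> \<in> P" using P(1) by (rule subgroup.one_closed)
    have yO: "y \<in> ?O" using oP psubset.prems(2)[OF y] by force
    have OX: "?O \<subseteq> X" using y psubset.prems(1) by auto
    have "card P = card ?O * card {g \<in> P. f g y = y}"
      by (rule orbit_card[OF P(1) y]) (use psubset.prems in auto)
    then have "card ?O dvd p ^ k" using P(2) by (metis dvd_triv_left)
    then obtain i where i: "card ?O = p ^ i" using P(3) by (auto simp: divides_primepow_nat)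
    have "card ?O \<noteq> 1"
    proof
      assume "card ?O = 1"
      then have "?O = {y}" using yO by (metis card_1_singletonE singletonD)
      then show False using psubset.prems(4)[OF y] by blast
    qed
    then have pO: "p dvd card ?O" using i by (cases i) auto
    have inv: "f g x \<in> X - ?O" if g: "g \<in> P" and x: "x \<in> X - ?O" for g x
    proof -
      have xX: "x \<in> X" using x by simp
      have ig: "inv g \<in> P" using P(1) g by (rule subgroup.m_inv_closed)
      have "f g x \<notin> ?O"
      proof
        assume "f g x \<in> ?O"
        then obtain h where h: "h \<in> P" "f g x = f h y" by auto
        have "f (inv g) (f g x) = f (inv g \<otimes> g) x" using ig g xX by (simp add: psubset.prems(3))
        also have "\<dots> = x" using g xX P(1) by (simp add: psubset.prems(2) subgroup.mem_carrier)
        finally have "x = f (inv g \<otimes> h) y" using h ig y by (simp add: psubset.prems(3))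
        moreover have "inv g \<otimes> h \<in> P" using ig h P(1) by (simp add: subgroup.m_closed)
        ultimately show False using x by auto
      qed
      then show ?thesis using psubset.prems(1) g xX by simp
    qed
    have "p dvd card (X - ?O)"
      by (rule psubset.IH) (use yO y inv psubset.prems in auto)
    moreover have "card X = card (X - ?O) + card ?O"
      using OX psubset.hyps by (metis card_Diff_subset card_mono finite_subset le_add_diff_inverse2)
    ultimately show ?thesis using pO by simp
  qed simp
qed

text \<open>The points that are not fixed form an invariant set without fixed points, so both
  cardinalities agree modulo \<open>p\<close>; only the consequence for divisibility is
  recorded.\<close>

lemma p_group_fixed_points:
  assumes P: "subgroup P G" "card P = p ^ k" "prime p" and fin: "finite X"
    and cl: "\<And>g x. g \<in> P \<Longrightarrow> x \<in> X \<Longrightarrow> f g x \<in> X"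
    and one: "\<And>x. x \<in> X \<Longrightarrow> f \<one> x = x"
    and mult: "\<And>g h x. g \<in> P \<Longrightarrow> h \<in> P \<Longrightarrow> x \<in> X \<Longrightarrow> f (g \<otimes> h) x = f g (f h x)"
  shows "p dvd card X \<longleftrightarrow> p dvd card {x \<in> X. \<forall>g\<in>P. f g x = x}"
proof -
  let ?F = "{x \<in> X. \<forall>g\<in>P. f g x = x}"
  have inv: "f g x \<in> X - ?F" if g: "g \<in> P" and x: "x \<in> X - ?F" for g x
  proof -
    have xX: "x \<in> X" using x by simp
    have ig: "inv g \<in> P" using P(1) g by (rule subgroup.m_inv_closed)
    have "f (inv g) (f g x) = x"
      using mult[OF ig g xX] one[OF xX] g P(1) by (simp add: subgroup.mem_carrier)
    then have eq: "f g x = x" if "f g x \<in> ?F" using that ig by auto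
    have "f g x \<notin> ?F"
    proof
      assume *: "f g x \<in> ?F"
      show False using * x unfolding eq[OF *] by blast
    qed
    then show ?thesis using cl g xX by simp
  qed
  have "p dvd card (X - ?F)"
    by (rule p_dvd_card_no_fixed_points[OF P, where f = f]) (use fin inv one mult in auto)
  moreover have "card X = card (X - ?F) + card ?F"
    using card_Diff_subset[of ?F X] card_mono[of X ?F] fin by simp
  ultimately show ?thesis using dvd_add_right_iff[of p "card (X - ?F)" "card ?F"] by simp
qed

section \<open>Actions on left cosets and conjugacy of Sylow subgroups\<close>

lemma lcoset_eq_iff:
  assumes Q: "subgroup Q G" and x: "x \<in> carrier G" "y \<in> carrier G"
  shows "x <# Q = y <# Q \<longleftrightarrow> inv y \<otimes> x \<in> Q"
proof
  assume "x <# Q = y <# Q"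
  moreover have "x \<in> x <# Q" using x Q subgroup.one_closed r_one unfolding l_coset_def by force
  ultimately obtain q where "q \<in> Q" "x = y \<otimes> q" unfolding l_coset_def by auto
  then show "inv y \<otimes> x \<in> Q" using x Q by (simp add: m_assoc subgroup.mem_carrier)
next
  assume q: "inv y \<otimes> x \<in> Q"
  have "y \<otimes> (inv y \<otimes> x) = x" using x by (simp add: m_assoc)
  then have "x \<in> y <# Q" using q unfolding l_coset_def by force
  then show "x <# Q = y <# Q" using l_repr_independence[of x y Q] x Q by auto
qed

lemma card_lcosets:
  assumes Q: "subgroup Q G" and L: "subgroup L G" and QL: "Q \<subseteq> L"
  shows "card L = card ((\<lambda>x. x <# Q) ` L) * card Q"
proof (rule fibre_card)
  show "finite L" using L by (rule finite_subgroup)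
  fix C assume "C \<in> (\<lambda>x. x <# Q) ` L"
  then obtain a where a: "a \<in> L" "C = a <# Q" by auto
  note cL = subgroup.mem_carrier[OF L]
  have "{x \<in> L. x <# Q = C} = (\<lambda>q. a \<otimes> q) ` Q"
  proof (intro equalityI subsetI)
    fix x assume x: "x \<in> {x \<in> L. x <# Q = C}"
    then have "inv a \<otimes> x \<in> Q" using a Q cL lcoset_eq_iff by auto
    moreover have "x = a \<otimes> (inv a \<otimes> x)" using x a cL by (simp add: m_assoc)
    ultimately show "x \<in> (\<lambda>q. a \<otimes> q) ` Q" by blast
  next
    fix x assume "x \<in> (\<lambda>q. a \<otimes> q) ` Q"
    then obtain q where q: "q \<in> Q" "x = a \<otimes> q" by auto
    have qL: "q \<in> L" using q QL by auto
    have "inv a \<otimes> x = q" using q a cL[OF qL] cL[OF a(1)] by simp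
    moreover have "x \<in> L" using subgroup.m_closed[OF L a(1) qL] q by simp
    ultimately show "x \<in> {x \<in> L. x <# Q = C}" using q a Q cL lcoset_eq_iff by auto
  qed
  moreover have "inj_on (\<lambda>q. a \<otimes> q) Q"
    using a QL cL by (intro inj_onI) (auto simp: subset_iff)
  ultimately show "card {x \<in> L. x <# Q = C} = card Q" by (simp add: card_image)
qed

lemma lcosets_fixed_points:
  assumes P: "subgroup P G" "P \<subseteq> L" "card P = p ^ k" "prime p"
    and Q: "subgroup Q G" and L: "subgroup L G" and QL: "Q \<subseteq> L"
  shows "p dvd card ((\<lambda>x. x <# Q) ` L) \<longleftrightarrow>
    p dvd card {C \<in> (\<lambda>x. x <# Q) ` L. \<forall>g\<in>P. g <# C = C}"
proof -
  note cL = subgroup.mem_carrier[OF L]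
  have sQ: "Q \<subseteq> carrier G" using Q by (rule subgroup.subset)
  have cP: "g \<in> L" "g \<in> carrier G" if "g \<in> P" for g using that P cL by auto
  have assoc: "g <# (x <# Q) = (g \<otimes> x) <# Q" if "g \<in> carrier G" "x \<in> L" for g x
    using lcos_m_assoc[OF sQ] that cL by blast
  show ?thesis
  proof (rule p_group_fixed_points[OF P(1,3,4)])
    show "finite ((\<lambda>x. x <# Q) ` L)" using L finite_subgroup by simp
    fix C assume "C \<in> (\<lambda>x. x <# Q) ` L"
    then obtain x where x: "x \<in> L" and C: "C = x <# Q" by auto
    show "\<one> <# C = C" using C assoc[OF one_closed x] x cL by simp
    fix g assume g: "g \<in> P"
    have gx: "g \<otimes> x \<in> L" using subgroup.m_closed[OF L cP(1)[OF g] x] .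
    then show "g <# C \<in> (\<lambda>x. x <# Q) ` L"
      using assoc[of g x] C x g cP by auto
    fix h assume h: "h \<in> P"
    have hx: "h \<otimes> x \<in> L" using subgroup.m_closed[OF L cP(1)[OF h] x] .
    show "(g \<otimes> h) <# C = g <# (h <# C)"
      using assoc[OF _ x] assoc[OF _ hx] C g h cP x cL by (simp add: m_assoc)
  qed
qed

text \<open>The number of cosets of \<open>Q\<close> is prime to \<open>p\<close>, so
  \<open>P\<close> fixes some coset \<open>l <# Q\<close>, and this means that a conjugate of
  \<open>P\<close> lies in \<open>Q\<close>.\<close>

lemma sylow_conjugate:
  assumes P: "subgroup P G" "P \<subseteq> L" "card P = p ^ k" "prime p"
    and Q: "subgroup Q G" and L: "subgroup L G" and QL: "Q \<subseteq> L"
    and ndvd: "\<not> p dvd card L div card Q"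
  obtains l where "l \<in> L" "\<And>g. g \<in> P \<Longrightarrow> inv l \<otimes> g \<otimes> l \<in> Q"
proof -
  note cL = subgroup.mem_carrier[OF L]
  have sQ: "Q \<subseteq> carrier G" using Q by (rule subgroup.subset)
  have "card L div card Q = card ((\<lambda>x. x <# Q) ` L)"
    using card_lcosets[OF Q L QL] card_subgroup_pos[OF Q] by simp
  then have "\<not> p dvd card {C \<in> (\<lambda>x. x <# Q) ` L. \<forall>g\<in>P. g <# C = C}"
    using lcosets_fixed_points[OF P Q L QL] ndvd by simp
  then have "{C \<in> (\<lambda>x. x <# Q) ` L. \<forall>g\<in>P. g <# C = C} \<noteq> {}" by (metis card.empty dvd_0_right)
  then obtain l where l: "l \<in> L" "\<And>g. g \<in> P \<Longrightarrow> g <# (l <# Q) = l <# Q" by auto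
  have "inv l \<otimes> g \<otimes> l \<in> Q" if g: "g \<in> P" for g
  proof -
    have gc: "g \<in> carrier G" using g P cL by auto
    have "(g \<otimes> l) <# Q = l <# Q" using l(2)[OF g] lcos_m_assoc[OF sQ gc cL[OF l(1)]] by simp
    then have "inv l \<otimes> (g \<otimes> l) \<in> Q" using lcoset_eq_iff[OF Q] gc l cL by simp
    then show ?thesis using gc l cL by (simp add: m_assoc)
  qed
  then show thesis using that l by blast
qed

text \<open>In the conjugation action on \<open>U\<close> the identity is fixed and the number of
  fixed points is divisible by \<open>p\<close>, so there is another one.\<close>

lemma p_group_centralizes_element:
  assumes P: "subgroup P G" "card P = p ^ k" "prime p" and n: "normalizes G P U"
    and U: "subgroup U G" "p dvd card U"
  obtains u where "u \<in> U" "u \<noteq> \<one>" "\<And>g. g \<in> P \<Longrightarrow> g \<otimes> u = u \<otimes> g"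
proof -
  note c = subgroup.mem_carrier[OF U(1)] subgroup.mem_carrier[OF P(1)]
  let ?F = "{u \<in> U. \<forall>g\<in>P. g \<otimes> u \<otimes> inv g = u}"
  have "p dvd card U \<longleftrightarrow> p dvd card ?F"
    by (rule p_group_fixed_points[OF P])
      (use finite_subgroup[OF U(1)] normalizesD[OF n] in \<open>auto simp: c inv_mult_group m_assoc\<close>)
  then have "p dvd card ?F" using U by simp
  moreover have "\<one> \<in> ?F" using U P by (auto simp: subgroup.one_closed c)
  ultimately have "?F \<noteq> {\<one>}" using P(3) not_prime_unit by force
  then obtain u where u: "u \<in> U" "u \<noteq> \<one>" "\<forall>g\<in>P. g \<otimes> u \<otimes> inv g = u" using \<open>\<one> \<in> ?F\<close> by blast
  have "g \<otimes> u = u \<otimes> g" if "g \<in> P" for g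
    using u(1,3) that c by (metis inv_solve_right' m_closed)
  then show thesis using that u by blast
qed

section \<open>Normalizers and centralizers\<close>

lemma normalizer_in_subgroup:
  assumes L: "subgroup L G" and U: "subgroup U G"
  shows "subgroup (normalizer_in G L U) G"
proof (rule subgroupI)
  note c = subgroup.mem_carrier[OF L] subgroup.mem_carrier[OF U]
  show "normalizer_in G L U \<subseteq> carrier G" using c by (auto simp: normalizer_in_def)
  have "\<one> \<in> normalizer_in G L U" using L U by (auto simp: normalizer_in_def subgroup.one_closed c)
  then show "normalizer_in G L U \<noteq> {}" by blast
  fix a assume a: "a \<in> normalizer_in G L U"
  then have ac: "a \<in> carrier G" using c by (auto simp: normalizer_in_def)
  \<comment> \<open>On the finite set \<open>U\<close> the injective map is onto, and surjectivity
    is what puts \<open>inv a\<close> into the normalizer.\<close>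
  have "(\<lambda>u. a \<otimes> u \<otimes> inv a) ` U \<subseteq> U" using a by (auto simp: normalizer_in_def)
  moreover have "inj_on (\<lambda>u. a \<otimes> u \<otimes> inv a) U"
    using ac c by (intro inj_onI) simp
  ultimately have eq: "(\<lambda>u. a \<otimes> u \<otimes> inv a) ` U = U"
    by (rule endo_inj_surj[OF finite_subgroup[OF U]])
  have "inv a \<otimes> u \<otimes> a \<in> U" if "u \<in> U" for u
  proof -
    have "u \<in> (\<lambda>u. a \<otimes> u \<otimes> inv a) ` U" using eq that by simp
    then obtain v where v: "v \<in> U" "u = a \<otimes> v \<otimes> inv a" by blast
    then show ?thesis using v ac c by (simp add: m_assoc)
  qed
  then show "inv a \<in> normalizer_in G L U"
    using a ac L by (auto simp: normalizer_in_def subgroup.m_inv_closed)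
  fix b assume b: "b \<in> normalizer_in G L U"
  then have bc: "b \<in> carrier G" using c by (auto simp: normalizer_in_def)
  have "a \<otimes> b \<otimes> u \<otimes> inv (a \<otimes> b) \<in> U" if "u \<in> U" for u
  proof -
    have "a \<otimes> (b \<otimes> u \<otimes> inv b) \<otimes> inv a \<in> U" using a b that by (auto simp: normalizer_in_def)
    then show ?thesis using ac bc that c by (simp add: inv_mult_group m_assoc)
  qed
  then show "a \<otimes> b \<in> normalizer_in G L U"
    using a b L by (auto simp: normalizer_in_def subgroup.m_closed)
qed

lemma normalizer_in_normalizes: "normalizes G (normalizer_in G L U) U"
  by (auto simp: normalizes_def normalizer_in_def)

lemma subset_normalizer_in: "A \<subseteq> normalizer_in G L U \<longleftrightarrow> A \<subseteq> L \<and> normalizes G A U"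
  by (auto simp: normalizes_def normalizer_in_def)

lemma normalizer_in_self: "subgroup U G \<Longrightarrow> U \<subseteq> L \<Longrightarrow> U \<subseteq> normalizer_in G L U"
  by (simp add: subset_normalizer_in normalizes_self)

lemma centralizer_subgroup:
  assumes L: "subgroup L G" and U: "U \<subseteq> carrier G"
  shows "subgroup (centralizer G L U) G"
proof (rule subgroupI)
  note c = subgroup.mem_carrier[OF L]
  show "centralizer G L U \<subseteq> carrier G" using c by (auto simp: centralizer_def)
  have "\<one> \<in> centralizer G L U" using L U by (auto simp: centralizer_def subgroup.one_closed)
  then show "centralizer G L U \<noteq> {}" by blast
  fix a assume a: "a \<in> centralizer G L U"
  then have ac: "a \<in> carrier G" using c by (auto simp: centralizer_def)
  have "inv a \<otimes> u = u \<otimes> inv a" if "u \<in> U" for u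
  proof -
    have uc: "u \<in> carrier G" using that U by auto
    have "u \<otimes> a = a \<otimes> u" using a that by (auto simp: centralizer_def)
    then have "u = a \<otimes> u \<otimes> inv a" using ac uc inv_solve_right[of u "a \<otimes> u" a] by simp
    then have "inv a \<otimes> u = inv a \<otimes> (a \<otimes> (u \<otimes> inv a))" using ac uc by (simp add: m_assoc)
    also have "\<dots> = u \<otimes> inv a" using ac uc by (simp add: m_assoc)
    finally show ?thesis .
  qed
  then show "inv a \<in> centralizer G L U"
    using a L by (auto simp: centralizer_def subgroup.m_inv_closed)
  fix b assume b: "b \<in> centralizer G L U"
  then have bc: "b \<in> carrier G" using c by (auto simp: centralizer_def)
  have "a \<otimes> b \<otimes> u = u \<otimes> (a \<otimes> b)" if "u \<in> U" for u
  proof -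
    have uc: "u \<in> carrier G" using that U by auto
    have 1: "b \<otimes> u = u \<otimes> b" "a \<otimes> u = u \<otimes> a" using a b that by (auto simp: centralizer_def)
    have "a \<otimes> b \<otimes> u = a \<otimes> u \<otimes> b" using 1(1) ac bc uc by (simp add: m_assoc)
    also have "\<dots> = u \<otimes> (a \<otimes> b)" using 1(2) ac bc uc by (simp add: m_assoc)
    finally show ?thesis .
  qed
  then show "a \<otimes> b \<in> centralizer G L U"
    using a b L by (auto simp: centralizer_def subgroup.m_closed)
qed

text \<open>\<open>D\<close> acts on its cosets in \<open>P\<close>. Their number is divisible by
  \<open>p\<close> and the coset \<open>D\<close> is fixed, so there is a further fixed coset, which
  yields an element outside \<open>D\<close> that normalizes \<open>D\<close>.\<close>

lemma normalizer_grows: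
  assumes P: "subgroup P G" "card P = p ^ k" "prime p" and D: "subgroup D G" "D \<subset> P"
  obtains x where "x \<in> normalizer_in G P D" "x \<notin> D"
proof -
  note c = subgroup.mem_carrier[OF P(1)]
  have sD: "D \<subseteq> carrier G" using D(1) by (rule subgroup.subset)
  let ?X = "(\<lambda>x. x <# D) ` P"
  let ?F = "{C \<in> ?X. \<forall>g\<in>D. g <# C = C}"
  have eq: "card P = card ?X * card D" using card_lcosets[OF D(1) P(1)] D(2) by auto
  have "card D dvd p ^ k" using card_subgroup_dvd[of D P] D P by auto
  then obtain j where j: "card D = p ^ j" using P(3) by (auto simp: divides_primepow_nat)
  have "card ?X dvd p ^ k" using eq P(2) by (metis dvd_triv_left)
  then obtain i where i: "card ?X = p ^ i" using P(3) by (auto simp: divides_primepow_nat)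
  have "card D < card P" using D(2) finite_subgroup[OF P(1)] by (rule psubset_card_mono[rotated])
  then have "card ?X \<noteq> 1" using eq by auto
  then have "p dvd card ?X" using i by (cases i) auto
  then have "p dvd card ?F"
    using lcosets_fixed_points[OF D(1) _ j P(3) D(1) P(1)] D(2) by auto
  moreover have "\<one> <# D \<in> ?F"
  proof -
    have "g <# D = D" if "g \<in> D" for g
      using that D(1) by (metis coset_join3 subgroup.mem_carrier)
    then show ?thesis using P(1) lcos_mult_one[OF sD] subgroup.one_closed by force
  qed
  ultimately have "?F \<noteq> {\<one> <# D}" using P(3) not_prime_unit by force
  then obtain C where C: "C \<in> ?F" "C \<noteq> \<one> <# D" using \<open>\<one> <# D \<in> ?F\<close> by blast
  then obtain x where x: "x \<in> P" "C = x <# D" by auto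
  have "inv x \<otimes> \<one> \<notin> D \<or> x \<notin> D" using C(2) x lcoset_eq_iff[OF D(1) c[OF x(1)] one_closed] c by auto
  then have xD: "inv x \<notin> D" using x c D(1) by (metis inv_closed inv_inv r_one subgroup.m_inv_closed)
  have "inv x \<otimes> g \<otimes> x \<in> D" if g: "g \<in> D" for g
  proof -
    have gc: "g \<in> carrier G" using g sD by auto
    have "g <# (x <# D) = x <# D" using C x g by auto
    then have "(g \<otimes> x) <# D = x <# D" using lcos_m_assoc[OF sD gc c[OF x(1)]] by simp
    then have "inv x \<otimes> (g \<otimes> x) \<in> D" using lcoset_eq_iff[OF D(1)] gc x c by simp
    then show ?thesis using gc x c by (simp add: m_assoc)
  qed
  \<comment> \<open>A fixed coset of \<open>x\<close> gives invariance of \<open>D\<close> under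
    \<open>g \<mapsto> inv x \<otimes> g \<otimes> x\<close>, so the witness in the convention of
    \<open>normalizer_in\<close> is \<open>inv x\<close>.\<close>
  then have "inv x \<in> normalizer_in G P D"
    using x c P(1) by (auto simp: normalizer_in_def subgroup.m_inv_closed)
  then show thesis using that xD by blast
qed

end

section \<open>Epimorphisms\<close>

text \<open>Arbitrary epimorphisms rather than canonical maps onto \<open>Mod\<close>: transfer maps
  and coordinate projections of direct products are instances as well.\<close>

locale fin_epi = group_hom G H h + G: fin_group G for G (structure) and H (structure) and h +
  assumes surj: "h ` carrier G = carrier H"
begin

sublocale H: fin_group H
  by unfold_locales (metis G.finite_carrier finite_imageI surj)

definition "ker = kernel G H h"
definition "pre B = {x \<in> carrier G. h x \<in> B}"

lemma ker_subgroup: "subgroup ker G"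
  by (simp add: ker_def subgroup_kernel)

lemma mem_ker: "x \<in> ker \<longleftrightarrow> x \<in> carrier G \<and> h x = \<one>\<^bsub>H\<^esub>"
  by (simp add: ker_def kernel_def)

lemma card_image_mult:
  assumes A: "subgroup A G"
  shows "card (h ` A) * card (A \<inter> ker) = card A"
proof -
  note c = subgroup.mem_carrier[OF A]
  have "card {x \<in> A. h x = y} = card (A \<inter> ker)" if y: "y \<in> h ` A" for y
  proof -
    from y obtain a where a: "a \<in> A" "y = h a" by auto
    have "{x \<in> A. h x = y} = (\<lambda>k. a \<otimes> k) ` (A \<inter> ker)"
    proof (intro equalityI subsetI)
      fix x assume x: "x \<in> {x \<in> A. h x = y}"
      then have xA: "x \<in> A" "h x = h a" using a by auto
      have "inv a \<otimes> x \<in> A"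
        using subgroup.m_closed[OF A subgroup.m_inv_closed[OF A a(1)] xA(1)] .
      moreover have "h (inv a \<otimes> x) = \<one>\<^bsub>H\<^esub>" using xA c[OF xA(1)] c[OF a(1)] by simp
      ultimately have "inv a \<otimes> x \<in> A \<inter> ker" using c by (simp add: mem_ker)
      moreover have "x = a \<otimes> (inv a \<otimes> x)" using c[OF xA(1)] c[OF a(1)] by simp
      ultimately show "x \<in> (\<lambda>k. a \<otimes> k) ` (A \<inter> ker)" by blast
    next
      fix x assume "x \<in> (\<lambda>k. a \<otimes> k) ` (A \<inter> ker)"
      then obtain k where k: "k \<in> A" "k \<in> ker" "x = a \<otimes> k" by auto
      have "x \<in> A" using subgroup.m_closed[OF A a(1) k(1)] k(3) by simp
      moreover have "h x = y" using k a c[OF a(1)] by (simp add: mem_ker)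
      ultimately show "x \<in> {x \<in> A. h x = y}" by simp
    qed
    moreover have "inj_on (\<lambda>k. a \<otimes> k) (A \<inter> ker)"
      using c[OF a(1)] c by (intro inj_onI) simp
    ultimately show ?thesis by (simp add: card_image)
  qed
  from G.fibre_card[of A h, OF G.finite_subgroup[OF A] this] show ?thesis by simp
qed

lemma image_subgroup: "subgroup A G \<Longrightarrow> subgroup (h ` A) H"
  by (rule subgroup_img_is_subgroup)

lemma pre_subgroup:
  assumes "subgroup B H"
  shows "subgroup (pre B) G"
proof (rule G.subgroupI)
  show "pre B \<subseteq> carrier G" by (auto simp: pre_def)
  have "\<one> \<in> pre B" using subgroup.one_closed[OF assms] by (simp add: pre_def)
  then show "pre B \<noteq> {}" by blast
qed (auto simp: pre_def subgroup.m_closed[OF assms] subgroup.m_inv_closed[OF assms])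

lemma image_pre: "B \<subseteq> carrier H \<Longrightarrow> h ` pre B = B"
  unfolding pre_def using surj by (auto simp: image_iff)

lemma ker_subset_pre: "subgroup B H \<Longrightarrow> ker \<subseteq> pre B"
  by (auto simp: pre_def mem_ker subgroup.one_closed)

lemma pre_mono: "B \<subseteq> C \<Longrightarrow> pre B \<subseteq> pre C"
  by (auto simp: pre_def)

lemma card_pre:
  assumes "subgroup B H"
  shows "card (pre B) = card B * card ker"
  using card_image_mult[OF pre_subgroup[OF assms]] image_pre[OF subgroup.subset[OF assms]]
    ker_subset_pre[OF assms] by (simp add: Int_absorb1)

lemma card_ker_mult: "order H * card ker = order G"
  using card_image_mult[OF G.subgroup_self] ker_subgroup[THEN subgroup.subset]
  by (simp add: surj order_def Int_absorb1)

lemma pre_image: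
  assumes A: "subgroup A G" and k: "ker \<subseteq> A"
  shows "pre (h ` A) = A"
proof (intro equalityI subsetI)
  fix x assume "x \<in> pre (h ` A)"
  then obtain a where a: "a \<in> A" and x: "x \<in> carrier G" "h x = h a" by (auto simp: pre_def)
  have ac: "a \<in> carrier G" using A a by (rule subgroup.mem_carrier)
  have "inv a \<otimes> x \<in> ker" using x ac by (simp add: mem_ker)
  then have "inv a \<otimes> x \<in> A" using k by auto
  then have "a \<otimes> (inv a \<otimes> x) \<in> A" using subgroup.m_closed[OF A a] by blast
  then show "x \<in> A" using x ac by simp
next
  fix x assume "x \<in> A"
  then show "x \<in> pre (h ` A)" using subgroup.mem_carrier[OF A] by (auto simp: pre_def)
qed

lemma normalizes_image:
  assumes L: "L \<subseteq> carrier G" and U: "U \<subseteq> carrier G" and n: "normalizes G L U"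
  shows "normalizes H (h ` L) (h ` U)"
proof -
  have "h l \<otimes>\<^bsub>H\<^esub> h u \<otimes>\<^bsub>H\<^esub> inv\<^bsub>H\<^esub> h l \<in> h ` U" if "l \<in> L" "u \<in> U" for l u
  proof -
    have "h (l \<otimes> u \<otimes> inv l) \<in> h ` U" using G.normalizesD[OF n that] by blast
    then show ?thesis using that L U by (simp add: subsetD)
  qed
  then show ?thesis by (auto simp: normalizes_def)
qed

lemma normalizes_pre:
  assumes "normalizes H L U" "U \<subseteq> carrier H"
  shows "normalizes G (pre L) (pre U)"
  using assms by (auto simp: normalizes_def pre_def)

lemma pre_normal:
  assumes "N \<lhd> H" shows "pre N \<lhd> G"
proof -
  have N: "subgroup N H" "normalizes H (carrier H) N" using assms H.normal_iff_normalizes by auto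
  have "pre (carrier H) = carrier G" by (auto simp: pre_def)
  then show ?thesis
    using normalizes_pre[OF N(2) subgroup.subset[OF N(1)]] pre_subgroup[OF N(1)] G.normal_iff_normalizes
    by simp
qed

lemma image_normal:
  assumes "N \<lhd> G" shows "h ` N \<lhd> H"
proof -
  have N: "subgroup N G" "normalizes G (carrier G) N" using assms G.normal_iff_normalizes by auto
  then show ?thesis
    using normalizes_image[OF order_refl subgroup.subset[OF N(1)] N(2)] image_subgroup H.normal_iff_normalizes surj
    by simp
qed

lemma image_set_mult:
  assumes "A \<subseteq> carrier G" "B \<subseteq> carrier G"
  shows "h ` (A <#> B) = h ` A <#>\<^bsub>H\<^esub> h ` B"
proof
  show "h ` (A <#> B) \<subseteq> h ` A <#>\<^bsub>H\<^esub> h ` B"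
    using assms by (fastforce simp: set_mult_def subset_iff)
  show "h ` A <#>\<^bsub>H\<^esub> h ` B \<subseteq> h ` (A <#> B)"
  proof
    fix y assume "y \<in> h ` A <#>\<^bsub>H\<^esub> h ` B"
    then obtain a b where ab: "a \<in> A" "b \<in> B" "y = h a \<otimes>\<^bsub>H\<^esub> h b" by (auto simp: set_mult_def)
    then have "y = h (a \<otimes> b)" using assms by (simp add: subsetD)
    moreover have "a \<otimes> b \<in> A <#> B" using ab by (auto simp: set_mult_def)
    ultimately show "y \<in> h ` (A <#> B)" by blast
  qed
qed

lemma image_conjugate:
  assumes "A \<subseteq> carrier G" "x \<in> carrier G"
  shows "h ` conjugate G A x = conjugate H (h ` A) (h x)"
  unfolding conjugate_def image_image
  by (rule image_cong) (use assms in \<open>auto simp: subset_iff\<close>)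

text \<open>The orders of the image and of \<open>A \<inter> ker\<close> divide those of
  \<open>H\<close> and of the kernel, while the product of their \<open>S\<close>-parts is the
  largest possible.\<close>

lemma part_card_image:
  assumes A: "subgroup A G" and eq: "part S (card A) = part S (order G)"
  shows "part S (card (h ` A)) = part S (order H)"
proof -
  have I: "subgroup (h ` A) H" "subgroup (A \<inter> ker) G"
    using A image_subgroup ker_subgroup G.subgroups_Inter_pair by blast+
  have pos: "card (h ` A) > 0" "card (A \<inter> ker) > 0" "card ker > 0"
    using I ker_subgroup G.card_subgroup_pos H.card_subgroup_pos by auto
  have "part S (card (h ` A)) * part S (card (A \<inter> ker)) = part S (order H) * part S (card ker)"
    using eq pos card_image_mult[OF A] card_ker_mult
    by (metis H.order_pos part_mult)
  moreover have "part S (card (h ` A)) dvd part S (order H)"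
    using H.card_subgroup_dvd_order[OF I(1)] by (simp add: part_dvd_mono)
  moreover have "part S (card (A \<inter> ker)) dvd part S (card ker)"
    using G.card_subgroup_dvd[OF I(2) ker_subgroup] pos by (simp add: part_dvd_mono)
  ultimately show ?thesis using part_mult_dvd_eq(1) by blast
qed

end

lemma (in fin_group) fin_epi_Mod:
  assumes "Y \<lhd> G"
  shows "fin_epi G (G Mod Y) (\<lambda>x. Y #> x)" "fin_epi.ker G (G Mod Y) (\<lambda>x. Y #> x) = Y"
proof -
  interpret Y: normal Y G by fact
  have g: "group (G Mod Y)" by (rule Y.factorgroup_is_group)
  have hom: "(\<lambda>x. Y #> x) \<in> hom G (G Mod Y)" by (rule Y.r_coset_hom_Mod)
  show fe: "fin_epi G (G Mod Y) (\<lambda>x. Y #> x)"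
    by (simp add: fin_epi_def fin_epi_axioms_def group_hom_def group_hom_axioms_def g hom
        fin_group_axioms carrier_FactGroup)
  show "fin_epi.ker G (G Mod Y) (\<lambda>x. Y #> x) = Y"
  proof (intro equalityI subsetI)
    fix x assume "x \<in> fin_epi.ker G (G Mod Y) (\<lambda>x. Y #> x)"
    then have "x \<in> carrier G" "Y #> x = Y" by (simp_all add: fin_epi.mem_ker[OF fe])
    then show "x \<in> Y" using Y.subgroup_axioms by (metis rcos_self)
  next
    fix x assume x: "x \<in> Y"
    then have "x \<in> carrier G" by (rule Y.mem_carrier)
    moreover have "Y #> x = Y" using x by (simp add: Y.rcos_const)
    ultimately show "x \<in> fin_epi.ker G (G Mod Y) (\<lambda>x. Y #> x)" by (simp add: fin_epi.mem_ker[OF fe])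
  qed
qed

section \<open>Transfer\<close>

context fin_group
begin

lemma rcosets_diff:
  assumes Q: "subgroup Q G" and C: "C \<in> rcosets Q" and x: "x \<in> C" "y \<in> C"
  shows "x \<otimes> inv y \<in> Q"
proof -
  obtain a where a: "a \<in> carrier G" "C = Q #> a" using C by (auto simp: RCOSETS_def)
  obtain p q where pq: "p \<in> Q" "q \<in> Q" "x = p \<otimes> a" "y = q \<otimes> a"
    using x a by (auto simp: r_coset_def)
  have "x \<otimes> inv y = p \<otimes> inv q"
    using pq a subgroup.mem_carrier[OF Q] by (simp add: inv_mult_group m_assoc)
  then show ?thesis using subgroup.m_closed[OF Q pq(1) subgroup.m_inv_closed[OF Q pq(2)]] by simp
qed

lemma rcosets_rep:
  assumes Q: "subgroup Q G" and C: "C \<in> rcosets Q"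
  shows "(SOME x. x \<in> C) \<in> C" "(SOME x. x \<in> C) \<in> carrier G" "C \<subseteq> carrier G"
proof -
  obtain a where a: "a \<in> carrier G" "C = Q #> a" using C by (auto simp: RCOSETS_def)
  have "a \<in> C" using rcos_self[OF a(1) Q] a by simp
  then show 1: "(SOME x. x \<in> C) \<in> C" by (rule someI)
  show "C \<subseteq> carrier G" using r_coset_subset_G[OF subgroup.subset[OF Q] a(1)] a by simp
  then show "(SOME x. x \<in> C) \<in> carrier G" using 1 by auto
qed

lemma rcosets_act:
  assumes Q: "subgroup Q G" and C: "C \<in> rcosets Q" and g: "g \<in> carrier G"
  shows "C #> g \<in> rcosets Q"
proof -
  obtain a where a: "a \<in> carrier G" "C = Q #> a" using C by (auto simp: RCOSETS_def)
  then have "C #> g = Q #> (a \<otimes> g)" using coset_mult_assoc[OF subgroup.subset[OF Q] a(1) g] by simp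
  then show ?thesis using rcosetsI[OF subgroup.subset[OF Q], of "a \<otimes> g"] a g by simp
qed

definition "coset_diff C g = (SOME x. x \<in> C) \<otimes> g \<otimes> inv (SOME x. x \<in> C #> g)"

text \<open>The classical transfer into an abelian subgroup; the factors lie in \<open>Q\<close> and
  are multiplied there, so their order is immaterial.\<close>

definition "transfer Q g = finprod (G\<lparr>carrier := Q\<rparr>) (\<lambda>C. coset_diff C g) (rcosets Q)"

lemma coset_diff_closed:
  assumes Q: "subgroup Q G" and C: "C \<in> rcosets Q" and g: "g \<in> carrier G"
  shows "coset_diff C g \<in> Q"
proof -
  have "(SOME x. x \<in> C) \<otimes> g \<in> C #> g"
    using rcosets_rep(1)[OF Q C] by (auto simp: r_coset_def)
  from rcosets_diff[OF Q rcosets_act[OF Q C g] this rcosets_rep(1)[OF Q rcosets_act[OF Q C g]]]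
  show ?thesis by (simp add: coset_diff_def)
qed

lemma coset_diff_mult:
  assumes Q: "subgroup Q G" and C: "C \<in> rcosets Q" and g: "g \<in> carrier G" and h: "h \<in> carrier G"
  shows "coset_diff C (g \<otimes> h) = coset_diff C g \<otimes> coset_diff (C #> g) h"
proof -
  have "C #> (g \<otimes> h) = (C #> g) #> h" using coset_mult_assoc[OF rcosets_rep(3)[OF Q C] g h] by simp
  then show ?thesis
    using rcosets_rep(2)[OF Q C] rcosets_rep(2)[OF Q rcosets_act[OF Q C g]]
      rcosets_rep(2)[OF Q rcosets_act[OF Q rcosets_act[OF Q C g] h]] g h
    by (simp add: coset_diff_def m_assoc)
qed

lemma coset_diff_one:
  assumes Q: "subgroup Q G" and C: "C \<in> rcosets Q"
  shows "coset_diff C \<one> = \<one>"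
  using coset_mult_one[OF rcosets_rep(3)[OF Q C]] rcosets_rep(2)[OF Q C] by (simp add: coset_diff_def)

lemma finite_rcosets: "subgroup Q G \<Longrightarrow> finite (rcosets Q)"
  by (simp add: rcosets_finite RCOSETS_def)

lemma comm_subgroup:
  assumes Q: "subgroup Q G" and comm: "\<And>x y. x \<in> Q \<Longrightarrow> y \<in> Q \<Longrightarrow> x \<otimes> y = y \<otimes> x"
  shows "comm_group (G\<lparr>carrier := Q\<rparr>)"
  by (rule group.group_comm_groupI[OF subgroup_imp_group[OF Q]]) (simp add: comm)

lemma transfer_closed:
  assumes Q: "subgroup Q G" and comm: "\<And>x y. x \<in> Q \<Longrightarrow> y \<in> Q \<Longrightarrow> x \<otimes> y = y \<otimes> x"
    and g: "g \<in> carrier G"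
  shows "transfer Q g \<in> Q"
proof -
  interpret Q: comm_group "G\<lparr>carrier := Q\<rparr>" using comm_subgroup[OF Q comm] .
  have "transfer Q g \<in> carrier (G\<lparr>carrier := Q\<rparr>)"
    unfolding transfer_def by (rule Q.finprod_closed) (use coset_diff_closed[OF Q _ g] in auto)
  then show ?thesis by simp
qed

text \<open>Right multiplication by \<open>g\<close> permutes the cosets, and
  \<open>coset_diff_mult\<close> is a cocycle identity along this permutation.\<close>

lemma transfer_mult:
  assumes Q: "subgroup Q G" and comm: "\<And>x y. x \<in> Q \<Longrightarrow> y \<in> Q \<Longrightarrow> x \<otimes> y = y \<otimes> x"
    and g: "g \<in> carrier G" and h: "h \<in> carrier G"
  shows "transfer Q (g \<otimes> h) = transfer Q g \<otimes> transfer Q h"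
proof -
  interpret Q: comm_group "G\<lparr>carrier := Q\<rparr>" using comm_subgroup[OF Q comm] .
  let ?Q = "G\<lparr>carrier := Q\<rparr>"
  have inj: "inj_on (\<lambda>C. C #> g) (rcosets Q)"
  proof (rule inj_onI)
    fix C D assume C: "C \<in> rcosets Q" "D \<in> rcosets Q" "C #> g = D #> g"
    then have "(C #> g) #> inv g = (D #> g) #> inv g" by simp
    then show "C = D"
      using coset_mult_assoc[OF rcosets_rep(3)[OF Q C(1)] g inv_closed[OF g]]
        coset_mult_assoc[OF rcosets_rep(3)[OF Q C(2)] g inv_closed[OF g]] g
        coset_mult_one[OF rcosets_rep(3)[OF Q C(1)]] coset_mult_one[OF rcosets_rep(3)[OF Q C(2)]]
      by simp
  qed
  have img: "(\<lambda>C. C #> g) ` (rcosets Q) = rcosets Q"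
    by (rule endo_inj_surj[OF finite_rcosets[OF Q] _ inj]) (use rcosets_act[OF Q _ g] in auto)
  have "transfer Q (g \<otimes> h) =
      finprod ?Q (\<lambda>C. coset_diff C g \<otimes>\<^bsub>?Q\<^esub> coset_diff (C #> g) h) (rcosets Q)"
    unfolding transfer_def
    by (rule Q.finprod_cong') (use coset_diff_mult[OF Q _ g h] coset_diff_closed[OF Q _ g]
        coset_diff_closed[OF Q rcosets_act[OF Q _ g] h] Q in \<open>auto simp: subgroup.m_closed\<close>)
  also have "\<dots> = finprod ?Q (\<lambda>C. coset_diff C g) (rcosets Q) \<otimes>\<^bsub>?Q\<^esub>
      finprod ?Q (\<lambda>C. coset_diff (C #> g) h) (rcosets Q)"
    by (rule Q.finprod_multf) (use coset_diff_closed[OF Q _ g]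
        coset_diff_closed[OF Q rcosets_act[OF Q _ g] h] in auto)
  also have "finprod ?Q (\<lambda>C. coset_diff (C #> g) h) (rcosets Q) =
      finprod ?Q (\<lambda>C. coset_diff C h) ((\<lambda>C. C #> g) ` (rcosets Q))"
    by (rule Q.finprod_reindex[symmetric]) (use inj img coset_diff_closed[OF Q _ h] in auto)
  finally show ?thesis by (simp add: transfer_def img)
qed

text \<open>A transfer that is injective on \<open>Q\<close> maps \<open>Q\<close> onto itself, so
  its kernel has order \<open>k\<close>. Describing the kernel by a power equation shows that it is
  invariant under every conjugation that preserves the carrier; this is how it becomes normal in
  larger groups later.\<close>

lemma kernel_of_transfer:
  assumes Q: "subgroup Q G" and comm: "\<And>x y. x \<in> Q \<Longrightarrow> y \<in> Q \<Longrightarrow> x \<otimes> y = y \<otimes> x"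
    and k: "order G = card Q * k" and cop: "coprime (card Q) k"
    and inj: "\<And>x. x \<in> Q \<Longrightarrow> transfer Q x = \<one> \<Longrightarrow> x = \<one>"
  shows "subgroup {x \<in> carrier G. x [^] k = \<one>} G" "card {x \<in> carrier G. x [^] k = \<one>} = k"
proof -
  let ?Q = "G\<lparr>carrier := Q\<rparr>"
  let ?V = "transfer Q"
  have gQ: "group ?Q" using subgroup_imp_group[OF Q] .
  have hom: "?V \<in> hom G ?Q"
    using transfer_closed[OF Q comm] transfer_mult[OF Q comm] by (auto simp: hom_def)
  have gh: "group_hom G ?Q ?V"
    using hom gQ by (simp add: group_hom_def group_hom_axioms_def)
  interpret V: group_hom G ?Q ?V by (rule gh)
  have injQ: "inj_on ?V Q"
  proof (rule inj_onI)
    fix x y assume xy: "x \<in> Q" "y \<in> Q" "?V x = ?V y"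
    note c = subgroup.mem_carrier[OF Q]
    have iy: "inv y \<in> Q" using subgroup.m_inv_closed[OF Q xy(2)] .
    have "?V (x \<otimes> inv y) = ?V (y \<otimes> inv y)"
      using transfer_mult[OF Q comm c[OF xy(1)] c[OF iy]] transfer_mult[OF Q comm c[OF xy(2)] c[OF iy]] xy(3)
      by simp
    also have "\<dots> = \<one>" using V.hom_one c[OF xy(2)] by simp
    finally have "x \<otimes> inv y = \<one>" using inj[OF subgroup.m_closed[OF Q xy(1) iy]] by simp
    then show "x = y" using c xy by (simp add: inv_solve_right')
  qed
  have "?V ` Q = Q"
    by (rule endo_inj_surj[OF finite_subgroup[OF Q] _ injQ])
      (use transfer_closed[OF Q comm] subgroup.mem_carrier[OF Q] in auto)
  then have surj: "?V ` carrier G = Q"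
    using transfer_closed[OF Q comm] subgroup.subset[OF Q] by blast
  interpret E: fin_epi G ?Q ?V
    using gh surj by (simp add: fin_epi_def fin_epi_axioms_def fin_group_axioms)
  have cQ: "card Q > 0" using Q card_subgroup_pos by blast
  have cardk: "card E.ker = k" using E.card_ker_mult k cQ by (simp add: order_def)
  have "E.ker = {x \<in> carrier G. x [^] k = \<one>}"
  proof (intro equalityI subsetI)
    fix x assume x: "x \<in> E.ker"
    then show "x \<in> {x \<in> carrier G. x [^] k = \<one>}"
      using pow_card_eq_one[OF E.ker_subgroup x] cardk by (simp add: E.mem_ker)
  next
    fix x assume "x \<in> {x \<in> carrier G. x [^] k = \<one>}"
    then have x: "x \<in> carrier G" "x [^] k = \<one>" by auto
    have Vx: "?V x \<in> Q" using transfer_closed[OF Q comm x(1)] .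
    have "?V (x [^] k) = ?V x [^]\<^bsub>?Q\<^esub> k" using V.hom_nat_pow[OF x(1)] .
    then have "?V x [^] k = \<one>" using x V.hom_one by (simp add: nat_pow_consistent[symmetric])
    then have "?V x = \<one>"
      using pow_eq_one_coprime[OF subgroup.mem_carrier[OF Q Vx] pow_card_eq_one[OF Q Vx] _ cop] by simp
    then show "x \<in> E.ker" using x by (simp add: E.mem_ker)
  qed
  then show "subgroup {x \<in> carrier G. x [^] k = \<one>} G" "card {x \<in> carrier G. x [^] k = \<one>} = k"
    using E.ker_subgroup cardk by auto
qed

text \<open>A central \<open>x\<close> fixes every coset, and each factor of its transfer is
  \<open>x\<close> itself; so the transfer of \<open>x\<close> is \<open>x [^] k\<close>, with
  \<open>k\<close> coprime to the order of \<open>Q\<close>.\<close>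

theorem central_hall_complement:
  assumes Q: "subgroup Q G" and central: "\<And>x y. x \<in> Q \<Longrightarrow> y \<in> carrier G \<Longrightarrow> x \<otimes> y = y \<otimes> x"
    and k: "order G = card Q * k" and cop: "coprime (card Q) k"
  shows "subgroup {x \<in> carrier G. x [^] k = \<one>} G" "card {x \<in> carrier G. x [^] k = \<one>} = k"
proof -
  note c = subgroup.mem_carrier[OF Q]
  have comm: "x \<otimes> y = y \<otimes> x" if "x \<in> Q" "y \<in> Q" for x y using central c that by blast
  interpret Q: comm_group "G\<lparr>carrier := Q\<rparr>" using comm_subgroup[OF Q comm] .
  have "x = \<one>" if x: "x \<in> Q" and t: "transfer Q x = \<one>" for x
  proof -
    have xc: "x \<in> carrier G" using c x .
    have "coset_diff C x = x" if C: "C \<in> rcosets Q" for C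
    proof -
      obtain a where a: "a \<in> carrier G" "C = Q #> a" using C by (auto simp: RCOSETS_def)
      have "C #> x = Q #> (x \<otimes> a)"
        using a coset_mult_assoc[OF subgroup.subset[OF Q] a(1) xc] central[OF x a(1)] by simp
      also have "\<dots> = (Q #> x) #> a" using coset_mult_assoc[OF subgroup.subset[OF Q] xc a(1)] by simp
      also have "\<dots> = C" using subgroup.rcos_const[OF Q is_group x] a by simp
      finally show ?thesis
        using rcosets_rep(2)[OF Q C] central[OF x rcosets_rep(2)[OF Q C]] xc
        by (simp add: coset_diff_def m_assoc flip: central[OF x rcosets_rep(2)[OF Q C]])
    qed
    then have "transfer Q x = finprod (G\<lparr>carrier := Q\<rparr>) (\<lambda>C. x) (rcosets Q)"
      unfolding transfer_def by (intro Q.finprod_cong') (use x in auto)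
    also have "\<dots> = x [^] card (rcosets Q)"
      using Q.finprod_const[of x "rcosets Q"] x by (simp add: nat_pow_consistent[symmetric])
    also have "card (rcosets Q) = k"
      using lagrange[OF Q] k card_subgroup_pos[OF Q] by (simp add: mult.commute)
    finally have "x [^] k = \<one>" using t by simp
    then show "x = \<one>" using pow_eq_one_coprime[OF xc pow_card_eq_one[OF Q x] _ cop] by simp
  qed
  note * = kernel_of_transfer[OF Q comm k cop this]
  show "subgroup {x \<in> carrier G. x [^] k = \<one>} G" by (rule *(1))
  show "card {x \<in> carrier G. x [^] k = \<one>} = k" by (rule *(2))
qed

text \<open>Lets one nontrivial element stand for all of \<open>Q\<close>: a property that defines a
  subgroup has to be verified at that element only.\<close>

lemma prime_order_generator:
  assumes Q: "subgroup Q G" "card Q = q" "prime q" and R: "subgroup R G" "x \<in> R" "x \<in> Q" "x \<noteq> \<one>"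
  shows "Q \<subseteq> R"
proof -
  have I: "subgroup (Q \<inter> R) G" using Q R subgroups_Inter_pair by blast
  have "card (Q \<inter> R) dvd q" using card_subgroup_dvd[OF I Q(1)] Q by simp
  moreover have "card (Q \<inter> R) \<noteq> 1"
  proof
    assume "card (Q \<inter> R) = 1"
    then obtain z where z: "Q \<inter> R = {z}" by (auto simp: card_1_singleton_iff)
    have "x \<in> {z}" "\<one> \<in> {z}" using R subgroup.one_closed[OF I] z by auto
    then show False using R by simp
  qed
  ultimately have "card (Q \<inter> R) = card Q" using Q(2,3) by (auto simp: prime_nat_iff)
  then have "Q \<inter> R = Q" using finite_subgroup[OF Q(1)] by (intro card_subset_eq) auto
  then show ?thesis by blast
qed

lemma stabilizer_subgroup:
  assumes Q: "subgroup Q G" and C: "C \<subseteq> carrier G"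
  shows "subgroup {g \<in> Q. C #> g = C} G"
proof (rule subgroupI)
  note c = subgroup.mem_carrier[OF Q]
  show "{g \<in> Q. C #> g = C} \<subseteq> carrier G" using c by auto
  have "\<one> \<in> {g \<in> Q. C #> g = C}" using subgroup.one_closed[OF Q] C by simp
  then show "{g \<in> Q. C #> g = C} \<noteq> {}" by blast
  fix a assume a: "a \<in> {g \<in> Q. C #> g = C}"
  have ac: "a \<in> carrier G" using a c by auto
  have "C #> inv a = (C #> a) #> inv a" using a by simp
  also have "\<dots> = C" using coset_mult_assoc[OF C ac inv_closed[OF ac]] ac C by simp
  finally show "inv a \<in> {g \<in> Q. C #> g = C}" using a subgroup.m_inv_closed[OF Q] by auto
  fix b assume b: "b \<in> {g \<in> Q. C #> g = C}"
  have bc: "b \<in> carrier G" using b c by auto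
  have "C #> (a \<otimes> b) = (C #> a) #> b" using coset_mult_assoc[OF C ac bc] by simp
  then show "a \<otimes> b \<in> {g \<in> Q. C #> g = C}" using a b subgroup.m_closed[OF Q] by auto
qed

text \<open>
  The factors of an orbit of length \<open>q\<close> telescope to \<open>coset_diff C (x [^] q) = \<one>\<close>, so only the
  cosets fixed by \<open>x\<close> contribute to the transfer of \<open>x\<close>.
\<close>

lemma transfer_free_part:
  assumes Q: "subgroup Q G" "card Q = q" "prime q"
    and comm: "\<And>x y. x \<in> Q \<Longrightarrow> y \<in> Q \<Longrightarrow> x \<otimes> y = y \<otimes> x" and x: "x \<in> Q"
    and Y: "finite Y" "Y \<subseteq> rcosets Q" and inv: "\<And>C. C \<in> Y \<Longrightarrow> C #> x \<in> Y"
    and free: "\<And>C. C \<in> Y \<Longrightarrow> C #> x \<noteq> C"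
  shows "finprod (G\<lparr>carrier := Q\<rparr>) (\<lambda>C. coset_diff C x) Y = \<one>"
  using Y inv free
proof (induction Y rule: finite_psubset_induct)
  case (psubset Y)
  let ?Q = "G\<lparr>carrier := Q\<rparr>"
  interpret Q: comm_group ?Q using comm_subgroup[OF Q(1) comm] .
  have xc: "x \<in> carrier G" using subgroup.mem_carrier[OF Q(1) x] .
  show ?case
  proof (cases "Y = {}")
    case True
    then show ?thesis using Q.finprod_empty by simp
  next
    case False
    then obtain C where C: "C \<in> Y" by auto
    have CQ: "C \<in> rcosets Q" using C psubset.prems by auto
    note CG = rcosets_rep(3)[OF Q(1) CQ]
    have xq: "x [^] q = \<one>" using pow_card_eq_one[OF Q(1) x] Q(2) by simp
    have act: "(C #> x [^] i) #> x = C #> x [^] Suc i" for i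
      using coset_mult_assoc[OF CG nat_pow_closed[OF xc] xc] by simp
    have mem: "C #> x [^] (i::nat) \<in> Y" for i
    proof (induction i)
      case 0
      then show ?case using C coset_mult_one[OF CG] by simp
    next
      case (Suc i)
      then show ?case using psubset.prems(2)[OF Suc] act by simp
    qed
    \<comment> \<open>A power of \<open>x\<close> with exponent strictly between 0 and
      \<open>q\<close> still generates \<open>Q\<close>; if it fixed \<open>C\<close>, so would
      \<open>x\<close>.\<close>
    have move: "C #> x [^] i \<noteq> C" if i: "0 < i" "i < q" for i :: nat
    proof
      assume *: "C #> x [^] i = C"
      have "\<not> q dvd i" using i by (auto dest: dvd_imp_le)
      then have cop: "coprime i q" using Q(3) by (metis coprime_commute prime_imp_coprime)
      have "x \<noteq> \<one>" using psubset.prems(3)[OF C] coset_mult_one[OF CG] by auto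
      then have ne: "x [^] i \<noteq> \<one>" using pow_eq_one_coprime[OF xc _ xq cop] by auto
      have xi: "x [^] i \<in> Q"
        using x by (induction i) (auto simp: subgroup.one_closed[OF Q(1)] subgroup.m_closed[OF Q(1)])
      have "Q \<subseteq> {g \<in> Q. C #> g = C}"
        by (rule prime_order_generator[OF Q stabilizer_subgroup[OF Q(1) CG] _ xi ne]) (use xi * in auto)
      then show False using x psubset.prems(3)[OF C] by auto
    qed
    define cs where "cs i = C #> x [^] (i::nat)" for i
    have ne: "cs i \<noteq> cs j" if "i < j" "j < q" for i j
    proof
      assume *: "cs i = cs j"
      have "C #> x [^] (q - i + i) = C"
        using that xq coset_mult_one[OF CG] by simp
      moreover have "C #> x [^] (q - i + i) = cs i #> x [^] (q - i)"
        using coset_mult_assoc[OF CG nat_pow_closed[OF xc] nat_pow_closed[OF xc]]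
        by (simp add: cs_def nat_pow_mult xc add.commute)
      moreover have "cs j #> x [^] (q - i) = C #> x [^] (j + (q - i))"
        using coset_mult_assoc[OF CG nat_pow_closed[OF xc] nat_pow_closed[OF xc]]
        by (simp add: cs_def nat_pow_mult xc)
      moreover have "x [^] (j + (q - i)) = x [^] (j - i)"
      proof -
        have "j + (q - i) = q + (j - i)" using that by simp
        then have "x [^] (j + (q - i)) = x [^] q \<otimes> x [^] (j - i)" by (simp add: nat_pow_mult xc)
        then show ?thesis using xq xc by simp
      qed
      ultimately have "C #> x [^] (j - i) = C" using * by simp
      then show False using move[of "j - i"] that by simp
    qed
    have injo: "inj_on cs {..<q}"
      by (rule linorder_inj_onI) (use ne in auto)
    let ?O = "cs ` {..<q}"
    have OY: "?O \<subseteq> Y" using mem by (auto simp: cs_def)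
    have q0: "q > 0" using Q(3) prime_gt_0_nat by blast
    have CO: "C \<in> ?O" using q0 coset_mult_one[OF CG] by (force simp: cs_def image_iff)
    have oSuc: "cs i #> x = cs (Suc i)" for i using act by (simp add: cs_def)
    have oq: "cs q = cs 0" using xq by (simp add: cs_def)
    have invO: "D #> x \<in> Y - ?O" if D: "D \<in> Y - ?O" for D
    proof -
      have "D #> x \<notin> ?O"
      proof
        assume "D #> x \<in> ?O"
        then obtain i where i: "i < q" "D #> x = cs i" by auto
        \<comment> \<open>The predecessor on the cyclic orbit; for index 0 it is
          \<open>q - 1\<close>, since \<open>cs q = cs 0\<close>.\<close>
        obtain j where j: "j < q" "cs j #> x = cs i"
        proof (cases i)
          case 0
          then show ?thesis using that[of "q - 1"] oSuc[of "q - 1"] oq q0 by simp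
        next
          case (Suc j)
          then show ?thesis using that[of j] oSuc[of j] i by simp
        qed
        have "(D #> x) #> inv x = (cs j #> x) #> inv x" using i j by simp
        moreover have "D \<subseteq> carrier G" "cs j \<subseteq> carrier G"
          using D psubset.prems(1) mem[of j] rcosets_rep(3)[OF Q(1)] by (auto simp: cs_def)
        ultimately have "D = cs j"
          using coset_mult_assoc[OF _ xc inv_closed[OF xc]] xc by simp
        then show False using D j by auto
      qed
      then show ?thesis using psubset.prems(2) D by simp
    qed
    have IH: "finprod ?Q (\<lambda>C. coset_diff C x) (Y - ?O) = \<one>"
      by (rule psubset.IH) (use CO C OY psubset.prems invO in auto)
    have cl: "coset_diff D x \<in> Q" if "D \<in> Y" for D
      using coset_diff_closed[OF Q(1) _ xc] that psubset.prems(1) by auto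
    have part: "finprod ?Q (\<lambda>i. coset_diff (cs i) x) {..<n} = coset_diff C (x [^] n)" for n
    proof (induction n)
      case 0
      then show ?case using coset_diff_one[OF Q(1) CQ] Q.finprod_empty by simp
    next
      case (Suc n)
      have cli: "coset_diff (cs i) x \<in> Q" for i using cl mem by (simp add: cs_def)
      have "finprod ?Q (\<lambda>i. coset_diff (cs i) x) {..<Suc n} =
          coset_diff (cs n) x \<otimes>\<^bsub>?Q\<^esub> finprod ?Q (\<lambda>i. coset_diff (cs i) x) {..<n}"
        unfolding lessThan_Suc by (rule Q.finprod_insert) (use cli in auto)
      also have "\<dots> = coset_diff (cs n) x \<otimes> coset_diff C (x [^] n)" using Suc by simp
      also have "\<dots> = coset_diff C (x [^] n) \<otimes> coset_diff (cs n) x"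
        using comm cli coset_diff_closed[OF Q(1) CQ nat_pow_closed[OF xc]] by blast
      also have "\<dots> = coset_diff C (x [^] Suc n)"
        using coset_diff_mult[OF Q(1) CQ nat_pow_closed[OF xc] xc] by (simp add: cs_def)
      finally show ?case .
    qed
    have "finprod ?Q (\<lambda>C. coset_diff C x) ?O = finprod ?Q (\<lambda>i. coset_diff (cs i) x) {..<q}"
      by (rule Q.finprod_reindex) (use injo cl OY in auto)
    also have "\<dots> = \<one>" using part xq coset_diff_one[OF Q(1) CQ] by simp
    finally have O1: "finprod ?Q (\<lambda>C. coset_diff C x) ?O = \<one>" .
    have "finprod ?Q (\<lambda>C. coset_diff C x) (?O \<union> (Y - ?O)) =
        finprod ?Q (\<lambda>C. coset_diff C x) ?O \<otimes>\<^bsub>?Q\<^esub> finprod ?Q (\<lambda>C. coset_diff C x) (Y - ?O)"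
      by (rule Q.finprod_Un_disjoint) (use psubset.hyps cl OY in auto)
    moreover have "?O \<union> (Y - ?O) = Y" using OY by auto
    ultimately show ?thesis using IH O1 by simp
  qed
qed

text \<open>Cosets moved by \<open>x\<close> contribute nothing to its transfer. A fixed coset has
  its representative in the normalizer of \<open>Q\<close>, hence commuting with \<open>x\<close>,
  and contributes \<open>x\<close>. The number of fixed cosets is prime to \<open>q\<close> because
  the index \<open>m\<close> is, so the transfer is injective on \<open>Q\<close>.\<close>

theorem burnside_prime_complement:
  assumes Q: "subgroup Q G" "card Q = q" "prime q" and m: "order G = q * m" "\<not> q dvd m"
    and cent: "\<And>g x. g \<in> normalizer_in G (carrier G) Q \<Longrightarrow> x \<in> Q \<Longrightarrow> g \<otimes> x = x \<otimes> g"
  shows "subgroup {x \<in> carrier G. x [^] m = \<one>} G" "card {x \<in> carrier G. x [^] m = \<one>} = m"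
proof -
  note c = subgroup.mem_carrier[OF Q(1)]
  let ?Q = "G\<lparr>carrier := Q\<rparr>"
  have comm: "x \<otimes> y = y \<otimes> x" if "x \<in> Q" "y \<in> Q" for x y
    using cent normalizer_in_self[OF Q(1) subgroup.subset[OF Q(1)]] that by blast
  interpret Q: comm_group ?Q using comm_subgroup[OF Q(1) comm] .
  have cop: "coprime (card Q) m" using Q m prime_imp_coprime by metis
  let ?R = "rcosets Q"
  have cardR: "card ?R = m"
    using lagrange[OF Q(1)] m Q prime_gt_0_nat[OF Q(3)] by (simp add: mult.commute)
  have "x = \<one>" if x: "x \<in> Q" and t: "transfer Q x = \<one>" for x
  proof (rule ccontr)
    assume x1: "x \<noteq> \<one>"
    have xc: "x \<in> carrier G" using c x .
    let ?F = "{C \<in> ?R. C #> x = C}"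
    have stab: "Q \<subseteq> {g \<in> Q. C #> g = C}" if "C \<in> ?F" for C
      by (rule prime_order_generator[OF Q stabilizer_subgroup[OF Q(1)] _ x x1])
        (use that rcosets_rep(3)[OF Q(1)] x in auto)
    have F: "?F = {C \<in> ?R. \<forall>g\<in>Q. C #> inv g = C}"
    proof (intro equalityI subsetI)
      fix C assume "C \<in> ?F"
      then show "C \<in> {C \<in> ?R. \<forall>g\<in>Q. C #> inv g = C}"
        using stab[of C] subgroup.m_inv_closed[OF Q(1)] by blast
    next
      fix C assume C: "C \<in> {C \<in> ?R. \<forall>g\<in>Q. C #> inv g = C}"
      then have "C #> inv (inv x) = C" using subgroup.m_inv_closed[OF Q(1) x] by blast
      then show "C \<in> ?F" using C xc by simp
    qed
    \<comment> \<open>Inverting the group element turns right multiplication of cosets into a left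
      action.\<close>
    have "q dvd card ?R \<longleftrightarrow> q dvd card {C \<in> ?R. \<forall>g\<in>Q. C #> inv g = C}"
    proof (rule p_group_fixed_points[OF Q(1) _ Q(3), of 1])
      show "card Q = q ^ 1" using Q by simp
      show "finite ?R" using finite_rcosets[OF Q(1)] .
      fix C assume C: "C \<in> ?R"
      show "C #> inv \<one> = C" using rcosets_rep(3)[OF Q(1) C] by simp
      fix g assume g: "g \<in> Q"
      show "C #> inv g \<in> ?R" using rcosets_act[OF Q(1) C] c[OF g] by simp
      fix h assume h: "h \<in> Q"
      show "C #> inv (g \<otimes> h) = C #> inv h #> inv g"
        using coset_mult_assoc[OF rcosets_rep(3)[OF Q(1) C], of "inv h" "inv g"] c[OF g] c[OF h]
        by (simp add: inv_mult_group)
    qed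
    then have nF: "\<not> q dvd card ?F" using m cardR F by simp
    have finR: "finite ?R" using finite_rcosets[OF Q(1)] .
    have cl: "coset_diff C x \<in> Q" if "C \<in> ?R" for C using coset_diff_closed[OF Q(1) that xc] .
    have fixd: "coset_diff C x = x" if C: "C \<in> ?F" for C
    proof -
      have CR: "C \<in> ?R" using C by simp
      define r where "r = (SOME x. x \<in> C)"
      have r: "r \<in> C" "r \<in> carrier G" using rcosets_rep[OF Q(1) CR] by (auto simp: r_def)
      have "r \<otimes> g \<otimes> inv r \<in> Q" if g: "g \<in> Q" for g
      proof -
        have "C #> g = C" using stab[OF C] g by auto
        then have "r \<otimes> g \<in> C" using r by (auto simp: r_coset_def)
        then show ?thesis using rcosets_diff[OF Q(1) CR _ r(1)] by blast
      qed
      then have "r \<in> normalizer_in G (carrier G) Q" using r by (auto simp: normalizer_in_def)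
      then have "r \<otimes> x = x \<otimes> r" using cent x by blast
      then have "r \<otimes> x \<otimes> inv r = x" using r xc by (simp add: m_assoc)
      then show ?thesis using C by (simp add: coset_diff_def r_def)
    qed
    have "finprod ?Q (\<lambda>C. coset_diff C x) (?F \<union> (?R - ?F)) =
        finprod ?Q (\<lambda>C. coset_diff C x) ?F \<otimes>\<^bsub>?Q\<^esub> finprod ?Q (\<lambda>C. coset_diff C x) (?R - ?F)"
      by (rule Q.finprod_Un_disjoint) (use finR cl in auto)
    moreover have "?F \<union> (?R - ?F) = ?R" by auto
    moreover have "finprod ?Q (\<lambda>C. coset_diff C x) (?R - ?F) = \<one>"
    proof (rule transfer_free_part[OF Q comm x])
      fix C assume C: "C \<in> ?R - ?F"
      then show "C #> x \<noteq> C" by auto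
      have CG: "C \<subseteq> carrier G" using C rcosets_rep(3)[OF Q(1)] by auto
      have CxG: "C #> x \<subseteq> carrier G" using r_coset_subset_G[OF CG xc] .
      have "C #> x \<noteq> (C #> x) #> x"
      proof
        assume "C #> x = (C #> x) #> x"
        then have "(C #> x) #> inv x = ((C #> x) #> x) #> inv x" by simp
        then show False
          using C coset_mult_assoc[OF CG xc inv_closed[OF xc]] coset_mult_assoc[OF CxG xc inv_closed[OF xc]]
            coset_mult_one[OF CG] coset_mult_one[OF CxG] xc by auto
      qed
      then show "C #> x \<in> ?R - ?F" using rcosets_act[OF Q(1) _ xc] C by auto
    qed (use finR in auto)
    moreover have "finprod ?Q (\<lambda>C. coset_diff C x) ?F = x [^] card ?F"
    proof -
      have "finprod ?Q (\<lambda>C. coset_diff C x) ?F = finprod ?Q (\<lambda>C. x) ?F"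
        by (rule Q.finprod_cong') (use fixd x in auto)
      also have "\<dots> = x [^] card ?F"
        using Q.finprod_const[of x ?F] x by (simp add: nat_pow_consistent[symmetric])
      finally show ?thesis .
    qed
    ultimately have "x [^] card ?F = \<one>" using t xc by (simp add: transfer_def)
    moreover have "coprime q (card ?F)" using nF Q(3) prime_imp_coprime by blast
    ultimately show False
      using pow_eq_one_coprime[OF xc pow_card_eq_one[OF Q(1) x], of "card ?F"] Q(2) x1 by simp
  qed
  note inj = this
  have k: "order G = card Q * m" using m Q by simp
  note * = kernel_of_transfer[OF Q(1) comm k cop inj]
  show "subgroup {x \<in> carrier G. x [^] m = \<one>} G" by (rule *(1))
  show "card {x \<in> carrier G. x [^] m = \<one>} = m" by (rule *(2))
qed

end

section \<open>A crossed homomorphism onto an abelian normal Hall subgroup\<close>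

context fin_group
begin

lemma finprod_conj:
  assumes N: "subgroup N G" and comm: "\<And>x y. x \<in> N \<Longrightarrow> y \<in> N \<Longrightarrow> x \<otimes> y = y \<otimes> x"
    and g: "g \<in> carrier G" and n: "\<And>x. x \<in> N \<Longrightarrow> g \<otimes> x \<otimes> inv g \<in> N"
    and fin: "finite A" and f: "\<And>a. a \<in> A \<Longrightarrow> f a \<in> N"
  shows "finprod (G\<lparr>carrier := N\<rparr>) (\<lambda>a. g \<otimes> f a \<otimes> inv g) A =
    g \<otimes> finprod (G\<lparr>carrier := N\<rparr>) f A \<otimes> inv g"
  using fin f
proof (induction A rule: finite_induct)
  interpret N: comm_group "G\<lparr>carrier := N\<rparr>" using comm_subgroup[OF N comm] .
  {
    case empty
    show ?case using N.finprod_empty g by simp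
  next
    case (insert a A)
    note c = subgroup.mem_carrier[OF N]
    have fa: "f a \<in> N" and fA: "\<And>b. b \<in> A \<Longrightarrow> f b \<in> N" using insert by auto
    have P: "finprod (G\<lparr>carrier := N\<rparr>) f A \<in> N"
      using N.finprod_closed[of f A] fA by auto
    have "finprod (G\<lparr>carrier := N\<rparr>) (\<lambda>a. g \<otimes> f a \<otimes> inv g) (insert a A) =
        (g \<otimes> f a \<otimes> inv g) \<otimes> finprod (G\<lparr>carrier := N\<rparr>) (\<lambda>a. g \<otimes> f a \<otimes> inv g) A"
      using insert(1,2) n fa fA by (subst N.finprod_insert) auto
    also have "\<dots> = (g \<otimes> f a \<otimes> inv g) \<otimes> (g \<otimes> finprod (G\<lparr>carrier := N\<rparr>) f A \<otimes> inv g)"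
      using insert.IH fA by simp
    also have "\<dots> = g \<otimes> (f a \<otimes> finprod (G\<lparr>carrier := N\<rparr>) f A) \<otimes> inv g"
      using g c[OF fa] c[OF P] by (simp add: m_assoc)
    also have "f a \<otimes> finprod (G\<lparr>carrier := N\<rparr>) f A = finprod (G\<lparr>carrier := N\<rparr>) f (insert a A)"
      using insert(1,2) fa fA by (subst N.finprod_insert) auto
    finally show ?case .
  }
qed

text \<open>
  Write \<open>rep C\<close> for a representative of the coset \<open>C\<close> and \<open>s t\<close> for the element of \<open>N\<close> with
  \<open>t = s t \<otimes> rep (N #> t)\<close>.  The product \<open>\<phi> g\<close> of all \<open>g \<otimes> s (inv g \<otimes> rep C \<otimes> g) \<otimes> inv g\<close> is a
  crossed homomorphism from \<open>G\<close> to \<open>N\<close>.  For \<open>x \<in> N\<close> it is \<open>inv x [^] k\<close> times an element of \<open>N\<close>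
  centralized by \<open>L\<close>, so it is injective on \<open>N\<close>, and its kernel is a complement.
\<close>

theorem normal_hall_complement:
  assumes N: "N \<lhd> G" and O: "L \<lhd> G" and NL: "N \<subseteq> L"
    and comm: "\<And>x y. x \<in> N \<Longrightarrow> y \<in> N \<Longrightarrow> x \<otimes> y = y \<otimes> x"
    and card: "card L = card N * k" and cop: "coprime (card N) k"
    and triv: "\<And>x. x \<in> N \<Longrightarrow> (\<And>y. y \<in> L \<Longrightarrow> y \<otimes> x = x \<otimes> y) \<Longrightarrow> x = \<one>"
  obtains M where "subgroup M G" "N \<inter> M = {\<one>}" "N <#> M = carrier G"
proof -
  have sN: "subgroup N G" and sL: "subgroup L G" using N O normal_imp_subgroup by auto
  note cN = subgroup.mem_carrier[OF sN] and cL = subgroup.mem_carrier[OF sL]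
  have Nn: "g \<otimes> x \<otimes> inv g \<in> N" "inv g \<otimes> x \<otimes> g \<in> N" if "g \<in> carrier G" "x \<in> N" for g x
    using that N normal.inv_op_closed1 normal.inv_op_closed2 by metis+
  have Ln: "inv g \<otimes> x \<otimes> g \<in> L" if "g \<in> carrier G" "x \<in> L" for g x
    using that O normal.inv_op_closed1 by metis
  have NsubG: "N \<subseteq> carrier G" using sN subgroup.subset by blast
  let ?N = "G\<lparr>carrier := N\<rparr>"
  interpret NG: comm_group ?N using comm_subgroup[OF sN comm] .
  define X where "X = (\<lambda>t. N #> t) ` L"
  define rep where "rep C = (SOME x. x \<in> C)" for C :: "'a set"
  define s where "s t = t \<otimes> inv (rep (N #> t))" for t
  have finX: "finite X" using finite_subgroup[OF sL] by (simp add: X_def)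
  have coset_mult: "N #> (n \<otimes> t) = N #> t" if "n \<in> N" "t \<in> carrier G" for n t
    using coset_mult_assoc[OF NsubG cN[OF that(1)] that(2)] subgroup.rcos_const[OF sN is_group that(1)] by simp
  have mem_coset: "N #> t = N #> u \<longleftrightarrow> t \<otimes> inv u \<in> N" if "t \<in> carrier G" "u \<in> carrier G" for t u
  proof
    assume "N #> t = N #> u"
    then have "t \<in> N #> u" using rcos_self[OF that(1) sN] by simp
    then obtain n where "n \<in> N" "t = n \<otimes> u" by (auto simp: r_coset_def)
    then show "t \<otimes> inv u \<in> N" using cN that by (simp add: m_assoc)
  next
    assume "t \<otimes> inv u \<in> N"
    from coset_mult[OF this that(2)] show "N #> t = N #> u" using that by (simp add: m_assoc)
  qed
  have rep: "rep (N #> t) \<in> L" "rep (N #> t) \<in> carrier G" "N #> rep (N #> t) = N #> t" if "t \<in> L" for t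
  proof -
    have "t \<in> N #> t" using rcos_self[OF cL[OF that] sN] .
    then have "rep (N #> t) \<in> N #> t" unfolding rep_def by (rule someI)
    then obtain n where n: "n \<in> N" "rep (N #> t) = n \<otimes> t" by (auto simp: r_coset_def)
    have "n \<in> L" using n NL by auto
    then show "rep (N #> t) \<in> L" using n subgroup.m_closed[OF sL _ that] by simp
    then show "rep (N #> t) \<in> carrier G" using cL by blast
    show "N #> rep (N #> t) = N #> t" using coset_mult[OF n(1) cL[OF that]] n by simp
  qed
  have repX: "rep C \<in> L" "rep C \<in> carrier G" "N #> rep C = C" if "C \<in> X" for C
    using that rep by (auto simp: X_def)
  have sN': "s t \<in> N" if "t \<in> L" for t
    using mem_coset[OF cL[OF that] rep(2)[OF that]] rep(3)[OF that] by (simp add: s_def)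
  have s_mult: "s (n \<otimes> t) = n \<otimes> s t" if "n \<in> N" "t \<in> L" for n t
    using coset_mult[OF that(1) cL[OF that(2)]] cN[OF that(1)] cL[OF that(2)] rep(2)[OF that(2)]
    by (simp add: s_def m_assoc)
  have s_split: "t = s t \<otimes> rep (N #> t)" if "t \<in> L" for t
    using cL[OF that] rep(2)[OF that] by (simp add: s_def m_assoc)
  \<comment> \<open>Conjugation by \<open>g\<close> permutes the cosets of \<open>N\<close> in
    \<open>L\<close> through \<open>act g\<close>; \<open>\<tau> g C\<close> is the element of
    \<open>N\<close> by which it fails to preserve the transversal, conjugated back by
    \<open>g\<close>.\<close>
  define act where "act g C = N #> (inv g \<otimes> rep C \<otimes> g)" for g C
  define \<tau> where "\<tau> g C = g \<otimes> s (inv g \<otimes> rep C \<otimes> g) \<otimes> inv g" for g C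
  define \<phi> where "\<phi> g = finprod ?N (\<tau> g) X" for g
  have \<tau>N: "\<tau> g C \<in> N" if "g \<in> carrier G" "C \<in> X" for g C
    using Nn(1)[OF that(1) sN'[OF Ln[OF that(1) repX(1)[OF that(2)]]]] by (simp add: \<tau>_def)
  have \<phi>N: "\<phi> g \<in> N" if "g \<in> carrier G" for g
    using NG.finprod_closed[of "\<tau> g" X] \<tau>N[OF that] by (auto simp: \<phi>_def)
  have actX: "act g C \<in> X" if "g \<in> carrier G" "C \<in> X" for g C
    using Ln[OF that(1) repX(1)[OF that(2)]] by (auto simp: act_def X_def)
  have inj_act: "inj_on (act g) X" if g: "g \<in> carrier G" for g
  proof (rule inj_onI)
    fix C D assume CD: "C \<in> X" "D \<in> X" "act g C = act g D"
    note r = repX(2)[OF CD(1)] repX(2)[OF CD(2)]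
    have "(inv g \<otimes> rep C \<otimes> g) \<otimes> inv (inv g \<otimes> rep D \<otimes> g) \<in> N"
      using mem_coset[of "inv g \<otimes> rep C \<otimes> g" "inv g \<otimes> rep D \<otimes> g"] CD(3) r g by (simp add: act_def)
    then have "inv g \<otimes> (rep C \<otimes> inv (rep D)) \<otimes> g \<in> N" using r g by (simp add: inv_mult_group m_assoc)
    from Nn(1)[OF g this] have "rep C \<otimes> inv (rep D) \<in> N" using r g by (simp add: m_assoc)
    then have "N #> rep C = N #> rep D" using mem_coset[OF r] by simp
    then show "C = D" using repX(3)[OF CD(1)] repX(3)[OF CD(2)] by simp
  qed
  have img_act: "act g ` X = X" if g: "g \<in> carrier G" for g
    by (rule endo_inj_surj[OF finX _ inj_act[OF g]]) (use actX[OF g] in auto)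
  have crossed: "\<phi> (g \<otimes> h) = \<phi> g \<otimes> (g \<otimes> \<phi> h \<otimes> inv g)" if g: "g \<in> carrier G" and h: "h \<in> carrier G" for g h
  proof -
    \<comment> \<open>The splitting \<open>u = s u \<otimes> v\<close> separates the error caused by
      \<open>g\<close> from the one caused by \<open>h\<close>; \<open>s_mult\<close> carries the
      first through the conjugation by \<open>h\<close>.\<close>
    have step: "\<tau> (g \<otimes> h) C = \<tau> g C \<otimes> (g \<otimes> \<tau> h (act g C) \<otimes> inv g)" if C: "C \<in> X" for C
    proof -
      define r where "r = rep C"
      define u where "u = inv g \<otimes> r \<otimes> g"
      define v where "v = rep (N #> u)"
      have rc: "r \<in> carrier G" "r \<in> L" using repX[OF C] by (auto simp: r_def)
      have uL: "u \<in> L" using Ln[OF g rc(2)] by (simp add: u_def)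
      have uc: "u \<in> carrier G" using cL[OF uL] .
      have v: "v \<in> L" "v \<in> carrier G" using rep[OF uL] by (auto simp: v_def)
      have su: "s u \<in> N" "s u \<in> carrier G" using sN'[OF uL] cN by auto
      have us: "u = s u \<otimes> v" using s_split[OF uL] by (simp add: v_def)
      have w: "inv h \<otimes> v \<otimes> h \<in> L" using Ln[OF h v(1)] .
      have sw: "s (inv h \<otimes> v \<otimes> h) \<in> carrier G" using cN sN'[OF w] by blast
      have "inv (g \<otimes> h) \<otimes> r \<otimes> (g \<otimes> h) = inv h \<otimes> u \<otimes> h"
        using g h rc by (simp add: u_def inv_mult_group m_assoc)
      also have "\<dots> = (inv h \<otimes> s u \<otimes> h) \<otimes> (inv h \<otimes> v \<otimes> h)"
        using h su v by (subst us) (simp add: m_assoc)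
      finally have "s (inv (g \<otimes> h) \<otimes> r \<otimes> (g \<otimes> h)) = (inv h \<otimes> s u \<otimes> h) \<otimes> s (inv h \<otimes> v \<otimes> h)"
        using s_mult[OF Nn(2)[OF h su(1)] w] by simp
      then have "\<tau> (g \<otimes> h) C =
          (g \<otimes> h) \<otimes> ((inv h \<otimes> s u \<otimes> h) \<otimes> s (inv h \<otimes> v \<otimes> h)) \<otimes> inv (g \<otimes> h)"
        by (simp add: \<tau>_def r_def)
      also have "\<dots> = (g \<otimes> s u \<otimes> inv g) \<otimes> (g \<otimes> (h \<otimes> s (inv h \<otimes> v \<otimes> h) \<otimes> inv h) \<otimes> inv g)"
        using g h su sw by (simp add: inv_mult_group m_assoc)
      finally show ?thesis by (simp add: \<tau>_def act_def r_def u_def v_def)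
    qed
    have cl: "g \<otimes> \<tau> h D \<otimes> inv g \<in> N" if "D \<in> X" for D using Nn(1)[OF g \<tau>N[OF h that]] .
    have "\<phi> (g \<otimes> h) = finprod ?N (\<lambda>C. \<tau> g C \<otimes>\<^bsub>?N\<^esub> (g \<otimes> \<tau> h (act g C) \<otimes> inv g)) X"
      unfolding \<phi>_def
      by (rule NG.finprod_cong') (use step \<tau>N[OF g] cl actX[OF g] subgroup.m_closed[OF sN] in auto)
    also have "\<dots> = \<phi> g \<otimes>\<^bsub>?N\<^esub> finprod ?N (\<lambda>C. g \<otimes> \<tau> h (act g C) \<otimes> inv g) X"
      unfolding \<phi>_def by (rule NG.finprod_multf) (use \<tau>N[OF g] cl actX[OF g] in auto)
    also have "finprod ?N (\<lambda>C. g \<otimes> \<tau> h (act g C) \<otimes> inv g) X =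
        finprod ?N (\<lambda>D. g \<otimes> \<tau> h D \<otimes> inv g) (act g ` X)"
      by (rule NG.finprod_reindex[symmetric]) (use cl img_act[OF g] inj_act[OF g] in auto)
    also have "\<dots> = g \<otimes> \<phi> h \<otimes> inv g"
      unfolding img_act[OF g] \<phi>_def
      by (rule finprod_conj[OF sN comm g Nn(1)[OF g] finX \<tau>N[OF h]])
    finally show ?thesis by simp
  qed
  have cardX: "card X = k"
  proof -
    have "card {t \<in> L. N #> t = C} = card N" if C: "C \<in> X" for C
    proof -
      have "{t \<in> L. N #> t = C} = (\<lambda>n. n \<otimes> rep C) ` N"
      proof (intro equalityI subsetI)
        fix t assume "t \<in> {t \<in> L. N #> t = C}"
        then have t: "t \<in> L" "N #> t = C" by auto
        then show "t \<in> (\<lambda>n. n \<otimes> rep C) ` N" using s_split[OF t(1)] sN'[OF t(1)] by auto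
      next
        fix t assume "t \<in> (\<lambda>n. n \<otimes> rep C) ` N"
        then obtain n where n: "n \<in> N" "t = n \<otimes> rep C" by auto
        have "n \<in> L" using n NL by auto
        then have "t \<in> L" using n subgroup.m_closed[OF sL _ repX(1)[OF C]] by simp
        then show "t \<in> {t \<in> L. N #> t = C}"
          using coset_mult[OF n(1) repX(2)[OF C]] repX(3)[OF C] n by simp
      qed
      moreover have "inj_on (\<lambda>n. n \<otimes> rep C) N"
        using repX(2)[OF C] cN by (intro inj_onI) simp
      ultimately show ?thesis by (simp add: card_image)
    qed
    then have "card L = card X * card N"
      using fibre_card[OF finite_subgroup[OF sL], of "\<lambda>t. N #> t" "card N"] by (simp add: X_def)
    then show ?thesis using card card_subgroup_pos[OF sN] by (simp add: mult.commute)
  qed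
  have ker: "n = \<one>" if n: "n \<in> N" and p: "\<phi> n = \<one>" for n
  proof -
    have nc: "n \<in> carrier G" using cN n .
    \<comment> \<open>For \<open>n\<close> in \<open>N\<close> each factor of
      \<open>\<phi> n\<close> is a conjugate of \<open>n\<close> times \<open>inv n\<close>;
      \<open>z\<close> collects these conjugates, and there are \<open>k\<close> copies of
      \<open>inv n\<close>.\<close>
    define z where "z = finprod ?N (\<lambda>C. rep C \<otimes> n \<otimes> inv (rep C)) X"
    have cl: "rep C \<otimes> n \<otimes> inv (rep C) \<in> N" if "C \<in> X" for C
      using Nn(1)[OF repX(2)[OF that] n] .
    have zN: "z \<in> N" using NG.finprod_closed[of "\<lambda>C. rep C \<otimes> n \<otimes> inv (rep C)" X] cl by (auto simp: z_def)
    have step: "\<tau> n C = (rep C \<otimes> n \<otimes> inv (rep C)) \<otimes> inv n" if C: "C \<in> X" for C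
    proof -
      define r where "r = rep C"
      have r: "r \<in> L" "r \<in> carrier G" "N #> r = C" using repX[OF C] by (auto simp: r_def)
      have 1: "r \<otimes> n \<otimes> inv r \<in> N" using cl[OF C] by (simp add: r_def)
      have in_: "inv n \<in> N" using subgroup.m_inv_closed[OF sN n] .
      have 2: "inv n \<otimes> (r \<otimes> n \<otimes> inv r) \<in> N" using subgroup.m_closed[OF sN in_ 1] .
      have "inv n \<otimes> r \<otimes> n = (inv n \<otimes> (r \<otimes> n \<otimes> inv r)) \<otimes> r" using r nc by (simp add: m_assoc)
      then have "s (inv n \<otimes> r \<otimes> n) = inv n \<otimes> (r \<otimes> n \<otimes> inv r) \<otimes> s r" using s_mult[OF 2 r(1)] by simp
      also have "s r = \<one>" using r by (simp add: s_def r_def[symmetric])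
      finally have "s (inv n \<otimes> r \<otimes> n) = inv n \<otimes> (r \<otimes> n \<otimes> inv r)" using r nc by simp
      then show ?thesis using r nc by (simp add: \<tau>_def r_def[symmetric] m_assoc)
    qed
    have "\<phi> n = finprod ?N (\<lambda>C. (rep C \<otimes> n \<otimes> inv (rep C)) \<otimes>\<^bsub>?N\<^esub> inv n) X"
      unfolding \<phi>_def by (rule NG.finprod_cong')
        (use step cl subgroup.m_closed[OF sN] subgroup.m_inv_closed[OF sN n] in auto)
    also have "\<dots> = z \<otimes>\<^bsub>?N\<^esub> finprod ?N (\<lambda>C. inv n) X"
      unfolding z_def by (rule NG.finprod_multf) (use cl subgroup.m_inv_closed[OF sN n] in auto)
    also have "finprod ?N (\<lambda>C. inv n) X = inv n [^] k"
      using NG.finprod_const[of "inv n" X] subgroup.m_inv_closed[OF sN n] cardX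
      by (simp add: nat_pow_consistent[symmetric])
    finally have "z \<otimes> inv (n [^] k) = \<one>" using p nc by (simp add: nat_pow_inv)
    then have zk: "z = n [^] k" using cN[OF zN] nc by (simp add: inv_solve_right')
    \<comment> \<open>Left multiplication by \<open>y\<close> permutes the cosets, and changing a
      representative by an element of the abelian group \<open>N\<close> does not change the
      conjugate of \<open>n\<close>. So conjugation by \<open>y\<close> only permutes the factors of
      \<open>z\<close>.\<close>
    have "y \<otimes> z = z \<otimes> y" if y: "y \<in> L" for y
    proof -
      have yc: "y \<in> carrier G" using cL y .
      define b where "b C = N #> (y \<otimes> rep C)" for C
      have yr: "y \<otimes> rep C \<in> L" if "C \<in> X" for C using subgroup.m_closed[OF sL y repX(1)[OF that]] .
      have bX: "b C \<in> X" if "C \<in> X" for C using yr[OF that] by (auto simp: b_def X_def)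
      have injb: "inj_on b X"
      proof (rule inj_onI)
        fix C D assume CD: "C \<in> X" "D \<in> X" "b C = b D"
        note r = repX(2)[OF CD(1)] repX(2)[OF CD(2)]
        have "(y \<otimes> rep C) \<otimes> inv (y \<otimes> rep D) \<in> N"
          using mem_coset[of "y \<otimes> rep C" "y \<otimes> rep D"] CD(3) r yc by (simp add: b_def)
        from Nn(2)[OF yc this] have "rep C \<otimes> inv (rep D) \<in> N"
          using r yc by (simp add: inv_mult_group m_assoc)
        then show "C = D" using mem_coset[OF r] repX(3)[OF CD(1)] repX(3)[OF CD(2)] by simp
      qed
      have imgb: "b ` X = X" by (rule endo_inj_surj[OF finX _ injb]) (use bX in auto)
      have conj: "y \<otimes> (rep C \<otimes> n \<otimes> inv (rep C)) \<otimes> inv y = rep (b C) \<otimes> n \<otimes> inv (rep (b C))"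
        if C: "C \<in> X" for C
      proof -
        define a where "a = s (y \<otimes> rep C)"
        define w where "w = rep (b C)"
        have a: "a \<in> N" "a \<in> carrier G" using sN'[OF yr[OF C]] cN by (auto simp: a_def)
        have w: "w \<in> carrier G" using repX(2)[OF bX[OF C]] by (simp add: w_def)
        have eq: "y \<otimes> rep C = a \<otimes> w" using s_split[OF yr[OF C]] by (simp add: a_def w_def b_def)
        have wN: "w \<otimes> n \<otimes> inv w \<in> N" using Nn(1)[OF w n] .
        have "y \<otimes> (rep C \<otimes> n \<otimes> inv (rep C)) \<otimes> inv y = (y \<otimes> rep C) \<otimes> n \<otimes> inv (y \<otimes> rep C)"
          using yc repX(2)[OF C] nc by (simp add: inv_mult_group m_assoc)
        also have "\<dots> = a \<otimes> (w \<otimes> n \<otimes> inv w) \<otimes> inv a"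
          using a w nc unfolding eq by (simp add: inv_mult_group m_assoc)
        also have "\<dots> = (w \<otimes> n \<otimes> inv w) \<otimes> a \<otimes> inv a" using comm[OF a(1) wN] by simp
        also have "\<dots> = w \<otimes> n \<otimes> inv w" using a w nc by (simp add: m_assoc)
        finally show ?thesis by (simp add: w_def)
      qed
      have "y \<otimes> z \<otimes> inv y = finprod ?N (\<lambda>C. y \<otimes> (rep C \<otimes> n \<otimes> inv (rep C)) \<otimes> inv y) X"
        unfolding z_def by (rule finprod_conj[OF sN comm yc Nn(1)[OF yc] finX cl, symmetric])
      also have "\<dots> = finprod ?N (\<lambda>C. rep (b C) \<otimes> n \<otimes> inv (rep (b C))) X"
        by (rule NG.finprod_cong') (use conj cl bX in auto)
      also have "\<dots> = finprod ?N (\<lambda>C. rep C \<otimes> n \<otimes> inv (rep C)) (b ` X)"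
        by (rule NG.finprod_reindex[symmetric]) (use cl imgb injb in auto)
      finally have "y \<otimes> z \<otimes> inv y = z" by (simp add: imgb z_def)
      then show ?thesis using yc cN[OF zN] by (metis inv_solve_right' m_closed)
    qed
    from triv[OF zN this] have "n [^] k = \<one>" using zk by simp
    then show ?thesis using pow_eq_one_coprime[OF nc pow_card_eq_one[OF sN n] _ cop] by simp
  qed
  \<comment> \<open>Equal values of \<open>\<phi>\<close> force equality modulo the kernel. This one
    fact yields closure of the kernel under inverses, injectivity on \<open>N\<close>, and the
    factorisation of an arbitrary element.\<close>
  have quot: "\<phi> (inv g \<otimes> h) = \<one>" if g: "g \<in> carrier G" and h: "h \<in> carrier G" and eq: "\<phi> g = \<phi> h" for g h
  proof -
    have c1: "\<phi> g \<in> carrier G" "\<phi> (inv g \<otimes> h) \<in> carrier G"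
      using cN \<phi>N g h by (meson inv_closed m_closed)+
    have "\<phi> g \<otimes> (g \<otimes> \<phi> (inv g \<otimes> h) \<otimes> inv g) = \<phi> h"
      using crossed[OF g, of "inv g \<otimes> h"] g h by simp
    then have "g \<otimes> \<phi> (inv g \<otimes> h) \<otimes> inv g = \<one>"
      using eq c1 g by (metis inv_closed l_cancel_one m_closed)
    then have "\<phi> (inv g \<otimes> h) = inv g \<otimes> \<one> \<otimes> g"
      using c1 g by (metis (no_types, lifting) inv_closed inv_mult_cancel(1) m_assoc m_closed l_inv r_one)
    then show ?thesis using g by simp
  qed
  have \<phi>1: "\<phi> \<one> = \<one>" using quot[of \<one> \<one>] by simp
  have "inj_on \<phi> N"
  proof (rule inj_onI)
    fix x y assume xy: "x \<in> N" "y \<in> N" "\<phi> x = \<phi> y"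
    have "inv x \<otimes> y \<in> N" using subgroup.m_closed[OF sN subgroup.m_inv_closed[OF sN xy(1)] xy(2)] .
    from ker[OF this quot[OF cN[OF xy(1)] cN[OF xy(2)] xy(3)]]
    have "inv x \<otimes> y = \<one>" .
    then show "x = y" using cN[OF xy(1)] cN[OF xy(2)] by (metis inv_equality inv_inv inv_closed)
  qed
  then have imgN: "\<phi> ` N = N"
    by (intro endo_inj_surj[OF finite_subgroup[OF sN]]) (use \<phi>N cN in auto)
  define M where "M = {g \<in> carrier G. \<phi> g = \<one>}"
  have "subgroup M G"
  proof (rule subgroupI)
    show "M \<subseteq> carrier G" by (auto simp: M_def)
    have "\<one> \<in> M" using \<phi>1 by (simp add: M_def)
    then show "M \<noteq> {}" by blast
    fix a assume a: "a \<in> M"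
    then show "inv a \<in> M" using quot[of a \<one>] \<phi>1 by (simp add: M_def)
    fix b assume "b \<in> M"
    then show "a \<otimes> b \<in> M" using a crossed[of a b] by (simp add: M_def)
  qed
  moreover have "N \<inter> M = {\<one>}" using ker \<phi>1 subgroup.one_closed[OF sN] by (auto simp: M_def)
  moreover have "N <#> M = carrier G"
  proof
    show "N <#> M \<subseteq> carrier G" using setmult_subset_G[OF NsubG, of M] by (auto simp: M_def)
    show "carrier G \<subseteq> N <#> M"
    proof
      fix g assume g: "g \<in> carrier G"
      then obtain n where n: "n \<in> N" "\<phi> n = \<phi> g" using imgN \<phi>N by (metis imageE)
      have "inv n \<otimes> g \<in> M" using quot[OF cN[OF n(1)] g n(2)] g cN[OF n(1)] by (simp add: M_def)
      moreover have "g = n \<otimes> (inv n \<otimes> g)" using g cN[OF n(1)] by simp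
      ultimately show "g \<in> N <#> M" using n by (auto simp: set_mult_def)
    qed
  qed
  ultimately show thesis using that by blast
qed

end

section \<open>\<open>\<sigma>\<close>-permutable subgroups and residuals\<close>

context fin_group
begin

section \<open>Conjugates, and the residual of a single class\<close>

lemma conjugate_subgroup:
  assumes A: "subgroup A G" and x: "x \<in> carrier G"
  shows "subgroup (conjugate G A x) G"
proof (rule subgroupI)
  note c = subgroup.mem_carrier[OF A]
  show "conjugate G A x \<subseteq> carrier G" using x c by (auto simp: conjugate_def)
  have "inv x \<otimes> \<one> \<otimes> x \<in> conjugate G A x"
    unfolding conjugate_def using subgroup.one_closed[OF A] by (rule imageI)
  then show "conjugate G A x \<noteq> {}" by blast
  fix a assume "a \<in> conjugate G A x"
  then obtain u where u: "u \<in> A" "a = inv x \<otimes> u \<otimes> x" by (auto simp: conjugate_def)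
  have "inv a = inv x \<otimes> inv u \<otimes> x" using u x c by (simp add: inv_mult_group m_assoc)
  then show "inv a \<in> conjugate G A x"
    using subgroup.m_inv_closed[OF A u(1)] by (auto simp: conjugate_def)
  fix b assume "b \<in> conjugate G A x"
  then obtain v where v: "v \<in> A" "b = inv x \<otimes> v \<otimes> x" by (auto simp: conjugate_def)
  have "a \<otimes> b = inv x \<otimes> (u \<otimes> v) \<otimes> x" using u v x c by (simp add: m_assoc)
  then show "a \<otimes> b \<in> conjugate G A x"
    using subgroup.m_closed[OF A u(1) v(1)] by (auto simp: conjugate_def)
qed

lemma card_conjugate:
  assumes "A \<subseteq> carrier G" "x \<in> carrier G"
  shows "card (conjugate G A x) = card A"
  unfolding conjugate_def
  by (rule card_image, rule inj_onI) (use assms in \<open>auto simp: subset_iff\<close>)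

lemma conjugate_conjugate:
  assumes "A \<subseteq> carrier G" "x \<in> carrier G" "y \<in> carrier G"
  shows "conjugate G (conjugate G A x) y = conjugate G A (x \<otimes> y)"
  unfolding conjugate_def image_image
  by (rule image_cong) (use assms in \<open>auto simp: subset_iff inv_mult_group m_assoc\<close>)

lemma conjugate_one: "A \<subseteq> carrier G \<Longrightarrow> conjugate G A \<one> = A"
  by (force simp: conjugate_def subset_iff)

lemma conjugate_set_mult:
  assumes "A \<subseteq> carrier G" "B \<subseteq> carrier G" "x \<in> carrier G"
  shows "conjugate G (A <#> B) x = conjugate G A x <#> conjugate G B x"
proof -
  have eq: "inv x \<otimes> (a \<otimes> b) \<otimes> x = (inv x \<otimes> a \<otimes> x) \<otimes> (inv x \<otimes> b \<otimes> x)"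
    if "a \<in> A" "b \<in> B" for a b
    using that assms by (simp add: m_assoc subsetD)
  show ?thesis
  proof (intro equalityI subsetI)
    fix y assume "y \<in> conjugate G (A <#> B) x"
    then obtain a b where ab: "a \<in> A" "b \<in> B" "y = inv x \<otimes> (a \<otimes> b) \<otimes> x"
      by (auto simp: conjugate_def set_mult_def)
    then show "y \<in> conjugate G A x <#> conjugate G B x"
      using eq by (auto simp: conjugate_def set_mult_def)
  next
    fix y assume "y \<in> conjugate G A x <#> conjugate G B x"
    then obtain a b where ab: "a \<in> A" "b \<in> B" "y = (inv x \<otimes> a \<otimes> x) \<otimes> (inv x \<otimes> b \<otimes> x)"
      by (auto simp: conjugate_def set_mult_def)
    then have "y = inv x \<otimes> (a \<otimes> b) \<otimes> x" using eq by simp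
    moreover have "a \<otimes> b \<in> A <#> B" using ab by (auto simp: set_mult_def)
    ultimately show "y \<in> conjugate G (A <#> B) x" by (auto simp: conjugate_def)
  qed
qed

text \<open>The index of \<open>E \<inter> N\<close> in \<open>F \<inter> N\<close> equals the index
  of \<open>E\<close> in the subgroup \<open>E <#> (F \<inter> N)\<close> of
  \<open>F\<close>.\<close>

lemma index_Int_dvd:
  assumes E: "subgroup E G" and F: "subgroup F G" and EF: "E \<subseteq> F" and N: "subgroup N G"
    and n: "normalizes G F N"
  obtains d where "card (F \<inter> N) = card (E \<inter> N) * d" "card E * d dvd card F"
proof -
  let ?I = "F \<inter> N"
  have I: "subgroup ?I G" "subgroup (E \<inter> N) G" using E F N subgroups_Inter_pair by blast+
  have "normalizes G F ?I" using normalizes_Int[OF normalizes_self[OF F] n] .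
  then have nE: "normalizes G E ?I" using EF normalizes_mono by blast
  have EI: "subgroup (E <#> ?I) G" using subgroup_set_mult[OF E I(1) nE] .
  have EIF: "E <#> ?I \<subseteq> F" using set_mult_least[OF F EF] by blast
  obtain d where d: "card ?I = card (E \<inter> N) * d"
    using card_subgroup_dvd[OF I(2,1)] EF unfolding dvd_def by blast
  have pos: "card (E \<inter> N) > 0" using card_subgroup_pos[OF I(2)] .
  have "E \<inter> ?I = E \<inter> N" using EF by blast
  then have "card (E <#> ?I) * card (E \<inter> N) = card E * card ?I"
    using card_set_mult[OF E I(1)] by simp
  then have "card (E <#> ?I) * card (E \<inter> N) = (card E * d) * card (E \<inter> N)"
    unfolding d by (simp only: ac_simps)
  then have "card (E <#> ?I) = card E * d" using pos by simp
  then have "card E * d dvd card F" using card_subgroup_dvd[OF EI F EIF] by simp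
  with d show thesis using that by blast
qed

text \<open>
  The smallest normal subgroup whose index is a product of primes in \<open>S\<close>.
\<close>

definition "res S = \<Inter>{N. N \<lhd> G \<and> part (-S) (card N) = part (-S) (order G)}"

text \<open>\<open>A <#> B\<close> has full \<open>S\<close>-part as well, and the order formula
  then leaves full \<open>S\<close>-part for the intersection.\<close>

lemma res_family_Int:
  assumes A: "A \<lhd> G" "part S (card A) = part S (order G)"
    and B: "B \<lhd> G" "part S (card B) = part S (order G)"
  shows "A \<inter> B \<lhd> G" "part S (card (A \<inter> B)) = part S (order G)"
proof -
  show "A \<inter> B \<lhd> G" using A B normal_subgroup_intersect by blast
  have s: "subgroup A G" "subgroup B G" using A B normal_imp_subgroup by auto
  have AB: "subgroup (A <#> B) G"
    using subgroup_set_mult[OF s normal_normalizes[OF B(1) subgroup.subset[OF s(1)]]] .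
  have I: "subgroup (A \<inter> B) G" using s subgroups_Inter_pair by blast
  note pos = card_subgroup_pos[OF s(1)] card_subgroup_pos[OF s(2)] card_subgroup_pos[OF AB] card_subgroup_pos[OF I]
  have "part S (order G) dvd part S (card (A <#> B))"
    using A(2) part_dvd_mono[OF card_subgroup_dvd[OF s(1) AB set_mult_subset(1)[OF s]] pos(3), of S] by simp
  moreover have "part S (card (A <#> B)) dvd part S (order G)"
    using part_dvd_mono[OF card_subgroup_dvd_order[OF AB]] by simp
  ultimately have "part S (card (A <#> B)) = part S (order G)" by (rule dvd_antisym[rotated])
  moreover have "part S (card (A <#> B)) * part S (card (A \<inter> B)) = part S (card A) * part S (card B)"
    using card_set_mult[OF s] part_mult[OF pos(3,4)] part_mult[OF pos(1,2)] by simp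
  ultimately show "part S (card (A \<inter> B)) = part S (order G)" using A B by simp
qed

text \<open>A member of least order meets every other member in a member, hence lies in it; so the
  intersection of the family is itself a member.\<close>

lemma res_in_family: "res S \<lhd> G \<and> part (-S) (card (res S)) = part (-S) (order G)"
proof -
  define F where "F = {N. N \<lhd> G \<and> part (-S) (card N) = part (-S) (order G)}"
  have "carrier G \<in> F" using normal_self by (simp add: F_def order_def)
  then obtain N where N: "N \<in> F" "\<And>M. M \<in> F \<Longrightarrow> card N \<le> card M"
    using ex_has_least_nat[of "\<lambda>N. N \<in> F" "carrier G" card] by blast
  have "N \<subseteq> M" if M: "M \<in> F" for M
  proof -
    have "M \<inter> N \<in> F" using res_family_Int[of M "-S" N] M N by (simp add: F_def)
    then have "card N \<le> card (M \<inter> N)" using N by blast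
    moreover have "finite N" using N finite_subgroup normal_imp_subgroup by (auto simp: F_def)
    ultimately have "M \<inter> N = N" by (intro card_seteq) auto
    then show ?thesis by blast
  qed
  then have "\<Inter>F = N" using N by blast
  then show ?thesis using N by (simp add: res_def F_def)
qed

lemma res_normal: "res S \<lhd> G" and res_subgroup: "subgroup (res S) G"
  and res_index: "part (-S) (card (res S)) = part (-S) (order G)"
  using res_in_family normal_imp_subgroup by auto

lemma res_least: "N \<lhd> G \<Longrightarrow> part (-S) (card N) = part (-S) (order G) \<Longrightarrow> res S \<subseteq> N"
  by (auto simp: res_def)

lemma part_eq_superset:
  assumes A: "subgroup A G" and B: "subgroup B G" "A \<subseteq> B" and p: "part S (card A) = part S (order G)"
  shows "part S (card B) = part S (order G)"
proof (rule dvd_antisym)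
  show "part S (card B) dvd part S (order G)"
    using part_dvd_mono[OF card_subgroup_dvd_order[OF B(1)]] by simp
  show "part S (order G) dvd part S (card B)"
    using part_dvd_mono[OF card_subgroup_dvd[OF A B] card_subgroup_pos[OF B(1)], of S] p by simp
qed

end

section \<open>Arithmetic class by class, and permutation with Hall subgroups\<close>

locale sigma_group = fin_group +
  fixes \<sigma> :: "nat set set"
  assumes partition: "prime_partition \<sigma>"
begin

lemma sigma_prime: "S \<in> \<sigma> \<Longrightarrow> p \<in> S \<Longrightarrow> prime p"
  using partition unfolding prime_partition_def partition_on_def by blast

lemma sigma_disjoint: "S \<in> \<sigma> \<Longrightarrow> T \<in> \<sigma> \<Longrightarrow> S \<noteq> T \<Longrightarrow> S \<inter> T = {}"
  using partition unfolding prime_partition_def partition_on_def disjoint_def by blast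

lemma sigma_unique: "S \<in> \<sigma> \<Longrightarrow> T \<in> \<sigma> \<Longrightarrow> p \<in> S \<Longrightarrow> p \<in> T \<Longrightarrow> S = T"
  using sigma_disjoint by blast

lemma sigma_cover: "prime p \<Longrightarrow> \<exists>S\<in>\<sigma>. p \<in> S"
  using partition unfolding prime_partition_def partition_on_def by blast

text \<open>Every prime outside \<open>S\<close> lies in some other class, so the part outside
  \<open>S\<close> may be compared class by class.\<close>

lemma part_compl_eqI:
  assumes "\<And>T. T \<in> \<sigma> \<Longrightarrow> T \<noteq> S \<Longrightarrow> part T a = part T b"
  shows "S \<in> \<sigma> \<Longrightarrow> part (-S) a = part (-S) b"
proof (rule part_eqI)
  fix p :: nat assume S: "S \<in> \<sigma>" and p: "prime p"
  show "multiplicity p (part (-S) b) = (if p \<in> -S then multiplicity p a else 0)"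
  proof (cases "p \<in> S")
    case False
    obtain T where T: "T \<in> \<sigma>" "p \<in> T" using sigma_cover[OF p] by blast
    then have "multiplicity p (part T a) = multiplicity p (part T b)" using assms[of T] False by metis
    then show ?thesis using False T p by (simp add: multiplicity_part)
  qed (use p in \<open>simp add: multiplicity_part\<close>)
qed simp

lemma part_compl_eqD:
  assumes "part (-S) a = part (-S) b" "S \<in> \<sigma>" "T \<in> \<sigma>" "T \<noteq> S"
  shows "part T a = part T b"
proof -
  have "T \<inter> -S = T" using sigma_disjoint[OF assms(3,2)] assms(4) by auto
  then show ?thesis using part_part[of T "-S" a] part_part[of T "-S" b] assms(1) by simp
qed

lemma sigma_dvdI:
  assumes "a > 0" "b > 0" "\<And>S. S \<in> \<sigma> \<Longrightarrow> part S a dvd b"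
  shows "a dvd b"
proof (rule multiplicity_le_imp_dvd)
  fix p :: nat assume p: "prime p"
  obtain T where T: "T \<in> \<sigma>" "p \<in> T" using sigma_cover[OF p] by blast
  show "multiplicity p a \<le> multiplicity p b"
    using assms(3)[OF T(1)] part_dvd_iff[OF assms(2), of T a] T p by blast
qed (use assms in auto)

lemma sigma_eqI:
  assumes "a > 0" "b > 0" "\<And>S. S \<in> \<sigma> \<Longrightarrow> part S a = part S b"
  shows "a = b"
proof (rule dvd_antisym)
  show "a dvd b"
    by (rule sigma_dvdI[OF assms(1,2)]) (metis assms(2,3) part_dvd)
  show "b dvd a"
    by (rule sigma_dvdI[OF assms(2,1)]) (metis assms(1,3) part_dvd)
qed

text \<open>
  Unlike a complete Hall \<open>\<sigma>\<close>-set, the family is indexed by all classes; it is trivial at the classes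
  that contain no prime divisor of the order of the group.
\<close>

definition "hall_family K \<longleftrightarrow> (\<forall>S\<in>\<sigma>. subgroup (K S) G \<and> card (K S) = part S (order G))"

text \<open>Separate from \<open>perm\<close>, which hides the Hall family: when two subgroups are
  joined, both must permute with conjugates of the same Hall subgroups.\<close>

definition "permutes_with E K \<longleftrightarrow>
  (\<forall>S\<in>\<sigma>. \<forall>x\<in>carrier G. E <#> conjugate G (K S) x = conjugate G (K S) x <#> E)"

definition "perm E \<longleftrightarrow> subgroup E G \<and> (\<exists>K. hall_family K \<and> permutes_with E K)"

lemma hall_conjugate:
  assumes "hall_family K" "S \<in> \<sigma>" "x \<in> carrier G"
  shows "subgroup (conjugate G (K S) x) G" "card (conjugate G (K S) x) = part S (order G)"
    "subgroup (K S) G"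
proof -
  show K: "subgroup (K S) G" using assms by (simp add: hall_family_def)
  show "subgroup (conjugate G (K S) x) G" using conjugate_subgroup[OF K assms(3)] .
  show "card (conjugate G (K S) x) = part S (order G)"
    using card_conjugate[OF subgroup.subset[OF K] assms(3)] assms by (simp add: hall_family_def)
qed

lemma permutes_withD:
  "permutes_with E K \<Longrightarrow> S \<in> \<sigma> \<Longrightarrow> x \<in> carrier G \<Longrightarrow>
    E <#> conjugate G (K S) x = conjugate G (K S) x <#> E"
  by (simp add: permutes_with_def)

text \<open>The product of \<open>E\<close> with the conjugate is a subgroup with full
  \<open>S\<close>-part. Comparing \<open>S\<close>-parts in the order formula leaves exactly the
  \<open>S\<close>-part of \<open>E\<close> for the intersection.\<close>

lemma perm_Int_hall:
  assumes K: "hall_family K" "permutes_with E K" and E: "subgroup E G" and S: "S \<in> \<sigma>" and x: "x \<in> carrier G"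
  shows "card (E \<inter> conjugate G (K S) x) = part S (card E)"
proof -
  let ?C = "conjugate G (K S) x"
  note C = hall_conjugate[OF K(1) S x]
  have I: "subgroup (E \<inter> ?C) G" using E C(1) subgroups_Inter_pair by blast
  have EC: "subgroup (E <#> ?C) G"
    using subgroup_set_mult_commute[OF E C(1) permutes_withD[OF K(2) S x]] .
  have pC: "part S (card ?C) = card ?C" using C(2) by simp
  have full: "part S (card (E <#> ?C)) = part S (order G)"
    using part_eq_superset[OF C(1) EC set_mult_subset(2)[OF E C(1)], of S] C(2) pC by simp
  note pos = card_subgroup_pos[OF E] card_subgroup_pos[OF C(1)] card_subgroup_pos[OF EC] card_subgroup_pos[OF I]
  have pI: "part S (card (E \<inter> ?C)) = card (E \<inter> ?C)"
    by (rule part_self_dvd[OF pC card_subgroup_dvd[OF I C(1)] pos(2)]) blast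
  have "part S (card (E <#> ?C)) * part S (card (E \<inter> ?C)) = part S (card E) * part S (card ?C)"
    using card_set_mult[OF E C(1)] part_mult[OF pos(3,4), of S] part_mult[OF pos(1,2), of S] by simp
  then have "part S (order G) * card (E \<inter> ?C) = part S (order G) * part S (card E)"
    using full pI pC C(2) by simp
  then show ?thesis by simp
qed

lemma perm_full:
  assumes K: "hall_family K" "permutes_with E K" and E: "subgroup E G" and S: "S \<in> \<sigma>" and x: "x \<in> carrier G"
    and full: "part S (card E) = part S (order G)"
  shows "conjugate G (K S) x \<subseteq> E"
proof -
  note C = hall_conjugate[OF K(1) S x]
  have "card (E \<inter> conjugate G (K S) x) = card (conjugate G (K S) x)"
    using perm_Int_hall[OF K E S x] full C(2) by simp
  then have "E \<inter> conjugate G (K S) x = conjugate G (K S) x"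
    using finite_subgroup[OF C(1)] by (intro card_subset_eq) auto
  then show ?thesis by blast
qed

text \<open>The subgroup generated by all these conjugates is normal and has full part in every
  class other than \<open>S\<close>, so it contains \<open>res S\<close>.\<close>

lemma res_subset_if_halls:
  assumes K: "hall_family K" and S: "S \<in> \<sigma>" and U: "subgroup U G"
    and sub: "\<And>T x. T \<in> \<sigma> \<Longrightarrow> T \<noteq> S \<Longrightarrow> x \<in> carrier G \<Longrightarrow> conjugate G (K T) x \<subseteq> U"
  shows "res S \<subseteq> U"
proof -
  let ?X = "\<Union>T\<in>\<sigma> - {S}. \<Union>x\<in>carrier G. conjugate G (K T) x"
  let ?L = "generate G ?X"
  have XG: "?X \<subseteq> carrier G" using hall_conjugate(1)[OF K, THEN subgroup.subset] by blast
  have sL: "subgroup ?L G" using generate_is_subgroup[OF XG] .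
  have nL: "?L \<lhd> G"
  proof (rule normal_generateI[OF XG])
    fix h g assume "h \<in> ?X" and g: "g \<in> carrier G"
    then obtain T x where Tx: "T \<in> \<sigma>" "T \<noteq> S" "x \<in> carrier G" "h \<in> conjugate G (K T) x" by auto
    have "g \<otimes> h \<otimes> inv g \<in> conjugate G (conjugate G (K T) x) (inv g)"
      using Tx(4) g by (auto simp: conjugate_def)
    also have "\<dots> = conjugate G (K T) (x \<otimes> inv g)"
      using conjugate_conjugate subgroup.subset[OF hall_conjugate(3)[OF K Tx(1,3)]] Tx(3) g by simp
    finally show "g \<otimes> h \<otimes> inv g \<in> ?X"
      using Tx(1-3) g by (intro UN_I[of T] UN_I[of "x \<otimes> inv g"]) auto
  qed
  have "part T (card ?L) = part T (order G)" if T: "T \<in> \<sigma>" "T \<noteq> S" for T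
  proof (rule part_eq_superset[OF hall_conjugate(1)[OF K T(1) one_closed] sL])
    have "conjugate G (K T) \<one> \<subseteq> ?X" using T by blast
    then show "conjugate G (K T) \<one> \<subseteq> ?L" using generate.incl[of _ ?X G] by blast
    show "part T (card (conjugate G (K T) \<one>)) = part T (order G)"
      using hall_conjugate(2)[OF K T(1) one_closed] by simp
  qed
  then have "part (-S) (card ?L) = part (-S) (order G)" using part_compl_eqI[OF _ S] by blast
  then have "res S \<subseteq> ?L" using res_least nL by blast
  moreover have "?L \<subseteq> U" by (rule generate_subgroup_incl[OF _ U]) (use sub in blast)
  ultimately show ?thesis by blast
qed

lemma perm_full_res_subset:
  assumes E: "perm E" and S: "S \<in> \<sigma>"
    and full: "\<And>T. T \<in> \<sigma> \<Longrightarrow> T \<noteq> S \<Longrightarrow> part T (card E) = part T (order G)"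
  shows "res S \<subseteq> E"
proof -
  have sE: "subgroup E G" using E by (simp add: perm_def)
  obtain K where K: "hall_family K" "permutes_with E K" using E by (auto simp: perm_def)
  show ?thesis using res_subset_if_halls[OF K(1) S sE] perm_full[OF K sE] full by blast
qed

text \<open>For a Hall conjugate \<open>C\<close> of another class, the index of
  \<open>E \<inter> N\<close> in \<open>(E <#> C) \<inter> N\<close> divides both
  \<open>card C\<close> and \<open>card N\<close>, hence is 1. So \<open>C\<close> normalizes
  \<open>E \<inter> N\<close>, and \<open>res_subset_if_halls\<close> applies to the
  normalizer.\<close>

lemma res_normalizes_Int:
  assumes E: "perm E" and S: "S \<in> \<sigma>" and N: "N \<lhd> G" "part S (card N) = card N"
  shows "normalizes G (res S) (E \<inter> N)"
proof -
  have sE: "subgroup E G" using E by (simp add: perm_def)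
  obtain K where K: "hall_family K" "permutes_with E K" using E by (auto simp: perm_def)
  have sN: "subgroup N G" using N normal_imp_subgroup by blast
  have I: "subgroup (E \<inter> N) G" using sE sN subgroups_Inter_pair by blast
  have "conjugate G (K T) x \<subseteq> normalizer_in G (carrier G) (E \<inter> N)"
    if T: "T \<in> \<sigma>" "T \<noteq> S" and x: "x \<in> carrier G" for T x
  proof -
    let ?C = "conjugate G (K T) x"
    note C = hall_conjugate[OF K(1) T(1) x]
    have F: "subgroup (E <#> ?C) G"
      using subgroup_set_mult_commute[OF sE C(1) permutes_withD[OF K(2) T(1) x]] .
    note EF = set_mult_subset[OF sE C(1)]
    obtain d where d: "card ((E <#> ?C) \<inter> N) = card (E \<inter> N) * d" "card E * d dvd card (E <#> ?C)"
      using index_Int_dvd[OF sE F EF(1) sN normal_normalizes[OF N(1) subgroup.subset[OF F]]] by blast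
    have IF: "subgroup ((E <#> ?C) \<inter> N) G" using F sN subgroups_Inter_pair by blast
    have "card (E <#> ?C) dvd card E * card ?C" using card_set_mult[OF sE C(1)] by (metis dvd_triv_left)
    with d(2) have "card E * d dvd card E * card ?C" by (rule dvd_trans)
    then have dC: "d dvd card ?C" using card_subgroup_pos[OF sE] by simp
    have "d dvd card ((E <#> ?C) \<inter> N)" using d(1) by simp
    also have "\<dots> dvd card N" using card_subgroup_dvd[OF IF sN] by blast
    finally have dN: "d dvd card N" .
    have "part T (card N) = part (T \<inter> S) (card N)" using N(2) part_part[of T S "card N"] by simp
    then have "part T (card N) = 1" using sigma_disjoint[OF T(1) S T(2)] by (simp add: part_def)
    moreover have "part T (card ?C) = card ?C" using C(2) by simp
    ultimately have "coprime (card ?C) (card N)"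
      using part_coprime[of T "card ?C" "card N"] card_subgroup_pos[OF C(1)] card_subgroup_pos[OF sN] by simp
    then have "d = 1" using dC dN by (metis coprime_common_divisor_nat)
    then have "card (E \<inter> N) = card ((E <#> ?C) \<inter> N)" using d by simp
    then have eq: "E \<inter> N = (E <#> ?C) \<inter> N"
      using EF(1) finite_subgroup[OF IF] by (intro card_subset_eq) auto
    have "normalizes G (E <#> ?C) ((E <#> ?C) \<inter> N)"
      using normalizes_Int[OF normalizes_self[OF F] normal_normalizes[OF N(1) subgroup.subset[OF F]]] .
    then have "normalizes G ?C (E \<inter> N)" using EF(2) eq normalizes_mono by metis
    then show ?thesis using subgroup.subset[OF C(1)] by (simp add: subset_normalizer_in)
  qed
  then have "res S \<subseteq> normalizer_in G (carrier G) (E \<inter> N)"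
    using res_subset_if_halls[OF K(1) S normalizer_in_subgroup[OF subgroup_self I]] by blast
  then show ?thesis by (simp add: subset_normalizer_in)
qed

end

locale sigma_epi = fin_epi G H h + G: sigma_group G \<sigma> for G (structure) and H (structure) and h and \<sigma>
begin

sublocale H: sigma_group H \<sigma>
  by unfold_locales (rule G.partition)

lemma hall_family_image:
  assumes "G.hall_family K" shows "H.hall_family (\<lambda>S. h ` K S)"
  unfolding H.hall_family_def
proof (intro ballI conjI)
  fix S assume S: "S \<in> \<sigma>"
  have K: "subgroup (K S) G" "card (K S) = part S (order G)" using assms S by (auto simp: G.hall_family_def)
  show I: "subgroup (h ` K S) H" using image_subgroup K by blast
  have "card (h ` K S) dvd card (K S)" using card_image_mult[OF K(1)] by (metis dvd_triv_left)
  then have "part S (card (h ` K S)) = card (h ` K S)"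
    by (rule part_self_dvd[rotated]) (use K in auto)
  then show "card (h ` K S) = part S (order H)"
    using part_card_image[OF K(1), of S] K(2) by simp
qed

lemma perm_image:
  assumes "G.perm E" shows "H.perm (h ` E)"
proof -
  have E: "subgroup E G" using assms by (simp add: G.perm_def)
  obtain K where K: "G.hall_family K" "G.permutes_with E K" using assms by (auto simp: G.perm_def)
  have "h ` E <#>\<^bsub>H\<^esub> conjugate H (h ` K S) y = conjugate H (h ` K S) y <#>\<^bsub>H\<^esub> h ` E"
    if S: "S \<in> \<sigma>" and y: "y \<in> carrier H" for S y
  proof -
    obtain x where x: "x \<in> carrier G" "y = h x" using y surj by auto
    note C = G.hall_conjugate[OF K(1) S x(1)]
    have "conjugate H (h ` K S) y = h ` conjugate G (K S) x"
      using image_conjugate[OF subgroup.subset[OF C(3)] x(1)] x(2) by simp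
    then show ?thesis
      using image_set_mult[OF subgroup.subset[OF E] subgroup.subset[OF C(1)]]
        image_set_mult[OF subgroup.subset[OF C(1)] subgroup.subset[OF E]]
        G.permutes_withD[OF K(2) S x(1)] by simp
  qed
  then have "H.permutes_with (h ` E) (\<lambda>S. h ` K S)" by (simp add: H.permutes_with_def)
  then show ?thesis
    using hall_family_image[OF K(1)] image_subgroup[OF E] H.perm_def by blast
qed

lemma image_res: "h ` G.res S = H.res S"
proof
  have "part (-S) (card (h ` G.res S)) = part (-S) (order H)"
    using part_card_image[OF G.res_subgroup G.res_index] .
  then show "H.res S \<subseteq> h ` G.res S" using H.res_least image_normal[OF G.res_normal] by blast
  have "part (-S) (card (pre (H.res S))) = part (-S) (order G)"
    using card_pre[OF H.res_subgroup] H.res_index card_ker_mult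
      part_mult[OF H.card_subgroup_pos[OF H.res_subgroup] G.card_subgroup_pos[OF ker_subgroup]]
      part_mult[OF H.order_pos G.card_subgroup_pos[OF ker_subgroup]] by metis
  then have "G.res S \<subseteq> pre (H.res S)" using G.res_least pre_normal[OF H.res_normal] by blast
  then show "h ` G.res S \<subseteq> H.res S" by (auto simp: pre_def)
qed

end

section \<open>The embedding condition and its images\<close>

context sigma_group
begin

text \<open>Condition (i) with the embedded subgroup forgotten: only the order of its permutable
  overgroup survives, and it is left free in the classes where \<open>card A\<close> has trivial
  part.\<close>

definition "embed_cond \<longleftrightarrow> (\<forall>A. subgroup A G \<longrightarrow>
  (\<exists>E. perm E \<and> (\<forall>S\<in>\<sigma>. part S (card A) \<noteq> 1 \<longrightarrow> part S (card E) = part S (card A))))"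

text \<open>
  Unlike the embedding condition itself, this consequence of it passes to epimorphic images.
\<close>

definition "weak_embed_cond \<longleftrightarrow>
  (\<forall>S\<in>\<sigma>. \<forall>p\<in>S. \<exists>E. perm E \<and> part S (card E) = part {p} (order G)) \<and>
  (\<forall>V q k p S T. subgroup V G \<longrightarrow> card V = q ^ k \<longrightarrow> k > 0 \<longrightarrow> S \<in> \<sigma> \<longrightarrow> T \<in> \<sigma> \<longrightarrow> S \<noteq> T \<longrightarrow>
    p \<in> S \<longrightarrow> q \<in> T \<longrightarrow> p dvd card (normalizer_in G (carrier G) V) \<longrightarrow>
    (\<exists>E j. perm E \<and> part S (card E) dvd p \<and> part T (card E) = q ^ j \<and> card V dvd q ^ j))"

lemma weak_embed_condD1:
  "weak_embed_cond \<Longrightarrow> S \<in> \<sigma> \<Longrightarrow> p \<in> S \<Longrightarrow> \<exists>E. perm E \<and> part S (card E) = part {p} (order G)"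
  by (simp add: weak_embed_cond_def)

lemma weak_embed_condD2:
  assumes "weak_embed_cond" "subgroup V G" "card V = q ^ k" "k > 0" "S \<in> \<sigma>" "T \<in> \<sigma>" "S \<noteq> T"
    "p \<in> S" "q \<in> T" "p dvd card (normalizer_in G (carrier G) V)"
  obtains E j where "perm E" "part S (card E) dvd p" "part T (card E) = q ^ j" "card V dvd q ^ j"
  using assms(1)[unfolded weak_embed_cond_def, THEN conjunct2, rule_format, OF assms(2-10)] that
  by blast

text \<open>The first clause comes from a Sylow \<open>p\<close>-subgroup, the second from the
  product of \<open>V\<close> with a subgroup of order \<open>p\<close> of its normalizer.\<close>

lemma embed_cond_imp_weak:
  assumes ec: "embed_cond"
  shows "weak_embed_cond"
  unfolding weak_embed_cond_def
proof (intro conjI ballI allI impI)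
  fix S p assume S: "S \<in> \<sigma>" "p \<in> S"
  have p: "prime p" using sigma_prime S by blast
  let ?m = "multiplicity p (order G)"
  have dvd: "p ^ ?m dvd order G" by (rule multiplicity_dvd)
  show "\<exists>E. perm E \<and> part S (card E) = part {p} (order G)"
  proof (cases "p dvd order G")
    case True
    obtain A where A: "subgroup A G" "card A = p ^ ?m"
      using sylow_exists[OF subgroup_self p, of ?m] dvd by (auto simp: order_def)
    have "?m > 0" using True p by (simp add: prime_multiplicity_gt_zero_iff)
    then have ne: "p ^ ?m \<noteq> 1" using prime_gt_1_nat[OF p] by simp
    have pA: "part S (card A) = p ^ ?m" using A S p by (simp add: part_prime_power)
    then obtain E where "perm E" "part S (card E) = p ^ ?m" using ec A(1) S(1) ne unfolding embed_cond_def by metis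
    then show ?thesis using p by (auto simp: part_singleton)
  next
    case False
    \<comment> \<open>Any instance of the condition supplies a Hall family; the trivial subgroup
      permutes with it and has the required part 1.\<close>
    obtain E where "perm E" using ec subgroup_self unfolding embed_cond_def by blast
    then obtain K where K: "hall_family K" by (auto simp: perm_def)
    have "{\<one>} <#> conjugate G (K S) x = conjugate G (K S) x <#> {\<one>}"
      if "S \<in> \<sigma>" "x \<in> carrier G" for S x
      by (rule set_mult_commute_if_normalizes[OF triv_subgroup hall_conjugate(1)[OF K that]])
        (use subgroup.mem_carrier[OF hall_conjugate(1)[OF K that]] in \<open>auto simp: normalizes_def\<close>)
    then have "perm {\<one>}" using K triv_subgroup by (auto simp: perm_def permutes_with_def)
    moreover have "part {p} (order G) = 1" using False p by (simp add: part_singleton not_dvd_imp_multiplicity_0)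
    ultimately show ?thesis by (intro exI[of _ "{\<one>}"]) simp
  qed
next
  fix V q k p S T
  assume V: "subgroup V G" "card V = q ^ k" "k > 0" and ST: "S \<in> \<sigma>" "T \<in> \<sigma>" "S \<noteq> T"
    and pq: "p \<in> S" "q \<in> T" and dvd: "p dvd card (normalizer_in G (carrier G) V)"
  have pr: "prime p" "prime q" "p \<noteq> q" using sigma_prime ST pq sigma_unique by blast+
  obtain R where R: "subgroup R G" "R \<subseteq> normalizer_in G (carrier G) V" "card R = p"
    using cauchy_exists[OF normalizer_in_subgroup[OF subgroup_self V(1)] pr(1) dvd] by blast
  have n: "normalizes G R V" using R(2) by (simp add: subset_normalizer_in)
  have A: "subgroup (R <#> V) G" using subgroup_set_mult[OF R(1) V(1) n] .
  have "coprime (card R) (card V)" using pr R V by (simp add: primes_coprime)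
  then have cA: "card (R <#> V) = p * q ^ k"
    using card_set_mult[OF R(1) V(1)] card_Int_coprime[OF R(1) V(1)] R V by simp
  have nS: "q \<notin> S" "p \<notin> T" using pq ST sigma_unique by blast+
  have pS: "part S (card (R <#> V)) = p" and pT: "part T (card (R <#> V)) = q ^ k"
    unfolding cA using pr pq nS prime_gt_0_nat[OF pr(1)] prime_gt_0_nat[OF pr(2)]
    by (simp_all add: part_mult part_prime part_prime_power)
  obtain E where E: "perm E" "\<forall>S\<in>\<sigma>. part S (card (R <#> V)) \<noteq> 1 \<longrightarrow> part S (card E) = part S (card (R <#> V))"
    using ec A unfolding embed_cond_def by blast
  have "p \<noteq> 1" "q ^ k \<noteq> 1" using prime_gt_1_nat[OF pr(1)] prime_gt_1_nat[OF pr(2)] V(3) by auto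
  then have "part S (card E) = p" "part T (card E) = q ^ k" using E(2) ST pS pT by metis+
  then show "\<exists>E j. perm E \<and> part S (card E) dvd p \<and> part T (card E) = q ^ j \<and> card V dvd q ^ j"
    using E(1) V(2) by (metis dvd_refl)
qed

end

context sigma_epi
begin

text \<open>Frattini argument: in the preimage of the normalizer of \<open>V\<close> all conjugates
  of the Sylow subgroup \<open>W\<close> of \<open>pre V\<close> are conjugate under
  \<open>pre V\<close>, so that preimage is \<open>pre V\<close> times the normalizer of
  \<open>W\<close> in it. After cancelling the kernel, the order of the normalizer of
  \<open>V\<close> divides \<open>q ^ k\<close> times the order of the normalizer of
  \<open>W\<close>.\<close>

lemma frattini_prime_dvd:
  assumes V: "subgroup V H" "card V = q ^ k" and pq: "prime p" "prime q" "p \<noteq> q"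
    and dvd: "p dvd card (normalizer_in H (carrier H) V)"
    and W: "subgroup W G" "W \<subseteq> pre V" "card W = q ^ multiplicity q (card (pre V))"
  shows "p dvd card (normalizer_in G (carrier G) W)"
proof -
  let ?NV = "normalizer_in H (carrier H) V"
  let ?X = "pre V" let ?L = "pre ?NV" let ?NW = "normalizer_in G ?L W"
  have sNV: "subgroup ?NV H" using H.normalizer_in_subgroup[OF H.subgroup_self V(1)] .
  have sX: "subgroup ?X G" and sL: "subgroup ?L G" using pre_subgroup V sNV by auto
  have XL: "?X \<subseteq> ?L" using pre_mono H.normalizer_in_self[OF V(1)] subgroup.subset[OF V(1)] by simp
  have nX: "normalizes G ?L ?X"
    using normalizes_pre[OF H.normalizer_in_normalizes subgroup.subset[OF V(1)]] .
  have sNW: "subgroup ?NW G" using G.normalizer_in_subgroup[OF sL W(1)] .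
  note cL = subgroup.mem_carrier[OF sL]
  have ndvd: "\<not> q dvd card ?X div card W"
    using W(3) multiplicity_decompose[of "card ?X" q] G.card_subgroup_pos[OF sX] pq(2)
    by (metis not_prime_unit not_gr0)
  have "?L \<subseteq> ?X <#> ?NW"
  proof
    fix l assume l: "l \<in> ?L"
    have lc: "l \<in> carrier G" using cL l .
    let ?P = "conjugate G W (inv l)"
    have P: "subgroup ?P G" "card ?P = q ^ multiplicity q (card ?X)"
      using G.conjugate_subgroup[OF W(1)] G.card_conjugate[OF subgroup.subset[OF W(1)]] lc W(3) by auto
    have "?P \<subseteq> ?X" using G.normalizesD[OF nX l] W(2) lc by (auto simp: conjugate_def)
    then obtain x where x: "x \<in> ?X" "\<And>g. g \<in> ?P \<Longrightarrow> inv x \<otimes> g \<otimes> x \<in> W"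
      using G.sylow_conjugate[OF P(1) _ P(2) pq(2) W(1) sX W(2) ndvd] by blast
    have xc: "x \<in> carrier G" "x \<in> ?L" using x XL cL by auto
    have "(inv x \<otimes> l) \<otimes> w \<otimes> inv (inv x \<otimes> l) \<in> W" if w: "w \<in> W" for w
    proof -
      have wc: "w \<in> carrier G" using subgroup.mem_carrier[OF W(1) w] .
      have "l \<otimes> w \<otimes> inv l \<in> ?P" using w lc by (force simp: conjugate_def)
      from x(2)[OF this] show ?thesis using xc lc wc by (simp add: G.inv_mult_group G.m_assoc)
    qed
    moreover have "inv x \<otimes> l \<in> ?L" using subgroup.m_closed[OF sL subgroup.m_inv_closed[OF sL xc(2)] l] .
    ultimately have "inv x \<otimes> l \<in> ?NW" by (simp add: normalizer_in_def)
    moreover have "l = x \<otimes> (inv x \<otimes> l)" using xc lc by simp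
    ultimately show "l \<in> ?X <#> ?NW" using x(1) by (auto simp: set_mult_def)
  qed
  moreover have "?X <#> ?NW \<subseteq> ?L" using G.set_mult_least[OF sL XL] by (auto simp: normalizer_in_def)
  ultimately have "card ?L * card (?X \<inter> ?NW) = card ?X * card ?NW"
    using G.card_set_mult[OF sX sNW] by simp
  then have "card ker * (card ?NV * card (?X \<inter> ?NW)) = card ker * (q ^ k * card ?NW)"
    using card_pre[OF sNV] card_pre[OF V(1)] V(2) by (simp add: ac_simps)
  then have "card ?NV * card (?X \<inter> ?NW) = q ^ k * card ?NW"
    using G.card_subgroup_pos[OF ker_subgroup] by simp
  then have "p dvd q ^ k * card ?NW" using dvd by (metis dvd_mult2)
  then have "p dvd card ?NW" using pq by (metis prime_dvd_mult_iff prime_dvd_power primes_dvd_imp_eq)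
  moreover have "?NW \<subseteq> normalizer_in G (carrier G) W" using cL by (auto simp: normalizer_in_def)
  ultimately show ?thesis
    using G.card_subgroup_dvd[OF sNW G.normalizer_in_subgroup[OF G.subgroup_self W(1)]] dvd_trans by blast
qed

text \<open>For the second clause \<open>V\<close> is replaced by a Sylow \<open>q\<close>-subgroup
  \<open>W\<close> of its preimage, larger than \<open>V\<close> by the \<open>q\<close>-part of the
  kernel. Mapping the permutable subgroup for \<open>W\<close> down loses at most this factor at
  \<open>q\<close>, while its \<open>S\<close>-part may shrink; this is why the clause asks for
  divisibilities instead of equalities.\<close>

lemma weak_embed_cond_image:
  assumes w: "G.weak_embed_cond" shows "H.weak_embed_cond"
  unfolding H.weak_embed_cond_def
proof (intro conjI ballI allI impI)
  fix S p assume S: "S \<in> \<sigma>" "p \<in> S"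
  have p: "prime p" using G.sigma_prime S by blast
  obtain E where E: "G.perm E" "part S (card E) = part {p} (order G)"
    using G.weak_embed_condD1[OF w S] by blast
  have sE: "subgroup E G" using E by (simp add: G.perm_def)
  have sI: "subgroup (h ` E) H" using image_subgroup[OF sE] .
  have Sp: "{p} \<inter> S = {p}" using S by auto
  have "part {p} (card E) = part {p} (part S (card E))" by (simp add: Sp)
  also have "\<dots> = part {p} (order G)" using E(2) by simp
  finally have full: "part {p} (card (h ` E)) = part {p} (order H)" by (rule part_card_image[OF sE])
  have "card (h ` E) dvd card E" using card_image_mult[OF sE] by (metis dvd_triv_left)
  then have "part S (card (h ` E)) dvd part {p} (order G)"
    using E(2) part_dvd_mono[of "card (h ` E)" "card E" S] G.card_subgroup_pos[OF sE] by simp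
  then have "part {p} (part S (card (h ` E))) = part S (card (h ` E))"
    by (rule part_self_dvd[rotated]) auto
  then have "part S (card (h ` E)) = part {p} (order H)" using full by (simp add: Sp)
  then show "\<exists>E. H.perm E \<and> part S (card E) = part {p} (order H)" using perm_image[OF E(1)] by blast
next
  fix V q k p S T
  assume V: "subgroup V H" "card V = q ^ k" "k > 0" and ST: "S \<in> \<sigma>" "T \<in> \<sigma>" "S \<noteq> T"
    and pq: "p \<in> S" "q \<in> T" and dvd: "p dvd card (normalizer_in H (carrier H) V)"
  have pr: "prime p" "prime q" "p \<noteq> q" using G.sigma_prime ST pq G.sigma_unique by blast+
  have cX: "card (pre V) = q ^ k * card ker" using card_pre V by simp
  have kpos: "card ker > 0" using G.card_subgroup_pos[OF ker_subgroup] .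
  have qm: "q ^ multiplicity q (card (pre V)) = q ^ k * part {q} (card ker)"
    unfolding part_singleton[OF pr(2), symmetric] cX
    using kpos pr(2) by (simp add: part_mult prime_gt_0_nat part_prime_power)
  obtain W where W: "subgroup W G" "W \<subseteq> pre V" "card W = q ^ multiplicity q (card (pre V))"
    using G.sylow_exists[OF pre_subgroup[OF V(1)] pr(2) multiplicity_dvd] by blast
  have "q dvd card (pre V)" unfolding cX using V(3) by simp
  then have m: "multiplicity q (card (pre V)) > 0"
    using pr(2) G.card_subgroup_pos[OF pre_subgroup[OF V(1)]] by (simp add: prime_multiplicity_gt_zero_iff)
  obtain E j where E: "G.perm E" "part S (card E) dvd p" "part T (card E) = q ^ j" "card W dvd q ^ j"
    using G.weak_embed_condD2[OF w W(1,3) m ST pq frattini_prime_dvd[OF V(1,2) pr dvd W]] by blast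
  have sE: "subgroup E G" using E by (simp add: G.perm_def)
  have sI: "subgroup (h ` E) H" "subgroup (E \<inter> ker) G"
    using image_subgroup[OF sE] sE ker_subgroup G.subgroups_Inter_pair by blast+
  have Epos: "card E > 0" "card (h ` E) > 0" "card (E \<inter> ker) > 0"
    using G.card_subgroup_pos H.card_subgroup_pos sE sI by blast+
  have d: "card (h ` E) dvd card E" "card (E \<inter> ker) dvd card E"
    using card_image_mult[OF sE] by (metis dvd_triv_left, metis dvd_triv_right)
  have 1: "part S (card (h ` E)) dvd p" using part_dvd_mono[OF d(1) Epos(1)] E(2) dvd_trans by blast
  have "part T (card (h ` E)) dvd q ^ j" using part_dvd_mono[OF d(1) Epos(1), of T] E(3) by simp
  then obtain i where i: "part T (card (h ` E)) = q ^ i" using pr(2) by (auto simp: divides_primepow_nat)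
  have qT: "{q} \<inter> T = {q}" using pq by auto
  have "part T (card (E \<inter> ker)) dvd q ^ j" using part_dvd_mono[OF d(2) Epos(1), of T] E(3) by simp
  then have "part {q} (part T (card (E \<inter> ker))) = part T (card (E \<inter> ker))"
    by (rule part_self_dvd[rotated]) (use pr(2) in \<open>auto simp: part_prime_power prime_gt_0_nat\<close>)
  then have e: "part T (card (E \<inter> ker)) = part {q} (card (E \<inter> ker))" by (simp add: qT)
  have "q ^ i * part {q} (card (E \<inter> ker)) dvd q ^ i * part {q} (card ker)"
    using part_dvd_mono[OF G.card_subgroup_dvd[OF sI(2) ker_subgroup] kpos, of "{q}"] by simp
  moreover have "q ^ i * part {q} (card (E \<inter> ker)) = q ^ j"
    using part_mult[OF Epos(2,3), of T] card_image_mult[OF sE] i e E(3) by simp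
  moreover have "q ^ k * part {q} (card ker) dvd q ^ j" using E(4) W(3) qm by simp
  ultimately have "q ^ k * part {q} (card ker) dvd q ^ i * part {q} (card ker)"
    by (metis dvd_trans)
  then have "q ^ k dvd q ^ i" by simp
  then show "\<exists>E j. H.perm E \<and> part S (card E) dvd p \<and> part T (card E) = q ^ j \<and> card V dvd q ^ j"
    using perm_image[OF E(1)] 1 i V(2) by (intro exI[of _ "h ` E"] exI[of _ i]) simp
qed

end

section \<open>Minimal normal subgroups are \<open>\<sigma>\<close>-primary\<close>

context fin_group
begin

definition "minimal_normal N \<longleftrightarrow> N \<lhd> G \<and> N \<noteq> {\<one>} \<and> (\<forall>U. U \<lhd> G \<longrightarrow> U \<subseteq> N \<longrightarrow> U = {\<one>} \<or> U = N)"

lemma normalizes_conjugate: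
  assumes N: "N \<lhd> G" and U: "U \<subseteq> carrier G" and n: "normalizes G N U" and x: "x \<in> carrier G"
  shows "normalizes G N (conjugate G U x)"
  unfolding normalizes_def
proof (intro ballI)
  have NG: "N \<subseteq> carrier G" using N normal_imp_subgroup subgroup.subset by blast
  fix l u assume l: "l \<in> N" and "u \<in> conjugate G U x"
  then obtain v where v: "v \<in> U" "u = inv x \<otimes> v \<otimes> x" by (auto simp: conjugate_def)
  have c: "l \<in> carrier G" "v \<in> carrier G" using l v NG U by auto
  have "x \<otimes> l \<otimes> inv x \<in> N" using normal.inv_op_closed2[OF N x l] .
  from normalizesD[OF n this v(1)]
  have "x \<otimes> l \<otimes> inv x \<otimes> v \<otimes> inv (x \<otimes> l \<otimes> inv x) \<in> U" .
  moreover have "l \<otimes> u \<otimes> inv l = inv x \<otimes> (x \<otimes> l \<otimes> inv x \<otimes> v \<otimes> inv (x \<otimes> l \<otimes> inv x)) \<otimes> x"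
    using c x v(2) by (simp add: inv_mult_group m_assoc)
  ultimately show "l \<otimes> u \<otimes> inv l \<in> conjugate G U x" by (simp add: conjugate_def)
qed

lemma conjugate_subset_normal:
  assumes N: "N \<lhd> G" and U: "U \<subseteq> N" and x: "x \<in> carrier G"
  shows "conjugate G U x \<subseteq> N"
  using normal.inv_op_closed1[OF N x] U by (auto simp: conjugate_def)

lemma normal_if_conjugate_subset:
  assumes U: "subgroup U G" and c: "\<And>x. x \<in> carrier G \<Longrightarrow> conjugate G U x \<subseteq> U"
  shows "U \<lhd> G"
  unfolding normal_inv_iff
proof (intro conjI ballI U)
  fix x u assume x: "x \<in> carrier G" and u: "u \<in> U"
  have "inv (inv x) \<otimes> u \<otimes> inv x \<in> conjugate G U (inv x)" using u by (auto simp: conjugate_def)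
  then show "x \<otimes> u \<otimes> inv x \<in> U" using c[OF inv_closed[OF x]] x by auto
qed

lemma normalizes_set_mult:
  assumes L: "L \<subseteq> carrier G" and A: "A \<subseteq> carrier G" "normalizes G L A" and B: "B \<subseteq> carrier G" "normalizes G L B"
  shows "normalizes G L (A <#> B)"
  unfolding normalizes_def
proof (intro ballI)
  fix l u assume l: "l \<in> L" and "u \<in> A <#> B"
  then obtain a b where ab: "a \<in> A" "b \<in> B" "u = a \<otimes> b" by (auto simp: set_mult_def)
  have c: "l \<in> carrier G" "a \<in> carrier G" "b \<in> carrier G" using l ab L A B by auto
  have "l \<otimes> u \<otimes> inv l = (l \<otimes> a \<otimes> inv l) \<otimes> (l \<otimes> b \<otimes> inv l)" using c ab(3) by (simp add: m_assoc)
  then show "l \<otimes> u \<otimes> inv l \<in> A <#> B"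
    using normalizesD[OF A(2) l ab(1)] normalizesD[OF B(2) l ab(2)] by (auto simp: set_mult_def)
qed

text \<open>Products of \<open>N\<close>-invariant \<open>S\<close>-subgroups of \<open>N\<close>
  are again such, so there is a greatest one. It is stable under conjugation by \<open>G\<close>,
  hence normal, and minimality of \<open>N\<close> makes it trivial.\<close>

lemma minimal_normal_no_part:
  assumes N: "minimal_normal N" and nS: "part S (card N) \<noteq> card N"
    and U: "subgroup U G" "U \<subseteq> N" "normalizes G N U" "part S (card U) = card U"
  shows "U = {\<one>}"
proof -
  have nN: "N \<lhd> G" using N by (simp add: minimal_normal_def)
  have sN: "subgroup N G" using nN normal_imp_subgroup by blast
  define F where "F = {U. subgroup U G \<and> U \<subseteq> N \<and> normalizes G N U \<and> part S (card U) = card U}"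
  have UF: "U \<in> F" using U by (simp add: F_def)
  have bound: "\<forall>V. V \<in> F \<longrightarrow> card V \<le> card N"
    using finite_subgroup[OF sN] by (auto simp: F_def intro: card_mono)
  obtain W where W: "W \<in> F" "\<forall>V. V \<in> F \<longrightarrow> card V \<le> card W"
    using ex_has_greatest_nat[of "\<lambda>V. V \<in> F" U card "Suc (card N)"] UF bound
    by (auto simp: less_Suc_eq_le)
  have sW: "subgroup W G" "W \<subseteq> N" "normalizes G N W" "part S (card W) = card W" using W by (auto simp: F_def)
  have sub: "V \<subseteq> W" if V: "V \<in> F" for V
  proof -
    have sV: "subgroup V G" "V \<subseteq> N" "normalizes G N V" "part S (card V) = card V" using V by (auto simp: F_def)
    have WV: "subgroup (W <#> V) G"
      using subgroup_set_mult[OF sW(1) sV(1)] normalizes_mono[OF sV(3) sW(2)] by blast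
    have I: "subgroup (W \<inter> V) G" using sW sV subgroups_Inter_pair by blast
    have "card (W <#> V) dvd card W * card V" using card_set_mult[OF sW(1) sV(1)] by (metis dvd_triv_left)
    moreover have "part S (card W * card V) = card W * card V"
      using sW sV card_subgroup_pos by (simp add: part_mult)
    ultimately have "part S (card (W <#> V)) = card (W <#> V)"
      using part_self_dvd card_subgroup_pos[OF sW(1)] card_subgroup_pos[OF sV(1)] by simp
    moreover have "normalizes G N (W <#> V)"
      using normalizes_set_mult[OF _ _ sW(3) _ sV(3)] subgroup.subset sN sW(1) sV(1) by blast
    ultimately have "W <#> V \<in> F"
      using WV set_mult_least[OF sN sW(2) sV(2)] by (simp add: F_def)
    then have "card (W <#> V) \<le> card W" using W(2) by blast
    then have "W <#> V = W"
      using set_mult_subset(1)[OF sW(1) sV(1)] finite_subgroup[OF WV] by (metis card_seteq)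
    then show ?thesis using set_mult_subset(2)[OF sW(1) sV(1)] by simp
  qed
  have "W \<lhd> G"
  proof (rule normal_if_conjugate_subset[OF sW(1)])
    fix x assume x: "x \<in> carrier G"
    have "conjugate G W x \<in> F"
      using conjugate_subgroup[OF sW(1) x] conjugate_subset_normal[OF nN sW(2) x]
        normalizes_conjugate[OF nN subgroup.subset[OF sW(1)] sW(3) x]
        card_conjugate[OF subgroup.subset[OF sW(1)] x] sW(4) by (simp add: F_def)
    then show "conjugate G W x \<subseteq> W" by (rule sub)
  qed
  then have "W = {\<one>}" using N sW nS unfolding minimal_normal_def by metis
  then show ?thesis using sub[OF UF] subgroup.one_closed[OF U(1)] by auto
qed

lemma commute_if_trivial_Int:
  assumes A: "subgroup A G" and B: "subgroup B G" and n: "normalizes G A B" "normalizes G B A"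
    and I: "A \<inter> B = {\<one>}" and ab: "a \<in> A" "b \<in> B"
  shows "a \<otimes> b = b \<otimes> a"
proof -
  have c: "a \<in> carrier G" "b \<in> carrier G" using ab A B subgroup.mem_carrier by metis+
  let ?x = "a \<otimes> b \<otimes> inv a \<otimes> inv b"
  have "?x \<in> B" using subgroup.m_closed[OF B normalizesD[OF n(1) ab] subgroup.m_inv_closed[OF B ab(2)]] .
  moreover have "?x \<in> A"
  proof -
    have "b \<otimes> inv a \<otimes> inv b \<in> A" using normalizesD[OF n(2) ab(2) subgroup.m_inv_closed[OF A ab(1)]] .
    then have "a \<otimes> (b \<otimes> inv a \<otimes> inv b) \<in> A" using subgroup.m_closed[OF A ab(1)] by blast
    then show ?thesis using c by (simp add: m_assoc)
  qed
  ultimately have "?x = \<one>" using I by blast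
  moreover have "a \<otimes> b = ?x \<otimes> (b \<otimes> a)" using c by (simp add: m_assoc)
  ultimately show ?thesis using c by simp
qed

lemma centralizer_normalized:
  assumes N: "subgroup N G" and Z: "Z \<subseteq> carrier G" "normalizes G N Z"
  shows "normalizes G N (centralizer G N Z)"
  unfolding normalizes_def
proof (intro ballI)
  fix n c assume n: "n \<in> N" and c: "c \<in> centralizer G N Z"
  have nc: "n \<in> carrier G" "c \<in> carrier G" "c \<in> N"
    using n c subgroup.mem_carrier[OF N] by (auto simp: centralizer_def)
  have "n \<otimes> c \<otimes> inv n \<otimes> z = z \<otimes> (n \<otimes> c \<otimes> inv n)" if z: "z \<in> Z" for z
  proof -
    have zc: "z \<in> carrier G" using z Z by auto
    have "inv n \<otimes> z \<otimes> n \<in> Z" using normalizesD'[OF Z(2) N n z] .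
    then have eq: "c \<otimes> (inv n \<otimes> z \<otimes> n) = (inv n \<otimes> z \<otimes> n) \<otimes> c" using c by (auto simp: centralizer_def)
    have "n \<otimes> c \<otimes> inv n \<otimes> z = n \<otimes> (c \<otimes> (inv n \<otimes> z \<otimes> n)) \<otimes> inv n"
      using nc zc by (simp add: m_assoc)
    also have "\<dots> = z \<otimes> (n \<otimes> c \<otimes> inv n)" unfolding eq using nc zc by (simp add: m_assoc)
    finally show ?thesis .
  qed
  moreover have "n \<otimes> c \<otimes> inv n \<in> N"
    using subgroup.m_closed[OF N subgroup.m_closed[OF N n nc(3)] subgroup.m_inv_closed[OF N n]] .
  ultimately show "n \<otimes> c \<otimes> inv n \<in> centralizer G N Z" by (simp add: centralizer_def)
qed

text \<open>\<open>N\<close> behaves like a direct product of nonabelian simple groups without the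
  factors being named: \<open>N\<close> is generated by the conjugates of a minimal
  \<open>N\<close>-invariant subgroup \<open>L\<close>, and each conjugate lies in \<open>Z\<close>
  or in its centralizer.\<close>

lemma minimal_normal_decompose:
  assumes N: "minimal_normal N"
    and ab: "\<And>U. subgroup U G \<Longrightarrow> U \<subseteq> N \<Longrightarrow> normalizes G N U \<Longrightarrow>
      (\<And>x y. x \<in> U \<Longrightarrow> y \<in> U \<Longrightarrow> x \<otimes> y = y \<otimes> x) \<Longrightarrow> U = {\<one>}"
    and Z: "subgroup Z G" "Z \<subseteq> N" "normalizes G N Z"
  shows "Z \<inter> centralizer G N Z = {\<one>}" "Z <#> centralizer G N Z = N"
proof -
  let ?C = "centralizer G N Z"
  have nN: "N \<lhd> G" "N \<noteq> {\<one>}" using N by (simp_all add: minimal_normal_def)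
  have sN: "subgroup N G" using nN normal_imp_subgroup by blast
  have NG: "N \<subseteq> carrier G" using sN subgroup.subset by blast
  have sC: "subgroup ?C G" using centralizer_subgroup[OF sN subgroup.subset[OF Z(1)]] .
  have CN: "?C \<subseteq> N" by (auto simp: centralizer_def)
  have nC: "normalizes G N ?C" using centralizer_normalized[OF sN subgroup.subset[OF Z(1)] Z(3)] .
  show "Z \<inter> ?C = {\<one>}"
  proof (rule ab)
    show "subgroup (Z \<inter> ?C) G" using Z(1) sC subgroups_Inter_pair by blast
    show "normalizes G N (Z \<inter> ?C)" using normalizes_Int[OF Z(3) nC] .
    show "Z \<inter> ?C \<subseteq> N" using Z(2) by blast
    fix x y assume "x \<in> Z \<inter> ?C" "y \<in> Z \<inter> ?C"
    then show "x \<otimes> y = y \<otimes> x" unfolding centralizer_def by blast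
  qed
  define F where "F = {L. subgroup L G \<and> L \<subseteq> N \<and> normalizes G N L \<and> L \<noteq> {\<one>}}"
  have "N \<in> F" using sN nN normalizes_self by (simp add: F_def)
  then obtain L where L: "L \<in> F" "\<And>M. M \<in> F \<Longrightarrow> card L \<le> card M"
    using ex_has_least_nat[of "\<lambda>L. L \<in> F" N card] by blast
  have sL: "subgroup L G" "L \<subseteq> N" "normalizes G N L" "L \<noteq> {\<one>}" using L by (auto simp: F_def)
  have ZC: "subgroup (Z <#> ?C) G"
    using subgroup_set_mult[OF Z(1) sC] normalizes_mono[OF nC Z(2)] by blast
  \<comment> \<open>A conjugate of \<open>L\<close> is minimal as well; it either meets
    \<open>Z\<close> trivially and then commutes with it, or is contained in
    \<open>Z\<close>.\<close>
  have conj: "conjugate G L x \<subseteq> Z <#> ?C" if x: "x \<in> carrier G" for x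
  proof -
    let ?M = "conjugate G L x"
    have M: "subgroup ?M G" "?M \<subseteq> N" "normalizes G N ?M" "card ?M = card L"
      using conjugate_subgroup[OF sL(1) x] conjugate_subset_normal[OF nN(1) sL(2) x]
        normalizes_conjugate[OF nN(1) subgroup.subset[OF sL(1)] sL(3) x]
        card_conjugate[OF subgroup.subset[OF sL(1)] x] by auto
    show ?thesis
    proof (cases "Z \<inter> ?M = {\<one>}")
      case True
      have "normalizes G Z ?M" "normalizes G ?M Z" using M Z normalizes_mono by blast+
      then have "?M \<subseteq> ?C"
        using commute_if_trivial_Int[OF Z(1) M(1) _ _ True] M(2) by (auto simp: centralizer_def)
      then show ?thesis using set_mult_subset(2)[OF Z(1) sC] by blast
    next
      case False
      have "subgroup (Z \<inter> ?M) G" using Z(1) M(1) subgroups_Inter_pair by blast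
      then have "Z \<inter> ?M \<in> F" using False normalizes_Int[OF Z(3) M(3)] Z(2) by (auto simp: F_def)
      then have "card ?M \<le> card (Z \<inter> ?M)" using L(2) M(4) by simp
      then have "Z \<inter> ?M = ?M" using finite_subgroup[OF M(1)] by (intro card_seteq) auto
      then show ?thesis using set_mult_subset(1)[OF Z(1) sC] by blast
    qed
  qed
  let ?X = "\<Union>x\<in>carrier G. conjugate G L x"
  have XN: "?X \<subseteq> N" using conjugate_subset_normal[OF nN(1) sL(2)] by blast
  then have XG: "?X \<subseteq> carrier G" using NG by blast
  have nX: "generate G ?X \<lhd> G"
  proof (rule normal_generateI[OF XG])
    fix h g assume "h \<in> ?X" and g: "g \<in> carrier G"
    then obtain x where x: "x \<in> carrier G" "h \<in> conjugate G L x" by auto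
    have "g \<otimes> h \<otimes> inv g \<in> conjugate G (conjugate G L x) (inv g)"
      using x(2) g by (auto simp: conjugate_def)
    also have "\<dots> = conjugate G L (x \<otimes> inv g)"
      using conjugate_conjugate[OF subgroup.subset[OF sL(1)] x(1)] g by simp
    finally show "g \<otimes> h \<otimes> inv g \<in> ?X" using x(1) g by (intro UN_I[of "x \<otimes> inv g"]) auto
  qed
  have "L \<subseteq> ?X" using conjugate_one[OF subgroup.subset[OF sL(1)]] one_closed by blast
  then have LX: "L \<subseteq> generate G ?X" using generate.incl[of _ ?X G] by blast
  have "generate G ?X \<noteq> {\<one>}" using LX sL(4) subgroup.one_closed[OF sL(1)] by blast
  moreover have "generate G ?X \<subseteq> N" using generate_subgroup_incl[OF XN sN] .
  ultimately have "generate G ?X = N" using N nX unfolding minimal_normal_def by blast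
  moreover have "generate G ?X \<subseteq> Z <#> ?C" by (rule generate_subgroup_incl[OF _ ZC]) (use conj in blast)
  ultimately show "Z <#> ?C = N" using set_mult_least[OF sN Z(2) CN] by blast
qed

lemma part_singleton_self_iff:
  assumes A: "subgroup A G" and p: "prime p" and x: "\<And>x. x \<in> A \<Longrightarrow> x [^] (p ^ m) = \<one>"
  shows "part {p} (card A) = card A"
proof -
  have "r = p" if r: "prime r" "r dvd card A" for r
  proof (rule ccontr)
    assume "r \<noteq> p"
    then have cop: "coprime r (p ^ m)" using r p by (simp add: primes_coprime)
    obtain R where R: "subgroup R G" "R \<subseteq> A" "card R = r" using cauchy_exists[OF A r] .
    have "y = \<one>" if y: "y \<in> R" for y
      using pow_eq_one_coprime[OF subgroup.mem_carrier[OF R(1) y], of r "p ^ m"] cop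
        pow_card_eq_one[OF R(1) y] R x y by auto
    then have "R \<subseteq> {\<one>}" by blast
    then have "card R \<le> 1" using card_mono[of "{\<one>}" R] by simp
    then show False using R(3) prime_gt_1_nat[OF r(1)] by simp
  qed
  then show ?thesis
    using part_eq_self_iff[OF card_subgroup_pos[OF A], of "{p}"] by (auto simp: in_prime_factors_iff)
qed

end

context sigma_group
begin

text \<open>The elements of \<open>p\<close>-power order of an abelian \<open>U\<close> form a
  subgroup defined by a power equation, hence invariant under \<open>N\<close>; it lies within one
  class, and \<open>minimal_normal_no_part\<close> excludes it.\<close>

lemma minimal_normal_no_abelian:
  assumes N: "minimal_normal N" and np: "\<And>S. S \<in> \<sigma> \<Longrightarrow> part S (card N) \<noteq> card N"
    and U: "subgroup U G" "U \<subseteq> N" "normalizes G N U"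
    and comm: "\<And>x y. x \<in> U \<Longrightarrow> y \<in> U \<Longrightarrow> x \<otimes> y = y \<otimes> x"
  shows "U = {\<one>}"
proof (rule ccontr)
  assume "U \<noteq> {\<one>}"
  then have "card U \<noteq> 1" using subgroup.one_closed[OF U(1)] by (metis card_1_singletonE singletonD)
  then obtain p where p: "prime p" "p dvd card U" using prime_factor_nat by blast
  have sN: "subgroup N G" using N normal_imp_subgroup by (auto simp: minimal_normal_def)
  note c = subgroup.mem_carrier[OF U(1)] and cN = subgroup.mem_carrier[OF sN]
  let ?m = "p ^ multiplicity p (card U)"
  define P where "P = {u \<in> U. u [^] ?m = \<one>}"
  have sP: "subgroup P G"
  proof (rule subgroupI)
    show "P \<subseteq> carrier G" using c by (auto simp: P_def)
    have "\<one> \<in> P" using subgroup.one_closed[OF U(1)] by (simp add: P_def)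
    then show "P \<noteq> {}" by blast
    fix a assume a: "a \<in> P"
    then show "inv a \<in> P" using c subgroup.m_inv_closed[OF U(1)] by (simp add: P_def nat_pow_inv)
    fix b assume b: "b \<in> P"
    show "a \<otimes> b \<in> P"
      using a b c comm[of a b] subgroup.m_closed[OF U(1)] by (simp add: P_def pow_mult_distrib)
  qed
  have nP: "normalizes G N P"
    unfolding normalizes_def
  proof (intro ballI)
    fix n u assume n: "n \<in> N" and u: "u \<in> P"
    have nc: "n \<in> carrier G" "u \<in> carrier G" using cN[OF n] u c by (auto simp: P_def)
    have pow: "(n \<otimes> u \<otimes> inv n) [^] k = n \<otimes> u [^] k \<otimes> inv n" for k :: nat
      by (induction k) (use nc in \<open>simp_all add: m_assoc\<close>)
    then have "(n \<otimes> u \<otimes> inv n) [^] ?m = \<one>" using u nc by (simp add: P_def)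
    then show "n \<otimes> u \<otimes> inv n \<in> P" using normalizesD[OF U(3) n] u by (simp add: P_def)
  qed
  have "part {p} (card P) = card P"
    by (rule part_singleton_self_iff[OF sP p(1), of "multiplicity p (card U)"]) (simp add: P_def)
  moreover obtain S where S: "S \<in> \<sigma>" "p \<in> S" using sigma_cover[OF p(1)] by blast
  ultimately have pS: "part S (card P) = card P"
    using part_part[of S "{p}" "card P"] by (metis Int_insert_right_if1 Int_empty_right)
  have PN: "P \<subseteq> N" using U(2) by (auto simp: P_def)
  have "P = {\<one>}" by (rule minimal_normal_no_part[OF N np[OF S(1)] sP PN nP pS])
  moreover obtain R where R: "subgroup R G" "R \<subseteq> U" "card R = p" using cauchy_exists[OF U(1) p] .
  have "R \<subseteq> P"
  proof
    fix r assume r: "r \<in> R"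
    have "p dvd ?m" using p card_subgroup_pos[OF U(1)] by (simp add: prime_multiplicity_gt_zero_iff)
    then obtain k where "?m = p * k" by (auto elim: dvdE)
    then have "r [^] ?m = (r [^] p) [^] k" using subgroup.mem_carrier[OF R(1) r] by (simp add: nat_pow_pow)
    then show "r \<in> P" using r R pow_card_eq_one[OF R(1) r] by (auto simp: P_def)
  qed
  ultimately have "card R \<le> 1" using card_mono[of "{\<one>}" R] by auto
  then show False using R(3) prime_gt_1_nat[OF p(1)] by simp
qed

end

section \<open>Conjugates and joins of subgroups that permute with Hall subgroups\<close>

context fin_group
begin

text \<open>Induction over words in \<open>X\<close> moves a whole word across \<open>C\<close>;
  inversion then gives the opposite inclusion.\<close>

lemma generate_permutes:
  assumes X: "X \<subseteq> carrier G" and inv: "\<And>a. a \<in> X \<Longrightarrow> inv a \<in> X" and C: "subgroup C G"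
    and XC: "\<And>a c. a \<in> X \<Longrightarrow> c \<in> C \<Longrightarrow> a \<otimes> c \<in> C <#> generate G X"
  shows "generate G X <#> C = C <#> generate G X"
proof -
  let ?L = "generate G X"
  have sL: "subgroup ?L G" using generate_is_subgroup[OF X] .
  note cL = subgroup.mem_carrier[OF sL] and cC = subgroup.mem_carrier[OF C]
  have "\<forall>c\<in>C. g \<otimes> c \<in> C <#> ?L" if "g \<in> ?L" for g
    using that
  proof (induction g rule: generate.induct)
    case one
    have "\<one> \<otimes> c = c \<otimes> \<one>" if "c \<in> C" for c using cC that by simp
    then show ?case using generate.one[of G X] by (auto simp: set_mult_def)
  next
    case (incl h)
    then show ?case using XC by blast
  next
    case (inv h)
    then show ?case using XC assms(2) by blast
  next
    case (eng a b)
    show ?case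
    proof
      fix c assume c: "c \<in> C"
      obtain c' b' where b: "c' \<in> C" "b' \<in> ?L" "b \<otimes> c = c' \<otimes> b'" using eng.IH(2) c unfolding set_mult_def by blast
      obtain c'' a' where a: "c'' \<in> C" "a' \<in> ?L" "a \<otimes> c' = c'' \<otimes> a'" using eng.IH(1) b(1) unfolding set_mult_def by blast
      note cc = cL[OF eng(1)] cL[OF eng(2)] cL[OF b(2)] cL[OF a(2)] cC[OF c] cC[OF b(1)] cC[OF a(1)]
      have "a \<otimes> b \<otimes> c = a \<otimes> (b \<otimes> c)" using cc by (simp add: m_assoc)
      also have "\<dots> = (a \<otimes> c') \<otimes> b'" unfolding b(3) using cc by (simp add: m_assoc)
      also have "\<dots> = c'' \<otimes> (a' \<otimes> b')" unfolding a(3) using cc by (simp add: m_assoc)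
      finally show "a \<otimes> b \<otimes> c \<in> C <#> ?L"
        using a(1) subgroup.m_closed[OF sL a(2) b(2)] by (auto simp: set_mult_def)
    qed
  qed
  then have 1: "?L <#> C \<subseteq> C <#> ?L" unfolding set_mult_def by blast
  have "C <#> ?L \<subseteq> ?L <#> C"
  proof
    fix x assume "x \<in> C <#> ?L"
    then obtain c g where cg: "c \<in> C" "g \<in> ?L" "x = c \<otimes> g" by (auto simp: set_mult_def)
    have "inv g \<otimes> inv c \<in> ?L <#> C"
      using subgroup.m_inv_closed[OF C cg(1)] subgroup.m_inv_closed[OF sL cg(2)] by (auto simp: set_mult_def)
    then obtain c' g' where 2: "c' \<in> C" "g' \<in> ?L" "inv g \<otimes> inv c = c' \<otimes> g'"
      using 1 unfolding set_mult_def by blast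
    have "x = inv (inv g \<otimes> inv c)" using cg cC cL by (simp add: inv_mult_group)
    also have "\<dots> = inv g' \<otimes> inv c'" unfolding 2(3) using 2 cC cL by (simp add: inv_mult_group)
    finally show "x \<in> ?L <#> C"
      using subgroup.m_inv_closed[OF C 2(1)] subgroup.m_inv_closed[OF sL 2(2)] by (auto simp: set_mult_def)
  qed
  with 1 show ?thesis by blast
qed

lemma normalizer_if_conjugate_subset:
  assumes C: "subgroup C G" and A: "A \<subseteq> carrier G" and c: "\<And>k. k \<in> C \<Longrightarrow> conjugate G A k \<subseteq> A"
  shows "normalizes G C A"
  unfolding normalizes_def
proof (intro ballI)
  fix k a assume k: "k \<in> C" and a: "a \<in> A"
  have "inv (inv k) \<otimes> a \<otimes> inv k \<in> conjugate G A (inv k)" using a by (auto simp: conjugate_def)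
  then show "k \<otimes> a \<otimes> inv k \<in> A"
    using c[OF subgroup.m_inv_closed[OF C k]] subgroup.mem_carrier[OF C k] by auto
qed

end

context sigma_group
begin

text \<open>The conjugate of the Hall subgroup by \<open>x\<close> is the conjugate by
  \<open>k\<close> of its conjugate by \<open>x \<otimes> inv k\<close>. Together with closure under
  joins this keeps the enlarged subgroups of the following argument in the same family.\<close>

lemma permutes_with_conjugate:
  assumes A: "A \<subseteq> carrier G" and K: "hall_family K" and p: "permutes_with A K" and k: "k \<in> carrier G"
  shows "permutes_with (conjugate G A k) K"
  unfolding permutes_with_def
proof (intro ballI)
  fix S x assume S: "S \<in> \<sigma>" and x: "x \<in> carrier G"
  have z: "x \<otimes> inv k \<in> carrier G" using x k by simp
  let ?C = "conjugate G (K S) (x \<otimes> inv k)"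
  note C = hall_conjugate[OF K S z]
  have "conjugate G (K S) x = conjugate G ?C k"
    using conjugate_conjugate[OF subgroup.subset[OF C(3)] z k] x k by (simp add: m_assoc)
  then show "conjugate G A k <#> conjugate G (K S) x = conjugate G (K S) x <#> conjugate G A k"
    using conjugate_set_mult[OF A subgroup.subset[OF C(1)] k] conjugate_set_mult[OF subgroup.subset[OF C(1)] A k]
      permutes_withD[OF p S z] by simp
qed

lemma permutes_with_generate:
  assumes A: "subgroup A G" "permutes_with A K" and B: "subgroup B G" "permutes_with B K" and K: "hall_family K"
  shows "permutes_with (generate G (A \<union> B)) K"
  unfolding permutes_with_def
proof (intro ballI generate_permutes)
  fix S x assume S: "S \<in> \<sigma>" and x: "x \<in> carrier G"
  let ?C = "conjugate G (K S) x"
  show "subgroup ?C G" using hall_conjugate(1)[OF K S x] .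
  show "A \<union> B \<subseteq> carrier G" using A B subgroup.subset by blast
  show "inv a \<in> A \<union> B" if "a \<in> A \<union> B" for a
    using that subgroup.m_inv_closed[OF A(1)] subgroup.m_inv_closed[OF B(1)] by auto
  fix a c assume a: "a \<in> A \<union> B" and c: "c \<in> ?C"
  have "a \<otimes> c \<in> A <#> ?C \<or> a \<otimes> c \<in> B <#> ?C" using a c by (auto simp: set_mult_def)
  then have "a \<otimes> c \<in> ?C <#> A \<or> a \<otimes> c \<in> ?C <#> B"
    using permutes_withD[OF A(2) S x] permutes_withD[OF B(2) S x] by simp
  then show "a \<otimes> c \<in> ?C <#> generate G (A \<union> B)"
    unfolding set_mult_def using generate.incl[of _ "A \<union> B" G] by blast
qed

lemma sigma_part_one:
  assumes "S \<in> \<sigma>" "T \<in> \<sigma>" "S \<noteq> T" "part T d = d"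
  shows "part S d = 1"
  using part_part[of S T d] sigma_disjoint[OF assms(1-3)] assms(4) by (simp add: part_def)

lemma part_self_dvd_hall:
  assumes "hall_family K" "T \<in> \<sigma>" "x \<in> carrier G" "d dvd card (conjugate G (K T) x)"
  shows "part T d = d"
  using part_self_dvd[of T "card (conjugate G (K T) x)" d] hall_conjugate(2)[OF assms(1-3)] assms(4) by simp

text \<open>
  The idea is Kegel's: a maximal overgroup of \<open>E\<close> that still permutes with all
  conjugates of the Hall subgroups and does not contain the full \<open>S\<close>-part of \<open>N\<close> is
  normalized by the other Hall subgroups.
\<close>

lemma perm_contains_or_centralizes:
  assumes E: "perm E" and N: "minimal_normal N" and np: "\<And>S. S \<in> \<sigma> \<Longrightarrow> part S (card N) \<noteq> card N"
  shows "N \<subseteq> E \<or> E \<subseteq> centralizer G (carrier G) N"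
proof (cases "N \<subseteq> E")
  case False
  have sE: "subgroup E G" using E by (simp add: perm_def)
  obtain K where K: "hall_family K" "permutes_with E K" using E by (auto simp: perm_def)
  have nN: "N \<lhd> G" "N \<noteq> {\<one>}" using N by (simp_all add: minimal_normal_def)
  have sN: "subgroup N G" using nN normal_imp_subgroup by blast
  note cN = subgroup.mem_carrier[OF sN]
  have Npos: "card N > 0" using card_subgroup_pos[OF sN] .
  have EN: "subgroup (E \<inter> N) G" using sE sN subgroups_Inter_pair by blast
  obtain S where S: "S \<in> \<sigma>" "part S (card (E \<inter> N)) \<noteq> part S (card N)"
  proof -
    have "card (E \<inter> N) \<noteq> card N"
    proof
      assume "card (E \<inter> N) = card N"
      then have "E \<inter> N = N" using finite_subgroup[OF sN] by (intro card_subset_eq) auto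
      then show False using False by blast
    qed
    then show thesis using sigma_eqI[OF card_subgroup_pos[OF EN] Npos] that by blast
  qed
  \<comment> \<open>Overgroups of \<open>E\<close> that permute with the fixed Hall family and still
    miss some of the \<open>S\<close>-part of \<open>N\<close>. A member \<open>A\<close> of
    greatest order absorbs every join that does not enlarge this part.\<close>
  define F where "F = {A. subgroup A G \<and> E \<subseteq> A \<and> permutes_with A K \<and> part S (card (A \<inter> N)) \<noteq> part S (card N)}"
  have EF: "E \<in> F" using sE K(2) S(2) by (simp add: F_def)
  have bound: "card V < Suc (order G)" if "V \<in> F" for V
    using that subgroup.subset[of V G] card_mono[OF finite_carrier, of V] by (simp add: F_def order_def less_Suc_eq_le)
  obtain A where A: "A \<in> F" "\<forall>V. V \<in> F \<longrightarrow> card V \<le> card A"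
    using ex_has_greatest_nat[of "\<lambda>V. V \<in> F" E card "Suc (order G)"] EF bound by blast
  have sA: "subgroup A G" "E \<subseteq> A" "permutes_with A K" "part S (card (A \<inter> N)) \<noteq> part S (card N)"
    using A by (auto simp: F_def)
  let ?Z = "A \<inter> N"
  have sZ: "subgroup ?Z G" using sA sN subgroups_Inter_pair by blast
  \<comment> \<open>\<open>A\<close> and its conjugate by \<open>k\<close> both lie in the subgroup
    \<open>A <#> ?C\<close>, so their join enlarges the intersection with \<open>N\<close> only by a
    factor dividing \<open>card ?C\<close>, a number of class \<open>T\<close>.\<close>
  have join: "\<exists>J d. subgroup J G \<and> A \<subseteq> J \<and> conjugate G A k \<subseteq> J \<and> permutes_with J K \<and>
      card (J \<inter> N) = card ?Z * d \<and> part T d = d"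
    if T: "T \<in> \<sigma>" and x: "x \<in> carrier G" and k: "k \<in> conjugate G (K T) x" for T x k
  proof -
    let ?C = "conjugate G (K T) x"
    note C = hall_conjugate[OF K(1) T x]
    have kc: "k \<in> carrier G" using subgroup.mem_carrier[OF C(1) k] .
    let ?B = "conjugate G A k"
    have B: "subgroup ?B G" using conjugate_subgroup[OF sA(1) kc] .
    let ?J = "generate G (A \<union> ?B)"
    have AB: "A \<union> ?B \<subseteq> carrier G" using subgroup.subset[OF sA(1)] subgroup.subset[OF B] by blast
    have J: "subgroup ?J G" using generate_is_subgroup[OF AB] .
    have sub: "A \<subseteq> ?J" "?B \<subseteq> ?J" using generate.incl[of _ "A \<union> ?B" G] by blast+
    have AC: "subgroup (A <#> ?C) G"
      using subgroup_set_mult_commute[OF sA(1) C(1) permutes_withD[OF sA(3) T x]] .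
    note ACs = set_mult_subset[OF sA(1) C(1)]
    have "?B \<subseteq> A <#> ?C"
    proof
      fix b assume "b \<in> ?B"
      then obtain a where a: "a \<in> A" "b = inv k \<otimes> a \<otimes> k" by (auto simp: conjugate_def)
      have "k \<in> A <#> ?C" "a \<in> A <#> ?C" using ACs k a by auto
      then show "b \<in> A <#> ?C" using a(2) subgroup.m_closed[OF AC] subgroup.m_inv_closed[OF AC] by simp
    qed
    then have "A \<union> ?B \<subseteq> A <#> ?C" using ACs(1) by simp
    then have JC: "?J \<subseteq> A <#> ?C" by (rule generate_subgroup_incl[OF _ AC])
    obtain d where d: "card (?J \<inter> N) = card ?Z * d" "card A * d dvd card ?J"
      using index_Int_dvd[OF sA(1) J sub(1) sN normal_normalizes[OF nN(1) subgroup.subset[OF J]]] by blast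
    have "card (A <#> ?C) dvd card A * card ?C" using card_set_mult[OF sA(1) C(1)] by (metis dvd_triv_left)
    then have "card A * d dvd card A * card ?C"
      using d(2) card_subgroup_dvd[OF J AC JC] dvd_trans by blast
    then have "d dvd card ?C" using card_subgroup_pos[OF sA(1)] by simp
    then have "part T d = d" using part_self_dvd_hall[OF K(1) T x] by blast
    moreover have "permutes_with ?J K"
      using permutes_with_generate[OF sA(1,3) B permutes_with_conjugate[OF subgroup.subset[OF sA(1)] K(1) sA(3) kc] K(1)] .
    ultimately show ?thesis using J sub d(1) by blast
  qed
  \<comment> \<open>For \<open>T\<close> other than \<open>S\<close> that factor does not affect the
    \<open>S\<close>-part, so the join stays in \<open>F\<close> and equals \<open>A\<close> by
    maximality.\<close>
  have nA: "normalizes G (conjugate G (K T) x) A" if T: "T \<in> \<sigma>" "T \<noteq> S" and x: "x \<in> carrier G" for T x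
  proof (rule normalizer_if_conjugate_subset[OF hall_conjugate(1)[OF K(1) T(1) x] subgroup.subset[OF sA(1)]])
    fix k assume k: "k \<in> conjugate G (K T) x"
    obtain J d where J: "subgroup J G" "A \<subseteq> J" "conjugate G A k \<subseteq> J" "permutes_with J K"
      "card (J \<inter> N) = card ?Z * d" "part T d = d" using join[OF T(1) x k] by blast
    have JN: "subgroup (J \<inter> N) G" using J sN subgroups_Inter_pair by blast
    have "d > 0" using card_subgroup_pos[OF JN] J(5) by (metis mult_0_right not_gr0)
    then have "part S (card (J \<inter> N)) = part S (card ?Z)"
      using J(5) card_subgroup_pos[OF sZ] sigma_part_one[OF S(1) T(1) _ J(6)] T(2) by (simp add: part_mult)
    then have "J \<in> F" using J sA by (simp add: F_def)
    then have "card J \<le> card A" using A(2) by blast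
    then have "A = J" using J(2) finite_subgroup[OF J(1)] by (intro card_seteq) auto
    then show "conjugate G A k \<subseteq> A" using J(3) by simp
  qed
  have sNA: "subgroup (normalizer_in G (carrier G) A) G" using normalizer_in_subgroup[OF subgroup_self sA(1)] .
  have "res S \<subseteq> normalizer_in G (carrier G) A"
    by (rule res_subset_if_halls[OF K(1) S(1) sNA])
      (simp add: subset_normalizer_in nA subgroup.subset[OF hall_conjugate(1)[OF K(1)]])
  \<comment> \<open>Otherwise \<open>res S\<close> and \<open>N\<close> would intersect trivially;
    as \<open>res S\<close> already has full part outside \<open>S\<close>, \<open>N\<close> would
    be an \<open>S\<close>-group.\<close>
  moreover have NO: "N \<subseteq> res S"
  proof -
    have "res S \<inter> N \<lhd> G" using res_normal nN(1) normal_subgroup_intersect by blast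
    then have "res S \<inter> N = {\<one>} \<or> res S \<inter> N = N" using N unfolding minimal_normal_def by blast
    moreover have "res S \<inter> N \<noteq> {\<one>}"
    proof
      assume "res S \<inter> N = {\<one>}"
      then have c: "card (res S <#> N) = card (res S) * card N" using card_set_mult[OF res_subgroup sN, of S] by simp
      have sub: "subgroup (res S <#> N) G"
        using subgroup_set_mult[OF res_subgroup sN normal_normalizes[OF nN(1) subgroup.subset[OF res_subgroup]]] .
      have "part (-S) (card (res S <#> N)) = part (-S) (order G)"
        using part_eq_superset[OF res_subgroup sub set_mult_subset(1)[OF res_subgroup sN] res_index] .
      then have "part (-S) (card N) = 1"
        using c part_mult[OF card_subgroup_pos[OF res_subgroup] Npos, of "-S"] res_index[of S] by simp
      then show False using part_mult_compl[OF Npos, of S] np[OF S(1)] by simp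
    qed
    ultimately show ?thesis by blast
  qed
  ultimately have nNA: "normalizes G N A" by (meson order_trans subset_normalizer_in)
  have nNZ: "normalizes G N ?Z" using normalizes_Int[OF nNA normalizes_self[OF sN]] .
  have noab: "U = {\<one>}" if "subgroup U G" "U \<subseteq> N" "normalizes G N U" "\<And>x y. x \<in> U \<Longrightarrow> y \<in> U \<Longrightarrow> x \<otimes> y = y \<otimes> x" for U
    using minimal_normal_no_abelian[OF N np that] .
  have ZN: "?Z \<subseteq> N" by blast
  note dec = minimal_normal_decompose[OF N noab sZ ZN nNZ]
  let ?C = "centralizer G N ?Z"
  have sC: "subgroup ?C G" using centralizer_subgroup[OF sN subgroup.subset[OF sZ]] .
  have nC: "normalizes G N ?C" using centralizer_normalized[OF sN subgroup.subset[OF sZ] nNZ] .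
  have nZ: "normalizes G (conjugate G (K T) x) ?Z" if T: "T \<in> \<sigma>" and x: "x \<in> carrier G" for T x
  proof (cases "T = S")
    case False
    then show ?thesis
      using normalizes_Int[OF nA[OF T _ x]] normal_normalizes[OF nN(1) subgroup.subset[OF hall_conjugate(1)[OF K(1) T x]]]
      by blast
  next
    case True
    show ?thesis
    proof (rule normalizer_if_conjugate_subset[OF hall_conjugate(1)[OF K(1) T x] subgroup.subset[OF sZ]])
      fix k assume k: "k \<in> conjugate G (K T) x"
      have kc: "k \<in> carrier G" using subgroup.mem_carrier[OF hall_conjugate(1)[OF K(1) T x] k] .
      obtain J d where J: "subgroup J G" "A \<subseteq> J" "conjugate G A k \<subseteq> J" "permutes_with J K"
        "card (J \<inter> N) = card ?Z * d" "part T d = d" using join[OF T x k] by blast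
      have JN: "subgroup (J \<inter> N) G" using J sN subgroups_Inter_pair by blast
      let ?Y = "conjugate G ?Z k"
      have Y: "subgroup ?Y G" "?Y \<subseteq> N" "normalizes G N ?Y"
        using conjugate_subgroup[OF sZ kc] conjugate_subset_normal[OF nN(1) ZN kc]
          normalizes_conjugate[OF nN(1) subgroup.subset[OF sZ] nNZ kc] by auto
      have YJ: "?Y \<subseteq> J" using J(3) by (auto simp: conjugate_def)
      let ?P = "?Z <#> ?Y"
      have P: "subgroup ?P G" using subgroup_set_mult[OF sZ Y(1) normalizes_mono[OF Y(3) ZN]] .
      have PJ: "?P \<subseteq> J \<inter> N" using set_mult_least[OF JN, of ?Z ?Y] YJ Y(2) J(2) by auto
      have nP: "normalizes G N ?P"
        using normalizes_set_mult[OF subgroup.subset[OF sN] subgroup.subset[OF sZ] nNZ subgroup.subset[OF Y(1)] Y(3)] .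
      \<comment> \<open>\<open>?B\<close> measures how far the conjugate \<open>?Y\<close> leaves
        \<open>?Z\<close>. Its order divides \<open>d\<close>, so it is an
        \<open>N\<close>-invariant \<open>T\<close>-subgroup and hence trivial; the direct
        decomposition of \<open>N\<close> then puts \<open>?Y\<close> into
        \<open>?Z\<close>.\<close>
      let ?B = "?P \<inter> ?C"
      have B: "subgroup ?B G" "normalizes G N ?B" "?B \<subseteq> N"
        using P sC subgroups_Inter_pair normalizes_Int[OF nP nC] by (auto simp: centralizer_def)
      have "?Z \<inter> ?B = {\<one>}" using dec(1) subgroup.one_closed[OF B(1)] subgroup.one_closed[OF sZ] by blast
      then have "card (?Z <#> ?B) = card ?Z * card ?B" using card_set_mult[OF sZ B(1)] by simp
      moreover have "?Z <#> ?B \<subseteq> J \<inter> N" using set_mult_least[OF JN, of ?Z ?B] PJ J(2) by auto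
      moreover have "subgroup (?Z <#> ?B) G" using subgroup_set_mult[OF sZ B(1) normalizes_mono[OF B(2) ZN]] .
      ultimately have "card ?Z * card ?B dvd card ?Z * d" using card_subgroup_dvd[OF _ JN] J(5) by metis
      then have Bd: "card ?B dvd d" using card_subgroup_pos[OF sZ] by simp
      have "d > 0" using card_subgroup_pos[OF JN] J(5) by (metis mult_0_right not_gr0)
      then have "part T (card ?B) = card ?B" using part_self_dvd[OF J(6) Bd] by blast
      then have B1: "?B = {\<one>}" using minimal_normal_no_part[OF N np[OF T] B(1,3,2)] by blast
      show "?Y \<subseteq> ?Z"
      proof
        fix y assume y: "y \<in> ?Y"
        then have yP: "y \<in> ?P" using set_mult_subset(2)[OF sZ Y(1)] by blast
        have "y \<in> ?Z <#> ?C" using y Y(2) dec(2) by blast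
        then obtain z c where zc: "z \<in> ?Z" "c \<in> ?C" "y = z \<otimes> c" unfolding set_mult_def by blast
        have c1: "z \<in> carrier G" "c \<in> carrier G" using zc subgroup.mem_carrier[OF sZ] subgroup.mem_carrier[OF sC] by auto
        have "z \<in> ?P" using zc(1) set_mult_subset(1)[OF sZ Y(1)] by blast
        then have "inv z \<otimes> y \<in> ?P" using yP subgroup.m_closed[OF P subgroup.m_inv_closed[OF P]] by blast
        then have "c \<in> ?B" using zc c1 by simp
        then have "c = \<one>" using B1 by blast
        then show "y \<in> ?Z" using zc c1 by simp
      qed
    qed
  qed
  let ?M = "normalizer_in G (carrier G) ?Z"
  have sM: "subgroup ?M G" using normalizer_in_subgroup[OF subgroup_self sZ] .
  have "card ?M = order G"
  proof (rule sigma_eqI[OF card_subgroup_pos[OF sM] order_pos])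
    fix T assume T: "T \<in> \<sigma>"
    note C = hall_conjugate[OF K(1) T one_closed]
    have "conjugate G (K T) \<one> \<subseteq> ?M"
      using nZ[OF T one_closed] subgroup.subset[OF C(1)] by (simp add: subset_normalizer_in)
    then show "part T (card ?M) = part T (order G)"
      using part_eq_superset[OF C(1) sM, of T] C(2) by simp
  qed
  then have "?M = carrier G"
    using subgroup.subset[OF sM] by (intro card_subset_eq) (auto simp: order_def)
  then have "normalizes G (carrier G) ?Z" using subset_normalizer_in[of "carrier G"] by blast
  then have "?Z \<lhd> G" using sZ normal_iff_normalizes by blast
  then have "?Z = {\<one>} \<or> ?Z = N" using N ZN unfolding minimal_normal_def by blast
  \<comment> \<open>\<open>?Z = N\<close> is excluded because \<open>A\<close> misses some of the
    \<open>S\<close>-part of \<open>N\<close>. With trivial intersection, \<open>A\<close> and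
    \<open>N\<close> normalize each other and therefore commute.\<close>
  then have Z1: "A \<inter> N = {\<one>}" using sA(4) by metis
  have "a \<otimes> n = n \<otimes> a" if "a \<in> A" "n \<in> N" for a n
    using commute_if_trivial_Int[OF sA(1) sN normal_normalizes[OF nN(1) subgroup.subset[OF sA(1)]] nNA Z1 that] .
  then show ?thesis using sA(2) subgroup.mem_carrier[OF sE] by (auto simp: centralizer_def)
qed simp

end

context fin_group
begin

section \<open>Groups of prime order, and Sylow subgroups with trivial intersection\<close>

lemma prime_order_commute:
  assumes Q: "subgroup Q G" "card Q = q" "prime q" and xy: "x \<in> Q" "y \<in> Q"
  shows "x \<otimes> y = y \<otimes> x"
proof (cases "x = \<one>")
  case True
  then show ?thesis using subgroup.mem_carrier[OF Q(1) xy(2)] by simp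
next
  case False
  have xc: "x \<in> carrier G" using subgroup.mem_carrier[OF Q(1) xy(1)] .
  have "Q \<subseteq> centralizer G Q {x}"
    by (rule prime_order_generator[OF Q centralizer_subgroup[OF Q(1)] _ xy(1) False])
      (use xc xy in \<open>auto simp: centralizer_def\<close>)
  then have "y \<otimes> x = x \<otimes> y" using xy(2) by (auto simp: centralizer_def)
  then show ?thesis by simp
qed

text \<open>For \<open>r\<close> other than \<open>q\<close>, a Sylow \<open>r\<close>-subgroup of
  the normalizer acts on the \<open>q - 1\<close> nontrivial elements of \<open>Q\<close>; since
  \<open>r\<close> does not divide \<open>q - 1\<close> it fixes one of them, hence centralizes
  \<open>Q\<close>. At \<open>q\<close> itself \<open>Q\<close> already has full order. So the
  centralizer exhausts the normalizer.\<close>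

lemma normalizer_centralizes_prime_order:
  assumes L: "subgroup L G" and Q: "subgroup Q G" "Q \<subseteq> L" "card Q = q" "prime q"
    and q2: "\<not> q\<^sup>2 dvd card L"
    and r: "\<And>r. prime r \<Longrightarrow> r dvd card (normalizer_in G L Q) \<Longrightarrow> r \<noteq> q \<Longrightarrow> \<not> r dvd q - 1"
    and g: "g \<in> normalizer_in G L Q" and x: "x \<in> Q"
  shows "g \<otimes> x = x \<otimes> g"
proof -
  let ?M = "normalizer_in G L Q"
  have sM: "subgroup ?M G" using normalizer_in_subgroup[OF L Q(1)] .
  let ?Z = "centralizer G ?M Q"
  have sZ: "subgroup ?Z G" using centralizer_subgroup[OF sM subgroup.subset[OF Q(1)]] .
  have QZ: "Q \<subseteq> ?Z"
    using normalizer_in_self[OF Q(1,2)] prime_order_commute[OF Q(1,3,4)] by (auto simp: centralizer_def)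
  have "card ?M dvd card ?Z"
  proof (rule multiplicity_le_imp_dvd)
    fix p :: nat assume p: "prime p"
    let ?m = "multiplicity p (card ?M)"
    obtain R where R: "subgroup R G" "R \<subseteq> ?M" "card R = p ^ ?m"
      using sylow_exists[OF sM p multiplicity_dvd] .
    have "p ^ ?m dvd card ?Z"
    proof (cases "p = q")
      case True
      have "?m \<le> 1"
      proof (rule ccontr)
        assume "\<not> ?m \<le> 1"
        then have "p ^ 2 dvd card ?M" by (intro multiplicity_dvd') auto
        moreover have "?M \<subseteq> L" by (auto simp: normalizer_in_def)
        ultimately show False using q2 True card_subgroup_dvd[OF sM L] dvd_trans by blast
      qed
      then have "p ^ ?m dvd q" using True le_imp_power_dvd[of ?m 1 p] by simp
      moreover have "q dvd card ?Z" using card_subgroup_dvd[OF Q(1) sZ QZ] Q(3) by simp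
      ultimately show ?thesis by (rule dvd_trans)
    next
      case False
      show ?thesis
      proof (cases "p dvd card ?M")
        case False
        then show ?thesis by (simp add: not_dvd_imp_multiplicity_0)
      next
        case True
        have nd: "\<not> p dvd q - 1" using r[OF p True False] .
        have RQ: "normalizes G R Q" using R(2) by (simp add: subset_normalizer_in)
        note cR = subgroup.mem_carrier[OF R(1)] and cQ = subgroup.mem_carrier[OF Q(1)]
        let ?X = "Q - {\<one>}"
        let ?F = "{u \<in> ?X. \<forall>g\<in>R. g \<otimes> u \<otimes> inv g = u}"
        have "p dvd card ?X \<longleftrightarrow> p dvd card ?F"
        proof (rule p_group_fixed_points[OF R(1,3) p])
          show "finite ?X" using finite_subgroup[OF Q(1)] by simp
          fix a u assume a: "a \<in> R" and u: "u \<in> ?X"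
          have "a \<otimes> u \<otimes> inv a \<noteq> \<one>"
          proof
            assume "a \<otimes> u \<otimes> inv a = \<one>"
            then have "inv a \<otimes> (a \<otimes> u \<otimes> inv a) \<otimes> a = \<one>" using cR[OF a] by simp
            then show False using u cR[OF a] cQ by (simp add: m_assoc)
          qed
          then show "a \<otimes> u \<otimes> inv a \<in> ?X" using normalizesD[OF RQ a] u by simp
        qed (use cR cQ in \<open>auto simp: m_assoc inv_mult_group\<close>)
        moreover have "card ?X = q - 1" using Q(3) subgroup.one_closed[OF Q(1)] finite_subgroup[OF Q(1)] by simp
        ultimately have "?F \<noteq> {}" using nd by (metis card.empty dvd_0_right)
        then obtain u where u: "u \<in> Q" "u \<noteq> \<one>" "\<forall>g\<in>R. g \<otimes> u \<otimes> inv g = u" by auto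
        have "g \<otimes> u = u \<otimes> g" if g: "g \<in> R" for g
        proof -
          have "g \<otimes> u = (g \<otimes> u \<otimes> inv g) \<otimes> g" using cR[OF g] cQ[OF u(1)] by (simp add: m_assoc)
          then show ?thesis using u(3) g by simp
        qed
        then have "u \<in> centralizer G Q R" using u(1) by (auto simp: centralizer_def)
        then have "Q \<subseteq> centralizer G Q R"
          using prime_order_generator[OF Q(1,3,4) centralizer_subgroup[OF Q(1) subgroup.subset[OF R(1)]]] u by blast
        then have "R \<subseteq> ?Z" using R(2) by (force simp: centralizer_def)
        then show ?thesis using card_subgroup_dvd[OF R(1) sZ] R(3) by simp
      qed
    qed
    then show "?m \<le> multiplicity p (card ?Z)"
      using p card_subgroup_pos[OF sZ] by (intro multiplicity_geI) auto
  qed (use card_subgroup_pos[OF sZ] card_subgroup_pos[OF sM] in auto)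
  moreover have "?Z \<subseteq> ?M" by (auto simp: centralizer_def)
  ultimately have "?Z = ?M"
    using finite_subgroup[OF sM] dvd_imp_le[OF _ card_subgroup_pos[OF sZ]] by (intro card_seteq) auto
  then show ?thesis using g x by (auto simp: centralizer_def)
qed

lemma burnside_prime_complement_subgroup:
  assumes L: "subgroup L G" and Q: "subgroup Q G" "Q \<subseteq> L" "card Q = q" "prime q"
    and m: "card L = q * m" "\<not> q dvd m"
    and cent: "\<And>g x. g \<in> normalizer_in G L Q \<Longrightarrow> x \<in> Q \<Longrightarrow> g \<otimes> x = x \<otimes> g"
  shows "subgroup {x \<in> L. x [^] m = \<one>} G" "card {x \<in> L. x [^] m = \<one>} = m"
proof -
  let ?L = "G\<lparr>carrier := L\<rparr>"
  interpret L: fin_group ?L using fin_group_subgroup[OF L] .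
  have Q': "subgroup Q ?L" using subgroup_incl[OF Q(1) L Q(2)] .
  have "normalizer_in ?L (carrier ?L) Q = normalizer_in G L Q"
    using m_inv_consistent[OF L] by (auto simp: normalizer_in_def)
  then have *: "\<And>g x. g \<in> normalizer_in ?L (carrier ?L) Q \<Longrightarrow> x \<in> Q \<Longrightarrow> g \<otimes>\<^bsub>?L\<^esub> x = x \<otimes>\<^bsub>?L\<^esub> g"
    using cent by simp
  have m': "order ?L = q * m" using m by (simp add: order_def)
  have eq: "{x \<in> carrier ?L. x [^]\<^bsub>?L\<^esub> m = \<one>\<^bsub>?L\<^esub>} = {x \<in> L. x [^] m = \<one>}"
    by (simp add: nat_pow_consistent[symmetric])
  note L.burnside_prime_complement[OF Q' Q(3,4) m' m(2) *]
  then show "subgroup {x \<in> L. x [^] m = \<one>} G" "card {x \<in> L. x [^] m = \<one>} = m"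
    using incl_subgroup[OF L] unfolding eq by auto
qed

lemma normalizes_pow_set:
  assumes L: "L \<subseteq> carrier G" and N: "N \<subseteq> carrier G" and n: "normalizes G L N"
  shows "normalizes G L {x \<in> N. x [^] (m::nat) = \<one>}"
  unfolding normalizes_def
proof (intro ballI)
  fix l u assume l: "l \<in> L" and u: "u \<in> {x \<in> N. x [^] m = \<one>}"
  have c: "l \<in> carrier G" "u \<in> carrier G" using l u L N by auto
  have "(l \<otimes> u \<otimes> inv l) [^] k = l \<otimes> u [^] k \<otimes> inv l" for k :: nat
    by (induction k) (use c in \<open>simp_all add: m_assoc\<close>)
  then show "l \<otimes> u \<otimes> inv l \<in> {x \<in> N. x [^] m = \<one>}" using normalizesD[OF n l] u c by simp
qed

text \<open>Two Sylow subgroups are chosen with nontrivial intersection \<open>?D\<close> of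
  greatest order. The normalizer of \<open>?D\<close> is a \<open>p\<close>-group and lies in a
  third Sylow subgroup \<open>?R\<close>; normalizers grow, so both meet \<open>?R\<close> in more
  than \<open>?D\<close> and must equal it.\<close>

lemma sylow_trivial_Int:
  assumes N: "subgroup N G" and p: "prime p"
    and norm: "\<And>X k. subgroup X G \<Longrightarrow> X \<subseteq> N \<Longrightarrow> card X = p ^ k \<Longrightarrow> k > 0 \<Longrightarrow>
      \<exists>j. card (normalizer_in G N X) = p ^ j"
    and P: "subgroup P G" "P \<subseteq> N" "card P = p ^ multiplicity p (card N)"
    and Q: "subgroup Q G" "Q \<subseteq> N" "card Q = p ^ multiplicity p (card N)" and ne: "P \<noteq> Q"
  shows "P \<inter> Q = {\<one>}"
proof (rule ccontr)
  assume nt: "P \<inter> Q \<noteq> {\<one>}"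
  let ?m = "multiplicity p (card N)"
  define Y where "Y = {X. subgroup X G \<and> X \<subseteq> N \<and> card X = p ^ ?m}"
  define W where "W = {(A,B). A \<in> Y \<and> B \<in> Y \<and> A \<noteq> B \<and> A \<inter> B \<noteq> {\<one>}}"
  let ?f = "\<lambda>(A,B). card (A \<inter> B)"
  have "(P,Q) \<in> W" using P Q ne nt by (simp add: W_def Y_def)
  moreover have "\<forall>w. w \<in> W \<longrightarrow> ?f w < Suc (card N)"
  proof (intro allI impI)
    fix w assume "w \<in> W"
    then obtain A B where "w = (A,B)" "A \<subseteq> N" by (auto simp: W_def Y_def)
    then show "?f w < Suc (card N)"
      using card_mono[OF finite_subgroup[OF N], of "A \<inter> B"] by (auto simp: less_Suc_eq_le)
  qed
  ultimately obtain w where w: "w \<in> W" "\<forall>v. v \<in> W \<longrightarrow> ?f v \<le> ?f w"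
    using ex_has_greatest_nat[of "\<lambda>w. w \<in> W" "(P,Q)" ?f "Suc (card N)"] by blast
  obtain A B where AB: "w = (A,B)" "A \<in> Y" "B \<in> Y" "A \<noteq> B" "A \<inter> B \<noteq> {\<one>}"
    using w(1) by (auto simp: W_def)
  have sA: "subgroup A G" "A \<subseteq> N" "card A = p ^ ?m" and sB: "subgroup B G" "B \<subseteq> N" "card B = p ^ ?m"
    using AB by (auto simp: Y_def)
  let ?D = "A \<inter> B"
  have D: "subgroup ?D G" "?D \<subseteq> N" using sA sB subgroups_Inter_pair by auto
  have "card ?D dvd p ^ ?m" using card_subgroup_dvd[OF D(1) sA(1)] sA(3) by simp
  then obtain k where k: "card ?D = p ^ k" using p by (auto simp: divides_primepow_nat)
  have "k \<noteq> 0"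
  proof
    assume "k = 0"
    then have "card ?D = 1" using k by simp
    then show False using AB(5) subgroup.one_closed[OF D(1)] by (metis card_1_singletonE singletonD)
  qed
  then obtain j where j: "card (normalizer_in G N ?D) = p ^ j" using norm[OF D k] by blast
  let ?M = "normalizer_in G N ?D"
  have sM: "subgroup ?M G" using normalizer_in_subgroup[OF N D(1)] .
  have MN: "?M \<subseteq> N" by (auto simp: normalizer_in_def)
  have "\<not> p dvd card N div card A"
    using sA(3) multiplicity_decompose[of "card N" p] card_subgroup_pos[OF N] p
    by (metis not_prime_unit not_gr0)
  then obtain l where l: "l \<in> N" "\<And>g. g \<in> ?M \<Longrightarrow> inv l \<otimes> g \<otimes> l \<in> A"
    using sylow_conjugate[OF sM MN j p sA(1) N sA(2)] by blast
  have lc: "l \<in> carrier G" using subgroup.mem_carrier[OF N l(1)] .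
  let ?R = "conjugate G A (inv l)"
  have RY: "?R \<in> Y"
  proof -
    have "?R \<subseteq> N"
    proof
      fix y assume "y \<in> ?R"
      then obtain a where a: "a \<in> A" "y = l \<otimes> a \<otimes> inv l" using lc by (auto simp: conjugate_def)
      then show "y \<in> N" using l sA(2) N subgroup.m_closed subgroup.m_inv_closed by (metis subsetD)
    qed
    then show ?thesis using conjugate_subgroup[OF sA(1)] card_conjugate[OF subgroup.subset[OF sA(1)]] lc sA(3)
      by (simp add: Y_def)
  qed
  have MR: "?M \<subseteq> ?R"
  proof
    fix g assume g: "g \<in> ?M"
    have gc: "g \<in> carrier G" using subgroup.mem_carrier[OF sM g] .
    have "g = inv (inv l) \<otimes> (inv l \<otimes> g \<otimes> l) \<otimes> inv l" using gc lc by (simp add: m_assoc)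
    then show "g \<in> ?R" using l(2)[OF g] unfolding conjugate_def by blast
  qed
  \<comment> \<open>If \<open>X\<close> differed from \<open>?R\<close>, an element of
    \<open>X\<close> outside \<open>?D\<close> normalizing \<open>?D\<close> would lie in
    \<open>?R\<close> and enlarge the intersection beyond the maximum.\<close>
  have eq: "X = ?R" if X: "X \<in> Y" "?D \<subset> X" for X
  proof (rule ccontr)
    assume ne: "X \<noteq> ?R"
    have sX: "subgroup X G" "X \<subseteq> N" "card X = p ^ ?m" using X by (auto simp: Y_def)
    obtain x where x: "x \<in> normalizer_in G X ?D" "x \<notin> ?D"
      using normalizer_grows[OF sX(1,3) p D(1) X(2)] by blast
    have xX: "x \<in> X" "x \<in> ?M" using x(1) sX(2) by (auto simp: normalizer_in_def)
    have "?D \<subseteq> ?R" using normalizer_in_self[OF D] MR by blast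
    then have sub: "?D \<subset> X \<inter> ?R" using X(2) xX x(2) MR by blast
    have fin: "finite (X \<inter> ?R)" using finite_subgroup[OF sX(1)] by simp
    have "card ?D < card (X \<inter> ?R)" using psubset_card_mono[OF fin sub] .
    moreover have "X \<inter> ?R \<noteq> {\<one>}"
    proof
      assume e: "X \<inter> ?R = {\<one>}"
      have "?D \<subset> {\<one>}" using sub unfolding e .
      then have "?D = {}" by auto
      then show False using subgroup.one_closed[OF D(1)] by simp
    qed
    then have "(X, ?R) \<in> W" using X RY ne by (simp add: W_def)
    then have "card (X \<inter> ?R) \<le> card ?D" using w(2) AB(1) by auto
    ultimately show False by simp
  qed
  have "?D \<noteq> A"
  proof
    assume "?D = A"
    then have "A \<subseteq> B" by blast
    then have "A = B" using sA(3) sB(3) finite_subgroup[OF sB(1)] by (intro card_subset_eq) auto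
    then show False using AB(4) by simp
  qed
  moreover have "?D \<noteq> B"
  proof
    assume "?D = B"
    then have "B \<subseteq> A" by blast
    then have "B = A" using sA(3) sB(3) finite_subgroup[OF sA(1)] by (intro card_subset_eq) auto
    then show False using AB(4) by simp
  qed
  ultimately have "A = ?R" "B = ?R" using eq[OF AB(2)] eq[OF AB(3)] by blast+
  then show False using AB(4) by simp
qed

text \<open>A Sylow subgroup equals its normalizer, which is a \<open>p\<close>-group containing it.
  So the number of its conjugates is its index, and by trivial intersections they overlap only in
  the identity.\<close>

lemma half_of_elements_in_sylow:
  assumes N: "subgroup N G" and p: "prime p" "p dvd card N"
    and norm: "\<And>X k. subgroup X G \<Longrightarrow> X \<subseteq> N \<Longrightarrow> card X = p ^ k \<Longrightarrow> k > 0 \<Longrightarrow>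
      \<exists>j. card (normalizer_in G N X) = p ^ j"
  shows "card N \<le> 2 * card {x \<in> N. x \<noteq> \<one> \<and> x [^] (p ^ multiplicity p (card N)) = \<one>}"
proof -
  let ?m = "multiplicity p (card N)"
  note cN = subgroup.mem_carrier[OF N]
  obtain P where P: "subgroup P G" "P \<subseteq> N" "card P = p ^ ?m"
    using sylow_exists[OF N p(1) multiplicity_dvd] .
  have m: "?m > 0" using p card_subgroup_pos[OF N] by (simp add: prime_multiplicity_gt_zero_iff)
  let ?NP = "normalizer_in G N P"
  have sNP: "subgroup ?NP G" using normalizer_in_subgroup[OF N P(1)] .
  obtain j where j: "card ?NP = p ^ j" using norm[OF P m] by blast
  have "p ^ j dvd card N" using card_subgroup_dvd[OF sNP N] j by (auto simp: normalizer_in_def)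
  then have "j \<le> ?m" using p card_subgroup_pos[OF N] by (intro multiplicity_geI) auto
  then have NPP: "?NP = P"
    using normalizer_in_self[OF P(1,2)] P(3) j finite_subgroup[OF sNP] prime_gt_1_nat[OF p(1)]
    by (intro card_seteq[symmetric]) auto
  define Y where "Y = (\<lambda>x. conjugate G P x) ` N"
  have fibre: "card {x \<in> N. conjugate G P x = C} = card P" if CY: "C \<in> Y" for C
  proof -
    obtain a where a: "a \<in> N" "C = conjugate G P a" using CY by (auto simp: Y_def)
    have "{x \<in> N. conjugate G P x = C} = (\<lambda>u. u \<otimes> a) ` P"
    proof (intro equalityI subsetI)
      fix x assume "x \<in> {x \<in> N. conjugate G P x = C}"
      then have x: "x \<in> N" "conjugate G P x = conjugate G P a" using a by auto
      have c: "x \<in> carrier G" "a \<in> carrier G" using x a cN by auto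
      have "(x \<otimes> inv a) \<otimes> u \<otimes> inv (x \<otimes> inv a) \<in> P" if u: "u \<in> P" for u
      proof -
        have uc: "u \<in> carrier G" using subgroup.mem_carrier[OF P(1) u] .
        have "inv a \<otimes> u \<otimes> a \<in> conjugate G P x" using u x by (auto simp: conjugate_def)
        then obtain v where v: "v \<in> P" "inv a \<otimes> u \<otimes> a = inv x \<otimes> v \<otimes> x" by (auto simp: conjugate_def)
        have "(x \<otimes> inv a) \<otimes> u \<otimes> inv (x \<otimes> inv a) = x \<otimes> (inv a \<otimes> u \<otimes> a) \<otimes> inv x"
          using c uc by (simp add: inv_mult_group m_assoc)
        also have "\<dots> = v" unfolding v(2) using c subgroup.mem_carrier[OF P(1) v(1)] by (simp add: m_assoc)
        finally show ?thesis using v by simp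
      qed
      moreover have "x \<otimes> inv a \<in> N" using subgroup.m_closed[OF N x(1) subgroup.m_inv_closed[OF N a(1)]] .
      ultimately have "x \<otimes> inv a \<in> P" using NPP by (auto simp: normalizer_in_def)
      moreover have "x = (x \<otimes> inv a) \<otimes> a" using c by (simp add: m_assoc)
      ultimately show "x \<in> (\<lambda>u. u \<otimes> a) ` P" by blast
    next
      fix x assume "x \<in> (\<lambda>u. u \<otimes> a) ` P"
      then obtain u where u: "u \<in> P" "x = u \<otimes> a" by auto
      have c: "u \<in> carrier G" "a \<in> carrier G" using subgroup.mem_carrier[OF P(1) u(1)] cN[OF a(1)] by auto
      have "conjugate G P u = P"
      proof (rule card_subset_eq[OF finite_subgroup[OF P(1)]])
        show "conjugate G P u \<subseteq> P"
          using subgroup.m_closed[OF P(1)] subgroup.m_inv_closed[OF P(1)] u(1) by (auto simp: conjugate_def)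
        show "card (conjugate G P u) = card P" using card_conjugate[OF subgroup.subset[OF P(1)] c(1)] .
      qed
      then have "conjugate G P x = C"
        using conjugate_conjugate[OF subgroup.subset[OF P(1)] c] u(2) a(2) by simp
      moreover have "x \<in> N" using u P(2) subgroup.m_closed[OF N _ a(1)] by auto
      ultimately show "x \<in> {x \<in> N. conjugate G P x = C}" by simp
    qed
    moreover have "inj_on (\<lambda>u. u \<otimes> a) P"
      using subgroup.mem_carrier[OF P(1)] cN[OF a(1)] by (intro inj_onI) simp
    ultimately show ?thesis by (simp add: card_image)
  qed
  have cNY: "card N = card Y * card P"
    unfolding Y_def by (rule fibre_card[OF finite_subgroup[OF N]]) (use fibre in \<open>simp add: Y_def\<close>)
  have finY: "finite Y" using finite_subgroup[OF N] by (simp add: Y_def)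
  have Y: "subgroup C G" "C \<subseteq> N" "card C = p ^ ?m" if CY: "C \<in> Y" for C
  proof -
    obtain a where a: "a \<in> N" "C = conjugate G P a" using CY by (auto simp: Y_def)
    show "subgroup C G" "card C = p ^ ?m"
      using a conjugate_subgroup[OF P(1)] card_conjugate[OF subgroup.subset[OF P(1)]] cN P(3) by auto
    show "C \<subseteq> N"
    proof
      fix y assume "y \<in> C"
      then obtain u where u: "u \<in> P" "y = inv a \<otimes> u \<otimes> a" using a(2) by (auto simp: conjugate_def)
      have "u \<in> N" using u P(2) by auto
      then show "y \<in> N"
        using u(2) subgroup.m_closed[OF N subgroup.m_closed[OF N subgroup.m_inv_closed[OF N a(1)]] a(1)] by simp
    qed
  qed
  have "card (\<Union>C\<in>Y. C - {\<one>}) = (\<Sum>C\<in>Y. card (C - {\<one>}))"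
  proof (rule card_UN_disjoint[OF finY])
    show "\<forall>C\<in>Y. finite (C - {\<one>})" using Y(1) finite_subgroup by blast
    show "\<forall>C\<in>Y. \<forall>D\<in>Y. C \<noteq> D \<longrightarrow> (C - {\<one>}) \<inter> (D - {\<one>}) = {}"
    proof (intro ballI impI)
      fix C D assume C: "C \<in> Y" and D: "D \<in> Y" and ne: "C \<noteq> D"
      have "C \<inter> D = {\<one>}"
        by (rule sylow_trivial_Int[OF N p(1) _ Y(1-3)[OF C] Y(1-3)[OF D] ne]) (rule norm; assumption)
      then show "(C - {\<one>}) \<inter> (D - {\<one>}) = {}" by blast
    qed
  qed
  also have "\<dots> = (\<Sum>C\<in>Y. p ^ ?m - 1)"
    by (rule sum.cong) (use Y(3) finite_subgroup[OF Y(1)] subgroup.one_closed[OF Y(1)] in auto)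
  also have "\<dots> = card Y * (p ^ ?m - 1)" by simp
  finally have U: "card (\<Union>C\<in>Y. C - {\<one>}) = card Y * (p ^ ?m - 1)" .
  \<comment> \<open>Removing the identity costs each Sylow subgroup at most half of its
    elements.\<close>
  have "p ^ ?m \<ge> 2" using self_le_power[of p ?m] m prime_ge_2_nat[OF p(1)] by linarith
  then have "p ^ ?m \<le> 2 * (p ^ ?m - 1)" by linarith
  then have "card Y * p ^ ?m \<le> card Y * (2 * (p ^ ?m - 1))" by (rule mult_le_mono2)
  moreover have "card N = card Y * p ^ ?m" using cNY P(3) by presburger
  ultimately have "card N \<le> card Y * (2 * (p ^ ?m - 1))" by linarith
  then have "card N \<le> 2 * card (\<Union>C\<in>Y. C - {\<one>})" unfolding U by (simp only: ac_simps)
  also have "\<dots> \<le> 2 * card {x \<in> N. x \<noteq> \<one> \<and> x [^] (p ^ ?m) = \<one>}"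
  proof (rule mult_le_mono2, rule card_mono)
    show "finite {x \<in> N. x \<noteq> \<one> \<and> x [^] (p ^ ?m) = \<one>}" using finite_subgroup[OF N] by simp
    show "(\<Union>C\<in>Y. C - {\<one>}) \<subseteq> {x \<in> N. x \<noteq> \<one> \<and> x [^] (p ^ ?m) = \<one>}"
    proof
      fix x assume "x \<in> (\<Union>C\<in>Y. C - {\<one>})"
      then obtain C where C: "C \<in> Y" "x \<in> C" "x \<noteq> \<one>" by auto
      have "x [^] (p ^ ?m) = \<one>" using pow_card_eq_one[OF Y(1)[OF C(1)] C(2)] Y(3)[OF C(1)] by simp
      then show "x \<in> {x \<in> N. x \<noteq> \<one> \<and> x [^] (p ^ ?m) = \<one>}" using C Y(2)[OF C(1)] by auto
    qed
  qed
  finally show ?thesis .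
qed

end

context sigma_group
begin

text \<open>
  In a counterexample, different primes dividing \<open>|N|\<close> lie in different classes.  By
  \<open>no_normalize\<close>, elements of order \<open>p\<close> with \<open>p\<^sup>2\<close> dividing \<open>|N|\<close> normalize no nontrivial
  \<open>q\<close>-subgroup of \<open>N\<close> for \<open>q \<noteq> p\<close>.  Burnside's transfer then excludes the smallest prime that
  divides \<open>|N|\<close> exactly once.  Hence distinct Sylow subgroups intersect trivially and are
  self-normalizing, so for every prime \<open>p\<close> dividing \<open>|N|\<close> at least half of the elements of \<open>N\<close>
  are nontrivial \<open>p\<close>-elements, which is impossible for two primes.
\<close>

theorem minimal_normal_sigma_primary:
  assumes w: "weak_embed_cond" and N: "minimal_normal N"
  shows "\<exists>S\<in>\<sigma>. part S (card N) = card N"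
proof (rule ccontr)
  assume "\<not> ?thesis"
  then have np: "\<And>S. S \<in> \<sigma> \<Longrightarrow> part S (card N) \<noteq> card N" by blast
  have nN: "N \<lhd> G" "N \<noteq> {\<one>}" using N by (simp_all add: minimal_normal_def)
  have sN: "subgroup N G" using nN normal_imp_subgroup by blast
  note cN = subgroup.mem_carrier[OF sN] and Npos = card_subgroup_pos[OF sN] and NG = subgroup.subset[OF sN]
  have noab: "U = {\<one>}" if "subgroup U G" "U \<subseteq> N" "normalizes G N U" "\<And>x y. x \<in> U \<Longrightarrow> y \<in> U \<Longrightarrow> x \<otimes> y = y \<otimes> x" for U
    using minimal_normal_no_abelian[OF N np that] .
  let ?C = "centralizer G (carrier G) N"
  have sC: "subgroup ?C G" using centralizer_subgroup[OF subgroup_self NG] .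
  have nC: "normalizes G (carrier G) ?C"
    using centralizer_normalized[OF subgroup_self NG normal_normalizes[OF nN(1) order_refl]] .
  have CN: "?C \<inter> N = {\<one>}"
  proof (rule noab)
    show "subgroup (?C \<inter> N) G" using sC sN subgroups_Inter_pair by blast
    show "normalizes G N (?C \<inter> N)" using normalizes_Int[OF normalizes_mono[OF nC NG] normalizes_self[OF sN]] .
    fix x y assume "x \<in> ?C \<inter> N" "y \<in> ?C \<inter> N"
    then show "x \<otimes> y = y \<otimes> x" unfolding centralizer_def by blast
  qed blast
  have CNdvd: "card ?C * card N dvd order G"
  proof -
    have "subgroup (?C <#> N) G"
      using subgroup_set_mult[OF sC sN normal_normalizes[OF nN(1) subgroup.subset[OF sC]]] .
    then show ?thesis using card_subgroup_dvd_order card_set_mult[OF sC sN] CN by fastforce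
  qed
  note kegel = perm_contains_or_centralizes[OF _ N np]
  \<comment> \<open>The subgroup \<open>E\<close> has only the prime \<open>p\<close> in its
    \<open>S\<close>-part. If it contains \<open>N\<close>, this limits the \<open>S\<close>-part of
    \<open>N\<close>. If it centralizes \<open>N\<close>, the centralizer has the full
    \<open>p\<close>-part of the order of \<open>G\<close>, and \<open>CNdvd\<close> leaves no
    factor \<open>p\<close> for \<open>N\<close>.\<close>
  have part1: "part S (card N) = part {p} (card N)" if S: "S \<in> \<sigma>" "p \<in> S" and pN: "p dvd card N" for S p
  proof -
    have p: "prime p" using sigma_prime S by blast
    have Sp: "{p} \<inter> S = {p}" using S by auto
    obtain E where E: "perm E" "part S (card E) = part {p} (order G)" using weak_embed_condD1[OF w S] by blast
    have sE: "subgroup E G" using E by (simp add: perm_def)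
    from kegel[OF E(1)] show ?thesis
    proof
      assume "N \<subseteq> E"
      then have "part S (card N) dvd part {p} (order G)"
        using part_dvd_mono[OF card_subgroup_dvd[OF sN sE] card_subgroup_pos[OF sE], of S] E(2) by simp
      then have "part {p} (part S (card N)) = part S (card N)"
        by (rule part_self_dvd[rotated]) auto
      then show ?thesis by (simp add: Sp)
    next
      assume EC: "E \<subseteq> ?C"
      have "part {p} (order G) = part {p} (card E)" using arg_cong[OF E(2), of "part {p}"] by (simp add: Sp)
      also have "\<dots> dvd part {p} (card ?C)"
        using part_dvd_mono[OF card_subgroup_dvd[OF sE sC EC] card_subgroup_pos[OF sC]] .
      finally have 1: "part {p} (order G) dvd part {p} (card ?C)" .
      have "part {p} (card ?C) * part {p} (card N) dvd part {p} (order G)"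
        using part_dvd_mono[OF CNdvd order_pos, of "{p}"] part_mult[OF card_subgroup_pos[OF sC] Npos] by simp
      then have "part {p} (card ?C) * part {p} (card N) dvd part {p} (card ?C) * 1" using 1 dvd_trans by fastforce
      then have "part {p} (card N) = 1"
        using dvd_times_left_cancel_iff[of "part {p} (card ?C)" "part {p} (card N)" 1] by simp
      then have "\<not> p dvd card N" using part_neq_1_iff[OF Npos, of "{p}"] p by auto
      then show ?thesis using pN by simp
    qed
  qed
  have no_normalize: "\<not> p dvd card (normalizer_in G N X)"
    if p: "prime p" "p\<^sup>2 dvd card N" and q: "prime q" "q dvd card N" "p \<noteq> q"
      and X: "subgroup X G" "X \<subseteq> N" "card X = q ^ k" "k > 0" for p q X k
  proof
    assume dvd: "p dvd card (normalizer_in G N X)"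
    have pN: "p dvd card N" using p(2) by (metis dvd_mult_left power2_eq_square)
    obtain S T where ST: "S \<in> \<sigma>" "p \<in> S" "T \<in> \<sigma>" "q \<in> T" using sigma_cover p q by meson
    have "S \<noteq> T"
    proof
      assume "S = T"
      then have "part {p} (card N) = part {q} (card N)" using part1 ST pN q by metis
      then have "part {p} (part {p} (card N)) = part {p} (part {q} (card N))" by simp
      moreover have "part {} (card N) = 1" by (simp add: part_def)
      ultimately have "part {p} (card N) = 1" using q(3) by simp
      then show False using part_neq_1_iff[OF Npos, of "{p}"] p pN by auto
    qed
    \<comment> \<open>Multiplying \<open>X\<close> by a Sylow \<open>q\<close>-subgroup of the
      centralizer makes the \<open>q\<close>-part of \<open>?V\<close> exceed that of the
      centralizer, so the subgroup \<open>E\<close> obtained for \<open>?V\<close> cannot centralize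
      \<open>N\<close>. It cannot contain \<open>N\<close> either, as its \<open>S\<close>-part
      divides \<open>p\<close>.\<close>
    let ?m = "multiplicity q (card ?C)"
    obtain Q where Q: "subgroup Q G" "Q \<subseteq> ?C" "card Q = q ^ ?m"
      using sylow_exists[OF sC q(1) multiplicity_dvd] .
    have comm: "n \<otimes> u = u \<otimes> n" if "n \<in> N" "u \<in> Q" for n u
      using that Q(2) by (force simp: centralizer_def)
    have conjQ: "n \<otimes> u \<otimes> inv n = u" if "n \<in> N" "u \<in> Q" for n u
      using comm[OF that] cN[OF that(1)] subgroup.mem_carrier[OF Q(1) that(2)] by (simp add: m_assoc)
    have nQ: "normalizes G N Q" using conjQ by (simp add: normalizes_def)
    let ?V = "X <#> Q"
    have V: "subgroup ?V G" using subgroup_set_mult[OF X(1) Q(1) normalizes_mono[OF nQ X(2)]] .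
    have XQ: "X \<inter> Q = {\<one>}" using CN X(2) Q(2) subgroup.one_closed[OF X(1)] subgroup.one_closed[OF Q(1)] by blast
    then have cV: "card ?V = q ^ (k + ?m)"
      using card_set_mult[OF X(1) Q(1)] X(3) Q(3) by (simp add: power_add)
    let ?M = "normalizer_in G N X"
    have sM: "subgroup ?M G" using normalizer_in_subgroup[OF sN X(1)] .
    have MN: "?M \<subseteq> N" by (auto simp: normalizer_in_def)
    have "normalizes G ?M ?V"
      using normalizes_set_mult[OF subgroup.subset[OF sM] subgroup.subset[OF X(1)] normalizer_in_normalizes
        subgroup.subset[OF Q(1)] normalizes_mono[OF nQ MN]] .
    then have "?M \<subseteq> normalizer_in G (carrier G) ?V"
      using subgroup.subset[OF sM] by (simp add: subset_normalizer_in)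
    then have "p dvd card (normalizer_in G (carrier G) ?V)"
      using dvd dvd_trans card_subgroup_dvd[OF sM normalizer_in_subgroup[OF subgroup_self V]] by blast
    then obtain E j where E: "perm E" "part S (card E) dvd p" "part T (card E) = q ^ j" "card ?V dvd q ^ j"
      using weak_embed_condD2[OF w V cV _ ST(1,3) \<open>S \<noteq> T\<close> ST(2,4)] X(4) by auto
    have sE: "subgroup E G" using E by (simp add: perm_def)
    from kegel[OF E(1)] show False
    proof
      assume "N \<subseteq> E"
      then have "part S (card N) dvd p"
        using part_dvd_mono[OF card_subgroup_dvd[OF sN sE] card_subgroup_pos[OF sE], of S] E(2) dvd_trans by blast
      moreover have "p\<^sup>2 dvd part S (card N)"
        using part_dvd_mono[OF p(2) Npos, of S] ST(2) p(1) by (simp add: part_prime_power)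
      ultimately have "p ^ 2 dvd p ^ 1" using dvd_trans by simp
      then show False using prime_gt_1_nat[OF p(1)] power_dvd_imp_le[of p 2 1] by simp
    next
      assume "E \<subseteq> ?C"
      then have "q ^ j dvd card ?C"
        using card_subgroup_dvd[OF sE sC] part_dvd[OF card_subgroup_pos[OF sE], of T] E(3) dvd_trans by metis
      then have "j \<le> ?m" using q card_subgroup_pos[OF sC] by (intro multiplicity_geI) auto
      moreover have "k + ?m \<le> j" using E(4) cV prime_gt_1_nat[OF q(1)] by (simp add: power_dvd_imp_le)
      ultimately show False using X(4) by simp
    qed
  qed
  \<comment> \<open>A prime dividing \<open>q - 1\<close> is smaller than \<open>q\<close>, so by
    induction its square divides \<open>card N\<close> and \<open>no_normalize\<close> keeps it out
    of the order of the normalizer of \<open>Q\<close>; this is what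
    \<open>normalizer_centralizes_prime_order\<close> asks for.\<close>
  have square: "q\<^sup>2 dvd card N" if q: "prime q" "q dvd card N" for q
    using q
  proof (induction q rule: less_induct)
    case (less q)
    show ?case
    proof (rule ccontr)
      assume q2: "\<not> q\<^sup>2 dvd card N"
      obtain Q where Q: "subgroup Q G" "Q \<subseteq> N" "card Q = q" using cauchy_exists[OF sN less.prems] .
      have r: "\<not> r dvd q - 1" if r: "prime r" "r dvd card (normalizer_in G N Q)" "r \<noteq> q" for r
      proof
        assume "r dvd q - 1"
        then have "r < q" using prime_gt_1_nat[OF less.prems(1)] by (auto dest!: dvd_imp_le)
        moreover have "r dvd card N"
          using r(2) card_subgroup_dvd[OF normalizer_in_subgroup[OF sN Q(1)] sN] dvd_trans
          by (auto simp: normalizer_in_def)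
        ultimately have "r\<^sup>2 dvd card N" using less.IH r(1) by blast
        then show False using no_normalize[OF r(1) _ less.prems r(3) Q(1,2), of 1] Q(3) r(2) by simp
      qed
      obtain m where m: "card N = q * m" using less.prems(2) by (auto elim: dvdE)
      have qm: "\<not> q dvd m" using q2 m by (auto simp: power2_eq_square)
      define T where "T = {x \<in> N. x [^] m = \<one>}"
      have T: "subgroup T G" "card T = m"
        using burnside_prime_complement_subgroup[OF sN Q less.prems(1) m qm
            normalizer_centralizes_prime_order[OF sN Q less.prems(1) q2 r]] by (auto simp: T_def)
      have TN: "T \<subseteq> N" by (auto simp: T_def)
      have nT: "normalizes G N T"
        unfolding T_def by (rule normalizes_pow_set[OF NG NG normalizes_self[OF sN]])
      \<comment> \<open>The normal complement \<open>T\<close> splits off a direct factor of order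
        \<open>q\<close>, a nontrivial \<open>N\<close>-invariant subgroup within one class.\<close>
      let ?Z = "centralizer G N T"
      have dec: "T \<inter> ?Z = {\<one>}" "T <#> ?Z = N"
        by (rule minimal_normal_decompose[OF N _ T(1) TN nT], (rule noab; assumption))+
      have sZ: "subgroup ?Z G" using centralizer_subgroup[OF sN subgroup.subset[OF T(1)]] .
      have "card N * card {\<one>} = m * card ?Z" using card_set_mult[OF T(1) sZ] unfolding dec T(2) .
      then have "m * q = m * card ?Z" using m by (simp add: mult.commute[of m q])
      moreover have "m \<noteq> 0" using m Npos by (intro notI) simp
      ultimately have cZ: "card ?Z = q" by simp
      obtain S where S: "S \<in> \<sigma>" "q \<in> S" using sigma_cover less.prems by blast
      have "?Z = {\<one>}"
        by (rule minimal_normal_no_part[OF N np[OF S(1)] sZ _ centralizer_normalized[OF sN subgroup.subset[OF T(1)] nT]])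
          (use S cZ less.prems in \<open>auto simp: centralizer_def part_prime\<close>)
      then show False using cZ prime_gt_1_nat[OF less.prems(1)] by simp
    qed
  qed
  have half: "card N \<le> 2 * card {x \<in> N. x \<noteq> \<one> \<and> x [^] (p ^ multiplicity p (card N)) = \<one>}"
    if p: "prime p" "p dvd card N" for p
  proof (rule half_of_elements_in_sylow[OF sN p])
    fix X k assume X: "subgroup X G" "X \<subseteq> N" "card X = p ^ k" "k > (0::nat)"
    let ?M = "normalizer_in G N X"
    have sM: "subgroup ?M G" using normalizer_in_subgroup[OF sN X(1)] .
    have "r = p" if r: "prime r" "r dvd card ?M" for r
    proof (rule ccontr)
      assume "r \<noteq> p"
      moreover have "r dvd card N"
        using r(2) card_subgroup_dvd[OF sM sN] dvd_trans by (auto simp: normalizer_in_def)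
      ultimately show False using no_normalize[OF r(1) square[OF r(1)] p _ X] r(2) by blast
    qed
    then have "part {p} (card ?M) = card ?M"
      using part_eq_self_iff[OF card_subgroup_pos[OF sM], of "{p}"] by (auto simp: in_prime_factors_iff)
    then show "\<exists>j. card ?M = p ^ j" using prime_power_part_self p(1) by blast
  qed
  have "card N \<noteq> 1" using nN(2) subgroup.one_closed[OF sN] by (metis card_1_singletonE singletonD)
  then obtain p where p: "prime p" "p dvd card N" using prime_factor_nat by blast
  obtain S where S: "S \<in> \<sigma>" "p \<in> S" using sigma_cover[OF p(1)] by blast
  have "\<not> prime_factors (card N) \<subseteq> S" using np[OF S(1)] part_eq_self_iff[OF Npos] by blast
  then obtain q where q: "prime q" "q dvd card N" "q \<notin> S" by (auto simp: in_prime_factors_iff)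
  have cop: "coprime (p ^ multiplicity p (card N)) (q ^ multiplicity q (card N))"
    using p q S by (metis coprime_power_left_iff coprime_power_right_iff primes_coprime)
  let ?X = "\<lambda>p. {x \<in> N. x \<noteq> \<one> \<and> x [^] (p ^ multiplicity p (card N)) = \<one>}"
  have fin: "finite N" using finite_subgroup[OF sN] .
  have disj: "?X p \<inter> ?X q = {}"
    using pow_eq_one_coprime[OF cN _ _ cop] by blast
  \<comment> \<open>The two sets of elements are disjoint and both omit the identity, so they cannot
    each contain half of \<open>N\<close>.\<close>
  have "card (?X p \<union> ?X q) = card (?X p) + card (?X q)"
    by (rule card_Un_disjoint) (use fin disj in auto)
  moreover have "card (?X p \<union> ?X q) < card N"
    by (rule psubset_card_mono[OF fin]) (use subgroup.one_closed[OF sN] in auto)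
  ultimately show False using half[OF p] half[OF q(1,2)] by simp
qed

end

section \<open>The order of the residuals\<close>

context sigma_group
begin

text \<open>If \<open>N\<close> were central in \<open>res S\<close>, transfer would give a
  complement of \<open>N\<close> there, given by a power equation and hence normal in
  \<open>G\<close>. Its index in \<open>G\<close> is still an \<open>S\<close>-number, against the
  minimality of \<open>res S\<close>.\<close>

lemma not_normal_hall_complement:
  assumes S: "S \<in> \<sigma>" and N: "subgroup N G" "N \<subseteq> res S" "part S (card (res S)) = card N" "card N \<noteq> 1"
  obtains x y where "x \<in> N" "y \<in> res S" "x \<otimes> y \<noteq> y \<otimes> x"
proof (rule ccontr)
  assume "\<not> thesis"
  with that have central: "\<And>x y. x \<in> N \<Longrightarrow> y \<in> res S \<Longrightarrow> x \<otimes> y = y \<otimes> x" by blast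
  let ?O = "res S" let ?k = "part (-S) (card (res S))"
  have pos: "card ?O > 0" using card_subgroup_pos[OF res_subgroup] .
  have k: "card ?O = card N * ?k" using part_mult_compl[OF pos, of S] N(3) by simp
  let ?L = "G\<lparr>carrier := ?O\<rparr>"
  interpret L: fin_group ?L using fin_group_subgroup[OF res_subgroup] .
  have N': "subgroup N ?L" using subgroup_incl[OF N(1) res_subgroup N(2)] .
  have sub1: "part S (card N) = card N" using N(3) by (metis Int_absorb part_part)
  have "part S ?k = 1" by simp
  then have cop: "coprime (card N) ?k" using part_coprime[OF sub1] card_subgroup_pos[OF N(1)] by simp
  have k': "order ?L = card N * ?k" using k by (simp add: order_def)
  define T where "T = {x \<in> ?O. x [^] ?k = \<one>}"
  have eq: "{x \<in> carrier ?L. x [^]\<^bsub>?L\<^esub> ?k = \<one>\<^bsub>?L\<^esub>} = T"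
    by (simp add: nat_pow_consistent[symmetric] T_def)
  have "subgroup T ?L" "card T = ?k"
    using L.central_hall_complement[OF N' _ k' cop] central unfolding eq by auto
  then have T: "subgroup T G" "card T = ?k" using incl_subgroup[OF res_subgroup] by auto
  have "normalizes G (carrier G) T"
    unfolding T_def by (rule normalizes_pow_set[OF order_refl subgroup.subset[OF res_subgroup]])
      (use res_normal normal_normalizes in auto)
  then have nT: "T \<lhd> G" using T(1) normal_iff_normalizes by blast
  have "part (-S) (card T) = part (-S) (order G)" using T(2) res_index[of S] by simp
  then have "?O \<subseteq> T" using res_least nT by blast
  then have "card ?O \<le> ?k" using card_mono[OF finite_subgroup[OF T(1)]] T(2) by metis
  then have "card N * ?k \<le> 1 * ?k" using k by linarith
  then have "card N \<le> 1" using mult_le_cancel2[of "card N" ?k 1] part_pos[of "-S" "card (res S)"] by blast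
  then show False using N(4) card_subgroup_pos[OF N(1)] by linarith
qed

text \<open>A permutable subgroup with only \<open>p\<close> in its \<open>S\<close>-part shows that
  \<open>N\<close> is a \<open>p\<close>-group. Its nontrivial centre and minimality make
  \<open>N\<close> abelian, and since \<open>N\<close> is not central in \<open>res S\<close>, no
  nontrivial element of \<open>N\<close> is centralized by \<open>res S\<close>; so the crossed
  homomorphism applies.\<close>

lemma minimal_normal_complement:
  assumes w: "weak_embed_cond" and N: "minimal_normal N" and S: "S \<in> \<sigma>" "part S (card N) = card N"
    and O: "N \<subseteq> res S" "part S (card (res S)) = card N"
  obtains p M where "p \<in> S" "part {p} (card N) = card N" "subgroup M G" "N \<inter> M = {\<one>}" "N <#> M = carrier G"
proof -
  have nN: "N \<lhd> G" "N \<noteq> {\<one>}" using N by (simp_all add: minimal_normal_def)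
  have sN: "subgroup N G" using nN normal_imp_subgroup by blast
  note Npos = card_subgroup_pos[OF sN] and NG = subgroup.subset[OF sN]
  have cN1: "card N \<noteq> 1" using nN(2) subgroup.one_closed[OF sN] by (metis card_1_singletonE singletonD)
  then obtain p where p: "prime p" "p dvd card N" using prime_factor_nat by blast
  have "prime_factors (card N) \<subseteq> S" using S(2) part_eq_self_iff[OF Npos] by blast
  then have pS: "p \<in> S" using p Npos by (auto simp: in_prime_factors_iff)
  have Sp: "{p} \<inter> S = {p}" using pS by auto
  obtain E where E: "perm E" "part S (card E) = part {p} (order G)" using weak_embed_condD1[OF w S(1) pS] by blast
  have sE: "subgroup E G" using E by (simp add: perm_def)
  have sI: "subgroup (E \<inter> N) G" using sE sN subgroups_Inter_pair by blast
  have EN: "subgroup (E <#> N) G" using subgroup_set_mult[OF sE sN normal_normalizes[OF nN(1) subgroup.subset[OF sE]]] .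
  have nI: "normalizes G N (E \<inter> N)"
    using normalizes_mono[OF res_normalizes_Int[OF E(1) S(1) nN(1) S(2)] O(1)] .
  have fullE: "part {p} (card E) = part {p} (order G)" using arg_cong[OF E(2), of "part {p}"] by (simp add: Sp)
  have pI: "part {p} (card (E \<inter> N)) = card (E \<inter> N)"
  proof -
    have "part S (card (E \<inter> N)) = card (E \<inter> N)"
      using part_self_dvd[OF S(2) card_subgroup_dvd[OF sI sN] Npos] by blast
    moreover have "part S (card (E \<inter> N)) dvd part {p} (order G)"
      using part_dvd_mono[OF card_subgroup_dvd[OF sI sE] card_subgroup_pos[OF sE], of S] E(2) by simp
    ultimately have "card (E \<inter> N) dvd part {p} (order G)" by simp
    then show ?thesis by (rule part_self_dvd[rotated]) auto
  qed
  \<comment> \<open>Otherwise the \<open>N\<close>-invariant \<open>p\<close>-subgroup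
    \<open>E \<inter> N\<close> is trivial, and \<open>E <#> N\<close> would exceed the full
    \<open>p\<close>-part that \<open>E\<close> already has.\<close>
  have pN: "part {p} (card N) = card N"
  proof (rule ccontr)
    assume ne: "part {p} (card N) \<noteq> card N"
    then have I1: "E \<inter> N = {\<one>}" using minimal_normal_no_part[OF N ne sI _ nI pI] by blast
    have "part {p} (card (E <#> N)) = part {p} (order G)"
      using part_eq_superset[OF sE EN set_mult_subset(1)[OF sE sN] fullE] .
    moreover have "card (E <#> N) = card E * card N" using card_set_mult[OF sE sN] I1 by simp
    ultimately have "part {p} (order G) * part {p} (card N) = part {p} (order G)"
      using part_mult[OF card_subgroup_pos[OF sE] Npos, of "{p}"] fullE by simp
    then have "part {p} (card N) = 1" by simp
    then show False using part_neq_1_iff[OF Npos, of "{p}"] p by auto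
  qed
  have normalC: "centralizer G (carrier G) L \<inter> N \<lhd> G" if L: "L \<lhd> G" for L
  proof -
    have sL: "subgroup L G" using L normal_imp_subgroup by blast
    have "subgroup (centralizer G (carrier G) L) G" using centralizer_subgroup[OF subgroup_self subgroup.subset[OF sL]] .
    moreover have "normalizes G (carrier G) (centralizer G (carrier G) L)"
      using centralizer_normalized[OF subgroup_self subgroup.subset[OF sL] normal_normalizes[OF L order_refl]] .
    ultimately have "centralizer G (carrier G) L \<lhd> G" using normal_iff_normalizes by blast
    then show ?thesis using nN(1) normal_subgroup_intersect by blast
  qed
  have alt: "centralizer G (carrier G) L \<inter> N = {\<one>} \<or> centralizer G (carrier G) L \<inter> N = N" if L: "L \<lhd> G" for L
    using N normalC[OF L] unfolding minimal_normal_def by blast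
  have comm: "x \<otimes> y = y \<otimes> x" if xy: "x \<in> N" "y \<in> N" for x y
  proof -
    have "\<exists>u\<in>N. u \<noteq> \<one> \<and> (\<forall>g\<in>N. g \<otimes> u = u \<otimes> g)"
      by (rule p_group_centralizes_element[OF sN prime_power_part_self[OF pN p(1)] p(1) normalizes_self[OF sN] sN p(2)]) blast
    then obtain u where u: "u \<in> N" "u \<noteq> \<one>" "\<forall>g\<in>N. g \<otimes> u = u \<otimes> g" by blast
    have "u \<in> centralizer G (carrier G) N \<inter> N"
      using u(1) subgroup.mem_carrier[OF sN u(1)] u(3) by (simp add: centralizer_def)
    then have "centralizer G (carrier G) N \<inter> N = N" using alt[OF nN(1)] u(2) by blast
    then have "x \<in> centralizer G (carrier G) N" using xy by blast
    then show ?thesis using xy(2) unfolding centralizer_def by blast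
  qed
  have triv: "x = \<one>" if x: "x \<in> N" "\<And>y. y \<in> res S \<Longrightarrow> y \<otimes> x = x \<otimes> y" for x
  proof -
    obtain a b where ab: "a \<in> N" "b \<in> res S" "a \<otimes> b \<noteq> b \<otimes> a"
      using not_normal_hall_complement[OF S(1) sN O cN1] by blast
    then have "centralizer G (carrier G) (res S) \<inter> N \<noteq> N" unfolding centralizer_def by blast
    then have 1: "centralizer G (carrier G) (res S) \<inter> N = {\<one>}" using alt[OF res_normal] by blast
    have "x \<otimes> y = y \<otimes> x" if "y \<in> res S" for y using x(2)[OF that] by (rule sym)
    then have "x \<in> centralizer G (carrier G) (res S) \<inter> N"
      using x(1) subgroup.mem_carrier[OF sN x(1)] unfolding centralizer_def by blast
    then show ?thesis using 1 by blast
  qed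
  let ?k = "part (-S) (card (res S))"
  have k: "card (res S) = card N * ?k"
    using part_mult_compl[OF card_subgroup_pos[OF res_subgroup], of S S] O(2) by simp
  have "part S ?k = 1" by simp
  then have cop: "coprime (card N) ?k" using part_coprime[OF S(2)] Npos by simp
  obtain M where "subgroup M G" "N \<inter> M = {\<one>}" "N <#> M = carrier G"
    by (rule normal_hall_complement[OF nN(1) res_normal O(1) _ k cop]) (use comm triv in blast)+
  then show thesis using that pS pN by blast
qed

text \<open>The permutable subgroup belonging to \<open>A\<close> inherits full part outside
  \<open>S\<close>, so it contains \<open>res S\<close>; at \<open>S\<close> its part is that of
  \<open>A\<close>.\<close>

lemma res_part_dvd_index_part:
  assumes ec: "embed_cond" and S: "S \<in> \<sigma>" and A: "subgroup A G" "part (-S) (card A) = part (-S) (order G)"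
    "part S (card A) \<noteq> 1"
  shows "part S (card (res S)) dvd part S (card A)"
proof -
  obtain E where E: "perm E" "\<forall>T\<in>\<sigma>. part T (card A) \<noteq> 1 \<longrightarrow> part T (card E) = part T (card A)"
    using ec A(1) unfolding embed_cond_def by blast
  have sE: "subgroup E G" using E by (simp add: perm_def)
  have "part T (card E) = part T (order G)" if T: "T \<in> \<sigma>" "T \<noteq> S" for T
  proof -
    have eq: "part T (card A) = part T (order G)" using part_compl_eqD[OF A(2) S T] .
    show ?thesis
    proof (cases "part T (card A) = 1")
      \<comment> \<open>Here \<open>order G\<close> has trivial part too, so the part of
        \<open>E\<close> is full although the condition is silent about this class.\<close>
      case True
      have "part T (card E) dvd part T (order G)" using part_dvd_mono[OF card_subgroup_dvd_order[OF sE]] by simp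
      then show ?thesis using True eq by simp
    qed (use E(2) T eq in simp)
  qed
  then have "res S \<subseteq> E" using perm_full_res_subset[OF E(1) S] by blast
  then have "part S (card (res S)) dvd part S (card E)"
    using part_dvd_mono[OF card_subgroup_dvd[OF res_subgroup sE] card_subgroup_pos[OF sE]] by blast
  then show ?thesis using E(2) S A(3) by simp
qed

text \<open>
  \<open>X / Y\<close> is a chief factor carrying the part of \<open>|res S|\<close> that belongs to \<open>S\<close>.  It has a
  complement \<open>M\<close> in \<open>G / Y\<close>, and the embedding condition is applied to preimages of subgroups
  \<open>T R\<close>, where \<open>T\<close> is the intersection of \<open>M\<close> with the image of \<open>res S\<close> and \<open>R\<close> has order \<open>1\<close>
  or \<open>r\<close>.
\<close>

theorem embed_cond_res_dvd:
  assumes ec: "embed_cond" and S: "S \<in> \<sigma>" and r: "r \<in> S" "r dvd order G"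
  shows "part S (card (res S)) dvd r"
proof (cases "part S (card (res S)) = 1")
  case False
  let ?c = "part S (card (res S))"
  have rp: "prime r" using sigma_prime S r by blast
  \<comment> \<open>\<open>X\<close> is least among the normal subgroups in \<open>res S\<close>
    carrying the whole part \<open>?c\<close>, and \<open>Y\<close> is maximal normal below it. So
    \<open>Y\<close> does not carry \<open>?c\<close>, and the order of the chief factor involves a
    prime of \<open>S\<close>.\<close>
  define FX where "FX = {X. X \<lhd> G \<and> X \<subseteq> res S \<and> part S (card X) = ?c}"
  have "res S \<in> FX" using res_normal by (simp add: FX_def)
  then obtain X where X: "X \<in> FX" "\<forall>Z. Z \<in> FX \<longrightarrow> card X \<le> card Z"
    using ex_has_least_nat[of "\<lambda>X. X \<in> FX" "res S" card] by blast
  have nX: "X \<lhd> G" "X \<subseteq> res S" "part S (card X) = ?c" using X by (auto simp: FX_def)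
  have sX: "subgroup X G" using nX normal_imp_subgroup by blast
  have finX: "finite X" using finite_subgroup[OF sX] .
  define FY where "FY = {Y. Y \<lhd> G \<and> Y \<subset> X}"
  have "X \<noteq> {\<one>}" using nX(3) False by auto
  then have "{\<one>} \<in> FY" using one_is_normal subgroup.one_closed[OF sX] by (auto simp: FY_def)
  moreover have "\<forall>Y. Y \<in> FY \<longrightarrow> card Y < Suc (card X)"
    using card_mono[OF finX] by (auto simp: FY_def less_Suc_eq_le)
  ultimately obtain Y where Y: "Y \<in> FY" "\<forall>Z. Z \<in> FY \<longrightarrow> card Z \<le> card Y"
    using ex_has_greatest_nat[of "\<lambda>Y. Y \<in> FY" "{\<one>}" card "Suc (card X)"] by blast
  have nY: "Y \<lhd> G" "Y \<subset> X" using Y by (auto simp: FY_def)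
  have sY: "subgroup Y G" using nY normal_imp_subgroup by blast
  have cYX: "card Y < card X" using psubset_card_mono[OF finX nY(2)] .
  have Ypos: "card Y > 0" using card_subgroup_pos[OF sY] .
  have ncY: "part S (card Y) \<noteq> ?c"
  proof
    assume "part S (card Y) = ?c"
    then have "Y \<in> FX" using nY nX(2) by (auto simp: FX_def)
    then show False using X(2) cYX by auto
  qed
  let ?H = "G Mod Y" let ?h = "\<lambda>x. Y #> x"
  interpret e: sigma_epi G ?H ?h \<sigma>
    using fin_epi_Mod(1)[OF nY(1)] sigma_group_axioms by (simp add: sigma_epi_def)
  have ker: "e.ker = Y" using fin_epi_Mod(2)[OF nY(1)] .
  have image_card: "card (?h ` A) * card Y = card A" if "subgroup A G" "Y \<subseteq> A" for A
    using e.card_image_mult[OF that(1)] ker that(2) by (simp add: Int_absorb1)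
  let ?N = "?h ` X"
  have cN: "card ?N * card Y = card X" using image_card[OF sX] nY(2) by blast
  have nN: "?N \<lhd> ?H" using e.image_normal[OF nX(1)] .
  have sN: "subgroup ?N ?H" using e.image_subgroup[OF sX] .
  have Npos: "card ?N > 0" using e.H.card_subgroup_pos[OF sN] .
  have min: "e.H.minimal_normal ?N"
    unfolding e.H.minimal_normal_def
  proof (intro conjI allI impI nN)
    show "?N \<noteq> {\<one>\<^bsub>?H\<^esub>}"
    proof
      assume "?N = {\<one>\<^bsub>?H\<^esub>}"
      then show False using cN cYX by simp
    qed
    fix U assume U: "U \<lhd> ?H" "U \<subseteq> ?N"
    have sU: "subgroup U ?H" using U normal_imp_subgroup by blast
    have pU: "e.pre U \<lhd> G" using e.pre_normal[OF U(1)] .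
    have "Y \<subseteq> e.pre U" using e.ker_subset_pre[OF sU] ker by simp
    moreover have "e.pre U \<subseteq> X" using e.pre_mono[OF U(2)] e.pre_image[OF sX] ker nY(2) by auto
    ultimately consider "e.pre U = Y" | "e.pre U = X" | "Y \<subset> e.pre U" "e.pre U \<in> FY"
      using pU by (auto simp: FY_def)
    then show "U = {\<one>\<^bsub>?H\<^esub>} \<or> U = ?N"
    proof cases
      case 1
      then have "card U = 1" using e.card_pre[OF sU] ker Ypos by simp
      then show ?thesis using subgroup.one_closed[OF sU] by (metis card_1_singletonE singletonD)
    next
      case 2
      then show ?thesis using e.image_pre[OF subgroup.subset[OF sU]] by simp
    next
      case 3
      have "card Y < card (e.pre U)"
        using psubset_card_mono[OF finite_subgroup[OF normal_imp_subgroup[OF pU]] 3(1)] .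
      then show ?thesis using Y(2) 3(2) by auto
    qed
  qed
  have w: "e.H.weak_embed_cond" using e.weak_embed_cond_image[OF embed_cond_imp_weak[OF ec]] .
  obtain S1 where S1: "S1 \<in> \<sigma>" "part S1 (card ?N) = card ?N"
    using e.H.minimal_normal_sigma_primary[OF w min] by blast
  have cprod: "part S (card ?N) * part S (card Y) = ?c"
    using part_mult[OF Npos Ypos, of S] cN nX(3) by simp
  then have "part S (card ?N) \<noteq> 1" using ncY by auto
  then have "S1 = S" using sigma_part_one[OF S S1(1) _ S1(2)] by blast
  then have Sn: "part S (card ?N) = card ?N" using S1 by simp
  have cN1: "card ?N \<noteq> 1" using \<open>part S (card ?N) \<noteq> 1\<close> Sn by simp
  have c: "card ?N * part S (card Y) = ?c" using cprod Sn by simp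
  let ?O = "e.H.res S"
  have O: "?O = ?h ` res S" using e.image_res by simp
  have NO: "?N \<subseteq> ?O" unfolding O using nX(2) by blast
  have sO: "subgroup ?O ?H" by (rule e.H.res_subgroup)
  have Opos: "card ?O > 0" using e.H.card_subgroup_pos[OF sO] .
  have "card ?O * card Y = card (res S)"
    unfolding O using image_card[OF res_subgroup] nY(2) nX(2) by blast
  then have "part S (card ?O) * part S (card Y) = ?c" using part_mult[OF Opos Ypos, of S] by simp
  then have pO: "part S (card ?O) = card ?N" using c by (metis mult_cancel_right part_neq_0)
  obtain p M where p: "p \<in> S" "part {p} (card ?N) = card ?N"
    and M: "subgroup M ?H" "?N \<inter> M = {\<one>\<^bsub>?H\<^esub>}" "?N <#>\<^bsub>?H\<^esub> M = carrier ?H"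
    using e.H.minimal_normal_complement[OF w min S Sn NO pO] .
  have cM: "card ?N * card M = order ?H"
    using e.H.card_set_mult[OF sN M(1)] M(2,3) by (simp add: order_def)
  define T where "T = M \<inter> ?O"
  have sT: "subgroup T ?H" using M(1) sO e.H.subgroups_Inter_pair by (simp add: T_def)
  have "?N <#>\<^bsub>?H\<^esub> T = ?O"
  proof
    show "?N <#>\<^bsub>?H\<^esub> T \<subseteq> ?O" using e.H.set_mult_least[OF sO NO] by (simp add: T_def)
    show "?O \<subseteq> ?N <#>\<^bsub>?H\<^esub> T"
    proof
      fix o' assume o': "o' \<in> ?O"
      then have "o' \<in> ?N <#>\<^bsub>?H\<^esub> M" using M(3) subgroup.mem_carrier[OF sO] by simp
      then obtain n m where nm: "n \<in> ?N" "m \<in> M" "o' = n \<otimes>\<^bsub>?H\<^esub> m" unfolding set_mult_def by blast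
      have nO: "n \<in> ?O" using nm(1) NO by blast
      have "inv\<^bsub>?H\<^esub> n \<otimes>\<^bsub>?H\<^esub> o' \<in> ?O"
        using subgroup.m_closed[OF sO subgroup.m_inv_closed[OF sO nO] o'] .
      moreover have "inv\<^bsub>?H\<^esub> n \<otimes>\<^bsub>?H\<^esub> o' = m"
        unfolding nm(3) using subgroup.mem_carrier[OF sO nO] subgroup.mem_carrier[OF M(1) nm(2)]
        by (rule e.H.inv_mult_cancel(1))
      ultimately have "m \<in> T" using nm(2) by (simp add: T_def)
      then show "o' \<in> ?N <#>\<^bsub>?H\<^esub> T" unfolding nm(3) set_mult_def using nm(1) by blast
    qed
  qed
  moreover have "?N \<inter> T = {\<one>\<^bsub>?H\<^esub>}"
    using M(2) subgroup.one_closed[OF sN] subgroup.one_closed[OF sT] by (auto simp: T_def)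
  ultimately have cT: "card ?O = card ?N * card T" using e.H.card_set_mult[OF sN sT] by simp
  have Tpos: "card T > 0" using e.H.card_subgroup_pos[OF sT] .
  have TS: "part S (card T) = 1"
    using part_mult[OF Npos Tpos, of S] cT pO Sn Npos by simp
  have "part (-S) (card ?N) = 1"
    using part_mult_compl[OF Npos, of S] Sn Npos by simp
  then have Tfull: "part (-S) (card T) = part (-S) (order ?H)"
    using part_mult[OF Npos Tpos, of "-S"] cT e.H.res_index[of S] by simp
  \<comment> \<open>The preimage of \<open>T R\<close> has full part outside \<open>S\<close>, so
    its \<open>S\<close>-part \<open>card R * part S (card Y)\<close> is a multiple of
    \<open>?c = card ?N * part S (card Y)\<close>, provided it is not 1; then the factor from
    \<open>Y\<close> cancels.\<close>
  have key: "card ?N dvd card R"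
    if R: "subgroup R ?H" "subgroup (T <#>\<^bsub>?H\<^esub> R) ?H" "part S (card R) = card R"
      and ne: "card R * part S (card Y) \<noteq> 1" for R
  proof -
    let ?A = "e.pre (T <#>\<^bsub>?H\<^esub> R)"
    have Rpos: "card R > 0" using e.H.card_subgroup_pos[OF R(1)] .
    have "coprime (card R) (card T)" using part_coprime[OF R(3) TS Rpos Tpos] .
    then have "T \<inter> R = {\<one>\<^bsub>?H\<^esub>}" using e.H.card_Int_coprime[OF sT R(1)] by (simp add: coprime_commute)
    then have "card (T <#>\<^bsub>?H\<^esub> R) = card T * card R" using e.H.card_set_mult[OF sT R(1)] by simp
    then have cA: "card ?A = card T * card R * card Y" using e.card_pre[OF R(2)] ker by simp
    have mult: "part Q (card ?A) = part Q (card T) * part Q (card R) * part Q (card Y)" for Q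
      unfolding cA using Tpos Rpos Ypos by (simp add: part_mult)
    have "part (-S) (card R) = 1" using part_mult_compl[OF Rpos, of S] R(3) Rpos by simp
    then have "part (-S) (card ?A) = part (-S) (order ?H) * part (-S) (card Y)" using mult Tfull by simp
    also have "\<dots> = part (-S) (order G)"
      using part_mult[OF e.H.order_pos Ypos, of "-S"] e.card_ker_mult ker by simp
    finally have A2: "part (-S) (card ?A) = part (-S) (order G)" .
    have A3: "part S (card ?A) = card R * part S (card Y)" using mult TS R(3) by simp
    have "?c dvd card R * part S (card Y)"
      using res_part_dvd_index_part[OF ec S e.pre_subgroup[OF R(2)] A2] A3 ne by simp
    then show ?thesis using c[symmetric] by (simp add: dvd_times_right_cancel_iff)
  qed
  \<comment> \<open>With trivial \<open>R\<close> the proviso of \<open>key\<close> can only fail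
    when \<open>Y\<close> has trivial \<open>S\<close>-part; otherwise \<open>card ?N\<close> would
    divide 1.\<close>
  have YS: "part S (card Y) = 1"
  proof (rule ccontr)
    assume ne: "part S (card Y) \<noteq> 1"
    have s1: "subgroup {\<one>\<^bsub>?H\<^esub>} ?H" by (rule e.H.triv_subgroup)
    have "subgroup (T <#>\<^bsub>?H\<^esub> {\<one>\<^bsub>?H\<^esub>}) ?H"
      by (rule e.H.subgroup_set_mult[OF sT s1])
        (use e.H.normal_normalizes[OF e.H.one_is_normal subgroup.subset[OF sT]] in simp)
    then have "card ?N dvd card {\<one>\<^bsub>?H\<^esub>}" using key[OF s1] ne by simp
    then show False using cN1 by simp
  qed
  have cc: "?c = card ?N" using c YS by simp
  have pp: "prime p" using sigma_prime[OF S p(1)] .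
  have rH: "r dvd order ?H"
  proof -
    have "r dvd order ?H * card Y" using r(2) e.card_ker_mult ker by simp
    moreover have "\<not> r dvd card Y" using part_neq_1_iff[OF Ypos, of S] YS r(1) rp by blast
    ultimately show ?thesis using rp prime_dvd_mult_iff by blast
  qed
  show ?thesis
  proof (cases "r dvd card M")
    case True
    obtain R where R: "subgroup R ?H" "R \<subseteq> M" "card R = r" using e.H.cauchy_exists[OF M(1) rp True] .
    \<comment> \<open>\<open>T\<close> is the intersection of \<open>M\<close> with a normal
      subgroup, so a subgroup of order \<open>r\<close> of \<open>M\<close> is compatible with
      it.\<close>
    have "normalizes ?H M T"
      unfolding T_def
      by (rule e.H.normalizes_Int[OF e.H.normalizes_self[OF M(1)]
            e.H.normal_normalizes[OF e.H.res_normal subgroup.subset[OF M(1)]]])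
    then have n: "normalizes ?H R T" using R(2) e.H.normalizes_mono by blast
    have "subgroup (T <#>\<^bsub>?H\<^esub> R) ?H"
      using e.H.subgroup_set_mult[OF R(1) sT n] e.H.set_mult_commute_if_normalizes[OF R(1) sT n] by simp
    then have "card ?N dvd card R"
      by (rule key[OF R(1)]) (use R(3) rp r(1) YS prime_gt_1_nat[OF rp] in \<open>auto simp: part_prime\<close>)
    then show ?thesis using cc R(3) by simp
  next
    case False
    then have "r dvd card ?N" using rH cM rp by (metis prime_dvd_mult_iff)
    moreover have "card ?N = p ^ multiplicity p (card ?N)" using prime_power_part_self[OF p(2) pp] .
    ultimately have rp': "r = p" using rp pp by (metis prime_dvd_power primes_dvd_imp_eq)
    have Sp: "{p} \<inter> S = {p}" using p by auto
    obtain A where A: "subgroup A G" "card A = p"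
      using cauchy_exists[OF subgroup_self pp] r(2) rp' by (auto simp: order_def)
    have pA: "part S (card A) = p" using A(2) pp p(1) by (simp add: part_prime)
    have "part S (card A) \<noteq> 1" using pA prime_gt_1_nat[OF pp] by simp
    then obtain E where E: "perm E" "part S (card E) = p"
      using ec A(1) pA S unfolding embed_cond_def by metis
    have sE: "subgroup E G" using E by (simp add: perm_def)
    let ?E = "?h ` E"
    have sE': "subgroup ?E ?H" using e.image_subgroup[OF sE] .
    have EY: "subgroup (E \<inter> Y) G" using sE sY subgroups_Inter_pair by blast
    have "part S (card (E \<inter> Y)) dvd part S (card Y)"
      using part_dvd_mono[OF card_subgroup_dvd[OF EY sY] Ypos] by blast
    then have "part S (card (E \<inter> Y)) = 1" using YS by simp
    moreover have "card ?E * card (E \<inter> Y) = card E" using e.card_image_mult[OF sE] ker by simp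
    ultimately have pE: "part S (card ?E) = p"
      using part_mult[OF e.H.card_subgroup_pos[OF sE'] card_subgroup_pos[OF EY], of S] E(2) by simp
    \<comment> \<open>Now \<open>r = p\<close> and the complement has no factor \<open>p\<close>.
      The required subgroup is cut out of \<open>?N\<close> by the image of a permutable subgroup
      with \<open>S\<close>-part \<open>p\<close>; \<open>?O\<close>, and with it \<open>T\<close>,
      normalizes this intersection.\<close>
    let ?R = "?E \<inter> ?N"
    have R: "subgroup ?R ?H" using sE' sN e.H.subgroups_Inter_pair by blast
    have Rpos: "card ?R > 0" using e.H.card_subgroup_pos[OF R] .
    have RS: "part S (card ?R) = card ?R"
      using part_self_dvd[OF Sn e.H.card_subgroup_dvd[OF R sN] Npos] by blast
    have "normalizes ?H ?O ?R" using e.H.res_normalizes_Int[OF e.perm_image[OF E(1)] S nN Sn] .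
    then have nT: "normalizes ?H T ?R" by (rule e.H.normalizes_mono) (simp add: T_def)
    have TR: "subgroup (T <#>\<^bsub>?H\<^esub> ?R) ?H" using e.H.subgroup_set_mult[OF sT R nT] .
    have Rp: "card ?R = p"
    proof (rule dvd_antisym)
      have "part S (card ?R) dvd part S (card ?E)"
        using part_dvd_mono[OF e.H.card_subgroup_dvd[OF R sE'] e.H.card_subgroup_pos[OF sE']] by blast
      then show "card ?R dvd p" using RS pE by simp
      have EN: "subgroup (?E <#>\<^bsub>?H\<^esub> ?N) ?H"
        using e.H.subgroup_set_mult[OF sE' sN e.H.normal_normalizes[OF nN subgroup.subset[OF sE']]] .
      \<comment> \<open>\<open>?N\<close> carries the whole \<open>p\<close>-part of the quotient,
        so the product with \<open>?E\<close> gains nothing at \<open>p\<close> and the factor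
        \<open>p\<close> of \<open>?E\<close> must appear in the intersection.\<close>
      have "part {p} (card M) = 1"
        using part_neq_1_iff[OF e.H.card_subgroup_pos[OF M(1)], of "{p}"] False rp' by auto
      then have "part {p} (order ?H) = card ?N"
        using part_mult[OF Npos e.H.card_subgroup_pos[OF M(1)], of "{p}"] cM p(2) by simp
      then have "part {p} (card (?E <#>\<^bsub>?H\<^esub> ?N)) = card ?N"
        using e.H.part_eq_superset[OF sN EN e.H.set_mult_subset(2)[OF sE' sN], of "{p}"] p(2) by simp
      moreover have "part {p} (card (?E <#>\<^bsub>?H\<^esub> ?N)) * part {p} (card ?R) = part {p} (card ?E) * part {p} (card ?N)"
        using e.H.card_set_mult[OF sE' sN]
          part_mult[OF e.H.card_subgroup_pos[OF EN] Rpos, of "{p}"]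
          part_mult[OF e.H.card_subgroup_pos[OF sE'] Npos, of "{p}"] by simp
      moreover have "part {p} (card ?E) = part {p} (part S (card ?E))" by (simp add: Sp)
      ultimately have "card ?N * part {p} (card ?R) = card ?N * p"
        using p(2) pE pp by (simp add: part_prime mult.commute)
      then have "part {p} (card ?R) = p" using Npos by simp
      then show "p dvd card ?R" using part_dvd[OF Rpos, of "{p}"] by simp
    qed
    have "card ?N dvd card ?R"
      by (rule key[OF R TR RS]) (use Rp YS prime_gt_1_nat[OF pp] in auto)
    then show ?thesis using cc Rp rp' by simp
  qed
qed simp

end

section \<open>The structure of the nilpotent residual\<close>

lemma (in group) conj_pow:
  assumes z: "z \<in> carrier G" and y: "y \<in> carrier G"
  shows "(z \<otimes> y \<otimes> inv z) [^] (j::nat) = z \<otimes> y [^] j \<otimes> inv z"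
proof (induction j)
  case (Suc j)
  have "z \<otimes> y [^] j \<otimes> inv z \<otimes> (z \<otimes> y \<otimes> inv z) = z \<otimes> y [^] j \<otimes> (inv z \<otimes> z) \<otimes> y \<otimes> inv z"
    using z y by (simp only: m_assoc m_closed inv_closed nat_pow_closed)
  then show ?case using Suc z y by (simp add: m_assoc)
qed (use z in simp)

lemma (in group) subgroup_nat_pow_closed:
  assumes "subgroup A G" "x \<in> A"
  shows "x [^] (n::nat) \<in> A"
  by (induction n) (use assms in \<open>simp_all add: subgroup.one_closed subgroup.m_closed\<close>)

context sigma_group
begin

text \<open>
  This is the \<open>\<sigma>\<close>-nilpotent residual; see \<open>sigma_nilpotent_residual_eq\<close>.
\<close>

definition "nres = (\<Inter>S\<in>\<sigma>. res S)"

text \<open>The index of \<open>U S\<close> is an \<open>S\<close>-number, so the indices are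
  coprime in pairs and multiply. Intersecting with the carrier gives the empty family its proper
  meaning.\<close>

lemma coprime_index_Inter:
  assumes fin: "finite F" and F: "F \<subseteq> \<sigma>"
    and U: "\<And>S. S \<in> F \<Longrightarrow> subgroup (U S) G \<and> part (-S) (card (U S)) = part (-S) (order G)"
  shows "subgroup (carrier G \<inter> (\<Inter>S\<in>F. U S)) G \<and>
    (\<forall>T\<in>\<sigma>. part T (card (carrier G \<inter> (\<Inter>S\<in>F. U S))) =
      (if T \<in> F then part T (card (U T)) else part T (order G)))"
  using fin F U
proof (induction F rule: finite_induct)
  case empty
  then show ?case using subgroup_self by (simp add: order_def)
next
  case (insert S F)
  let ?W = "carrier G \<inter> (\<Inter>S\<in>F. U S)"
  have IH: "subgroup ?W G" "\<And>T. T \<in> \<sigma> \<Longrightarrow> part T (card ?W) = (if T \<in> F then part T (card (U T)) else part T (order G))"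
    using insert.IH insert.prems by auto
  have US: "subgroup (U S) G" "part (-S) (card (U S)) = part (-S) (order G)" and S: "S \<in> \<sigma>"
    using insert.prems by auto
  have WU: "U S \<inter> ?W = carrier G \<inter> (\<Inter>S\<in>insert S F. U S)" by blast
  have sI: "subgroup (U S \<inter> ?W) G" using US IH subgroups_Inter_pair by blast
  obtain a where a: "order G = card (U S) * a" using card_subgroup_dvd_order[OF US(1)] unfolding dvd_def by blast
  obtain b where b: "order G = card ?W * b" using card_subgroup_dvd_order[OF IH(1)] unfolding dvd_def by blast
  note pos = card_subgroup_pos[OF US(1)] card_subgroup_pos[OF IH(1)] card_subgroup_pos[OF sI]
  have ab: "a > 0" "b > 0" using a b order_pos by (metis mult_0_right not_gr0)+
  have "part (-S) (card (U S)) * part (-S) a = part (-S) (card (U S))"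
    using part_mult[OF pos(1) ab(1), of "-S"] a US(2) by simp
  then have "part (-S) a = 1" by simp
  then have aS: "part S a = a" using part_mult_compl[OF ab(1), of S] by simp
  have "part S (card ?W) * part S b = part S (card ?W)"
    using part_mult[OF pos(2) ab(2), of S] b IH(2)[OF S] insert.hyps(2) by simp
  then have bS: "part S b = 1" by simp
  have ia: "order G div card (U S) = a" using a pos by simp
  have ib: "order G div card ?W = b" using b pos by simp
  have "coprime (order G div card (U S)) (order G div card ?W)"
    unfolding ia ib using part_coprime[OF aS bS ab] .
  from subgroup_index_mult[OF US(1) IH(1) this]
  have "order G div card (U S \<inter> ?W) = a * b" unfolding ia ib .
  then have c: "order G = card (U S \<inter> ?W) * (a * b)"
    using card_subgroup_dvd_order[OF sI] by (metis dvd_mult_div_cancel)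
  have "card (U S \<inter> ?W) * a * b = card ?W * b" using b c by (simp only: ac_simps)
  then have ca: "card (U S \<inter> ?W) * a = card ?W" using ab by simp
  have "card (U S \<inter> ?W) * b * a = card (U S) * a" using a c by (simp only: ac_simps)
  then have cb: "card (U S \<inter> ?W) * b = card (U S)" using ab by simp
  have "part T (card (U S \<inter> ?W)) = (if T \<in> insert S F then part T (card (U T)) else part T (order G))"
    if T: "T \<in> \<sigma>" for T
  proof (cases "T = S")
    case True
    then show ?thesis using part_mult[OF pos(3) ab(2), of S] cb bS by simp
  next
    case False
    then have "part T a = 1" using sigma_part_one[OF T S _ aS] by simp
    then have "part T (card (U S \<inter> ?W)) = part T (card ?W)"
      using part_mult[OF pos(3) ab(1), of T] ca by simp
    then show ?thesis using IH(2)[OF T] False by simp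
  qed
  then show ?case using sI unfolding WU by blast
qed

lemma finite_sigma_of: "finite (sigma_of \<sigma> n)"
proof -
  have "sigma_of \<sigma> n \<subseteq> (\<lambda>p. SOME S. S \<in> \<sigma> \<and> p \<in> S) ` prime_factors n"
  proof
    fix S assume "S \<in> sigma_of \<sigma> n"
    then obtain p where p: "S \<in> \<sigma>" "p \<in> S" "p \<in> prime_factors n" by (auto simp: sigma_of_def)
    then have "(SOME S. S \<in> \<sigma> \<and> p \<in> S) = S" using sigma_unique by (intro some_equality) auto
    then show "S \<in> (\<lambda>p. SOME S. S \<in> \<sigma> \<and> p \<in> S) ` prime_factors n" using p by force
  qed
  then show ?thesis by (rule finite_subset) simp
qed

lemma not_sigma_of: "n > 0 \<Longrightarrow> S \<in> \<sigma> \<Longrightarrow> S \<notin> sigma_of \<sigma> n \<longleftrightarrow> part S n = 1"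
  using part_eq_1_iff[of n S] by (auto simp: sigma_of_def)

lemma sigma_nonempty: "\<sigma> \<noteq> {}"
  using sigma_cover[OF two_is_prime_nat] by blast

text \<open>Reduces the intersection over all classes, possibly infinitely many, to the finitely
  many that matter: elsewhere \<open>res S\<close> is the whole group.\<close>

lemma nres_eq: "nres = carrier G \<inter> (\<Inter>S\<in>sigma_of \<sigma> (order G). res S)"
proof -
  have "res S = carrier G" if S: "S \<in> \<sigma>" "S \<notin> sigma_of \<sigma> (order G)" for S
  proof -
    have "part S (order G) = 1" using not_sigma_of[OF order_pos S(1)] S(2) by simp
    then have "part (-S) (order G) = order G" using part_mult_compl[OF order_pos, of S] by simp
    then have "order G dvd card (res S)"
      using part_dvd[OF card_subgroup_pos[OF res_subgroup], of "-S" S] res_index[of S] by simp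
    then have "order G \<le> card (res S)" using card_subgroup_pos[OF res_subgroup] by (rule dvd_imp_le)
    then show ?thesis
      using subgroup.subset[OF res_subgroup[of S]] by (intro card_seteq) (auto simp: order_def)
  qed
  moreover have "sigma_of \<sigma> (order G) \<subseteq> \<sigma>" by (auto simp: sigma_of_def)
  moreover have "nres \<subseteq> carrier G"
    using sigma_nonempty subgroup.subset[OF res_subgroup] unfolding nres_def by blast
  ultimately show ?thesis unfolding nres_def by blast
qed

lemma nres_subgroup: "subgroup nres G"
  and part_nres: "S \<in> \<sigma> \<Longrightarrow> part S (card nres) = part S (card (res S))"
proof -
  have sub: "sigma_of \<sigma> (order G) \<subseteq> \<sigma>" by (auto simp: sigma_of_def)
  have *: "subgroup nres G \<and> (\<forall>T\<in>\<sigma>. part T (card nres) =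
      (if T \<in> sigma_of \<sigma> (order G) then part T (card (res T)) else part T (order G)))"
    unfolding nres_eq
    by (rule coprime_index_Inter[OF finite_sigma_of sub]) (use res_subgroup res_index in blast)
  then show "subgroup nres G" by blast
  assume S: "S \<in> \<sigma>"
  show "part S (card nres) = part S (card (res S))"
  proof (cases "S \<in> sigma_of \<sigma> (order G)")
    case False
    then have "part S (order G) = 1" using not_sigma_of[OF order_pos S] by simp
    moreover have "part S (card (res S)) dvd part S (order G)"
      using part_dvd_mono[OF card_subgroup_dvd_order[OF res_subgroup]] by simp
    ultimately show ?thesis using * S False by simp
  qed (use * S in simp)
qed

lemma nres_subset: "S \<in> \<sigma> \<Longrightarrow> nres \<subseteq> res S"
  by (auto simp: nres_def)

lemma nres_normal: "nres \<lhd> G"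
proof -
  have "normalizes G (carrier G) nres"
    unfolding normalizes_def nres_def
    using normalizesD[OF normal_normalizes[OF res_normal order_refl]] by blast
  then show ?thesis using nres_subgroup normal_iff_normalizes by blast
qed

text \<open>Elements act on a normal cyclic subgroup by power maps, and these commute. Hence, for
  \<open>n\<close> the part of \<open>order G\<close> outside \<open>S\<close>, the elements whose
  \<open>n\<close>-th power centralizes \<open>y\<close> form a normal subgroup. It contains the
  Sylow subgroups for primes outside \<open>S\<close>, and so \<open>res S\<close>. If
  \<open>S\<close> is the class of \<open>q\<close>, then \<open>n\<close> is prime to
  \<open>q\<close> and \<open>n\<close>-th powers still generate \<open>Q\<close>.\<close>

lemma nres_centralizes_cyclic_normal:
  assumes y: "y \<in> carrier G" and Y: "generate G {y} \<lhd> G" and Q: "subgroup Q G" "Q \<subseteq> nres" "card Q = q" "prime q"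
    and x: "x \<in> Q"
  shows "x \<otimes> y = y \<otimes> x"
proof (cases "x = \<one>")
  case False
  have pow: "\<exists>k::nat. z = y [^] k" if "z \<in> generate G {y}" for z
    using that generate_pow_on_finite_carrier[OF finite_carrier y] by blast
  have powmem: "y [^] (k::nat) \<in> generate G {y}" for k
    using generate_pow_on_finite_carrier[OF finite_carrier y] by blast
  have iter: "g [^] m \<otimes> y \<otimes> inv (g [^] m) = y [^] (a ^ m)"
    if g: "g \<in> carrier G" and a: "g \<otimes> y \<otimes> inv g = y [^] a" for g and a m :: nat
  proof (induction m)
    case 0
    then show ?case using y by simp
  next
    case (Suc m)
    let ?z = "g [^] m"
    have z: "?z \<in> carrier G" using g by simp
    have "g [^] Suc m \<otimes> y \<otimes> inv (g [^] Suc m) = ?z \<otimes> (g \<otimes> y \<otimes> inv g) \<otimes> inv ?z"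
      using g y z by (simp add: inv_mult_group m_assoc)
    also have "\<dots> = (y [^] (a ^ m)) [^] a" unfolding a conj_pow[OF z y, symmetric] Suc ..
    also have "\<dots> = y [^] (a ^ Suc m)" using y by (simp add: nat_pow_pow mult.commute)
    finally show ?case .
  qed
  have conj_eq: "g \<otimes> y \<otimes> inv g = y \<longleftrightarrow> g \<otimes> y = y \<otimes> g" if "g \<in> carrier G" for g
    using that y by (metis inv_solve_right m_closed)
  have in_T: "x \<otimes> y = y \<otimes> x \<or> x [^] n \<otimes> y = y \<otimes> x [^] n" if S: "S \<in> \<sigma>" and n: "n = part (-S) (order G)" for S n
  proof -
    define T where "T = {g \<in> carrier G. g [^] n \<otimes> y = y \<otimes> g [^] n}"
    have T: "subgroup T G"
    proof (rule subgroupI)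
      show "T \<subseteq> carrier G" by (auto simp: T_def)
      have "\<one> \<in> T" using y by (simp add: T_def)
      then show "T \<noteq> {}" by blast
      fix g assume g: "g \<in> T"
      then have gc: "g \<in> carrier G" "g [^] n \<in> carrier G" by (auto simp: T_def)
      have "g [^] n \<in> centralizer G (carrier G) {y}" using g gc by (auto simp: T_def centralizer_def)
      then have "inv (g [^] n) \<in> centralizer G (carrier G) {y}"
        using subgroup.m_inv_closed[OF centralizer_subgroup[OF subgroup_self]] y by blast
      then show "inv g \<in> T" using gc by (simp add: T_def centralizer_def nat_pow_inv)
      fix h assume h: "h \<in> T"
      then have hc: "h \<in> carrier G" by (auto simp: T_def)
      have "g \<otimes> y \<otimes> inv g \<in> generate G {y}" "h \<otimes> y \<otimes> inv h \<in> generate G {y}"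
        using normal.inv_op_closed2[OF Y] gc hc generate.incl[of y "{y}" G] by auto
      then obtain a b :: nat where ab: "g \<otimes> y \<otimes> inv g = y [^] a" "h \<otimes> y \<otimes> inv h = y [^] b" using pow by blast
      have "g \<otimes> (h \<otimes> y \<otimes> inv h) \<otimes> inv g = y [^] (a * b)"
      proof -
        have "g \<otimes> y [^] b \<otimes> inv g = (g \<otimes> y \<otimes> inv g) [^] b" using conj_pow[OF gc(1) y] by simp
        then show ?thesis unfolding ab using y by (simp add: nat_pow_pow)
      qed
      then have "g \<otimes> h \<otimes> y \<otimes> inv (g \<otimes> h) = y [^] (a * b)" using gc hc y by (simp add: inv_mult_group m_assoc)
      then have "(g \<otimes> h) [^] n \<otimes> y \<otimes> inv ((g \<otimes> h) [^] n) = y [^] ((a * b) ^ n)"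
        using iter[of "g \<otimes> h"] gc hc by simp
      also have "\<dots> = (y [^] (a ^ n)) [^] (b ^ n)" using y by (simp add: nat_pow_pow power_mult_distrib)
      also have "y [^] (a ^ n) = y" using iter[OF gc(1) ab(1), of n] g conj_eq[OF gc(2)] by (simp add: T_def)
      also have "y [^] (b ^ n) = y" using iter[OF hc ab(2), of n] h conj_eq[of "h [^] n"] hc by (simp add: T_def)
      finally show "g \<otimes> h \<in> T" using conj_eq[of "(g \<otimes> h) [^] n"] gc hc by (simp add: T_def)
    qed
    have nT: "T \<lhd> G"
      unfolding normal_inv_iff
    proof (intro conjI ballI T)
      fix z g assume z: "z \<in> carrier G" and g: "g \<in> T"
      then have gc: "g \<in> carrier G" "g [^] n \<in> carrier G" by (auto simp: T_def)
      note conj_pow[OF z gc(1), of n]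
      moreover have "z \<otimes> g [^] n \<otimes> inv z \<otimes> y = y \<otimes> (z \<otimes> g [^] n \<otimes> inv z)"
      proof -
        have "inv z \<otimes> y \<otimes> z \<in> generate G {y}"
          using normal.inv_op_closed1[OF Y z] generate.incl[of y "{y}" G] by auto
        then obtain k :: nat where k: "inv z \<otimes> y \<otimes> z = y [^] k" using pow by blast
        have "g [^] n \<otimes> y [^] j = y [^] j \<otimes> g [^] n" for j :: nat
        proof (induction j)
          case (Suc j)
          have "g [^] n \<otimes> y [^] Suc j = (g [^] n \<otimes> y [^] j) \<otimes> y" using gc y by (simp add: m_assoc)
          also have "\<dots> = y [^] j \<otimes> (g [^] n \<otimes> y)" unfolding Suc using gc y by (simp add: m_assoc)
          also have "g [^] n \<otimes> y = y \<otimes> g [^] n" using g by (simp add: T_def)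
          finally show ?case using gc y by (simp add: m_assoc)
        qed (use gc in simp)
        then have e: "g [^] n \<otimes> (inv z \<otimes> y \<otimes> z) = (inv z \<otimes> y \<otimes> z) \<otimes> g [^] n" unfolding k .
        have "z \<otimes> g [^] n \<otimes> inv z \<otimes> y = z \<otimes> (g [^] n \<otimes> (inv z \<otimes> y \<otimes> z)) \<otimes> inv z"
          using z gc y by (simp add: m_assoc)
        also have "\<dots> = y \<otimes> (z \<otimes> g [^] n \<otimes> inv z)" unfolding e using z gc y by (simp add: m_assoc)
        finally show ?thesis .
      qed
      ultimately show "z \<otimes> g \<otimes> inv z \<in> T" using z gc by (simp add: T_def)
    qed
    have Tpos: "card T > 0" using card_subgroup_pos[OF T] .
    have "part (-S) (order G) dvd card T"
      unfolding part_dvd_iff[OF Tpos]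
    proof (intro ballI impI)
      fix p assume pS: "p \<in> -S" and p: "prime p"
      let ?m = "multiplicity p (order G)"
      obtain P where P: "subgroup P G" "card P = p ^ ?m"
        using sylow_exists[OF subgroup_self p, of ?m] multiplicity_dvd[of p "order G"] by (auto simp: order_def)
      have "P \<subseteq> T"
      proof
        fix g assume g: "g \<in> P"
        have gc: "g \<in> carrier G" using subgroup.mem_carrier[OF P(1) g] .
        have "p ^ multiplicity p n dvd n" by (rule multiplicity_dvd)
        moreover have "multiplicity p n = ?m" using pS p n by (simp add: multiplicity_part)
        ultimately obtain j where j: "n = p ^ ?m * j" by (auto elim: dvdE)
        have "g [^] n = (g [^] (p ^ ?m)) [^] j" using gc j by (simp add: nat_pow_pow)
        then have "g [^] n = \<one>" using pow_card_eq_one[OF P(1) g] P(2) by simp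
        then show "g \<in> T" using gc y by (simp add: T_def)
      qed
      then have "p ^ ?m dvd card T" using card_subgroup_dvd[OF P(1) T] P(2) by simp
      then show "?m \<le> multiplicity p (card T)" using p Tpos by (intro multiplicity_geI) auto
    qed
    then have "part (-S) (part (-S) (order G)) dvd part (-S) (card T)" using Tpos by (rule part_dvd_mono)
    moreover have "part (-S) (card T) dvd part (-S) (order G)"
      using part_dvd_mono[OF card_subgroup_dvd_order[OF T]] by simp
    ultimately have "part (-S) (card T) = part (-S) (order G)" by (simp add: dvd_antisym)
    then have "res S \<subseteq> T" using res_least nT by blast
    then have "x \<in> T" using x Q(2) nres_subset[OF S] by blast
    then show ?thesis by (simp add: T_def)
  qed
  obtain S where S: "S \<in> \<sigma>" "q \<in> S" using sigma_cover[OF Q(4)] by blast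
  let ?n = "part (-S) (order G)"
  have xc: "x \<in> carrier G" using subgroup.mem_carrier[OF Q(1) x] .
  have "\<not> q dvd ?n"
  proof -
    have "multiplicity q ?n = 0" using S Q(4) by (simp add: multiplicity_part)
    moreover have "q dvd ?n \<Longrightarrow> multiplicity q ?n > 0"
      using Q(4) by (simp add: prime_multiplicity_gt_zero_iff)
    ultimately show ?thesis by auto
  qed
  then have cop: "coprime q ?n" using Q(4) prime_imp_coprime by blast
  have ne: "x [^] ?n \<noteq> \<one>"
    using pow_eq_one_coprime[OF xc _ _ cop] pow_card_eq_one[OF Q(1) x] Q(3) False by auto
  have xnQ: "x [^] ?n \<in> Q" using subgroup_nat_pow_closed[OF Q(1) x] .
  show ?thesis
  proof (rule ccontr)
    assume nc: "x \<otimes> y \<noteq> y \<otimes> x"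
    then have "x [^] ?n \<otimes> y = y \<otimes> x [^] ?n" using in_T[OF S(1) refl] by blast
    then have "x [^] ?n \<in> centralizer G (carrier G) {y}" using xc by (simp add: centralizer_def)
    then have "Q \<subseteq> centralizer G (carrier G) {y}"
      using prime_order_generator[OF Q(1,3,4) centralizer_subgroup[OF subgroup_self] _ xnQ ne] y by blast
    then show False using x nc by (auto simp: centralizer_def)
  qed
qed (use y in simp)

text \<open>Induction on the order. For the least prime \<open>q\<close> no prime divisor of
  \<open>card K\<close> divides \<open>q - 1\<close>, so Burnside's transfer gives a complement of a
  subgroup \<open>Q\<close> of order \<open>q\<close>. A power equation makes the complement normal
  in \<open>G\<close>, so it is cyclic by induction and centralized by \<open>Q\<close>.\<close>

lemma normal_in_nres_cyclic:
  assumes sq: "squarefree (card nres)"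
  shows "K \<lhd> G \<Longrightarrow> K \<subseteq> nres \<Longrightarrow> \<exists>y\<in>carrier G. K = generate G {y}"
proof (induction "card K" arbitrary: K rule: less_induct)
  case less
  have sK: "subgroup K G" using less.prems normal_imp_subgroup by blast
  have KG: "K \<subseteq> carrier G" using sK subgroup.subset by blast
  have Kpos: "card K > 0" using card_subgroup_pos[OF sK] .
  show ?case
  proof (cases "card K = 1")
    case True
    then have "K = {\<one>}" using subgroup.one_closed[OF sK] by (metis card_1_singletonE singletonD)
    moreover have "generate G {\<one>} = {\<one>}"
      using generate_subgroup_incl[OF _ triv_subgroup, of "{\<one>}"] generate.one[of G "{\<one>}"] by auto
    ultimately show ?thesis by auto
  next
    case False
    then have ex: "\<exists>q. prime q \<and> q dvd card K" using prime_factor_nat by blast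
    define q where "q = (LEAST q. prime q \<and> q dvd card K)"
    have q: "prime q" "q dvd card K" using LeastI_ex[OF ex] by (auto simp: q_def)
    have qmin: "q \<le> r" if "prime r" "r dvd card K" for r unfolding q_def using that by (intro Least_le) auto
    obtain Q where Q: "subgroup Q G" "Q \<subseteq> K" "card Q = q" using cauchy_exists[OF sK q] .
    have q2: "\<not> q\<^sup>2 dvd card K"
    proof
      assume "q\<^sup>2 dvd card K"
      then have "q\<^sup>2 dvd card nres" using card_subgroup_dvd[OF sK nres_subgroup less.prems(2)] dvd_trans by blast
      then have "q dvd 1" using squarefreeD[OF sq] by blast
      then show False using prime_gt_1_nat[OF q(1)] by simp
    qed
    have r: "\<not> r dvd q - 1" if r: "prime r" "r dvd card (normalizer_in G K Q)" "r \<noteq> q" for r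
    proof
      assume d: "r dvd q - 1"
      have "r dvd card K"
        using r(2) card_subgroup_dvd[OF normalizer_in_subgroup[OF sK Q(1)] sK] dvd_trans
        by (auto simp: normalizer_in_def)
      then have "q \<le> r" using qmin r(1) by blast
      moreover have "r \<le> q - 1" using d prime_gt_1_nat[OF q(1)] by (intro dvd_imp_le) auto
      ultimately show False using prime_gt_1_nat[OF q(1)] by linarith
    qed
    obtain m where m: "card K = q * m" using q(2) by (auto elim: dvdE)
    have qm: "\<not> q dvd m" using q2 m by (auto simp: power2_eq_square)
    define T where "T = {x \<in> K. x [^] m = \<one>}"
    have T: "subgroup T G" "card T = m"
      using burnside_prime_complement_subgroup[OF sK Q q(1) m qm
          normalizer_centralizes_prime_order[OF sK Q q(1) q2 r]] by (auto simp: T_def)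
    have TK: "T \<subseteq> K" by (auto simp: T_def)
    have "normalizes G (carrier G) T"
      unfolding T_def by (rule normalizes_pow_set[OF order_refl KG normal_normalizes[OF less.prems(1) order_refl]])
    then have nT: "T \<lhd> G" using T normal_iff_normalizes by blast
    have "m > 0" using m Kpos by (cases m) auto
    then have "m < card K" using m prime_gt_1_nat[OF q(1)] by simp
    then obtain y where y: "y \<in> carrier G" "T = generate G {y}"
      using less.hyps[OF _ nT] T(2) TK less.prems(2) by blast
    have "Q \<noteq> {\<one>}" using Q(3) prime_gt_1_nat[OF q(1)] by auto
    then obtain x where x: "x \<in> Q" "x \<noteq> \<one>" using subgroup.one_closed[OF Q(1)] by blast
    have xc: "x \<in> carrier G" using subgroup.mem_carrier[OF Q(1) x(1)] .
    have QD: "Q \<subseteq> nres" using Q(2) less.prems(2) by blast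
    have comm: "x \<otimes> y = y \<otimes> x"
      using nres_centralizes_cyclic_normal[OF y(1) _ Q(1) QD Q(3) q(1) x(1)] nT y(2) by simp
    have yT: "y \<in> T" using y(2) generate.incl[of y "{y}" G] by simp
    \<comment> \<open>The generator: a product of commuting elements of the coprime orders
      \<open>q\<close> and \<open>m\<close>.\<close>
    let ?z = "x \<otimes> y"
    have zc: "?z \<in> carrier G" using xc y by simp
    have copqm: "coprime q m" using q(1) qm prime_imp_coprime by blast
    have QT: "Q \<inter> T = {\<one>}" using card_Int_coprime[OF Q(1) T(1)] Q(3) T(2) copqm by simp
    have ordx: "ord x = q"
    proof -
      have "ord x dvd q" using pow_card_eq_one[OF Q(1) x(1)] Q(3) xc pow_eq_id by metis
      moreover have "ord x \<noteq> 1" using x(2) xc ord_eq_1 by blast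
      ultimately show ?thesis using q(1) by (metis prime_nat_iff)
    qed
    have ordy: "ord y = m" using generate_pow_card[OF y(1)] y(2) T(2) by simp
    have "q * m dvd ord ?z"
    proof -
      let ?n = "ord ?z"
      have e: "x [^] ?n \<otimes> y [^] ?n = \<one>"
        using pow_ord_eq_1[OF zc] pow_mult_distrib[OF comm xc y(1), of ?n] by simp
      have xn: "x [^] ?n \<in> Q"
        using subgroup_nat_pow_closed[OF Q(1) x(1)] .
      have yn: "y [^] ?n \<in> T"
        using subgroup_nat_pow_closed[OF T(1) yT] .
      have "x [^] ?n = inv (y [^] ?n)" using e xc y(1) by (simp add: inv_equality)
      then have "x [^] ?n \<in> Q \<inter> T" using xn subgroup.m_inv_closed[OF T(1) yn] by simp
      then have x1: "x [^] ?n = \<one>" using QT by simp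
      then have "y [^] ?n = \<one>" using e y(1) by simp
      then have "q dvd ?n" "m dvd ?n" using x1 ordx ordy pow_eq_id xc y(1) by blast+
      then show ?thesis using copqm by (simp add: divides_mult)
    qed
    then have "card K dvd card (generate G {?z})" using m generate_pow_card[OF zc] by simp
    moreover have sub: "generate G {?z} \<subseteq> K"
      using generate_subgroup_incl[OF _ sK] subgroup.m_closed[OF sK, of x y] x(1) Q(2) yT TK by auto
    moreover have gz: "subgroup (generate G {?z}) G" using generate_is_subgroup zc by simp
    ultimately have "generate G {?z} = K"
      using finite_subgroup[OF sK] dvd_imp_le card_subgroup_pos[OF gz] by (intro card_seteq) auto
    then show ?thesis using zc by blast
  qed
qed

section \<open>Primary components of the residual and its complement\<close>

lemma cyclic_nres_commute:
  assumes y: "y \<in> carrier G" "A = generate G {y}" and ab: "a \<in> A" "b \<in> A"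
  shows "a \<otimes> b = b \<otimes> a"
proof -
  have *: "\<exists>k::nat. z = y [^] k" if "z \<in> A" for z
    using that generate_pow_on_finite_carrier[OF finite_carrier y(1)] y(2) by blast
  obtain i j :: nat where ij: "a = y [^] i" "b = y [^] j" using *[OF ab(1)] *[OF ab(2)] by blast
  show ?thesis unfolding ij using y(1) by (simp add: nat_pow_mult add.commute)
qed

text \<open>When \<open>nres\<close> is cyclic and the prime \<open>p\<close> divides its order,
  this is its subgroup of order \<open>p\<close>; the power equation makes it normal in
  \<open>G\<close>.\<close>

definition "nres_part p = {x \<in> nres. x [^] (p::nat) = \<one>}"

lemma nres_part_props:
  assumes sq: "squarefree (card nres)" and cyc: "y \<in> carrier G" "nres = generate G {y}"
    and p: "prime p" "p dvd card nres"
  shows "nres_part p \<lhd> G" "card (nres_part p) = p"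
proof -
  note c = subgroup.mem_carrier[OF nres_subgroup]
  have s: "subgroup (nres_part p) G"
  proof (rule subgroupI)
    show "nres_part p \<subseteq> carrier G" using c by (auto simp: nres_part_def)
    have "\<one> \<in> nres_part p" using subgroup.one_closed[OF nres_subgroup] by (simp add: nres_part_def)
    then show "nres_part p \<noteq> {}" by blast
    fix a assume a: "a \<in> nres_part p"
    then show "inv a \<in> nres_part p"
      using c subgroup.m_inv_closed[OF nres_subgroup] by (simp add: nres_part_def nat_pow_inv)
    fix b assume b: "b \<in> nres_part p"
    have ab: "a \<in> nres" "b \<in> nres" using a b by (auto simp: nres_part_def)
    have "(a \<otimes> b) [^] p = a [^] p \<otimes> b [^] p"
      using pow_mult_distrib[OF cyclic_nres_commute[OF cyc ab] c[OF ab(1)] c[OF ab(2)]] .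
    then show "a \<otimes> b \<in> nres_part p"
      using a b subgroup.m_closed[OF nres_subgroup ab] by (simp add: nres_part_def)
  qed
  have "normalizes G (carrier G) (nres_part p)"
    unfolding nres_part_def
    by (rule normalizes_pow_set[OF order_refl subgroup.subset[OF nres_subgroup] normal_normalizes[OF nres_normal order_refl]])
  then show "nres_part p \<lhd> G" using s normal_iff_normalizes by blast
  have "part {p} (card (nres_part p)) = card (nres_part p)"
    by (rule part_singleton_self_iff[OF s p(1), of 1]) (simp add: nres_part_def)
  then obtain k where k: "card (nres_part p) = p ^ k" using prime_power_part_self p(1) by blast
  have dvd: "card (nres_part p) dvd card nres"
    using card_subgroup_dvd[OF s nres_subgroup] by (auto simp: nres_part_def)
  have "k \<le> 1"
  proof (rule ccontr)
    assume "\<not> k \<le> 1"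
    then have "p\<^sup>2 dvd p ^ k" by (intro le_imp_power_dvd) auto
    then have "p dvd 1" using squarefreeD[OF sq] dvd k dvd_trans by metis
    then show False using prime_gt_1_nat[OF p(1)] by simp
  qed
  obtain R where R: "subgroup R G" "R \<subseteq> nres" "card R = p" using cauchy_exists[OF nres_subgroup p] .
  have "R \<subseteq> nres_part p" using R pow_card_eq_one[OF R(1)] by (auto simp: nres_part_def)
  then have "p dvd card (nres_part p)" using card_subgroup_dvd[OF R(1) s] R(3) by simp
  then have "k \<noteq> 0" using k prime_gt_1_nat[OF p(1)] by (intro notI) simp
  with \<open>k \<le> 1\<close> have "k = 1" by linarith
  then show "card (nres_part p) = p" using k by simp
qed

text \<open>The \<open>S\<close>-part of \<open>card nres\<close> divides every prime of
  \<open>S\<close> in \<open>order G\<close>; when nontrivial it is therefore the only such prime.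
  The complement of \<open>nres\<close> is an intersection of complements of its primary components,
  one for each class.\<close>

lemma res_dvd_imp_nres_structure:
  assumes dvd: "\<And>S r. S \<in> \<sigma> \<Longrightarrow> r \<in> S \<Longrightarrow> r dvd order G \<Longrightarrow> part S (card (res S)) dvd r"
  shows "squarefree (card nres)" "\<exists>y\<in>carrier G. nres = generate G {y}"
    "\<And>S p. S \<in> \<sigma> \<Longrightarrow> p \<in> S \<Longrightarrow> p dvd card nres \<Longrightarrow> part S (card nres) = p"
    "\<And>S p. S \<in> \<sigma> \<Longrightarrow> p \<in> S \<Longrightarrow> p dvd card nres \<Longrightarrow> S \<inter> prime_factors (order G) = {p}"
    "\<exists>M. subgroup M G \<and> nres <#> M = carrier G \<and> nres \<inter> M = {\<one>}"
proof -
  have npos: "card nres > 0" using card_subgroup_pos[OF nres_subgroup] .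
  have ndvd: "card nres dvd order G" using card_subgroup_dvd_order[OF nres_subgroup] .
  have sp: "p dvd part S (card nres)" if "S \<in> \<sigma>" "p \<in> S" "p dvd card nres" for S p
    using part_dvd_mono[OF that(3) npos, of S] part_prime[OF sigma_prime[OF that(1,2)], of S] that(2) by simp
  show A: "part S (card nres) = p" if S: "S \<in> \<sigma>" "p \<in> S" "p dvd card nres" for S p
  proof -
    have "p dvd order G" using S(3) ndvd dvd_trans by blast
    then have "part S (card nres) dvd p" using dvd[OF S(1,2)] part_nres[OF S(1)] by simp
    then show ?thesis using sp[OF S] dvd_antisym by blast
  qed
  show B: "S \<inter> prime_factors (order G) = {p}" if S: "S \<in> \<sigma>" "p \<in> S" "p dvd card nres" for S p
  proof -
    have "r = p" if r: "r \<in> S" "r \<in> prime_factors (order G)" for r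
    proof -
      have "r dvd order G" using r(2) by (simp add: in_prime_factors_iff)
      then have "p dvd r" using dvd[OF S(1) r(1)] part_nres[OF S(1)] A[OF S] by simp
      then show ?thesis using sigma_prime[OF S(1)] S(2) r(1) primes_dvd_imp_eq by blast
    qed
    moreover have "p \<in> prime_factors (order G)"
      using S sigma_prime[OF S(1,2)] ndvd dvd_trans by (auto simp: in_prime_factors_iff intro: dvd_trans)
    ultimately show ?thesis using S(2) by blast
  qed
  show sq: "squarefree (card nres)"
  proof (rule ccontr)
    assume "\<not> squarefree (card nres)"
    then obtain p where p: "prime p" "p\<^sup>2 dvd card nres"
      using squarefree_factorial_semiring[of "card nres"] npos by auto
    obtain S where S: "S \<in> \<sigma>" "p \<in> S" using sigma_cover[OF p(1)] by blast
    have "p dvd card nres" using p(2) by (metis dvd_mult_left power2_eq_square)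
    then have "part S (card nres) = p" using A[OF S] by blast
    moreover have "p\<^sup>2 dvd part S (card nres)"
      using part_dvd_mono[OF p(2) npos, of S] part_prime_power[OF p(1), of S 2] S(2) by simp
    ultimately have "p ^ 2 dvd p ^ 1" by simp
    then show False using power_dvd_imp_le[of p 2 1] prime_gt_1_nat[OF p(1)] by simp
  qed
  show cyc: "\<exists>y\<in>carrier G. nres = generate G {y}"
    using normal_in_nres_cyclic[OF sq nres_normal order_refl] .
  then obtain y where y: "y \<in> carrier G" "nres = generate G {y}" by blast
  \<comment> \<open>A nontrivial element centralized by \<open>res S\<close> would make all of
    \<open>nres_part p\<close> central in \<open>res S\<close>, which
    \<open>not_normal_hall_complement\<close> forbids; so the crossed homomorphism gives a
    complement.\<close>
  have comp: "\<exists>M. subgroup M G \<and> card M * p = order G \<and> nres_part p \<inter> M = {\<one>}"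
    if S: "S \<in> \<sigma>" "p \<in> S" "p dvd card nres" for S p
  proof -
    have pp: "prime p" using sigma_prime[OF S(1,2)] .
    note R = nres_part_props[OF sq y pp S(3)]
    have sR: "subgroup (nres_part p) G" using R(1) normal_imp_subgroup by blast
    have sub: "nres_part p \<subseteq> res S" using nres_subset[OF S(1)] by (auto simp: nres_part_def)
    have pc: "part S (card (res S)) = card (nres_part p)" using A[OF S] part_nres[OF S(1)] R(2) by simp
    have p1: "card (nres_part p) \<noteq> 1" using R(2) prime_gt_1_nat[OF pp] by simp
    let ?k = "part (-S) (card (res S))"
    have k: "card (res S) = card (nres_part p) * ?k"
      using part_mult_compl[OF card_subgroup_pos[OF res_subgroup], of S S] pc by simp
    have "part S (card (nres_part p)) = card (nres_part p)" using R(2) part_prime[OF pp, of S] S(2) by simp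
    then have cop: "coprime (card (nres_part p)) ?k"
      using part_coprime[of S "card (nres_part p)" ?k] card_subgroup_pos[OF sR] by simp
    obtain a b where ab: "a \<in> nres_part p" "b \<in> res S" "a \<otimes> b \<noteq> b \<otimes> a"
      using not_normal_hall_complement[OF S(1) sR sub pc p1] by blast
    have triv: "x = \<one>" if x: "x \<in> nres_part p" "\<And>z. z \<in> res S \<Longrightarrow> z \<otimes> x = x \<otimes> z" for x
    proof (rule ccontr)
      assume ne: "x \<noteq> \<one>"
      have xc: "x \<in> centralizer G (carrier G) (res S)"
        unfolding centralizer_def using x(1) subgroup.mem_carrier[OF sR x(1)] x(2)[symmetric] by blast
      have "nres_part p \<subseteq> centralizer G (carrier G) (res S)"
        by (rule prime_order_generator[OF sR R(2) pp
              centralizer_subgroup[OF subgroup_self subgroup.subset[OF res_subgroup]] xc x(1) ne])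
      then show False using ab unfolding centralizer_def by blast
    qed
    have comm: "u \<otimes> v = v \<otimes> u" if "u \<in> nres_part p" "v \<in> nres_part p" for u v
      using cyclic_nres_commute[OF y] that by (simp add: nres_part_def)
    obtain M where M: "subgroup M G" "nres_part p \<inter> M = {\<one>}" "nres_part p <#> M = carrier G"
      by (rule normal_hall_complement[OF R(1) res_normal sub _ k cop]) (use comm triv in blast)+
    have "card M * p = order G" using card_set_mult[OF sR M(1)] M R(2) by (simp add: order_def)
    then show ?thesis using M by blast
  qed
  define F where "F = sigma_of \<sigma> (card nres)"
  have F: "finite F" "F \<subseteq> \<sigma>" using finite_sigma_of by (auto simp: F_def sigma_of_def)
  have "\<forall>S\<in>F. \<exists>p. p \<in> S \<and> p dvd card nres"
    by (auto simp: F_def sigma_of_def in_prime_factors_iff)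
  then obtain q where q: "\<And>S. S \<in> F \<Longrightarrow> q S \<in> S \<and> q S dvd card nres" by metis
  have "\<forall>S\<in>F. \<exists>M. subgroup M G \<and> card M * q S = order G \<and> nres_part (q S) \<inter> M = {\<one>}"
    using comp q F(2) by blast
  then obtain U where U: "\<And>S. S \<in> F \<Longrightarrow> subgroup (U S) G \<and> card (U S) * q S = order G \<and> nres_part (q S) \<inter> U S = {\<one>}"
    by metis
  have qp: "prime (q S)" if "S \<in> F" for S using q[OF that] F(2) that sigma_prime by blast
  have parts: "part T (card (U S)) * part T (q S) = part T (order G)" if "S \<in> F" for S T
    using U[OF that] part_mult[OF card_subgroup_pos[of "U S"] prime_gt_0_nat[OF qp[OF that]], of T] by auto
  \<comment> \<open>The index of \<open>U S\<close> is the prime \<open>q S\<close> of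
    \<open>S\<close>, so the part of the intersection outside the classes of \<open>F\<close> stays
    full.\<close>
  let ?M = "carrier G \<inter> (\<Inter>S\<in>F. U S)"
  have Ms: "subgroup ?M G \<and> (\<forall>T\<in>\<sigma>. part T (card ?M) = (if T \<in> F then part T (card (U T)) else part T (order G)))"
  proof (rule coprime_index_Inter[OF F])
    fix S assume S: "S \<in> F"
    have "part (-S) (q S) = 1" using part_prime[OF qp[OF S]] q[OF S] by simp
    then show "subgroup (U S) G \<and> part (-S) (card (U S)) = part (-S) (order G)"
      using parts[OF S, of "-S"] U[OF S] by simp
  qed
  then have sM: "subgroup ?M G" by blast
  have sI: "subgroup (nres \<inter> ?M) G" using nres_subgroup sM subgroups_Inter_pair by blast
  \<comment> \<open>A nontrivial intersection contains a subgroup of prime order, which would lie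
    both in a primary component and in the complement of that component.\<close>
  have I1: "nres \<inter> ?M = {\<one>}"
  proof (rule ccontr)
    assume "nres \<inter> ?M \<noteq> {\<one>}"
    then have "card (nres \<inter> ?M) \<noteq> 1" using subgroup.one_closed[OF sI] by (metis card_1_singletonE singletonD)
    then obtain p where p: "prime p" "p dvd card (nres \<inter> ?M)" using prime_factor_nat by blast
    obtain R where R: "subgroup R G" "R \<subseteq> nres \<inter> ?M" "card R = p" using cauchy_exists[OF sI p] .
    have pn: "p dvd card nres" using card_subgroup_dvd[OF R(1) nres_subgroup] R by auto
    obtain S where S: "S \<in> \<sigma>" "p \<in> S" using sigma_cover[OF p(1)] by blast
    have SF: "S \<in> F" using S pn p(1) npos by (auto simp: F_def sigma_of_def in_prime_factors_iff)
    have "q S = p" using A[OF S pn] A[OF S(1)] q[OF SF] by metis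
    moreover have "R \<subseteq> nres_part p" using R pow_card_eq_one[OF R(1)] by (auto simp: nres_part_def)
    moreover have "R \<subseteq> U S" using R(2) SF by blast
    ultimately have "R \<subseteq> {\<one>}" using U[OF SF] by blast
    then have "card R \<le> 1" using card_mono[of "{\<one>}" R] by simp
    then show False using R(3) prime_gt_1_nat[OF p(1)] by simp
  qed
  have "card nres * card ?M = order G"
  proof (rule sigma_eqI)
    fix S assume S: "S \<in> \<sigma>"
    show "part S (card nres * card ?M) = part S (order G)"
    proof (cases "S \<in> F")
      case True
      have "part S (card ?M) = part S (card (U S))" using Ms S True by simp
      moreover have "part S (card nres) = q S" using A[OF S] q[OF True] by blast
      moreover have "part S (q S) = q S" using part_prime[OF qp[OF True]] q[OF True] by simp
      ultimately show ?thesis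
        using parts[OF True, of S] part_mult[OF npos card_subgroup_pos[OF sM], of S] by (simp add: mult.commute)
    next
      case False
      then have "part S (card nres) = 1" using not_sigma_of[OF npos S] by (simp add: F_def)
      moreover have "part S (card ?M) = part S (order G)" using Ms S False by simp
      ultimately show ?thesis using part_mult[OF npos card_subgroup_pos[OF sM], of S] by simp
    qed
  qed (use npos card_subgroup_pos[OF sM] in auto)
  then have "card (nres <#> ?M) = order G" using card_set_mult[OF nres_subgroup sM] I1 by simp
  then have "nres <#> ?M = carrier G"
    using setmult_subset_G[OF subgroup.subset[OF nres_subgroup] subgroup.subset[OF sM]]
    by (intro card_subset_eq) (auto simp: order_def)
  then show "\<exists>M. subgroup M G \<and> nres <#> M = carrier G \<and> nres \<inter> M = {\<one>}" using sM I1 by blast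
qed

end

section \<open>Constructing embedded subgroups\<close>

context fin_group
begin

lemma normalizes_restrict:
  assumes "subgroup P G" "L \<subseteq> P"
  shows "normalizes (G\<lparr>carrier := P\<rparr>) L U \<longleftrightarrow> normalizes G L U"
  using m_inv_consistent[OF assms(1)] assms(2) by (auto simp: normalizes_def subset_iff)

text \<open>A subgroup of order \<open>p\<close> in the centre of the quotient of \<open>P\<close>
  by \<open>C\<close> is pulled back.\<close>

lemma p_group_normal_extension:
  assumes P: "subgroup P G" "card P = p ^ n" "prime p" and C: "subgroup C G" "C \<subseteq> P" "card C = p ^ k" "normalizes G P C"
    and k: "k < n"
  obtains C' where "subgroup C' G" "C \<subseteq> C'" "C' \<subseteq> P" "card C' = p ^ Suc k" "normalizes G P C'"
proof -
  let ?L = "G\<lparr>carrier := P\<rparr>"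
  interpret L: fin_group ?L using fin_group_subgroup[OF P(1)] .
  have CL: "C \<lhd> ?L"
    using L.normal_iff_normalizes subgroup_incl[OF C(1) P(1) C(2)] normalizes_restrict[OF P(1) order_refl] C(4)
    by simp
  interpret e: fin_epi ?L "?L Mod C" "\<lambda>x. C #>\<^bsub>?L\<^esub> x" by (rule L.fin_epi_Mod(1)[OF CL])
  let ?H = "?L Mod C"
  have ker: "e.ker = C" by (rule L.fin_epi_Mod(2)[OF CL])
  have "order ?H * p ^ k = p ^ n" using e.card_ker_mult ker C(3) P(2) by (simp add: order_def)
  moreover have "p ^ n = p ^ (n - k) * p ^ k" using k by (simp flip: power_add)
  ultimately have H: "order ?H = p ^ (n - k)" using prime_gt_0_nat[OF P(3)] by simp
  have H': "card (carrier ?H) = p ^ (n - k)" using H by (simp add: order_def)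
  have pH: "p dvd card (carrier ?H)" using H' k by simp
  have nH: "normalizes ?H (carrier ?H) (carrier ?H)" by (rule e.H.normalizes_self[OF e.H.subgroup_self])
  let ?Z = "centralizer ?H (carrier ?H) (carrier ?H)"
  have sZ: "subgroup ?Z ?H" by (rule e.H.centralizer_subgroup[OF e.H.subgroup_self order_refl])
  have "\<exists>u\<in>carrier ?H. u \<noteq> \<one>\<^bsub>?H\<^esub> \<and> (\<forall>g\<in>carrier ?H. g \<otimes>\<^bsub>?H\<^esub> u = u \<otimes>\<^bsub>?H\<^esub> g)"
    by (rule e.H.p_group_centralizes_element[OF e.H.subgroup_self H' P(3) nH e.H.subgroup_self pH]) blast
  then obtain u where u: "u \<in> ?Z" "u \<noteq> \<one>\<^bsub>?H\<^esub>" unfolding centralizer_def by force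
  have "card ?Z \<noteq> 1" using u subgroup.one_closed[OF sZ] by (metis card_1_singletonE singletonD)
  moreover have "card ?Z dvd p ^ (n - k)" using e.H.card_subgroup_dvd_order[OF sZ] H by simp
  then obtain j where j: "card ?Z = p ^ j" using P(3) by (auto simp: divides_primepow_nat)
  ultimately have "p dvd card ?Z" by (cases j) auto
  then obtain R where R: "subgroup R ?H" "R \<subseteq> ?Z" "card R = p" using e.H.cauchy_exists[OF sZ P(3)] by blast
  have Rc: "R \<subseteq> carrier ?H" using subgroup.subset[OF R(1)] .
  have "normalizes ?H (carrier ?H) R"
    unfolding normalizes_def
  proof (intro ballI)
    fix l v assume l: "l \<in> carrier ?H" and v: "v \<in> R"
    have vc: "v \<in> carrier ?H" using v Rc by blast
    have "v \<otimes>\<^bsub>?H\<^esub> l = l \<otimes>\<^bsub>?H\<^esub> v" using v R(2) l unfolding centralizer_def by blast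
    then have "l \<otimes>\<^bsub>?H\<^esub> v \<otimes>\<^bsub>?H\<^esub> inv\<^bsub>?H\<^esub> l = v \<otimes>\<^bsub>?H\<^esub> l \<otimes>\<^bsub>?H\<^esub> inv\<^bsub>?H\<^esub> l" by metis
    also have "\<dots> = v" using e.H.m_assoc[OF vc l e.H.inv_closed[OF l]] e.H.r_inv[OF l] e.H.r_one[OF vc] by metis
    finally show "l \<otimes>\<^bsub>?H\<^esub> v \<otimes>\<^bsub>?H\<^esub> inv\<^bsub>?H\<^esub> l \<in> R" using v by metis
  qed
  then have "R \<lhd> ?H" using R(1) e.H.normal_iff_normalizes by blast
  then have pR: "e.pre R \<lhd> ?L" by (rule e.pre_normal)
  have s: "subgroup (e.pre R) ?L" using pR normal_imp_subgroup by blast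
  show thesis
  proof (rule that)
    show "subgroup (e.pre R) G" using incl_subgroup[OF P(1) s] .
    show "C \<subseteq> e.pre R" using e.ker_subset_pre[OF R(1)] ker by simp
    show "e.pre R \<subseteq> P" using subgroup.subset[OF s] by simp
    show "card (e.pre R) = p ^ Suc k" using e.card_pre[OF R(1)] ker R(3) C(3) by simp
    show "normalizes G P (e.pre R)"
      using pR L.normal_iff_normalizes normalizes_restrict[OF P(1) order_refl] by simp
  qed
qed

lemma p_group_normal_chain:
  assumes P: "subgroup P G" "card P = p ^ n" "prime p" and C: "subgroup C G" "C \<subseteq> P" "card C = p" "normalizes G P C"
  shows "1 \<le> k \<Longrightarrow> k \<le> n \<Longrightarrow>
    \<exists>B. subgroup B G \<and> C \<subseteq> B \<and> B \<subseteq> P \<and> card B = p ^ k \<and> normalizes G P B"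
proof (induction k rule: dec_induct)
  case base
  then show ?case using C by auto
next
  case (step k)
  then obtain B where B: "subgroup B G" "C \<subseteq> B" "B \<subseteq> P" "card B = p ^ k" "normalizes G P B" by auto
  obtain B' where "subgroup B' G" "B \<subseteq> B'" "B' \<subseteq> P" "card B' = p ^ Suc k" "normalizes G P B'"
    using p_group_normal_extension[OF P B(1,3,4,5)] step.prems by auto
  then show ?case using B(2) by blast
qed

text \<open>The Hall subgroup of an abelian group for an arbitrary set \<open>Q\<close> of primes:
  Sylow subgroups for primes in \<open>Q\<close> satisfy the equation, and elements of any other
  prime order do not.\<close>

lemma card_pow_set_abelian:
  assumes D: "subgroup D G" and comm: "\<And>x y. x \<in> D \<Longrightarrow> y \<in> D \<Longrightarrow> x \<otimes> y = y \<otimes> x"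
    and d: "d = part Q (card D)"
  shows "subgroup {x \<in> D. x [^] d = \<one>} G" "card {x \<in> D. x [^] d = \<one>} = d"
proof -
  let ?B = "{x \<in> D. x [^] d = \<one>}"
  note c = subgroup.mem_carrier[OF D]
  show s: "subgroup ?B G"
  proof (rule subgroupI)
    show "?B \<subseteq> carrier G" using c by auto
    have "\<one> \<in> ?B" using subgroup.one_closed[OF D] by simp
    then show "?B \<noteq> {}" by blast
    fix a assume a: "a \<in> ?B"
    then show "inv a \<in> ?B" using c subgroup.m_inv_closed[OF D] by (simp add: nat_pow_inv)
    fix b assume b: "b \<in> ?B"
    have ab: "a \<in> D" "b \<in> D" using a b by auto
    have "(a \<otimes> b) [^] d = a [^] d \<otimes> b [^] d"
      using pow_mult_distrib[OF comm[OF ab] c[OF ab(1)] c[OF ab(2)]] .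
    then show "a \<otimes> b \<in> ?B" using a b subgroup.m_closed[OF D ab] by simp
  qed
  note Bpos = card_subgroup_pos[OF s] and Dpos = card_subgroup_pos[OF D]
  have BD: "card ?B dvd card D" using card_subgroup_dvd[OF s D] by blast
  have "part Q (card D) = card ?B"
  proof (rule part_eqI[OF Bpos])
    fix p :: nat assume p: "prime p"
    show "multiplicity p (card ?B) = (if p \<in> Q then multiplicity p (card D) else 0)"
    proof (cases "p \<in> Q")
      case True
      let ?m = "multiplicity p (card D)"
      obtain P where P: "subgroup P G" "P \<subseteq> D" "card P = p ^ ?m" using sylow_exists[OF D p multiplicity_dvd] .
      have "multiplicity p d = ?m" using True p d by (simp add: multiplicity_part)
      then have "p ^ ?m dvd d" using multiplicity_dvd[of p d] by simp
      then obtain j where j: "d = p ^ ?m * j" by (auto elim: dvdE)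
      have "P \<subseteq> ?B"
      proof
        fix x assume x: "x \<in> P"
        have "x [^] d = (x [^] (p ^ ?m)) [^] j" using subgroup.mem_carrier[OF P(1) x] j by (simp add: nat_pow_pow)
        then show "x \<in> ?B" using x P pow_card_eq_one[OF P(1) x] by auto
      qed
      then have "p ^ ?m dvd card ?B" using card_subgroup_dvd[OF P(1) s] P(3) by simp
      then have "?m \<le> multiplicity p (card ?B)" using p Bpos by (intro multiplicity_geI) auto
      moreover have "multiplicity p (card ?B) \<le> ?m" using dvd_imp_multiplicity_le[OF BD] Dpos by simp
      ultimately show ?thesis using True by simp
    next
      case False
      have "\<not> p dvd card ?B"
      proof
        assume "p dvd card ?B"
        then obtain R where R: "subgroup R G" "R \<subseteq> ?B" "card R = p" using cauchy_exists[OF s p] by blast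
        have "multiplicity p d = 0" using False p d by (simp add: multiplicity_part)
        moreover have "p dvd d \<Longrightarrow> multiplicity p d > 0"
          using p d by (simp add: prime_multiplicity_gt_zero_iff)
        ultimately have cop: "coprime p d" using p prime_imp_coprime by (metis less_irrefl)
        have "x = \<one>" if x: "x \<in> R" for x
          using pow_eq_one_coprime[OF subgroup.mem_carrier[OF R(1) x] _ _ cop] pow_card_eq_one[OF R(1) x] R(2,3) x
          by auto
        then have "R \<subseteq> {\<one>}" by blast
        then have "card R \<le> 1" using card_mono[of "{\<one>}" R] by simp
        then show False using R(3) prime_gt_1_nat[OF p] by simp
      qed
      then show ?thesis using False by (simp add: not_dvd_imp_multiplicity_0)
    qed
  qed
  then show "card ?B = d" using d by simp
qed

lemma dedekind_complement:
  assumes D: "subgroup D G" and M: "subgroup M G" "D <#> M = carrier G" "D \<inter> M = {\<one>}"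
    and E: "subgroup E G" "D \<subseteq> E"
  shows "subgroup (E \<inter> M) G" "card D * card (E \<inter> M) = card E"
proof -
  show s: "subgroup (E \<inter> M) G" using E M subgroups_Inter_pair by blast
  have "D <#> (E \<inter> M) = E"
  proof
    show "D <#> (E \<inter> M) \<subseteq> E" by (rule set_mult_least[OF E]) blast
    show "E \<subseteq> D <#> (E \<inter> M)"
    proof
      fix x assume x: "x \<in> E"
      then have "x \<in> D <#> M" using M(2) subgroup.mem_carrier[OF E(1)] by simp
      then obtain d m where dm: "d \<in> D" "m \<in> M" "x = d \<otimes> m" unfolding set_mult_def by blast
      have dE: "d \<in> E" using dm(1) E(2) by blast
      have "inv d \<otimes> x \<in> E" using subgroup.m_closed[OF E(1) subgroup.m_inv_closed[OF E(1) dE] x] .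
      then have "m \<in> E" using dm subgroup.mem_carrier[OF D dm(1)] subgroup.mem_carrier[OF M(1) dm(2)] by simp
      then show "x \<in> D <#> (E \<inter> M)" unfolding dm(3) set_mult_def using dm by blast
    qed
  qed
  moreover have "D \<inter> (E \<inter> M) = {\<one>}" using M(3) subgroup.one_closed[OF s] by blast
  ultimately show "card D * card (E \<inter> M) = card E" using card_set_mult[OF D s] by simp
qed

end

section \<open>Subgroups containing the residual\<close>

context sigma_group
begin

text \<open>The preimage of the Hall \<open>S\<close>-subgroup of the quotient by
  \<open>nres\<close>, described without forming that quotient; normality is then immediate.\<close>

definition "hall_cover S = carrier G \<inter> (\<Inter>T\<in>sigma_of \<sigma> (order G) - {S}. res T)"

lemma hall_cover:
  assumes S: "S \<in> \<sigma>"
  shows "hall_cover S \<lhd> G" "nres \<subseteq> hall_cover S" "part S (card (hall_cover S)) = part S (order G)"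
    "\<And>T. T \<in> \<sigma> \<Longrightarrow> T \<noteq> S \<Longrightarrow> part T (card (hall_cover S)) = part T (card nres)"
proof -
  let ?F = "sigma_of \<sigma> (order G) - {S}"
  have F: "finite ?F" "?F \<subseteq> \<sigma>" using finite_sigma_of by (auto simp: sigma_of_def)
  have *: "subgroup (hall_cover S) G \<and> (\<forall>T\<in>\<sigma>. part T (card (hall_cover S)) =
      (if T \<in> ?F then part T (card (res T)) else part T (order G)))"
    unfolding hall_cover_def by (rule coprime_index_Inter[OF F]) (use res_subgroup res_index in blast)
  have "normalizes G (carrier G) (hall_cover S)"
    unfolding normalizes_def hall_cover_def
    using normalizesD[OF normal_normalizes[OF res_normal order_refl]] by auto
  then show "hall_cover S \<lhd> G" using * normal_iff_normalizes by blast
  show "nres \<subseteq> hall_cover S" unfolding nres_eq hall_cover_def by blast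
  show "part S (card (hall_cover S)) = part S (order G)" using * S by simp
  fix T assume T: "T \<in> \<sigma>" "T \<noteq> S"
  show "part T (card (hall_cover S)) = part T (card nres)"
  proof (cases "T \<in> sigma_of \<sigma> (order G)")
    case True
    then show ?thesis using * T part_nres[OF T(1)] by simp
  next
    case False
    then have 1: "part T (order G) = 1" using not_sigma_of[OF order_pos T(1)] by simp
    have "part T (card nres) dvd part T (order G)"
      using part_dvd_mono[OF card_subgroup_dvd_order[OF nres_subgroup]] by simp
    then show ?thesis using * T False 1 by simp
  qed
qed

text \<open>\<open>K\<close> has order prime to the index of each \<open>res T\<close> with
  \<open>T\<close> other than \<open>S\<close>, so it lies in all of them. Comparing parts shows
  that \<open>K\<close> and \<open>nres\<close> together already account for the order of
  \<open>hall_cover S\<close>.\<close>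

lemma hall_mult_nres:
  assumes S: "S \<in> \<sigma>" and K: "subgroup K G" "card K = part S (order G)"
  shows "nres <#> K = hall_cover S" "K <#> nres = hall_cover S"
proof -
  note W = hall_cover[OF S]
  have sW: "subgroup (hall_cover S) G" using W(1) normal_imp_subgroup by blast
  have KG: "K \<subseteq> carrier G" using subgroup.subset[OF K(1)] .
  have "K \<subseteq> res T" if T: "T \<in> sigma_of \<sigma> (order G) - {S}" for T
  proof (rule coprime_index_subset[OF K(1) res_subgroup normal_normalizes[OF res_normal KG] subgroup_self KG subgroup.subset[OF res_subgroup]])
    have Ts: "T \<in> \<sigma>" "T \<noteq> S" using T by (auto simp: sigma_of_def)
    obtain a where a: "order G = card (res T) * a" using card_subgroup_dvd_order[OF res_subgroup] unfolding dvd_def by blast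
    have ap: "a > 0" using a order_pos by (metis mult_0_right not_gr0)
    have "part (-T) (card (res T)) * part (-T) a = part (-T) (card (res T))"
      using part_mult[OF card_subgroup_pos[OF res_subgroup] ap, of "-T" T] a res_index[of T] by simp
    then have "part (-T) a = 1" by simp
    then have "part T a = a" using part_mult_compl[OF ap, of T] by simp
    then have "part S a = 1" using sigma_part_one[OF S Ts(1)] Ts(2) by metis
    moreover have "part S (card K) = card K" using K(2) by simp
    ultimately have "coprime (card K) a" using part_coprime card_subgroup_pos[OF K(1)] ap by blast
    moreover have "order G div card (res T) = a" using a card_subgroup_pos[OF res_subgroup, of T] by simp
    ultimately show "coprime (card K) (card (carrier G) div card (res T))" by (simp add: order_def)
  qed
  then have KW: "K \<subseteq> hall_cover S" using KG unfolding hall_cover_def by blast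
  have n: "normalizes G K nres" using normal_normalizes[OF nres_normal KG] .
  have comm: "K <#> nres = nres <#> K" using set_mult_commute_if_normalizes[OF K(1) nres_subgroup n] .
  have sKD: "subgroup (K <#> nres) G" using subgroup_set_mult[OF K(1) nres_subgroup n] .
  have sub: "K <#> nres \<subseteq> hall_cover S" using set_mult_least[OF sW KW W(2)] .
  have d: "card K dvd card (K <#> nres)" "card nres dvd card (K <#> nres)"
    using card_subgroup_dvd[OF K(1) sKD] card_subgroup_dvd[OF nres_subgroup sKD]
      set_mult_subset[OF K(1) nres_subgroup] by auto
  have "card (hall_cover S) dvd card (K <#> nres)"
  proof (rule sigma_dvdI[OF card_subgroup_pos[OF sW] card_subgroup_pos[OF sKD]])
    fix T assume T: "T \<in> \<sigma>"
    show "part T (card (hall_cover S)) dvd card (K <#> nres)"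
    proof (cases "T = S")
      case True
      then show ?thesis using W(3) K(2) d(1) by simp
    next
      case False
      then show ?thesis
        using W(4)[OF T] d(2) part_dvd[OF card_subgroup_pos[OF nres_subgroup], of T] dvd_trans by metis
    qed
  qed
  then have "card (hall_cover S) \<le> card (K <#> nres)" using card_subgroup_pos[OF sKD] by (rule dvd_imp_le)
  then show "K <#> nres = hall_cover S" using sub finite_subgroup[OF sW] by (intro card_seteq) auto
  then show "nres <#> K = hall_cover S" using comm by simp
qed

text \<open>\<open>E\<close> absorbs \<open>nres\<close>, so multiplying \<open>E\<close> by
  \<open>K\<close> amounts to multiplying it by the normal subgroup \<open>hall_cover S\<close>,
  which permutes with everything.\<close>

lemma contains_nres_permutes:
  assumes E: "subgroup E G" "nres \<subseteq> E" and S: "S \<in> \<sigma>" and K: "subgroup K G" "card K = part S (order G)"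
  shows "E <#> K = K <#> E"
proof -
  have EG: "E \<subseteq> carrier G" and KG: "K \<subseteq> carrier G" and DG: "nres \<subseteq> carrier G"
    using E K nres_subgroup subgroup.subset by blast+
  have ED: "E <#> nres = E"
    using set_mult_least[OF E(1) order_refl E(2)] set_mult_subset(1)[OF E(1) nres_subgroup] by blast
  have DE: "nres <#> E = E"
    using set_mult_least[OF E(1) E(2) order_refl] set_mult_subset(2)[OF nres_subgroup E(1)] by blast
  have sW: "subgroup (hall_cover S) G" using hall_cover(1)[OF S] normal_imp_subgroup by blast
  have "E <#> K = E <#> (nres <#> K)" using set_mult_assoc[OF EG DG KG] ED by simp
  also have "\<dots> = E <#> hall_cover S" using hall_mult_nres(1)[OF S K] by simp
  also have "\<dots> = hall_cover S <#> E"
    using set_mult_commute_if_normalizes[OF E(1) sW normal_normalizes[OF hall_cover(1)[OF S] EG]] .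
  also have "\<dots> = (K <#> nres) <#> E" using hall_mult_nres(2)[OF S K] by simp
  also have "\<dots> = K <#> E" using set_mult_assoc[OF KG DG EG] DE by simp
  finally show ?thesis .
qed

end

text \<open>Condition (ii) with its witnesses fixed: \<open>y\<close> generates the residual and
  \<open>M\<close> is a complement.\<close>

locale structured_sigma_group = sigma_group +
  fixes M y
  assumes squarefree: "squarefree (card nres)"
    and cyclic: "y \<in> carrier G" "nres = generate G {y}"
    and complement: "subgroup M G" "nres <#> M = carrier G" "nres \<inter> M = {\<one>}"
    and single: "\<And>S p. S \<in> \<sigma> \<Longrightarrow> p \<in> S \<Longrightarrow> p dvd card nres \<Longrightarrow> S \<inter> prime_factors (order G) = {p}"
begin

lemma part_single:
  assumes S: "S \<in> \<sigma>" "p \<in> S" "p dvd card nres" and m: "m dvd order G" "m > 0"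
  shows "part S m = p ^ multiplicity p m"
proof (rule part_eqI)
  have pp: "prime p" using sigma_prime[OF S(1,2)] .
  show "p ^ multiplicity p m > 0" using prime_gt_0_nat[OF pp] by simp
  fix r :: nat assume r: "prime r"
  show "multiplicity r (p ^ multiplicity p m) = (if r \<in> S then multiplicity r m else 0)"
  proof (cases "r = p")
    case True
    then show ?thesis using S(2) pp by simp
  next
    case False
    have "multiplicity r m = 0" if "r \<in> S"
    proof -
      have "\<not> r dvd order G"
      proof
        assume "r dvd order G"
        then have "r \<in> S \<inter> prime_factors (order G)" using that r order_pos by (simp add: in_prime_factors_iff)
        then show False using single[OF S] False by simp
      qed
      then have "\<not> r dvd m" using m dvd_trans by blast
      then show ?thesis by (simp add: not_dvd_imp_multiplicity_0)
    qed
    then show ?thesis using False multiplicity_distinct_prime_power[OF r pp False] by simp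
  qed
qed

lemma part_nres_single:
  assumes S: "S \<in> \<sigma>" "p \<in> S" "p dvd card nres"
  shows "part S (card nres) = p"
proof -
  have pp: "prime p" using sigma_prime[OF S(1,2)] .
  have npos: "card nres > 0" using card_subgroup_pos[OF nres_subgroup] .
  have "multiplicity p (card nres) = 1"
    using squarefree squarefree_factorial_semiring'[of "card nres"] npos pp S(3)
    by (auto simp: in_prime_factors_iff)
  then show ?thesis using part_single[OF S card_subgroup_dvd_order[OF nres_subgroup] npos] by simp
qed

text \<open>Used to control the order of a product with \<open>res S\<close>: the factor should
  contain the \<open>S\<close>-part of the residual. If that part is a prime \<open>p\<close>, then
  \<open>K\<close> is a \<open>p\<close>-group containing the normal subgroup
  \<open>nres_part p\<close>, and subgroups normal in \<open>K\<close> of every larger order exist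
  above it.\<close>

lemma adjust_subgroup:
  assumes K: "subgroup K G" "card K = part S (order G)" and S: "S \<in> \<sigma>"
    and A: "subgroup A G" "part S (card A) = card A"
  obtains A' where "subgroup A' G" "card A' = card A"
    "card A = 1 \<or> part S (card nres) = 1 \<or> (\<exists>p\<in>S. p dvd card nres \<and> nres_part p \<subseteq> A')"
    "normalizes G K A \<Longrightarrow> normalizes G K A'"
proof (cases "card A = 1 \<or> part S (card nres) = 1")
  case True
  then show ?thesis using that[of A] A by blast
next
  case False
  have npos: "card nres > 0" using card_subgroup_pos[OF nres_subgroup] .
  obtain p where p: "p \<in> S" "prime p" "p dvd card nres"
    using False part_neq_1_iff[OF npos, of S] by blast
  note R = nres_part_props[OF squarefree cyclic p(2,3)]
  have sR: "subgroup (nres_part p) G" using R(1) normal_imp_subgroup by blast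
  let ?n = "multiplicity p (order G)"
  have cK: "card K = p ^ ?n" using part_single[OF S p(1,3) dvd_refl order_pos] K(2) by simp
  \<comment> \<open>The product of \<open>K\<close> with the normal \<open>p\<close>-subgroup is
    again a \<open>p\<close>-group, and \<open>K\<close> already has the greatest possible
    order.\<close>
  have RK: "nres_part p \<subseteq> K"
  proof -
    have sW: "subgroup (nres_part p <#> K) G"
      using subgroup_set_mult_commute[OF sR K(1)]
        set_mult_commute_if_normalizes[OF K(1) sR normal_normalizes[OF R(1) subgroup.subset[OF K(1)]]] by simp
    have "card (nres_part p <#> K) dvd card (nres_part p) * card K"
      using card_set_mult[OF sR K(1)] by (metis dvd_triv_left)
    then have "card (nres_part p <#> K) dvd p ^ Suc ?n" using R(2) cK by simp
    then obtain j where j: "card (nres_part p <#> K) = p ^ j"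
      unfolding divides_primepow_nat[OF p(2)] by blast
    have "p ^ j dvd order G" using card_subgroup_dvd_order[OF sW] j by simp
    then have "j \<le> ?n" using p(2) by (intro multiplicity_geI) auto
    then have "card (nres_part p <#> K) \<le> card K"
      using j cK prime_gt_0_nat[OF p(2)] by (simp add: power_increasing)
    then have "K = nres_part p <#> K"
      using set_mult_subset(2)[OF sR K(1)] finite_subgroup[OF sW] by (intro card_seteq) auto
    then show "nres_part p \<subseteq> K" using set_mult_subset(1)[OF sR K(1)] by simp
  qed
  have "card A = p ^ multiplicity p (card A)"
    using part_single[OF S p(1,3) card_subgroup_dvd_order[OF A(1)] card_subgroup_pos[OF A(1)]] A(2) by simp
  then obtain k where k: "card A = p ^ k" by blast
  have "k \<noteq> 0" using False k by (intro notI) simp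
  have "p ^ k dvd order G" using card_subgroup_dvd_order[OF A(1)] k by simp
  then have "k \<le> ?n" using p(2) by (intro multiplicity_geI) auto
  then obtain B where "subgroup B G" "nres_part p \<subseteq> B" "card B = p ^ k" "normalizes G K B"
    using p_group_normal_chain[OF K(1) cK p(2) sR RK R(2) normal_normalizes[OF R(1) subgroup.subset[OF K(1)]], of k]
      \<open>k \<noteq> 0\<close> by auto
  then show ?thesis using that[of B] k p by auto
qed

text \<open>
  \<open>E\<close> is the intersection of the products \<open>A' S <#> res S\<close>, whose indices are coprime in pairs, and
  \<open>B\<close> is its Hall subgroup for the union of the classes with \<open>A S\<close> nontrivial.
\<close>

lemma exists_embedded:
  assumes K: "hall_family K" and A: "\<And>S. S \<in> \<sigma> \<Longrightarrow> subgroup (A S) G \<and> part S (card (A S)) = card (A S)"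
  obtains E B where "subgroup E G" "nres \<subseteq> E" "subgroup B G" "B \<subseteq> E"
    "\<And>S. S \<in> \<sigma> \<Longrightarrow> part S (card B) = card (A S)"
    "\<And>S. S \<in> \<sigma> \<Longrightarrow> card (A S) = 1 \<or> part S (card E) = card (A S)"
    "(\<And>S. S \<in> \<sigma> \<Longrightarrow> normalizes G (K S) (A S)) \<Longrightarrow> E \<lhd> G"
proof -
  have Ks: "subgroup (K S) G" "card (K S) = part S (order G)" if "S \<in> \<sigma>" for S
    using K that by (auto simp: hall_family_def)
  define good where "good S X \<longleftrightarrow> subgroup X G \<and> card X = card (A S) \<and>
      (card (A S) = 1 \<or> part S (card nres) = 1 \<or> (\<exists>p\<in>S. p dvd card nres \<and> nres_part p \<subseteq> X)) \<and>
      (normalizes G (K S) (A S) \<longrightarrow> normalizes G (K S) X)" for S X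
  have "\<exists>X. good S X" if S: "S \<in> \<sigma>" for S
    by (rule adjust_subgroup[OF Ks[OF S] S, of "A S"]) (use A[OF S] in \<open>auto simp: good_def\<close>)
  then obtain A' where "\<And>S. S \<in> \<sigma> \<Longrightarrow> good S (A' S)" by metis
  then have A': "subgroup (A' S) G" "card (A' S) = card (A S)"
      "card (A S) = 1 \<or> part S (card nres) = 1 \<or> (\<exists>p\<in>S. p dvd card nres \<and> nres_part p \<subseteq> A' S)"
      "normalizes G (K S) (A S) \<Longrightarrow> normalizes G (K S) (A' S)" if "S \<in> \<sigma>" for S
    using that by (auto simp: good_def)
  define U where "U S = A' S <#> res S" for S
  have U: "subgroup (U S) G" "A' S \<subseteq> U S" "res S \<subseteq> U S" if S: "S \<in> \<sigma>" for S
    unfolding U_def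
    using subgroup_set_mult[OF A'(1)[OF S] res_subgroup normal_normalizes[OF res_normal subgroup.subset[OF A'(1)[OF S]]]]
      set_mult_subset[OF A'(1)[OF S] res_subgroup] by auto
  have Uidx: "part (-S) (card (U S)) = part (-S) (order G)" if S: "S \<in> \<sigma>" for S
    using part_eq_superset[OF res_subgroup U(1)[OF S] U(3)[OF S] res_index] .
  \<comment> \<open>Containing \<open>A' S\<close> and the \<open>S\<close>-part of the residual at
    once costs nothing after the adjustment. For trivial \<open>A S\<close> the part of
    \<open>nres\<close> remains; \<open>B\<close> has to remove it again.\<close>
  have Upart: "part S (card (U S)) = (if card (A S) = 1 then part S (card nres) else card (A S))" if S: "S \<in> \<sigma>" for S
  proof -
    have I: "subgroup (A' S \<inter> res S) G" using A'(1)[OF S] res_subgroup subgroups_Inter_pair by blast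
    note pos = card_subgroup_pos[OF I] card_subgroup_pos[OF A'(1)[OF S]] card_subgroup_pos[OF U(1)[OF S]] card_subgroup_pos[OF res_subgroup[of S]]
    have pA: "part S (card (A' S)) = card (A S)" using A[OF S] A'(2)[OF S] by simp
    have pI: "part S (card (A' S \<inter> res S)) = card (A' S \<inter> res S)"
      by (rule part_self_dvd[of S "card (A' S)"]) (use pA A'(1,2)[OF S] pos card_subgroup_dvd[OF I A'(1)[OF S]] in auto)
    have eq: "part S (card (U S)) * card (A' S \<inter> res S) = card (A S) * part S (card nres)"
      using card_set_mult[OF A'(1)[OF S] res_subgroup, of S] part_mult[OF pos(3,1), of S]
        part_mult[OF pos(2,4), of S] pI pA part_nres[OF S] by (simp add: U_def)
    have dvd: "card (A' S \<inter> res S) dvd part S (card nres)"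
      using part_dvd_mono[OF card_subgroup_dvd[OF I res_subgroup] pos(4), of S] pI part_nres[OF S] by simp
    show ?thesis
    proof (cases "card (A S) = 1")
      case True
      then have "card (A' S \<inter> res S) dvd 1" using card_subgroup_dvd[OF I A'(1)[OF S]] A'(2)[OF S] by simp
      then show ?thesis using eq True by simp
    next
      case False
      have "card (A' S \<inter> res S) = part S (card nres)"
      proof (cases "part S (card nres) = 1")
        case True
        then show ?thesis using dvd by simp
      next
        case ne: False
        then obtain p where p: "p \<in> S" "p dvd card nres" "nres_part p \<subseteq> A' S" using A'(3)[OF S] False by blast
        have pp: "prime p" using sigma_prime[OF S p(1)] .
        note R = nres_part_props[OF squarefree cyclic pp p(2)]
        have "nres_part p \<subseteq> A' S \<inter> res S" using p(3) nres_subset[OF S] by (auto simp: nres_part_def)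
        then have "p dvd card (A' S \<inter> res S)"
          using card_subgroup_dvd[OF normal_imp_subgroup[OF R(1)] I] R(2) by simp
        then show ?thesis using dvd part_nres_single[OF S p(1,2)] dvd_antisym by simp
      qed
      then show ?thesis using eq False by simp
    qed
  qed
  define F where "F = sigma_of \<sigma> (order G)"
  have F: "finite F" "F \<subseteq> \<sigma>" using finite_sigma_of by (auto simp: F_def sigma_of_def)
  define E where "E = carrier G \<inter> (\<Inter>S\<in>F. U S)"
  have E0: "subgroup E G \<and> (\<forall>T\<in>\<sigma>. part T (card E) = (if T \<in> F then part T (card (U T)) else part T (order G)))"
    unfolding E_def by (rule coprime_index_Inter[OF F]) (use U(1) Uidx F(2) in blast)
  then have sE: "subgroup E G" by blast
  have Epart: "part S (card E) = (if card (A S) = 1 then part S (card nres) else card (A S))" if S: "S \<in> \<sigma>" for S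
  proof (cases "S \<in> F")
    case True
    then show ?thesis using E0 S Upart[OF S] by simp
  next
    case False
    then have 1: "part S (order G) = 1" using not_sigma_of[OF order_pos S] by (simp add: F_def)
    have "part S (card nres) dvd part S (order G)" "part S (card (A S)) dvd part S (order G)"
      using part_dvd_mono[OF card_subgroup_dvd_order[OF nres_subgroup]]
        part_dvd_mono[OF card_subgroup_dvd_order] A[OF S] order_pos by blast+
    then show ?thesis using E0 S False 1 A[OF S] by simp
  qed
  have DE: "nres \<subseteq> E"
    unfolding E_def using nres_subset U(3) F(2) subgroup.subset[OF nres_subgroup] by blast
  have nE: "E \<lhd> G" if n: "\<And>S. S \<in> \<sigma> \<Longrightarrow> normalizes G (K S) (A S)"
  proof -
    \<comment> \<open>The normalizer contains \<open>K S\<close>, with full part at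
      \<open>S\<close>, and \<open>res S\<close>, with full part outside \<open>S\<close>; so it is
      the whole group.\<close>
    have "normalizes G (carrier G) (U S)" if S: "S \<in> \<sigma>" for S
    proof -
      let ?N = "normalizer_in G (carrier G) (U S)"
      have sN: "subgroup ?N G" using normalizer_in_subgroup[OF subgroup_self U(1)[OF S]] .
      have KG: "K S \<subseteq> carrier G" using subgroup.subset[OF Ks(1)[OF S]] .
      have "normalizes G (K S) (U S)"
        unfolding U_def
        by (rule normalizes_set_mult[OF KG subgroup.subset[OF A'(1)[OF S]] A'(4)[OF S n[OF S]]
              subgroup.subset[OF res_subgroup] normal_normalizes[OF res_normal KG]])
      then have KN: "K S \<subseteq> ?N" using KG by (simp add: subset_normalizer_in)
      have RN: "res S \<subseteq> ?N" using normalizer_in_self[OF U(1)[OF S] subgroup.subset[OF U(1)[OF S]]] U(3)[OF S] by blast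
      have "part (-S) (card ?N) = part (-S) (order G)" using part_eq_superset[OF res_subgroup sN RN res_index] .
      moreover have "part S (card ?N) = part S (order G)"
        using part_eq_superset[OF Ks(1)[OF S] sN KN, of S] Ks(2)[OF S] by simp
      ultimately have "card ?N = order G"
        using part_mult_compl[OF card_subgroup_pos[OF sN], of S] part_mult_compl[OF order_pos, of S] by metis
      then have "?N = carrier G" using subgroup.subset[OF sN] by (intro card_subset_eq) (auto simp: order_def)
      then show ?thesis using subset_normalizer_in[of "carrier G"] by blast
    qed
    then have "normalizes G (carrier G) E"
      unfolding E_def normalizes_def using F(2) by blast
    then show ?thesis using sE normal_iff_normalizes by blast
  qed
  note L = dedekind_complement[OF nres_subgroup complement sE DE]
  let ?L = "E \<inter> M"
  \<comment> \<open>\<open>B\<close> should keep the contribution of \<open>nres\<close> exactly in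
    the classes with nontrivial \<open>A S\<close>. So \<open>E\<close> is first reduced to its part
    \<open>?L\<close> in the complement and then multiplied by the Hall \<open>Q\<close>-subgroup
    \<open>D'\<close> of \<open>nres\<close>.\<close>
  define Q where "Q = \<Union>{S \<in> \<sigma>. card (A S) \<noteq> 1}"
  define d where "d = part Q (card nres)"
  define D' where "D' = {x \<in> nres. x [^] d = \<one>}"
  have D': "subgroup D' G" "card D' = d"
    using card_pow_set_abelian[OF nres_subgroup cyclic_nres_commute[OF cyclic] d_def] by (auto simp: D'_def)
  have D'D: "D' \<subseteq> nres" by (auto simp: D'_def)
  have "normalizes G (carrier G) D'"
    unfolding D'_def
    by (rule normalizes_pow_set[OF order_refl subgroup.subset[OF nres_subgroup] normal_normalizes[OF nres_normal order_refl]])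
  then have nD': "normalizes G ?L D'" using normalizes_mono subgroup.subset[OF L(1)] by blast
  define B where "B = ?L <#> D'"
  have sB: "subgroup B G" unfolding B_def by (rule subgroup_set_mult[OF L(1) D'(1) nD'])
  have BE: "B \<subseteq> E" unfolding B_def using set_mult_least[OF sE] D'D DE by blast
  have "?L \<inter> D' = {\<one>}" using complement(3) D'D subgroup.one_closed[OF L(1)] subgroup.one_closed[OF D'(1)] by blast
  then have cB: "card B = card ?L * d" using card_set_mult[OF L(1) D'(1)] D'(2) by (simp add: B_def)
  note pos = card_subgroup_pos[OF L(1)] card_subgroup_pos[OF nres_subgroup]
  have Bpart: "part S (card B) = card (A S)" if S: "S \<in> \<sigma>" for S
  proof -
    have B: "part S (card B) = part S (card ?L) * part (S \<inter> Q) (card nres)"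
      using cB part_mult[OF pos(1), of d S] d_def by simp
    have eq: "part S (card nres) * part S (card ?L) = part S (card E)"
      using L(2) part_mult[OF pos(2,1), of S] by simp
    show ?thesis
    proof (cases "card (A S) = 1")
      case True
      then have "part S (card ?L) = 1" using eq Epart[OF S] by simp
      moreover have "S \<inter> Q = {}" using sigma_disjoint[OF S] True by (fastforce simp: Q_def)
      ultimately show ?thesis using B True by simp
    next
      case False
      then have "S \<inter> Q = S" using S by (auto simp: Q_def)
      then show ?thesis using B eq Epart[OF S] False by (simp add: mult.commute)
    qed
  qed
  show thesis
  proof (rule that[OF sE DE sB BE Bpart _ nE])
    fix S assume "S \<in> \<sigma>"
    then show "card (A S) = 1 \<or> part S (card E) = card (A S)" using Epart by simp
  qed
qed

text \<open>If \<open>S\<close> contains a prime of the residual, the \<open>S\<close>-part is a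
  prime power and Sylow's theorem applies. Otherwise \<open>A \<inter> hall_cover S\<close> keeps
  the \<open>S\<close>-part of \<open>A\<close>, and intersecting its product with
  \<open>nres\<close> with the complement \<open>M\<close> removes everything else. The subgroup
  found need not lie in \<open>A\<close>; only its order matters.\<close>

lemma exists_sigma_part_subgroup:
  assumes A: "subgroup A G" and S: "S \<in> \<sigma>"
  shows "\<exists>B. subgroup B G \<and> card B = part S (card A)"
proof (cases "part S (card nres) = 1")
  case False
  have npos: "card nres > 0" using card_subgroup_pos[OF nres_subgroup] .
  obtain p where p: "p \<in> S" "prime p" "p dvd card nres" using False part_neq_1_iff[OF npos, of S] by blast
  have "part S (card A) = p ^ multiplicity p (card A)"
    using part_single[OF S p(1,3) card_subgroup_dvd_order[OF A] card_subgroup_pos[OF A]] .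
  then show ?thesis using sylow_exists[OF A p(2) multiplicity_dvd] by metis
next
  case True
  let ?W = "hall_cover S"
  note W = hall_cover[OF S]
  have sW: "subgroup ?W G" using W(1) normal_imp_subgroup by blast
  have AW: "subgroup (A <#> ?W) G" using subgroup_set_mult[OF A sW normal_normalizes[OF W(1) subgroup.subset[OF A]]] .
  let ?C = "A \<inter> ?W"
  have sC: "subgroup ?C G" using A sW subgroups_Inter_pair by blast
  have pC: "part S (card ?C) = part S (card A)"
  proof -
    have "part S (card (A <#> ?W)) = part S (order G)"
      using part_eq_superset[OF sW AW set_mult_subset(2)[OF A sW] W(3)] .
    moreover have "part S (card (A <#> ?W)) * part S (card ?C) = part S (card A) * part S (card ?W)"
      using card_set_mult[OF A sW] part_mult[OF card_subgroup_pos[OF AW] card_subgroup_pos[OF sC], of S]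
        part_mult[OF card_subgroup_pos[OF A] card_subgroup_pos[OF sW], of S] by simp
    ultimately show ?thesis using W(3) by (simp add: mult.commute)
  qed
  let ?I = "?C <#> nres"
  have sI: "subgroup ?I G"
    using subgroup_set_mult[OF sC nres_subgroup normal_normalizes[OF nres_normal subgroup.subset[OF sC]]] .
  have IW: "?I \<subseteq> ?W" using set_mult_least[OF sW _ W(2)] by blast
  have sCD: "subgroup (?C \<inter> nres) G" using sC nres_subgroup subgroups_Inter_pair by blast
  note L = dedekind_complement[OF nres_subgroup complement sI set_mult_subset(2)[OF sC nres_subgroup]]
  let ?L = "?I \<inter> M"
  note pos = card_subgroup_pos[OF nres_subgroup] card_subgroup_pos[OF L(1)] card_subgroup_pos[OF sI]
    card_subgroup_pos[OF sC] card_subgroup_pos[OF sCD] card_subgroup_pos[OF A] card_subgroup_pos[OF sW]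
  have mult: "part T (card nres) * part T (card ?L) = part T (card ?I)" for T
    using L(2) part_mult[OF pos(1,2), of T] by simp
  have "card ?L = part S (card A)"
  proof (rule sigma_eqI[OF pos(2)])
    fix T assume T: "T \<in> \<sigma>"
    show "part T (card ?L) = part T (part S (card A))"
    proof (cases "T = S")
      case T_eq: True
      have "part S (card (?C \<inter> nres)) dvd part S (card nres)"
        using part_dvd_mono[OF card_subgroup_dvd[OF sCD nres_subgroup] pos(1)] by blast
      then have "part S (card (?C \<inter> nres)) = 1" using True by simp
      then have "part S (card ?I) = part S (card ?C)"
        using card_set_mult[OF sC nres_subgroup] part_mult[OF pos(3,5), of S] part_mult[OF pos(4,1), of S] True by simp
      then show ?thesis using mult[of S] True pC T_eq by simp
    next
      case False
      have "part T (card ?I) dvd part T (card ?W)"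
        using part_dvd_mono[OF card_subgroup_dvd[OF sI sW IW] pos(7)] .
      then have "part T (card nres) * part T (card ?L) dvd part T (card nres) * 1"
        using mult[of T] W(4)[OF T False] by simp
      then have "part T (card ?L) = 1"
        using dvd_times_left_cancel_iff[of "part T (card nres)" "part T (card ?L)" 1] by simp
      moreover have "part T (part S (card A)) = 1" using sigma_disjoint[OF T S False] by simp
      ultimately show ?thesis by simp
    qed
  qed simp
  then show ?thesis using L(1) by blast
qed

end

section \<open>Translation to the definitions of the theorem\<close>

lemma part_prod:
  assumes "finite I" "\<And>i. i \<in> I \<Longrightarrow> n i > 0"
  shows "part T (\<Prod>i\<in>I. n i) = (\<Prod>i\<in>I. part T (n i))"
  using assms
proof (induction I rule: finite_induct)
  case (insert i I)
  then show ?case by (simp add: part_mult prod_pos)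
qed simp

context sigma_group
begin

text \<open>Each coordinate projection has primary image, so its kernel contains
  \<open>res S\<close> for some class \<open>S\<close>, and hence \<open>nres\<close>; an element
  all of whose coordinates are trivial is trivial.\<close>

lemma sigma_nilpotent_imp_nres_trivial:
  assumes "sigma_nilpotent \<sigma> G"
  shows "nres = {\<one>}"
proof -
  obtain n :: nat and K where K: "\<And>i. i < n \<Longrightarrow> subgroup (K i) G \<and> sigma_primary \<sigma> (G\<lparr>carrier := K i\<rparr>)"
    and iso: "G \<cong> product_group {..<n} (\<lambda>i. G\<lparr>carrier := K i\<rparr>)"
    using assms unfolding sigma_nilpotent_def by blast
  let ?P = "product_group {..<n} (\<lambda>i. G\<lparr>carrier := K i\<rparr>)"
  obtain f where f: "f \<in> iso G ?P" using iso by (auto simp: is_iso_def)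
  have fhom: "f \<in> hom G ?P" and fbij: "bij_betw f (carrier G) (carrier ?P)" using f by (auto simp: iso_def)
  have fm: "f (x \<otimes> z) = f x \<otimes>\<^bsub>?P\<^esub> f z" if "x \<in> carrier G" "z \<in> carrier G" for x z
    using hom_mult[OF fhom that] .
  have triv: "f x i = \<one>" if x: "x \<in> nres" and i: "i < n" for x i
  proof -
    have sK: "subgroup (K i) G" using K[OF i] by blast
    obtain S where S: "S \<in> \<sigma>" "prime_factors (card (K i)) \<subseteq> S"
      using K[OF i] by (auto simp: sigma_primary_def group_primes_def order_def)
    have pK: "part S (card (K i)) = card (K i)" using part_eq_self_iff[OF card_subgroup_pos[OF sK]] S(2) by blast
    let ?f = "\<lambda>x. f x i"
    have fK: "?f x \<in> K i" if "x \<in> carrier G" for x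
    proof -
      have "f x \<in> carrier ?P" using hom_in_carrier[OF fhom that] .
      then show ?thesis using i by (auto simp: PiE_iff)
    qed
    have fmi: "?f (x \<otimes> z) = ?f x \<otimes> ?f z" if "x \<in> carrier G" "z \<in> carrier G" for x z
      using fm[OF that] i by simp
    have homG: "?f \<in> hom G G" using fK fmi subgroup.mem_carrier[OF sK] by (auto simp: hom_def)
    interpret g: group_hom G G ?f using homG by (simp add: group_hom_def group_hom_axioms_def)
    have sI: "subgroup (?f ` carrier G) G" using g.subgroup_img_is_subgroup[OF subgroup_self] .
    let ?H = "G\<lparr>carrier := ?f ` carrier G\<rparr>"
    have gh: "group_hom G ?H ?f"
      using fmi subgroup_imp_group[OF sI] by (auto simp: group_hom_def group_hom_axioms_def hom_def)
    interpret e: fin_epi G ?H ?f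
      using gh by (simp add: fin_epi_def fin_epi_axioms_def fin_group_axioms)
    have "order ?H dvd card (K i)" using card_subgroup_dvd[OF sI sK] fK by (auto simp: order_def)
    then have pH: "part S (order ?H) = order ?H"
      using part_self_dvd[OF pK] card_subgroup_pos[OF sK] by blast
    have "part (-S) (order ?H) = 1" using part_mult_compl[OF e.H.order_pos, of S] pH e.H.order_pos by simp
    then have "part (-S) (card e.ker) = part (-S) (order G)"
      using part_mult[OF e.H.order_pos card_subgroup_pos[OF e.ker_subgroup], of "-S"] e.card_ker_mult by simp
    moreover have "e.ker \<lhd> G" using e.normal_kernel by (simp add: e.ker_def)
    ultimately have "res S \<subseteq> e.ker" using res_least by blast
    then have "x \<in> e.ker" using x nres_subset[OF S(1)] by blast
    then show ?thesis by (simp add: e.mem_ker)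
  qed
  have f1: "f \<one> \<in> carrier ?P" "f x \<in> carrier ?P" if "x \<in> carrier G" for x
    using hom_in_carrier[OF fhom] that by auto
  have "x = \<one>" if x: "x \<in> nres" for x
  proof -
    have xc: "x \<in> carrier G" using subgroup.mem_carrier[OF nres_subgroup x] .
    have "f x = f \<one>"
    proof
      fix i
      show "f x i = f \<one> i"
      proof (cases "i < n")
        case True
        then show ?thesis using triv[OF x] triv[OF subgroup.one_closed[OF nres_subgroup]] by simp
      next
        case False
        then show ?thesis using f1[OF xc] by (auto simp: PiE_iff extensional_def)
      qed
    qed
    then show ?thesis using fbij xc by (auto simp: bij_betw_def dest: inj_onD)
  qed
  then show ?thesis using subgroup.one_closed[OF nres_subgroup] by blast
qed

text \<open>\<open>G\<close> is isomorphic to the product with \<open>G\<close> as its single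
  factor.\<close>

lemma sigma_primary_imp_nilpotent:
  assumes "sigma_primary \<sigma> G"
  shows "sigma_nilpotent \<sigma> G"
proof -
  let ?P = "product_group {..<1::nat} (\<lambda>i. G)"
  let ?f = "\<lambda>x. \<lambda>i\<in>{..<1::nat}. x"
  have "?f \<in> iso G ?P"
    unfolding iso_def
  proof (intro CollectI conjI)
    show "?f \<in> hom G ?P" by (auto simp: hom_def fun_eq_iff)
    show "bij_betw ?f (carrier G) (carrier ?P)"
    proof (rule bij_betwI[where g = "\<lambda>f. f 0"])
      fix g assume "g \<in> carrier ?P"
      then show "?f (g 0) = g" by (auto simp: fun_eq_iff PiE_iff extensional_def)
    qed auto
  qed
  then have "G \<cong> ?P" by (auto simp: is_iso_def)
  then show ?thesis
    unfolding sigma_nilpotent_def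
    using assms subgroup_self by (intro exI[of _ 1] exI[of _ "\<lambda>i. carrier G"]) simp
qed

text \<open>Quotients by \<open>res S\<close> are primary, hence admissible in the intersection.
  Conversely, \<open>nres\<close> is mapped into the corresponding subgroup of any
  \<open>\<sigma>\<close>-nilpotent quotient, which is trivial.\<close>

theorem sigma_nilpotent_residual_eq: "sigma_nilpotent_residual \<sigma> G = nres"
proof
  show "sigma_nilpotent_residual \<sigma> G \<subseteq> nres"
    unfolding nres_def
  proof
    fix x assume x: "x \<in> sigma_nilpotent_residual \<sigma> G"
    have "x \<in> res S" if S: "S \<in> \<sigma>" for S
    proof -
      interpret e: sigma_epi G "G Mod res S" "\<lambda>x. res S #> x" \<sigma>
        using fin_epi_Mod(1)[OF res_normal[of S]] sigma_group_axioms by (simp add: sigma_epi_def)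
      have "order (G Mod res S) * card (res S) = order G"
        using e.card_ker_mult fin_epi_Mod(2)[OF res_normal[of S]] by simp
      then have "part (-S) (order (G Mod res S)) * part (-S) (card (res S)) = part (-S) (card (res S))"
        using part_mult[OF e.H.order_pos card_subgroup_pos[OF res_subgroup], of "-S" S] res_index[of S] by simp
      then have "part (-S) (order (G Mod res S)) = 1" by simp
      then have "part S (order (G Mod res S)) = order (G Mod res S)"
        using part_mult_compl[OF e.H.order_pos, of S] by simp
      then have "sigma_primary \<sigma> (G Mod res S)"
        using part_eq_self_iff[OF e.H.order_pos] S by (auto simp: sigma_primary_def group_primes_def)
      then have "sigma_nilpotent \<sigma> (G Mod res S)" by (rule e.H.sigma_primary_imp_nilpotent)
      then show ?thesis using x res_normal unfolding sigma_nilpotent_residual_def by blast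
    qed
    then show "x \<in> (\<Inter>S\<in>\<sigma>. res S)" by blast
  qed
  have "nres \<subseteq> N" if N: "N \<lhd> G" "sigma_nilpotent \<sigma> (G Mod N)" for N
  proof
    fix x assume x: "x \<in> nres"
    interpret e: sigma_epi G "G Mod N" "\<lambda>x. N #> x" \<sigma>
      using fin_epi_Mod(1)[OF N(1)] sigma_group_axioms by (simp add: sigma_epi_def)
    have "N #> x \<in> e.H.nres"
      unfolding e.H.nres_def using x nres_subset e.image_res by blast
    then have "N #> x = \<one>\<^bsub>G Mod N\<^esub>" using e.H.sigma_nilpotent_imp_nres_trivial[OF N(2)] by blast
    then have "x \<in> e.ker" using subgroup.mem_carrier[OF nres_subgroup x] by (simp add: e.mem_ker)
    then show "x \<in> N" using fin_epi_Mod(2)[OF N(1)] by simp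
  qed
  then show "nres \<subseteq> sigma_nilpotent_residual \<sigma> G"
    unfolding sigma_nilpotent_residual_def by blast
qed

lemma hall_subgroup_card: "hall_subgroup S A G \<Longrightarrow> subgroup A G \<and> card A = part S (order G)"
proof -
  assume h: "hall_subgroup S A G"
  then have A: "subgroup A G" and pf: "prime_factors (card A) \<subseteq> S" "prime_factors (subgroup_index G A) \<inter> S = {}"
    by (auto simp: hall_subgroup_def)
  have pos: "card A > 0" using card_subgroup_pos[OF A] .
  have eq: "order G = card A * subgroup_index G A"
    using lagrange[OF A] by (simp add: subgroup_index_def mult.commute)
  then have ip: "subgroup_index G A > 0" using order_pos by (metis mult_0_right not_gr0)
  have "part S (card A) = card A" using part_eq_self_iff[OF pos] pf by blast
  moreover have "part S (subgroup_index G A) = 1" using part_eq_1_iff[OF ip] pf by blast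
  ultimately show ?thesis using A eq part_mult[OF pos ip, of S] by simp
qed

lemma sigma_hall_subgroup_iff:
  assumes E: "subgroup E G"
  shows "sigma_hall_subgroup \<sigma> B (G\<lparr>carrier := E\<rparr>) \<longleftrightarrow>
    subgroup B G \<and> B \<subseteq> E \<and> (\<forall>S\<in>\<sigma>. part S (card B) = 1 \<or> part S (card E) = part S (card B))"
proof -
  interpret E: fin_group "G\<lparr>carrier := E\<rparr>" using fin_group_subgroup[OF E] .
  have sub: "subgroup B (G\<lparr>carrier := E\<rparr>) \<longleftrightarrow> subgroup B G \<and> B \<subseteq> E"
    using incl_subgroup[OF E] subgroup_incl[OF _ E] subgroup.subset by fastforce
  have "sigma_of \<sigma> (card B) \<inter> sigma_of \<sigma> (subgroup_index (G\<lparr>carrier := E\<rparr>) B) = {} \<longleftrightarrow>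
      (\<forall>S\<in>\<sigma>. part S (card B) = 1 \<or> part S (card E) = part S (card B))" if B: "subgroup B G" "B \<subseteq> E"
  proof -
    let ?i = "subgroup_index (G\<lparr>carrier := E\<rparr>) B"
    have "?i * card B = card E"
      using E.lagrange[of B] sub B by (simp add: subgroup_index_def order_def)
    then have eq: "card E = card B * ?i" by (simp add: mult.commute)
    have pos: "card B > 0" using card_subgroup_pos[OF B(1)] .
    have ip: "?i > 0" using eq card_subgroup_pos[OF E] by (metis mult_0_right not_gr0)
    have m: "part S (card E) = part S (card B) * part S ?i" for S
      using eq part_mult[OF pos ip, of S] by simp
    have "part S ?i = 1 \<longleftrightarrow> part S (card E) = part S (card B)" for S unfolding m by simp
    moreover have "sigma_of \<sigma> (card B) \<inter> sigma_of \<sigma> ?i = {} \<longleftrightarrow> (\<forall>S\<in>\<sigma>. part S (card B) = 1 \<or> part S ?i = 1)"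
      using not_sigma_of[OF pos] not_sigma_of[OF ip] by (auto simp: sigma_of_def)
    ultimately show ?thesis by simp
  qed
  then show ?thesis using sub by (auto simp: sigma_hall_subgroup_def)
qed

lemma complete_hall_set_family:
  assumes "complete_hall_set \<sigma> G \<H>"
  obtains K where "hall_family K" "\<And>S. S \<in> \<sigma> \<Longrightarrow> K S \<in> \<H> \<or> K S = {\<one>}"
proof -
  have ex: "\<And>S. S \<in> sigma_of \<sigma> (order G) \<Longrightarrow> \<exists>A. A \<in> \<H> \<and> hall_subgroup S A G"
    using assms unfolding complete_hall_set_def by blast
  then obtain f where f: "\<And>S. S \<in> sigma_of \<sigma> (order G) \<Longrightarrow> f S \<in> \<H> \<and> hall_subgroup S (f S) G" by metis
  \<comment> \<open>A class without primes in \<open>order G\<close> receives the trivial subgroup,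
    whose order is the part 1 required there.\<close>
  define K where "K S = (if S \<in> sigma_of \<sigma> (order G) then f S else {\<one>})" for S
  have "hall_family K"
    unfolding hall_family_def
  proof
    fix S assume S: "S \<in> \<sigma>"
    show "subgroup (K S) G \<and> card (K S) = part S (order G)"
    proof (cases "S \<in> sigma_of \<sigma> (order G)")
      case True
      then show ?thesis using f[OF True] hall_subgroup_card[of S "f S"] by (simp add: K_def)
    next
      case False
      then show ?thesis using not_sigma_of[OF order_pos S] triv_subgroup by (simp add: K_def)
    qed
  qed
  moreover have "K S \<in> \<H> \<or> K S = {\<one>}" for S using f by (simp add: K_def)
  ultimately show thesis using that by blast
qed

lemma trivial_conjugate_commutes:
  assumes "E \<subseteq> carrier G" "x \<in> carrier G"
  shows "E <#> conjugate G {\<one>} x = conjugate G {\<one>} x <#> E"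
proof -
  have "conjugate G {\<one>} x = {\<one>}" using assms by (simp add: conjugate_def)
  then show ?thesis using assms(1) by (force simp: set_mult_def)
qed

lemma sigma_permutable_imp_perm:
  assumes "sigma_permutable \<sigma> E G" shows "perm E"
proof -
  obtain \<H> where E: "subgroup E G" and H: "complete_hall_set \<sigma> G \<H>"
    "\<forall>H\<in>\<H>. \<forall>x\<in>carrier G. E <#> conjugate G H x = conjugate G H x <#> E"
    using assms unfolding sigma_permutable_def by blast
  obtain K where K: "hall_family K" "\<And>S. S \<in> \<sigma> \<Longrightarrow> K S \<in> \<H> \<or> K S = {\<one>}"
    using complete_hall_set_family[OF H(1)] by blast
  have "permutes_with E K"
    unfolding permutes_with_def
  proof (intro ballI)
    fix S x assume "S \<in> \<sigma>" and x: "x \<in> carrier G"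
    then consider "K S \<in> \<H>" | "K S = {\<one>}" using K(2) by blast
    then show "E <#> conjugate G (K S) x = conjugate G (K S) x <#> E"
      using H(2) x trivial_conjugate_commutes[OF subgroup.subset[OF E] x] by cases auto
  qed
  then show ?thesis using E K(1) perm_def by blast
qed

text \<open>The given complete Hall set serves as witness: conjugates of its members still have the
  full order of their class, so \<open>contains_nres_permutes\<close> applies to them.\<close>

lemma contains_nres_sigma_permutable:
  assumes H: "complete_hall_set \<sigma> G \<H>" and E: "subgroup E G" "nres \<subseteq> E"
  shows "sigma_permutable \<sigma> E G"
proof -
  have "E <#> conjugate G A x = conjugate G A x <#> E" if A: "A \<in> \<H>" and x: "x \<in> carrier G" for A x
  proof (cases "A = {\<one>}")
    case True
    then show ?thesis using trivial_conjugate_commutes[OF subgroup.subset[OF E(1)] x] by simp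
  next
    case False
    then obtain S where S: "S \<in> \<sigma>" "hall_subgroup S A G"
      using H A unfolding complete_hall_set_def by blast
    have sA: "subgroup A G" "card A = part S (order G)" using hall_subgroup_card[OF S(2)] by auto
    show ?thesis
      by (rule contains_nres_permutes[OF E S(1) conjugate_subgroup[OF sA(1) x]])
        (simp add: card_conjugate[OF subgroup.subset[OF sA(1)] x] sA(2))
  qed
  then show ?thesis using H E(1) unfolding sigma_permutable_def by blast
qed

lemma permutably_embedded_imp_perm:
  assumes "H_sigma_permutably_embedded \<sigma> B G"
  obtains E where "perm E" "subgroup B G"
    "\<And>S. S \<in> \<sigma> \<Longrightarrow> part S (card B) \<noteq> 1 \<Longrightarrow> part S (card E) = part S (card B)"
proof -
  obtain E where E: "sigma_permutable \<sigma> E G" "sigma_hall_subgroup \<sigma> B (G\<lparr>carrier := E\<rparr>)"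
    using assms unfolding H_sigma_permutably_embedded_def by blast
  have sE: "subgroup E G" using E(1) by (simp add: sigma_permutable_def)
  show thesis using that[OF sigma_permutable_imp_perm[OF E(1)]] E(2) sigma_hall_subgroup_iff[OF sE] by blast
qed

lemma cyclic_group_subgroup_iff:
  assumes D: "subgroup D G"
  shows "cyclic_group (G\<lparr>carrier := D\<rparr>) \<longleftrightarrow> (\<exists>y\<in>carrier G. D = generate G {y})"
proof -
  interpret D: fin_group "G\<lparr>carrier := D\<rparr>" using fin_group_subgroup[OF D] .
  have gen: "generate G {y} = range (\<lambda>n::int. y [^]\<^bsub>G\<lparr>carrier := D\<rparr>\<^esub> n)" if y: "y \<in> D" for y
    using generate_pow[OF subgroup.mem_carrier[OF D y]] int_pow_consistent[OF D y] by auto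
  have "cyclic_group (G\<lparr>carrier := D\<rparr>) \<longleftrightarrow> (\<exists>y\<in>D. D = generate G {y})"
    using D.cyclic_group gen by auto
  moreover have "y \<in> D" if "D = generate G {y}" for y using that generate.incl[of y "{y}" G] by simp
  ultimately show ?thesis using subgroup.mem_carrier[OF D] by blast
qed

end

context structured_sigma_group
begin

lemma exists_embedded_of_order:
  assumes H: "complete_hall_set \<sigma> G \<H>" and K: "hall_family K"
    and A: "\<And>S. S \<in> \<sigma> \<Longrightarrow> subgroup (A S) G \<and> part S (card (A S)) = card (A S)"
    and n: "n > 0" "\<And>S. S \<in> \<sigma> \<Longrightarrow> part S n = card (A S)"
  shows "\<exists>B. H_sigma_permutably_embedded \<sigma> B G \<and> card B = n"
    "(\<And>S. S \<in> \<sigma> \<Longrightarrow> normalizes G (K S) (A S)) \<Longrightarrow> \<exists>B. H_sigma_normally_embedded \<sigma> B G \<and> card B = n"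
proof -
  obtain E B where E: "subgroup E G" "nres \<subseteq> E" and B: "subgroup B G" "B \<subseteq> E"
    "\<And>S. S \<in> \<sigma> \<Longrightarrow> part S (card B) = card (A S)"
    and hall: "\<And>S. S \<in> \<sigma> \<Longrightarrow> card (A S) = 1 \<or> part S (card E) = card (A S)"
    and normal: "(\<And>S. S \<in> \<sigma> \<Longrightarrow> normalizes G (K S) (A S)) \<Longrightarrow> E \<lhd> G"
    by (rule exists_embedded[OF K A]) blast+
  have cB: "card B = n"
    using sigma_eqI[OF card_subgroup_pos[OF B(1)] n(1)] B(3) n(2) by simp
  have sh: "sigma_hall_subgroup \<sigma> B (G\<lparr>carrier := E\<rparr>)"
    unfolding sigma_hall_subgroup_iff[OF E(1)] using B hall by auto
  then show "\<exists>B. H_sigma_permutably_embedded \<sigma> B G \<and> card B = n"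
    using contains_nres_sigma_permutable[OF H E] cB unfolding H_sigma_permutably_embedded_def by blast
  assume "\<And>S. S \<in> \<sigma> \<Longrightarrow> normalizes G (K S) (A S)"
  then have "E \<lhd> G" by (rule normal)
  then show "\<exists>B. H_sigma_normally_embedded \<sigma> B G \<and> card B = n"
    using sh cB unfolding H_sigma_normally_embedded_def by blast
qed

end

context sigma_group
begin

text \<open>Passes from numbered Hall subgroups to classes: a nontrivial member determines its
  class, and uniqueness in the complete Hall set makes the assignment injective.\<close>

lemma hall_index:
  assumes H: "complete_hall_set \<sigma> G (insert {\<one>} (H ` I))" "inj_on H I" "\<forall>i\<in>I. H i \<noteq> {\<one>}"
  obtains s where "s ` I \<subseteq> \<sigma>" "inj_on s I"
    "\<And>i. i \<in> I \<Longrightarrow> subgroup (H i) G \<and> card (H i) = part (s i) (order G)"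
    "\<And>S. S \<in> \<sigma> \<Longrightarrow> S \<notin> s ` I \<Longrightarrow> part S (order G) = 1"
proof -
  have "\<forall>i\<in>I. \<exists>S\<in>\<sigma>. hall_subgroup S (H i) G"
    using H(1)[unfolded complete_hall_set_def, THEN conjunct2, THEN conjunct1] H(3) by auto
  then obtain s where s: "\<And>i. i \<in> I \<Longrightarrow> s i \<in> \<sigma> \<and> hall_subgroup (s i) (H i) G" by metis
  have c: "subgroup (H i) G" "card (H i) = part (s i) (order G)" if "i \<in> I" for i
    using hall_subgroup_card s[OF that] by auto
  have ne: "part (s i) (order G) \<noteq> 1" if i: "i \<in> I" for i
  proof
    assume "part (s i) (order G) = 1"
    then have "card (H i) = 1" using c(2)[OF i] by simp
    then have "H i = {\<one>}" using subgroup.one_closed[OF c(1)[OF i]] by (metis card_1_singletonE singletonD)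
    then show False using H(3) i by blast
  qed
  note ex1 = H(1)[unfolded complete_hall_set_def, THEN conjunct2, THEN conjunct2]
  have uniq: "\<And>S A B. S \<in> sigma_of \<sigma> (order G) \<Longrightarrow> A \<in> H ` I \<Longrightarrow> B \<in> H ` I \<Longrightarrow>
      hall_subgroup S A G \<Longrightarrow> hall_subgroup S B G \<Longrightarrow> A = B"
    using ex1 by blast
  have "inj_on s I"
  proof (rule inj_onI)
    fix i j assume ij: "i \<in> I" "j \<in> I" "s i = s j"
    have "s i \<in> sigma_of \<sigma> (order G)" using not_sigma_of[OF order_pos, of "s i"] s[OF ij(1)] ne[OF ij(1)] by blast
    then have "H i = H j" using uniq[of "s i" "H i" "H j"] s[OF ij(1)] s[OF ij(2)] ij by simp
    then show "i = j" using H(2) ij by (auto dest: inj_onD)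
  qed
  moreover have "part S (order G) = 1" if S: "S \<in> \<sigma>" "S \<notin> s ` I" for S
  proof (rule ccontr)
    assume n1: "part S (order G) \<noteq> 1"
    then have Sm: "S \<in> sigma_of \<sigma> (order G)" using not_sigma_of[OF order_pos S(1)] by blast
    obtain A where A: "A \<in> insert {\<one>} (H ` I)" "hall_subgroup S A G"
      using ex1_implies_ex[OF ex1[rule_format, OF Sm]] by blast
    have cA: "card A = part S (order G)" using hall_subgroup_card[OF A(2)] by blast
    then have "A \<noteq> {\<one>}" using n1 by auto
    then obtain i where i: "i \<in> I" "A = H i" using A(1) by auto
    have "part (s i) (card A) = card A" unfolding i(2) using c(2)[OF i(1)] by simp
    moreover have "part S (card A) \<noteq> 1" unfolding cA using n1 by simp
    ultimately have "S = s i" using sigma_part_one[OF S(1), of "s i" "card A"] s[OF i(1)] by blast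
    then show False using S(2) i(1) by blast
  qed
  ultimately show thesis using that[of s] s c by blast
qed

lemma part_indexed_prod:
  assumes "finite I" "inj_on s I" "s ` I \<subseteq> \<sigma>" "\<And>i. i \<in> I \<Longrightarrow> n i > 0 \<and> part (s i) (n i) = n i" "T \<in> \<sigma>"
  shows "part T (\<Prod>i\<in>I. n i) = (if T \<in> s ` I then n (inv_into I s T) else 1)"
proof -
  have "part T (\<Prod>i\<in>I. n i) = (\<Prod>i\<in>I. part T (n i))" using part_prod assms(1,4) by blast
  also have "\<dots> = (\<Prod>i\<in>I. if s i = T then n i else 1)"
    using assms sigma_part_one[of T] by (intro prod.cong) auto
  also have "\<dots> = (if T \<in> s ` I then n (inv_into I s T) else 1)"
  proof (cases "T \<in> s ` I")
    case True
    then have j: "inv_into I s T \<in> I" "s (inv_into I s T) = T" by (auto simp: inv_into_into f_inv_into_f)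
    then have "(\<Prod>i\<in>I. if s i = T then n i else 1) = (\<Prod>i\<in>I. if i = inv_into I s T then n i else 1)"
      using assms(2) by (intro prod.cong) (auto dest: inj_onD)
    then show ?thesis using assms(1) j True by (simp add: prod.delta)
  next
    case False
    then have "(\<Prod>i\<in>I. if s i = T then n i else 1) = 1" by (intro prod.neutral) auto
    then show ?thesis using False by simp
  qed
  finally show ?thesis .
qed

text \<open>The test order is \<open>r\<close> at \<open>S\<close> and the full Hall order
  elsewhere. The permutable overgroup then has full part outside \<open>S\<close>, contains
  \<open>res S\<close>, and has \<open>S\<close>-part \<open>r\<close>.\<close>

lemma hall_products_embedded_imp_res_dvd:
  assumes I: "finite I" "s ` I \<subseteq> \<sigma>" "inj_on s I"
    and H: "\<And>i. i \<in> I \<Longrightarrow> subgroup (H i) G \<and> card (H i) = part (s i) (order G)"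
    and triv: "\<And>S. S \<in> \<sigma> \<Longrightarrow> S \<notin> s ` I \<Longrightarrow> part S (order G) = 1"
    and emb: "\<And>A. (\<And>i. i \<in> I \<Longrightarrow> subgroup (A i) G \<and> A i \<subseteq> H i) \<Longrightarrow>
      \<exists>B. H_sigma_permutably_embedded \<sigma> B G \<and> card B = (\<Prod>i\<in>I. card (A i))"
    and S: "S \<in> \<sigma>" "r \<in> S" "r dvd order G"
  shows "part S (card (res S)) dvd r"
proof -
  have rp: "prime r" using sigma_prime[OF S(1,2)] .
  have "r dvd part S (order G)"
    using part_dvd_mono[OF S(3) order_pos, of S] part_prime[OF rp, of S] S(2) by simp
  then have "part S (order G) \<noteq> 1" using prime_gt_1_nat[OF rp] by auto
  then obtain k where k: "k \<in> I" "S = s k" using triv[OF S(1)] by blast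
  obtain R where R: "subgroup R G" "R \<subseteq> H k" "card R = r"
    using cauchy_exists[of "H k" r] H[OF k(1)] rp \<open>r dvd part S (order G)\<close> k(2) by auto
  define A where "A i = (if i = k then R else H i)" for i
  have A: "subgroup (A i) G \<and> A i \<subseteq> H i" if "i \<in> I" for i using R H[OF that] by (auto simp: A_def)
  obtain B where B: "H_sigma_permutably_embedded \<sigma> B G" "card B = (\<Prod>i\<in>I. card (A i))"
    using emb[OF A] by blast
  have pA: "card (A i) > 0 \<and> part (s i) (card (A i)) = card (A i)" if i: "i \<in> I" for i
    using card_subgroup_pos[of "A i"] A[OF i] H[OF i] R(3) S(2) k part_prime[OF rp, of S] by (auto simp: A_def)
  have cB: "part T (card B) = (if T \<in> s ` I then card (A (inv_into I s T)) else 1)" if "T \<in> \<sigma>" for T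
    unfolding B(2) by (rule part_indexed_prod[OF I(1,3,2) pA that])
  have BS: "part S (card B) = r"
    using cB[OF S(1)] k inv_into_f_f[OF I(3) k(1)] R(3) by (simp add: A_def)
  have BT: "part T (card B) = part T (order G)" if T: "T \<in> \<sigma>" "T \<noteq> S" for T
  proof (cases "T \<in> s ` I")
    case True
    then obtain j where j: "j \<in> I" "T = s j" by blast
    then show ?thesis using cB[OF T(1)] inv_into_f_f[OF I(3) j(1)] H[OF j(1)] T(2) k by (auto simp: A_def)
  next
    case False
    then show ?thesis using cB[OF T(1)] triv[OF T(1)] by simp
  qed
  obtain E where E: "perm E" "\<And>T. T \<in> \<sigma> \<Longrightarrow> part T (card B) \<noteq> 1 \<Longrightarrow> part T (card E) = part T (card B)"
    using permutably_embedded_imp_perm[OF B(1)] by metis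
  have sE: "subgroup E G" using E(1) by (simp add: perm_def)
  have "part T (card E) = part T (order G)" if T: "T \<in> \<sigma>" "T \<noteq> S" for T
  proof (cases "part T (card B) = 1")
    case True
    have "part T (card E) dvd part T (order G)" using part_dvd_mono[OF card_subgroup_dvd_order[OF sE]] by simp
    then show ?thesis using True BT[OF T] by simp
  qed (use E(2) BT T in simp)
  then have "res S \<subseteq> E" using perm_full_res_subset[OF E(1) S(1)] by blast
  then have "part S (card (res S)) dvd part S (card E)"
    using part_dvd_mono[OF card_subgroup_dvd[OF res_subgroup sE] card_subgroup_pos[OF sE]] by blast
  then show ?thesis using E(2)[OF S(1)] BS prime_gt_1_nat[OF rp] by simp
qed

lemma normal_in_subgroup_iff:
  assumes "subgroup P G"
  shows "A \<lhd> G\<lparr>carrier := P\<rparr> \<longleftrightarrow> subgroup A G \<and> A \<subseteq> P \<and> normalizes G P A"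
proof -
  interpret P: fin_group "G\<lparr>carrier := P\<rparr>" using fin_group_subgroup[OF assms] .
  have "subgroup A (G\<lparr>carrier := P\<rparr>) \<longleftrightarrow> subgroup A G \<and> A \<subseteq> P"
    using incl_subgroup[OF assms] subgroup_incl[OF _ assms] subgroup.subset by fastforce
  then show ?thesis using P.normal_iff_normalizes normalizes_restrict[OF assms order_refl] by simp
qed

end

lemma (in structured_sigma_group) hall_products_embedded:
  assumes I: "finite I" "s ` I \<subseteq> \<sigma>" "inj_on s I"
    and H: "complete_hall_set \<sigma> G \<H>" "\<And>i. i \<in> I \<Longrightarrow> subgroup (H i) G \<and> card (H i) = part (s i) (order G)"
    and triv: "\<And>S. S \<in> \<sigma> \<Longrightarrow> S \<notin> s ` I \<Longrightarrow> part S (order G) = 1"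
    and A: "\<And>i. i \<in> I \<Longrightarrow> subgroup (A i) G \<and> A i \<subseteq> H i"
  shows "\<exists>B. H_sigma_permutably_embedded \<sigma> B G \<and> card B = (\<Prod>i\<in>I. card (A i))"
    "(\<And>i. i \<in> I \<Longrightarrow> normalizes G (H i) (A i)) \<Longrightarrow>
      \<exists>B. H_sigma_normally_embedded \<sigma> B G \<and> card B = (\<Prod>i\<in>I. card (A i))"
proof -
  \<comment> \<open>Re-indexes a family from numbers to classes, with the trivial subgroup at
    classes that carry no member.\<close>
  define fam where "fam X S = (if S \<in> s ` I then X (inv_into I s S) else {\<one>})" for X and S :: "nat set"
  have fam: "fam X S = {\<one>} \<and> S \<notin> s ` I \<or> (\<exists>i\<in>I. S = s i \<and> fam X S = X i)" for X S
    using inv_into_f_f[OF I(3)] by (auto simp: fam_def)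
  have K: "hall_family (fam H)"
    unfolding hall_family_def
  proof
    fix S assume "S \<in> \<sigma>"
    then show "subgroup (fam H S) G \<and> card (fam H S) = part S (order G)"
      using fam[of H S] H(2) triv triv_subgroup by auto
  qed
  have pA: "card (A i) > 0 \<and> part (s i) (card (A i)) = card (A i)" if i: "i \<in> I" for i
  proof
    show "card (A i) > 0" using card_subgroup_pos A[OF i] by blast
    have "card (A i) dvd part (s i) (order G)"
      using card_subgroup_dvd[of "A i" "H i"] A[OF i] H(2)[OF i] by simp
    then show "part (s i) (card (A i)) = card (A i)" by (rule part_self_dvd[rotated]) auto
  qed
  have famA: "subgroup (fam A S) G \<and> part S (card (fam A S)) = card (fam A S)" for S
    using fam[of A S] A pA triv_subgroup by auto
  have pos: "(\<Prod>i\<in>I. card (A i)) > 0" using pA by (intro prod_pos) blast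
  have prod: "part S (\<Prod>i\<in>I. card (A i)) = card (fam A S)" if "S \<in> \<sigma>" for S
    using part_indexed_prod[OF I(1,3,2) pA that] by (simp add: fam_def)
  note * = exists_embedded_of_order[OF H(1) K famA pos prod]
  show "\<exists>B. H_sigma_permutably_embedded \<sigma> B G \<and> card B = (\<Prod>i\<in>I. card (A i))" using *(1) .
  assume n: "\<And>i. i \<in> I \<Longrightarrow> normalizes G (H i) (A i)"
  have "normalizes G (fam H S) (fam A S)" for S
  proof (cases "S \<in> s ` I")
    case True
    then show ?thesis using n inv_into_into[OF True] by (simp add: fam_def)
  next
    case False
    then show ?thesis by (simp add: fam_def normalizes_def)
  qed
  then show "\<exists>B. H_sigma_normally_embedded \<sigma> B G \<and> card B = (\<Prod>i\<in>I. card (A i))" using *(2) by blast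
qed

theorem theorem1p3:
  fixes \<sigma> :: "nat set set"
    and G :: "('a, 'b) monoid_scheme"
    and t :: nat
    and H :: "nat \<Rightarrow> 'a set"
    and D :: "'a set"
  assumes "prime_partition \<sigma>"
    and "group G" and "finite (carrier G)"
    and "sigma_full \<sigma> G"
    and "complete_hall_set \<sigma> G (insert {\<one>\<^bsub>G\<^esub>} (H ` {1..t}))"
    and "inj_on H {1..t}" and "\<forall>i\<in>{1..t}. H i \<noteq> {\<one>\<^bsub>G\<^esub>}"
    and "D = sigma_nilpotent_residual \<sigma> G"
  shows
    "((\<forall>A. subgroup A G \<longrightarrow> (\<exists>B. H_sigma_permutably_embedded \<sigma> B G \<and> card B = card A))
       \<longleftrightarrow>
      (cyclic_group (G\<lparr>carrier := D\<rparr>) \<and> squarefree (card D) \<and> complemented D G \<and>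
       (\<forall>S\<in>\<sigma>. S \<inter> prime_factors (card D) \<noteq> {} \<longrightarrow> card (S \<inter> group_primes G) = 1)))
     \<and>
     ((\<forall>A. subgroup A G \<longrightarrow> (\<exists>B. H_sigma_permutably_embedded \<sigma> B G \<and> card B = card A))
       \<longleftrightarrow>
      ((\<forall>A. (\<forall>i\<in>{1..t}. subgroup (A i) (G\<lparr>carrier := H i\<rparr>)) \<longrightarrow>
          (\<exists>B. H_sigma_permutably_embedded \<sigma> B G \<and> card B = (\<Prod>i\<in>{1..t}. card (A i)))) \<and>
       (\<forall>A. (\<forall>i\<in>{1..t}. A i \<lhd> G\<lparr>carrier := H i\<rparr>) \<longrightarrow>
          (\<exists>B. H_sigma_normally_embedded \<sigma> B G \<and> card B = (\<Prod>i\<in>{1..t}. card (A i))))))"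
proof -
  interpret fin_group G using assms(2,3) by (simp add: fin_group_def fin_group_axioms_def)
  interpret sigma_group G \<sigma> using assms(1) by unfold_locales
  have D: "D = nres" using assms(8) sigma_nilpotent_residual_eq by simp
  let ?I = "{1..t}"
  obtain s where s: "s ` ?I \<subseteq> \<sigma>" "inj_on s ?I"
    and H: "\<And>i. i \<in> ?I \<Longrightarrow> subgroup (H i) G \<and> card (H i) = part (s i) (order G)"
    and triv: "\<And>S. S \<in> \<sigma> \<Longrightarrow> S \<notin> s ` ?I \<Longrightarrow> part S (order G) = 1"
    using hall_index[OF assms(5,6,7)] by metis
  have fin: "finite ?I" by simp
  have subH: "subgroup A (G\<lparr>carrier := H i\<rparr>) \<longleftrightarrow> subgroup A G \<and> A \<subseteq> H i" if "i \<in> ?I" for A i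
    using incl_subgroup[of "H i"] subgroup_incl[of A "H i"] subgroup.subset H[OF that] by fastforce
  let ?i = "\<forall>A. subgroup A G \<longrightarrow> (\<exists>B. H_sigma_permutably_embedded \<sigma> B G \<and> card B = card A)"
  let ?ii = "cyclic_group (G\<lparr>carrier := D\<rparr>) \<and> squarefree (card D) \<and> complemented D G \<and>
    (\<forall>S\<in>\<sigma>. S \<inter> prime_factors (card D) \<noteq> {} \<longrightarrow> card (S \<inter> group_primes G) = 1)"
  let ?iii1 = "\<forall>A. (\<forall>i\<in>?I. subgroup (A i) (G\<lparr>carrier := H i\<rparr>)) \<longrightarrow>
    (\<exists>B. H_sigma_permutably_embedded \<sigma> B G \<and> card B = (\<Prod>i\<in>?I. card (A i)))"
  let ?iii2 = "\<forall>A. (\<forall>i\<in>?I. A i \<lhd> G\<lparr>carrier := H i\<rparr>) \<longrightarrow>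
    (\<exists>B. H_sigma_normally_embedded \<sigma> B G \<and> card B = (\<Prod>i\<in>?I. card (A i)))"
  have npos: "card nres > 0" using card_subgroup_pos[OF nres_subgroup] .
  have pf: "p \<in> prime_factors (card nres) \<longleftrightarrow> prime p \<and> p dvd card nres" for p
    using npos by (auto simp: in_prime_factors_iff)
  \<comment> \<open>Common end of the implications from (i) and from (iii): each only has to supply
    the divisibility.\<close>
  have to_ii: ?ii if dvd: "\<And>S r. S \<in> \<sigma> \<Longrightarrow> r \<in> S \<Longrightarrow> r dvd order G \<Longrightarrow> part S (card (res S)) dvd r"
  proof -
    note st = res_dvd_imp_nres_structure[OF dvd]
    have "card (S \<inter> group_primes G) = 1" if S: "S \<in> \<sigma>" "S \<inter> prime_factors (card nres) \<noteq> {}" for S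
    proof -
      obtain p where p: "p \<in> S" "p dvd card nres" using S(2) pf by blast
      have "S \<inter> group_primes G = {p}" unfolding group_primes_def by (rule st(4)[OF _ _ _ S(1) p])
      then show ?thesis by simp
    qed
    moreover have "complemented nres G"
      unfolding complemented_def using nres_subgroup st(5) by metis
    ultimately show ?thesis
      unfolding D using st(1,2) cyclic_group_subgroup_iff[OF nres_subgroup] by blast
  qed
  have i_ii: ?ii if i: ?i
  proof (rule to_ii, rule embed_cond_res_dvd)
    show embed_cond
      unfolding embed_cond_def
    proof (intro allI impI)
      fix A assume "subgroup A G"
      then obtain B where B: "H_sigma_permutably_embedded \<sigma> B G" "card B = card A" using i by blast
      show "\<exists>E. perm E \<and> (\<forall>S\<in>\<sigma>. part S (card A) \<noteq> 1 \<longrightarrow> part S (card E) = part S (card A))"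
        by (rule permutably_embedded_imp_perm[OF B(1)]) (use B(2) in metis)
    qed
  qed
  have iii_ii: ?ii if iii: ?iii1
  proof (rule to_ii, rule hall_products_embedded_imp_res_dvd[OF fin s H triv])
    fix A assume "\<And>i. i \<in> ?I \<Longrightarrow> subgroup (A i) G \<and> A i \<subseteq> H i"
    then have "\<forall>i\<in>?I. subgroup (A i) (G\<lparr>carrier := H i\<rparr>)" using subH by blast
    then show "\<exists>B. H_sigma_permutably_embedded \<sigma> B G \<and> card B = (\<Prod>i\<in>?I. card (A i))"
      using iii by blast
  qed
  have ii_rest: "?i \<and> ?iii1 \<and> ?iii2" if ii: ?ii
  proof -
    obtain y where y: "y \<in> carrier G" "nres = generate G {y}"
      using ii cyclic_group_subgroup_iff[OF nres_subgroup] unfolding D by blast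
    obtain M where M: "subgroup M G" "nres <#>\<^bsub>G\<^esub> M = carrier G" "nres \<inter> M = {\<one>\<^bsub>G\<^esub>}"
      using ii unfolding D complemented_def by metis
    have single: "S \<inter> prime_factors (order G) = {p}" if S: "S \<in> \<sigma>" "p \<in> S" "p dvd card nres" for S p
    proof -
      have pp: "prime p" using sigma_prime[OF S(1,2)] .
      have "S \<inter> prime_factors (card nres) \<noteq> {}" using S(2,3) pp pf by blast
      then have "card (S \<inter> prime_factors (order G)) = 1"
        using ii S(1) unfolding D group_primes_def by blast
      moreover have "p dvd order G" using S(3) card_subgroup_dvd_order[OF nres_subgroup] by (rule dvd_trans)
      then have "p \<in> S \<inter> prime_factors (order G)" using S(2) pp by (simp add: in_prime_factors_iff)
      ultimately show ?thesis by (metis card_1_singletonE singletonD)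
    qed
    have sq: "squarefree (card nres)" using ii unfolding D by blast
    interpret structured_sigma_group G \<sigma> M y
      by (intro structured_sigma_group.intro structured_sigma_group_axioms.intro
          sigma_group_axioms sq y M single)
    obtain K where K: "hall_family K" using complete_hall_set_family[OF assms(5)] by metis
    have ?i
    proof (intro allI impI)
      fix A assume A: "subgroup A G"
      \<comment> \<open>One subgroup for each class-part of \<open>card A\<close>, chosen
        independently; \<open>exists_embedded_of_order\<close> assembles their orders.\<close>
      then obtain F where F: "\<And>S. S \<in> \<sigma> \<Longrightarrow> subgroup (F S) G \<and> card (F S) = part S (card A)"
        using exists_sigma_part_subgroup[OF A] by metis
      show "\<exists>B. H_sigma_permutably_embedded \<sigma> B G \<and> card B = card A"
        by (rule exists_embedded_of_order(1)[OF assms(5) K _ card_subgroup_pos[OF A], of F]) (simp_all add: F)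
    qed
    moreover have ?iii1
      using hall_products_embedded(1)[OF fin s assms(5) H triv] subH by simp
    moreover have ?iii2
    proof (intro allI impI)
      fix A assume A: "\<forall>i\<in>?I. A i \<lhd> G\<lparr>carrier := H i\<rparr>"
      have "subgroup (A i) G \<and> A i \<subseteq> H i" "normalizes G (H i) (A i)" if "i \<in> ?I" for i
        using A that normal_in_subgroup_iff[of "H i" "A i"] H[OF that] by auto
      then show "\<exists>B. H_sigma_normally_embedded \<sigma> B G \<and> card B = (\<Prod>i\<in>?I. card (A i))"
        using hall_products_embedded(2)[OF fin s assms(5) H triv] by blast
    qed
    ultimately show ?thesis by blast
  qed
  have "?i \<longleftrightarrow> ?ii" using i_ii ii_rest by blast
  moreover have "?i \<longleftrightarrow> ?iii1 \<and> ?iii2" using i_ii iii_ii ii_rest by blast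
  ultimately show ?thesis by blast
qed

end
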